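(* Let $d\ge 1$, let $u$ be a weak solution to $$u_t-\Delta(u^m)=f\quad\text{in } Q_1,$$ where $m>1$, and suppose that $f\in L^{p,q}(Q_1)$ (so $\|f\|_{L^{p,q}(Q_1)}\le C_0$ for some positive constant $C_0$) with $$p>\frac{d}{2-m}\quad\text{and}\quad q\ge\frac{2(3-m)p}{(2-m)p-d}.$$ Given $\alpha\in(0,1)$ there exists $\varepsilon=\varepsilon(d,\alpha)>0$ such that, if $0<m-1<\varepsilon$, then $u$ is of class $\mathcal{C}^{\alpha,\frac{\alpha}{\sigma}}$ at every $(x_0,t_0)\in S_0(u)\cap Q_{1/2}$, where $$\sigma:=2+(1-m)\alpha .$$ In addition, there exists $C>0$, depending only on $\alpha$ and the dimension $d$, for which $$\sup_{B_r(x_0)\times(t_0-r^\sigma,t_0)}\left|u(x_0,t_0)-u(x,t)\right|\le C r^\alpha\left(\|u\|_{L^\infty(Q_1)}+\|f\|_{L^{p,q}(Q_1)}\right)$$ for $0<r\ll 1/2$ (that is, for all sufficiently small $r\in(0,1/2)$).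
   Context: Notation: $B_r(x_0)\subset\mathbb{R}^d$ is the open ball of radius $r$ centered at $x_0$, $B_r:=B_r(0)$; $Q_1:=B_1\times(-1,0]$ and $Q_r:=B_r\times(-r^2,0]$. The zero level-set is $S_0(u):=\{(x,t)\in Q_1 : u(x,t)=0\}$. The anisotropic Lebesgue space $L^{p,q}(Q_1)$ consists of measurable $f$ on $Q_1$ with $$\|f\|_{L^{p,q}(Q_1)}:=\left(\int_{-1}^0\left(\int_{B_1}|f(x,t)|^p\,dx\right)^{q/p}dt\right)^{1/q}<\infty.$$ Weak solution: a function $u\ge 0$ (a density) with $u\in L^\infty_{loc}(-1,0;L^{m+1}_{loc}(B_1))$ and $u^m\in L^2_{loc}(-1,0;W^{1,2}_{loc}(B_1))$ is a weak (distributional) solution to $u_t-\Delta(u^m)=f$ in $Q_1$ if $$\int_{-1}^0\int_{B_1}-u\phi_t+D(u^m)\cdot D\phi\,dx\,dt=\int_{-1}^0\int_{B_1}f\phi\,dx\,dt$$ for every $\phi\in\mathcal{C}^\infty_0(Q_1)$. Pointwise values of $u$ refer to its continuous representative. $u$ being of class $\mathcal{C}^{\alpha,\alpha/\sigma}$ at $(x_0,t_0)$ means Hölder continuity at that point with exponent $\alpha$ in space and $\alpha/\sigma$ in time, i.e. the oscillation of $u$ from $u(x_0,t_0)$ over $B_r(x_0)\times(t_0-r^\sigma,t_0)$ is bounded by a constant times $r^\alpha$ for small $r$. *)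

theory Defs
  imports "HOL-Probability.Essential_Supremum"
begin

definition cyl :: "real \<Rightarrow> ((real ^ 'd) \<times> real) set" where
  "cyl r = ball 0 r \<times> {- (r\<^sup>2) <.. 0}"

definition zero_level :: "((real ^ 'd) \<times> real \<Rightarrow> real) \<Rightarrow> ((real ^ 'd) \<times> real) set" where
  "zero_level u = {z \<in> cyl 1. u z = 0}"

primrec Ck :: "nat \<Rightarrow> ('a::euclidean_space \<Rightarrow> real) \<Rightarrow> bool" where
  "Ck 0 f \<longleftrightarrow> continuous_on UNIV f"
| "Ck (Suc k) f \<longleftrightarrow> (\<forall>x. f differentiable at x) \<and>
     (\<forall>b\<in>Basis. Ck k (\<lambda>x. frechet_derivative f (at x) b))"

definition test_fun :: "'a::euclidean_space set \<Rightarrow> ('a \<Rightarrow> real) \<Rightarrow> bool" where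
  "test_fun U \<phi> \<longleftrightarrow> (\<forall>k. Ck k \<phi>) \<and>
     compact (closure {x. \<phi> x \<noteq> 0}) \<and> closure {x. \<phi> x \<noteq> 0} \<subseteq> U"

definition grad :: "('a::euclidean_space \<Rightarrow> real) \<Rightarrow> 'a \<Rightarrow> 'a" where
  "grad f x = (\<Sum>b\<in>Basis. frechet_derivative f (at x) b *\<^sub>R b)"

definition loc_integrable ::
  "'a::euclidean_space set \<Rightarrow> ('a \<Rightarrow> 'b::{banach, second_countable_topology}) \<Rightarrow> bool" where
  "loc_integrable U f \<longleftrightarrow> (\<forall>K. compact K \<and> K \<subseteq> U \<longrightarrow> set_integrable lebesgue K f)"

definition has_weak_grad ::
  "'a::euclidean_space set \<Rightarrow> ('a \<Rightarrow> real) \<Rightarrow> ('a \<Rightarrow> 'a) \<Rightarrow> bool" where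
  "has_weak_grad U v g \<longleftrightarrow> loc_integrable U v \<and> loc_integrable U g \<and>
     (\<forall>\<phi>. test_fun U \<phi> \<longrightarrow>
        (LINT x:U|lebesgue. v x *\<^sub>R grad \<phi> x) = - (LINT x:U|lebesgue. \<phi> x *\<^sub>R g x))"

text \<open>
  Extension of \<open>x powr a\<close> to \<open>[0, \<infinity>]\<close> for exponents \<open>a > 0\<close>.
\<close>
definition epowr :: "ennreal \<Rightarrow> real \<Rightarrow> ennreal" where
  "epowr x a = (if x = top then top else ennreal (enn2real x powr a))"

definition Lpq_norm :: "real \<Rightarrow> real \<Rightarrow> ((real ^ 'd) \<times> real \<Rightarrow> real) \<Rightarrow> ennreal" where
  "Lpq_norm p q f =
     epowr (\<integral>\<^sup>+t\<in>{-1<..0}.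
       epowr (\<integral>\<^sup>+x\<in>ball 0 1. ennreal (\<bar>f (x, t)\<bar> powr p) \<partial>lebesgue) (q / p) \<partial>lebesgue) (1 / q)"

definition Lpq :: "real \<Rightarrow> real \<Rightarrow> ((real ^ 'd) \<times> real \<Rightarrow> real) set" where
  "Lpq p q = {f. f \<in> borel_measurable (lebesgue_on (cyl 1)) \<and> Lpq_norm p q f < top}"

definition Linf_norm :: "((real ^ 'd) \<times> real \<Rightarrow> real) \<Rightarrow> ennreal" where
  "Linf_norm u = esssup (lebesgue_on (cyl 1)) (\<lambda>z. ennreal \<bar>u z\<bar>)"

text \<open>The space \<open>L\<^sup>\<infinity>\<^sub>l\<^sub>o\<^sub>c(-1,0; L\<^sup>s\<^sub>l\<^sub>o\<^sub>c(B\<^sub>1))\<close>.\<close>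
definition Linf_Ls_loc :: "real \<Rightarrow> ((real ^ 'd) \<times> real \<Rightarrow> real) set" where
  "Linf_Ls_loc s = {u. u \<in> borel_measurable (lebesgue_on (cyl 1)) \<and>
     (\<forall>K a b. compact K \<and> K \<subseteq> ball 0 1 \<and> -1 < a \<and> b < 0 \<longrightarrow>
        (\<exists>M::real. AE t in lebesgue_on {a..b}.
           (\<integral>\<^sup>+x\<in>K. ennreal (\<bar>u (x, t)\<bar> powr s) \<partial>lebesgue) \<le> ennreal M))}"

text \<open>
  \<open>v \<in> L\<^sup>2\<^sub>l\<^sub>o\<^sub>c(-1,0; W\<^sup>1\<^sup>,\<^sup>2\<^sub>l\<^sub>o\<^sub>c(B\<^sub>1))\<close> with spatial weak gradient \<open>g\<close>. That
  almost every slice is locally square integrable together with its weak gradient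
  follows from the integrability on all sets \<open>K \<times> [a,b]\<close>.
\<close>
definition L2_W12_loc ::
  "((real ^ 'd) \<times> real \<Rightarrow> real) \<Rightarrow> ((real ^ 'd) \<times> real \<Rightarrow> real ^ 'd) \<Rightarrow> bool" where
  "L2_W12_loc v g \<longleftrightarrow>
     v \<in> borel_measurable (lebesgue_on (cyl 1)) \<and>
     g \<in> borel_measurable (lebesgue_on (cyl 1)) \<and>
     (AE t in lebesgue_on {-1<..<0}.
        has_weak_grad (ball 0 1) (\<lambda>x. v (x, t)) (\<lambda>x. g (x, t))) \<and>
     (\<forall>K a b. compact K \<and> K \<subseteq> ball 0 1 \<and> -1 < a \<and> b < 0 \<longrightarrow>
        set_integrable lebesgue (K \<times> {a..b}) (\<lambda>z. (v z)\<^sup>2) \<and>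
        set_integrable lebesgue (K \<times> {a..b}) (\<lambda>z. (norm (g z))\<^sup>2))"

text \<open>
  The weak formulation carries no term at the top \<open>t = 0\<close>, so test functions are
  compactly supported in the open cylinder \<open>B\<^sub>1 \<times> (-1,0)\<close>.
\<close>
definition weak_solution ::
  "real \<Rightarrow> ((real ^ 'd) \<times> real \<Rightarrow> real) \<Rightarrow> ((real ^ 'd) \<times> real \<Rightarrow> real) \<Rightarrow> bool" where
  "weak_solution m f u \<longleftrightarrow>
     (\<forall>z\<in>cyl 1. 0 \<le> u z) \<and> u \<in> Linf_Ls_loc (m + 1) \<and>
     (\<exists>g. L2_W12_loc (\<lambda>z. u z powr m) g \<and>
        (\<forall>\<phi>. test_fun (ball 0 1 \<times> {-1<..<0}) \<phi> \<longrightarrow>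
           (LINT z:cyl 1|lebesgue.
              - u z * deriv (\<lambda>s. \<phi> (fst z, s)) (snd z)
              + g z \<bullet> grad (\<lambda>y. \<phi> (y, snd z)) (fst z))
           = (LINT z:cyl 1|lebesgue. f z * \<phi> z)))"

definition cyl_at :: "real \<Rightarrow> (real ^ 'd) \<times> real \<Rightarrow> real \<Rightarrow> ((real ^ 'd) \<times> real) set" where
  "cyl_at \<sigma> z r = ball (fst z) r \<times> {snd z - r powr \<sigma> <..< snd z}"

text \<open>
  Exponent \<open>\<alpha>\<close> in space and \<open>\<alpha>/\<sigma>\<close> in time: the backward cylinders
  have height \<open>r powr \<sigma>\<close>.
\<close>
definition Holder_at ::
  "real \<Rightarrow> real \<Rightarrow> ((real ^ 'd) \<times> real \<Rightarrow> real) \<Rightarrow> (real ^ 'd) \<times> real \<Rightarrow> bool" where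
  "Holder_at \<alpha> \<sigma> u z \<longleftrightarrow> (\<exists>K. \<forall>\<^sub>F r in at_right 0.
     \<forall>w\<in>cyl_at \<sigma> z r. \<bar>u z - u w\<bar> \<le> K * r powr \<alpha>)"

end

theory Submission
  imports Defs "HOL-Probability.Distributions"
begin

text \<open>
  For \<open>m\<close> close to 1 the equation is a perturbation of the heat equation: after normalisation
  it reads \<open>u\<^sub>t = \<Delta>(u + g) + f\<close>, where \<open>g = u\<^sup>m - u\<close> differs from a constant by a small multiple
  of \<open>\<bar>u - c\<bar>\<close>, provided that \<open>c\<close> stays away from 0. Duality with cut-off heat kernels gives improvement of
  flatness: the mean square distance of \<open>u\<close> to constants decays geometrically along shrinking
  parabolic cylinders, up to a small Morrey norm of \<open>f\<close>. Summation over the scales bounds \<open>u\<close> at a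
  point from both sides in terms of its mean square distance to a constant on a larger cylinder.

  Let \<open>0 \<le> u \<le> 1\<close> and \<open>u(0) = 0\<close>. The lower bound forces \<open>u\<close> to be small on average near the top of the
  cylinder, testing with a nonnegative potential carries this over to earlier times, and the upper
  bound then gives \<open>u \<le> \<eta>\<close> on a smaller cylinder, for any prescribed \<open>\<eta> > 0\<close> if \<open>m - 1\<close> is small. With
  \<open>\<eta> = 8 powr (-a)\<close> and \<open>\<alpha> < a < 1\<close> this is iterated on the intrinsic cylinders of radius
  \<open>R\<^sub>k = R\<^sub>0 / 8 ^ k\<close> and height \<open>A\<^sub>k powr (1 - m) * R\<^sub>k ^ 2\<close>, where \<open>A\<^sub>k = A\<^sub>0 * 8 powr (-k a)\<close>; the
  conditions on \<open>p\<close> and \<open>q\<close> are what keeps the rescaled sources small. Since \<open>\<alpha> < a\<close>, all constants are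
  absorbed for small \<open>r\<close>, so \<open>C = 1\<close> is admissible.
\<close>

section \<open>Smooth functions and test functions\<close>

text \<open>The degeneracy at 0 shapes the argument. The map u powr m - u has small secant slopes
  only if one end lies at height at least \<open>\<kappa>\<close>. Constants are therefore lifted to
  \<open>\<kappa>\<close> before linearising, and a step with a constant below
  \<open>\<kappa>\<close> pays a penalty. In the bound from above the penalties cost only a multiple
  of \<open>\<kappa>\<close>; in the bound from below they never occur, because the constants stay
  above \<open>\<kappa>\<close>. This makes a zero usable: a large average would force a positive
  value there.

  The error g enters as the integral of g times the Laplacian of a potential. The L2 bound of that
  Laplacian by the density replaces an energy estimate, so the very weak form suffices and no
  gradient of u is estimated.

  Two kernels occur: one with a continuous error kernel, whose modulus of continuity produces
  flatness, and one with a nonnegative error kernel, which carries smallness back in time.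

  The ratio 8 between scales, where the one-step estimate would cover radius 1/4, leaves room for
  the growth of A powr (1 - m) from one scale to the next.\<close>

definition pd :: "'a::euclidean_space \<Rightarrow> ('a \<Rightarrow> real) \<Rightarrow> 'a \<Rightarrow> real" where
  "pd b f x = frechet_derivative f (at x) b"

definition smooth :: "('a::euclidean_space \<Rightarrow> real) \<Rightarrow> bool" where
  "smooth f \<longleftrightarrow> (\<forall>k. Ck k f)"

lemma Ck_Suc: "Ck (Suc k) f \<longleftrightarrow> (\<forall>x. f differentiable at x) \<and> (\<forall>b\<in>Basis. Ck k (pd b f))"
  unfolding pd_def[abs_def] by simp

declare Ck.simps(2) [simp del]

lemma pd_eqI: "(f has_derivative D) (at x) \<Longrightarrow> pd b f x = D b"
  unfolding pd_def using frechet_derivative_at by metis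

lemma Ck_continuous: "Ck k f \<Longrightarrow> continuous_on UNIV f"
  by (cases k)
    (auto simp: Ck_Suc intro!: continuous_at_imp_continuous_on differentiable_imp_continuous_within)

lemma Ck_SucD: "Ck (Suc k) f \<Longrightarrow> Ck k f"
proof (induction k arbitrary: f)
  case 0
  then show ?case using Ck_continuous by fastforce
next
  case (Suc k)
  then show ?case by (auto simp: Ck_Suc)
qed

lemma smooth_continuous: "smooth f \<Longrightarrow> continuous_on S f"
  unfolding smooth_def using Ck_continuous continuous_on_subset by blast

lemma smooth_pd: "smooth f \<Longrightarrow> b \<in> Basis \<Longrightarrow> smooth (pd b f)"
  unfolding smooth_def using Ck_Suc by blast

lemma smooth_differentiable: "smooth f \<Longrightarrow> f differentiable at x"
  unfolding smooth_def using Ck_Suc by blast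

lemma differentiable_has_derivative_pd:
  fixes f :: "'a::euclidean_space \<Rightarrow> real"
  assumes "f differentiable at x"
  shows "(f has_derivative (\<lambda>h. \<Sum>b\<in>Basis. (h \<bullet> b) * pd b f x)) (at x)"
proof -
  have d: "(f has_derivative frechet_derivative f (at x)) (at x)"
    using assms frechet_derivative_works by blast
  then interpret linear "frechet_derivative f (at x)"
    by (rule has_derivative_linear)
  have "frechet_derivative f (at x) = (\<lambda>h. \<Sum>b\<in>Basis. (h \<bullet> b) * pd b f x)"
  proof
    fix h
    have "frechet_derivative f (at x) h = frechet_derivative f (at x) (\<Sum>b\<in>Basis. (h \<bullet> b) *\<^sub>R b)"
      by (simp add: euclidean_representation)
    then show "frechet_derivative f (at x) h = (\<Sum>b\<in>Basis. (h \<bullet> b) * pd b f x)"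
      by (simp add: sum scale pd_def)
  qed
  then show ?thesis using d by simp
qed

lemmas smooth_has_derivative = differentiable_has_derivative_pd[OF smooth_differentiable]

text \<open>Continuity is demanded only at the bottom of the recursion for \<open>Ck\<close> and
  follows from differentiability, so a class of differentiable functions closed under
  \<open>pd\<close> lies in every \<open>Ck k\<close>. Translates, affine pullbacks, slices and
  convolutions are treated this way without formulas for higher derivatives.\<close>

lemma smooth_coinduct:
  assumes "X f"
    and "\<And>f x. X f \<Longrightarrow> f differentiable at x"
    and "\<And>f b. X f \<Longrightarrow> b \<in> Basis \<Longrightarrow> X (pd b f)"
  shows "smooth f"
proof -
  have "Ck k f" if "X f" for k f
    using that
  proof (induction k arbitrary: f)
    case 0
    then show ?case
      by (auto intro!: continuous_at_imp_continuous_on differentiable_imp_continuous_within assms(2))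
  next
    case (Suc k)
    then show ?case using assms by (auto simp: Ck_Suc)
  qed
  then show ?thesis using assms(1) by (simp add: smooth_def)
qed

lemma pd_const [simp]: "pd b (\<lambda>x. c) = (\<lambda>x. 0)"
  by (rule ext, subst pd_eqI[OF has_derivative_const]) simp

lemma smooth_const [simp]: "smooth (\<lambda>x. c)"
  by (rule smooth_coinduct[of "\<lambda>f. \<exists>c. f = (\<lambda>x. c)"]) auto

lemma pd_add: "f differentiable at x \<Longrightarrow> g differentiable at x \<Longrightarrow>
    pd b (\<lambda>x. f x + g x) x = pd b f x + pd b g x"
  using has_derivative_add[of f "frechet_derivative f (at x)" "at x" g "frechet_derivative g (at x)"]
  by (subst pd_eqI) (auto simp: pd_def frechet_derivative_works)

lemma pd_mult:
  assumes "f differentiable at x" "g differentiable at x"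
  shows "pd b (\<lambda>x. f x * g x) x = f x * pd b g x + pd b f x * g x"
  using has_derivative_mult[OF assms[unfolded frechet_derivative_works]]
  by (subst pd_eqI) (auto simp: pd_def)

lemma Ck_add: "Ck k f \<Longrightarrow> Ck k g \<Longrightarrow> Ck k (\<lambda>x. f x + g x)"
proof (induction k arbitrary: f g)
  case 0
  then show ?case by (auto intro: continuous_intros)
next
  case (Suc k)
  have "pd b (\<lambda>x. f x + g x) = (\<lambda>x. pd b f x + pd b g x)" for b
    using Suc.prems by (auto simp: Ck_Suc intro!: pd_add)
  then show ?case using Suc by (auto simp: Ck_Suc)
qed

lemma Ck_mult: "Ck k f \<Longrightarrow> Ck k g \<Longrightarrow> Ck k (\<lambda>x. f x * g x)"
proof (induction k arbitrary: f g)
  case 0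
  then show ?case by (auto intro: continuous_intros)
next
  case (Suc k)
  have "pd b (\<lambda>x. f x * g x) = (\<lambda>x. f x * pd b g x + pd b f x * g x)" for b
    using Suc.prems by (auto simp: Ck_Suc intro!: pd_mult)
  moreover have "Ck k (\<lambda>x. f x * pd b g x + pd b f x * g x)" if "b \<in> Basis" for b
    using that Suc.prems Ck_SucD[OF Suc.prems(1)] Ck_SucD[OF Suc.prems(2)]
    by (intro Ck_add Suc.IH) (auto simp: Ck_Suc)
  ultimately show ?case using Suc.prems by (auto simp: Ck_Suc)
qed

lemma smooth_add: "smooth f \<Longrightarrow> smooth g \<Longrightarrow> smooth (\<lambda>x. f x + g x)"
  by (simp add: smooth_def Ck_add)

lemma smooth_mult: "smooth f \<Longrightarrow> smooth g \<Longrightarrow> smooth (\<lambda>x. f x * g x)"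
  by (simp add: smooth_def Ck_mult)

lemma pd_cmult: "f differentiable at x \<Longrightarrow> pd b (\<lambda>x. c * f x) x = c * pd b f x"
  by (subst pd_mult) auto

lemma sum_Basis_inner: "b \<in> Basis \<Longrightarrow> (\<Sum>i\<in>Basis. (b \<bullet> i) * f i) = (f b :: real)"
  by (subst sum.remove[of _ b]) (auto simp: inner_Basis intro!: sum.neutral split: if_splits)

lemma smooth_sum: "finite I \<Longrightarrow> (\<And>i. i \<in> I \<Longrightarrow> smooth (f i)) \<Longrightarrow> smooth (\<lambda>x. \<Sum>i\<in>I. f i x)"
  by (induction I rule: finite_induct) (auto intro: smooth_add)

lemma smooth_inner: "smooth (\<lambda>x. x \<bullet> a)"
proof -
  have d: "((\<lambda>x. x \<bullet> a) has_derivative (\<lambda>h. h \<bullet> a)) (at x)" for x :: 'a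
    by (auto intro!: derivative_eq_intros)
  then have "pd b (\<lambda>x. x \<bullet> a) = (\<lambda>x. b \<bullet> a)" for b :: 'a
    by (rule pd_eqI[THEN ext])
  then show ?thesis
    using d unfolding differentiable_def
    by (intro smooth_coinduct[of "\<lambda>f. f = (\<lambda>x. x \<bullet> a) \<or> (\<exists>c. f = (\<lambda>x. c))"])
      (auto simp: differentiable_def[symmetric])
qed

text \<open>The factor \<open>1 / x ^ n\<close> makes the family closed under differentiation up to linear combinations.\<close>
definition flat :: "nat \<Rightarrow> real \<Rightarrow> real" where
  "flat n x = (if x > 0 then exp (- 1 / x) / x ^ n else 0)"

lemma power_le_fact_exp: "0 \<le> x \<Longrightarrow> x ^ k \<le> fact k * exp (x::real)"
proof -
  assume x: "0 \<le> x"
  have "(\<Sum>n\<in>{k}. x ^ n /\<^sub>R fact n) \<le> (\<Sum>n. x ^ n /\<^sub>R fact n)"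
    using x by (intro sum_le_suminf summable_exp_generic) auto
  then show ?thesis by (simp add: exp_def field_simps)
qed

text \<open>Two powers of \<open>x\<close> are left after the exponential has beaten
  \<open>1 / x ^ n\<close>; they make the difference quotient at 0 vanish in
  \<open>flat_has_derivative\<close>.\<close>

lemma flat_le: "flat n x \<le> fact (n + 2) * x\<^sup>2"
proof (cases "x > 0")
  case True
  have "(1 / x) ^ (n + 2) \<le> fact (n + 2) * exp (1 / x)"
    using True by (intro power_le_fact_exp) auto
  then show ?thesis using True
    by (simp add: flat_def exp_minus field_simps power_add power2_eq_square)
qed (auto simp: flat_def)

lemma flat_nonneg: "0 \<le> flat n x"
  by (auto simp: flat_def)

lemma flat_has_derivative: "(flat n has_real_derivative (flat (n + 2) x - n * flat (n + 1) x)) (at x)"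
proof -
  consider "x > 0" | "x < 0" | "x = 0" by linarith
  then show ?thesis
  proof cases
    case 1
    have "((\<lambda>x. exp (- 1 / x) / x ^ n) has_real_derivative (flat (n + 2) x - n * flat (n + 1) x)) (at x)"
      using 1 by (auto intro!: derivative_eq_intros simp: flat_def divide_simps power2_eq_square)
        (cases n; simp add: algebra_simps)
    moreover have "\<forall>\<^sub>F y in nhds x. flat n y = exp (- 1 / y) / y ^ n"
      using eventually_nhds_in_open[of "{0<..}" x] 1 by (auto simp: flat_def elim!: eventually_mono)
    ultimately show ?thesis by (subst DERIV_cong_ev[OF refl _ refl]) auto
  next
    case 2
    have "\<forall>\<^sub>F y in nhds x. flat n y = 0"
      using eventually_nhds_in_open[of "{..<0}" x] 2 by (auto simp: flat_def elim!: eventually_mono)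
    then have "(flat n has_real_derivative 0) (at x)"
      by (subst DERIV_cong_ev[OF refl _ refl]) auto
    then show ?thesis using 2 by (simp add: flat_def)
  next
    case 3
    have "((\<lambda>h. (flat n h) / h) \<longlongrightarrow> 0) (at 0)"
    proof (rule Lim_null_comparison)
      show "\<forall>\<^sub>F h in at 0. norm (flat n h / h) \<le> fact (n + 2) * \<bar>h\<bar>"
        unfolding eventually_at
      proof (intro exI[of _ 1] conjI ballI impI)
        fix h :: real assume "h \<noteq> 0 \<and> dist h 0 < 1"
        then show "norm (flat n h / h) \<le> fact (n + 2) * \<bar>h\<bar>"
          using flat_le[of n h] flat_nonneg[of n h]
          by (simp add: divide_le_eq power2_eq_square mult.assoc del: fact_Suc)
      qed auto
      show "((\<lambda>h::real. fact (n + 2) * \<bar>h\<bar>) \<longlongrightarrow> 0) (at 0)"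
        by (auto intro!: tendsto_eq_intros)
    qed
    then show ?thesis using 3 by (simp add: DERIV_def flat_def)
  qed
qed

text \<open>The induction over the order runs for all \<open>n\<close> simultaneously, because the
  derivative of \<open>flat n\<close> involves \<open>flat (n + 1)\<close> and
  \<open>flat (n + 2)\<close>.\<close>

lemma smooth_flat_comp:
  fixes p :: "'a::euclidean_space \<Rightarrow> real"
  assumes "smooth p"
  shows "smooth (\<lambda>x. flat n (p x))"
proof -
  have d: "((\<lambda>x. flat n (p x)) has_derivative
      (\<lambda>h. (\<Sum>b\<in>Basis. (h \<bullet> b) * pd b p x) * (flat (n + 2) (p x) - n * flat (n + 1) (p x)))) (at x)" for n x
    using has_derivative_compose[OF smooth_has_derivative[OF assms]
        flat_has_derivative[of n "p x", unfolded has_field_derivative_def]]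
    by (simp add: mult.commute)
  have pd: "pd b (\<lambda>x. flat n (p x)) = (\<lambda>x. pd b p x * (flat (n + 2) (p x) + (- real n) * flat (n + 1) (p x)))"
    if "b \<in> Basis" for b n
    using that by (auto simp: pd_eqI[OF d] sum_Basis_inner)
  have "Ck k (\<lambda>x. flat n (p x))" for k n
  proof (induction k arbitrary: n)
    case 0
    show ?case using d
      by (auto intro!: continuous_at_imp_continuous_on has_derivative_continuous simp del: of_nat_Suc)
  next
    case (Suc k)
    have "Ck k (\<lambda>x. pd b p x * (flat (n + 2) (p x) + (- real n) * flat (n + 1) (p x)))"
      if "b \<in> Basis" for b
      using smooth_const[of "- real n"] smooth_pd[OF assms that] unfolding smooth_def
      by (intro Ck_mult Ck_add Suc) auto
    then show ?case
      using d unfolding Ck_Suc differentiable_def by (auto simp only: pd)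
  qed
  then show ?thesis by (simp add: smooth_def)
qed

lemma pd_eq_0_outside:
  fixes f :: "'a::euclidean_space \<Rightarrow> real"
  assumes "closed K" "\<And>x. x \<notin> K \<Longrightarrow> f x = 0" "x \<notin> K"
  shows "pd b f x = 0"
proof -
  have "(f has_derivative (\<lambda>h. 0)) (at x)"
    by (rule has_derivative_transform_within_open[of "\<lambda>x. 0" _ _ UNIV "- K"]) (use assms in auto)
  then show ?thesis by (rule pd_eqI)
qed

lemma test_funI:
  assumes "smooth f" "compact K" "K \<subseteq> U" "\<And>x. x \<notin> K \<Longrightarrow> f x = 0"
  shows "test_fun U f"
proof -
  have "closure {x. f x \<noteq> 0} \<subseteq> K"
    using assms by (intro closure_minimal compact_imp_closed) auto
  then show ?thesis using assms unfolding test_fun_def smooth_def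
    by (meson bounded_subset closed_closure compact_eq_bounded_closed order_trans)
qed

lemma test_funE:
  assumes "test_fun U f"
  obtains K where "smooth f" "compact K" "K \<subseteq> U" "\<And>x. x \<notin> K \<Longrightarrow> f x = 0"
  using assms that[of "closure {x. f x \<noteq> 0}"] unfolding test_fun_def smooth_def
  by (metis (mono_tags, lifting) closure_subset mem_Collect_eq subsetD)

lemma test_fun_smooth: "test_fun U f \<Longrightarrow> smooth f"
  by (auto elim: test_funE)

lemma test_fun_pd: "test_fun U f \<Longrightarrow> b \<in> Basis \<Longrightarrow> test_fun U (pd b f)"
  by (elim test_funE, rule test_funI) (auto intro: smooth_pd pd_eq_0_outside compact_imp_closed)

lemma test_fun_mono: "test_fun U f \<Longrightarrow> U \<subseteq> V \<Longrightarrow> test_fun V f"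
  by (auto simp: test_fun_def)

lemma continuous_compact_support_bounded:
  fixes f :: "'a::euclidean_space \<Rightarrow> real"
  assumes "continuous_on UNIV f" "compact K" "\<And>x. x \<notin> K \<Longrightarrow> f x = 0"
  obtains B where "B > 0" "\<And>x. \<bar>f x\<bar> \<le> B"
proof -
  have "bounded (f ` K)"
    using assms by (intro compact_imp_bounded compact_continuous_image) (auto intro: continuous_on_subset)
  then obtain B where B: "\<And>x. x \<in> K \<Longrightarrow> \<bar>f x\<bar> \<le> B" unfolding bounded_iff by auto
  show ?thesis
  proof (rule that[of "max B 1"])
    show "\<bar>f x\<bar> \<le> max B 1" for x
      using B[of x] assms(3)[of x] by (cases "x \<in> K") auto
  qed auto
qed

lemma continuous_compact_support_uniform:
  fixes f :: "'a::euclidean_space \<Rightarrow> real"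
  assumes "continuous_on UNIV f" "compact K" "\<And>x. x \<notin> K \<Longrightarrow> f x = 0" "e > 0"
  obtains d where "d > 0" "\<And>x y. dist x y < d \<Longrightarrow> \<bar>f x - f y\<bar> < e"
proof -
  obtain r where r: "r > 0" "K \<subseteq> cball 0 r"
    using compact_imp_bounded[OF assms(2)] bounded_subset_ballD[of K 0] ball_subset_cball[of 0]
    by (metis order_trans)
  have "uniformly_continuous_on (cball 0 (r + 1)) f"
    using assms by (intro compact_uniformly_continuous) (auto intro: continuous_on_subset)
  then obtain d where d: "d > 0" "\<And>x y. x \<in> cball 0 (r+1) \<Longrightarrow> y \<in> cball 0 (r+1) \<Longrightarrow> dist y x < d \<Longrightarrow> dist (f y) (f x) < e"
    unfolding uniformly_continuous_on_def using assms(4) by metis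
  show ?thesis
  proof (rule that[of "min d 1"])
    fix x y :: 'a assume xy: "dist x y < min d 1"
    show "\<bar>f x - f y\<bar> < e"
    proof (cases "x \<in> cball 0 (r+1) \<and> y \<in> cball 0 (r+1)")
      case True
      then show ?thesis using d(2)[of y x] xy by (auto simp: dist_real_def)
    next
      case False
      have "norm x \<le> norm y + dist x y" "norm y \<le> norm x + dist x y"
        using norm_triangle_ineq2[of x y] norm_triangle_ineq2[of y x] by (auto simp: dist_norm norm_minus_commute)
      then have "x \<notin> cball 0 r" "y \<notin> cball 0 r" using False xy by auto
      then show ?thesis using r assms(3,4) by (metis abs_zero diff_zero subsetD)
    qed
  qed (use d in auto)
qed

section \<open>Convolution and integration by parts\<close>

text \<open>With the sign \<open>z + w\<close> and a kernel living in positive times, \<open>conv\<close> yields potentials for the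
  backward heat operator \<open>dt + lap\<close>, as needed for test functions.\<close>
definition conv :: "('a::euclidean_space \<Rightarrow> real) \<Rightarrow> ('a \<Rightarrow> real) \<Rightarrow> 'a \<Rightarrow> real" where
  "conv K f z = (LINT w|lborel. K w * f (z + w))"

lemma conv_integrable:
  fixes K :: "'a::euclidean_space \<Rightarrow> real"
  assumes "integrable lborel K" "continuous_on UNIV f" "\<And>x. \<bar>f x\<bar> \<le> B"
  shows "integrable lborel (\<lambda>w. K w * f (z + w))"
proof (rule Bochner_Integration.integrable_bound[of _ "\<lambda>w. B * K w"])
  have [measurable]: "f \<in> borel_measurable borel" by (rule borel_measurable_continuous_onI) fact
  have [measurable]: "K \<in> borel_measurable borel" using assms(1) by auto
  show "(\<lambda>w. K w * f (z + w)) \<in> borel_measurable lborel" by measurable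
  have "0 \<le> B" using assms(3)[of 0] by linarith
  then show "AE w in lborel. norm (K w * f (z + w)) \<le> norm (B * K w)"
    using mult_right_mono[OF assms(3), of "\<bar>K w\<bar>" for w]
    by (intro AE_I2) (simp add: abs_mult mult.commute)
qed (use assms in auto)

lemma conv_bound:
  fixes K :: "'a::euclidean_space \<Rightarrow> real"
  assumes "integrable lborel K" "continuous_on UNIV f" "\<And>x. \<bar>f x\<bar> \<le> B"
  shows "\<bar>conv K f z\<bar> \<le> B * (LINT w|lborel. \<bar>K w\<bar>)"
proof -
  have "\<bar>conv K f z\<bar> \<le> (LINT w|lborel. \<bar>K w * f (z + w)\<bar>)"
    unfolding conv_def by (rule integral_abs_bound)
  also have "\<dots> \<le> (LINT w|lborel. B * \<bar>K w\<bar>)"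
  proof (rule integral_mono)
    show "integrable lborel (\<lambda>w. \<bar>K w * f (z + w)\<bar>)"
      using conv_integrable[OF assms] by (rule integrable_abs)
    show "\<bar>K w * f (z + w)\<bar> \<le> B * \<bar>K w\<bar>" for w
      using mult_right_mono[OF assms(3)[of "z + w"], of "\<bar>K w\<bar>"] by (simp add: abs_mult mult.commute)
  qed (use assms(1) in auto)
  finally show ?thesis by simp
qed

text \<open>Compact support makes the partial derivatives uniformly continuous, so the remainder is
  small uniformly in the base point. This uniformity is what permits differentiation under an
  integral against a merely integrable kernel.\<close>

lemma uniform_derivative_remainder:
  fixes f :: "'a::euclidean_space \<Rightarrow> real"
  assumes "smooth f" "compact C" "\<And>x. x \<notin> C \<Longrightarrow> f x = 0" "e > 0"
  obtains d where "d > 0"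
    "\<And>x h. norm h < d \<Longrightarrow> \<bar>f (x + h) - f x - (\<Sum>b\<in>Basis. (h \<bullet> b) * pd b f x)\<bar> \<le> e * norm h"
proof -
  define e' where "e' = e / DIM('a)"
  have e': "e' > 0" using assms(4) by (simp add: e'_def)
  have "\<exists>d>0. \<forall>x y. dist x y < d \<longrightarrow> \<bar>pd b f x - pd b f y\<bar> < e'" if "b \<in> Basis" for b
  proof -
    have "continuous_on UNIV (pd b f)" using smooth_continuous[OF smooth_pd[OF assms(1) that]] .
    moreover have "pd b f x = 0" if "x \<notin> C" for x
      using pd_eq_0_outside[OF compact_imp_closed[OF assms(2)] assms(3) that] .
    ultimately obtain d where "d > 0" "\<And>x y. dist x y < d \<Longrightarrow> \<bar>pd b f x - pd b f y\<bar> < e'"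
      using continuous_compact_support_uniform assms(2) e' by blast
    then show ?thesis by blast
  qed
  then obtain d where d: "\<And>b. b \<in> Basis \<Longrightarrow> d b > 0"
    "\<And>b x y. b \<in> Basis \<Longrightarrow> dist x y < d b \<Longrightarrow> \<bar>pd b f x - pd b f y\<bar> < e'"
    by metis
  define d' where "d' = Min (d ` Basis)"
  have d': "d' > 0" "\<And>b. b \<in> Basis \<Longrightarrow> d' \<le> d b"
    using d by (auto simp: d'_def)
  show ?thesis
  proof (rule that[OF d'(1)])
    fix x h :: 'a assume h: "norm h < d'"
    let ?D = "\<lambda>y h. \<Sum>b\<in>Basis. (h \<bullet> b) * pd b f y"
    define F where "F = (\<lambda>y. f y - ?D x y)"
    have "norm (F (x + h) - F x) \<le> norm h * e"
    proof (rule differentiable_bound_segment[where f' = "\<lambda>y h. ?D y h - ?D x h" and G = UNIV])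
      fix y assume "y \<in> (UNIV :: 'a set)"
      show "(F has_derivative (\<lambda>h. ?D y h - ?D x h)) (at y within UNIV)"
        by (auto simp: F_def intro!: derivative_eq_intros smooth_has_derivative assms)
    next
      fix t :: real assume t: "t \<in> {0..1}"
      have "norm (?D (x + t *\<^sub>R h) k - ?D x k) \<le> norm k * e" for k
      proof -
        have "norm (?D (x + t *\<^sub>R h) k - ?D x k) = \<bar>\<Sum>b\<in>Basis. (k \<bullet> b) * (pd b f (x + t *\<^sub>R h) - pd b f x)\<bar>"
          by (simp add: sum_subtractf right_diff_distrib)
        also have "\<dots> \<le> (\<Sum>b\<in>(Basis::'a set). norm k * e')"
        proof (rule order.trans[OF sum_abs], rule sum_mono)
          fix b :: 'a assume b: "b \<in> Basis"
          have "dist (x + t *\<^sub>R h) x \<le> norm h"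
            using t by (auto simp: dist_norm intro!: mult_left_le_one_le)
          then have "\<bar>pd b f (x + t *\<^sub>R h) - pd b f x\<bar> < e'"
            using h d'(2)[OF b] by (intro d(2)[OF b]) auto
          then show "\<bar>(k \<bullet> b) * (pd b f (x + t *\<^sub>R h) - pd b f x)\<bar> \<le> norm k * e'"
            using Basis_le_norm[OF b, of k] by (auto simp: abs_mult intro!: mult_mono)
        qed
        finally show ?thesis by (simp add: e'_def)
      qed
      then show "onorm (\<lambda>h'. ?D (x + t *\<^sub>R h) h' - ?D x h') \<le> e"
        by (intro onorm_le) (simp add: mult.commute)
    qed auto
    then show "\<bar>f (x + h) - f x - ?D x h\<bar> \<le> e * norm h"
      by (simp add: F_def inner_add_left distrib_right sum.distrib algebra_simps)
  qed
qed

text \<open>All derivatives fall on \<open>f\<close>. The kernel only has to be integrable, which is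
  all that a heat kernel with its pole offers.\<close>

lemma conv_has_derivative:
  fixes f :: "'a::euclidean_space \<Rightarrow> real"
  assumes K: "integrable lborel K" and f: "smooth f" "compact C" "\<And>x. x \<notin> C \<Longrightarrow> f x = 0"
  shows "(conv K f has_derivative (\<lambda>h. \<Sum>b\<in>Basis. (h \<bullet> b) * conv K (pd b f) z)) (at z)"
proof -
  have pd: "continuous_on UNIV (pd b f)" "\<And>x. x \<notin> C \<Longrightarrow> pd b f x = 0" if "b \<in> Basis" for b
    using f that by (auto intro: smooth_continuous smooth_pd pd_eq_0_outside compact_imp_closed)
  have int: "integrable lborel (\<lambda>w. K w * g (z + w))"
    if g: "continuous_on UNIV g" and g0: "\<And>x. x \<notin> C \<Longrightarrow> g x = 0" for g z
  proof -
    obtain B where "\<And>x. \<bar>g x\<bar> \<le> B"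
      using continuous_compact_support_bounded[OF g f(2) g0] by blast
    then show ?thesis by (rule conv_integrable[OF K g])
  qed
  note int_pd = int[OF pd]
  note int_f = int[OF smooth_continuous[OF f(1)] f(3)]
  define N where "N = (LINT w|lborel. \<bar>K w\<bar>)"
  have N: "N \<ge> 0" by (simp add: N_def)
  let ?D = "\<lambda>y h. \<Sum>b\<in>Basis. (h \<bullet> b) * pd b f y"
  have intD: "integrable lborel (\<lambda>w. K w * ?D (z + w) h)" for h
  proof -
    have "integrable lborel (\<lambda>w. \<Sum>b\<in>Basis. (h \<bullet> b) * (K w * pd b f (z + w)))"
      using int_pd by (intro Bochner_Integration.integrable_sum integrable_mult_right) auto
    then show ?thesis by (simp add: sum_distrib_left mult.left_commute)
  qed
  have eqD: "(LINT w|lborel. K w * ?D (z + w) h) = (\<Sum>b\<in>Basis. (h \<bullet> b) * conv K (pd b f) z)" for h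
  proof -
    have "(\<Sum>b\<in>Basis. (h \<bullet> b) * conv K (pd b f) z) = (LINT w|lborel. (\<Sum>b\<in>Basis. (h \<bullet> b) * (K w * pd b f (z + w))))"
      unfolding conv_def using int_pd
      by (subst Bochner_Integration.integral_sum) (auto intro: integrable_mult_right)
    then show ?thesis by (simp add: sum_distrib_left mult.left_commute)
  qed
  show ?thesis unfolding has_derivative_at_alt
  proof (intro conjI allI impI)
    show "bounded_linear (\<lambda>h. \<Sum>b\<in>Basis. (h \<bullet> b) * conv K (pd b f) z)"
      by (intro bounded_linear_intros)
    fix e :: real assume e: "e > 0"
    obtain d where d: "d > 0"
      "\<And>x h. norm h < d \<Longrightarrow> \<bar>f (x + h) - f x - ?D x h\<bar> \<le> (e / (N + 1)) * norm h"
    proof -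
      have e': "0 < e / (N + 1)" using e N by simp
      show ?thesis by (rule uniform_derivative_remainder[OF f(1,2) _ e']) (rule f(3), assumption, rule that)
    qed
    show "\<exists>d>0. \<forall>y. norm (y - z) < d \<longrightarrow> norm (conv K f y - conv K f z -
        (\<Sum>b\<in>Basis. ((y - z) \<bullet> b) * conv K (pd b f) z)) \<le> e * norm (y - z)"
    proof (intro exI[of _ d] conjI allI impI d(1))
      fix y assume y: "norm (y - z) < d"
      define h where "h = y - z"
      have zwh: "z + w + h = y + w" for w by (simp add: h_def)
      have eq: "conv K f y - conv K f z - (LINT w|lborel. K w * ?D (z + w) h)
        = (LINT w|lborel. K w * (f (z + w + h) - f (z + w) - ?D (z + w) h))"
        using int_f[of y] int_f[of z] intD[of h]
        unfolding conv_def zwh by (simp add: right_diff_distrib)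
      have "\<bar>conv K f y - conv K f z - (LINT w|lborel. K w * ?D (z + w) h)\<bar>
          \<le> (LINT w|lborel. \<bar>K w * (f (z + w + h) - f (z + w) - ?D (z + w) h)\<bar>)"
        unfolding eq
        by (rule integral_abs_bound)
      also have "\<dots> \<le> (LINT w|lborel. (e / (N + 1) * norm h) * \<bar>K w\<bar>)"
      proof (rule integral_mono)
        show "integrable lborel (\<lambda>w. \<bar>K w * (f (z + w + h) - f (z + w) - ?D (z + w) h)\<bar>)"
          using int_f[of y] int_f[of z] intD[of h] unfolding zwh by (simp add: right_diff_distrib)
        show "\<bar>K w * (f (z + w + h) - f (z + w) - ?D (z + w) h)\<bar> \<le> (e / (N + 1) * norm h) * \<bar>K w\<bar>" for w
          unfolding abs_mult mult.commute[of "\<bar>K w\<bar>"]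
          by (intro mult_right_mono d(2)) (use y h_def in auto)
      qed (use K in auto)
      also have "\<dots> = (e / (N + 1) * norm h) * N" by (simp add: N_def)
      also have "\<dots> \<le> e * norm h"
        using mult_right_mono[of "N / (N + 1)" 1 "e * norm h"] N e by (simp add: mult_ac)
      finally show "norm (conv K f y - conv K f z -
        (\<Sum>b\<in>Basis. ((y - z) \<bullet> b) * conv K (pd b f) z)) \<le> e * norm (y - z)"
        unfolding eqD h_def by simp
    qed
  qed
qed

lemma pd_conv:
  assumes "integrable lborel K" "test_fun UNIV f" "b \<in> Basis"
  shows "pd b (conv K f) = conv K (pd b f)"
proof
  fix z
  obtain C where C: "smooth f" "compact C" "\<And>x. x \<notin> C \<Longrightarrow> f x = 0"
    using assms(2) by (auto elim: test_funE)
  show "pd b (conv K f) z = conv K (pd b f) z"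
    using pd_eqI[OF conv_has_derivative[OF assms(1) C, of z]] assms(3) by (simp add: sum_Basis_inner)
qed

lemma smooth_conv:
  assumes "integrable lborel K" "test_fun UNIV f"
  shows "smooth (conv K f)"
proof (rule smooth_coinduct[of "\<lambda>g. \<exists>f. g = conv K f \<and> test_fun UNIV f"])
  show "\<exists>f'. conv K f = conv K f' \<and> test_fun UNIV f'" using assms by auto
  fix g :: "'a \<Rightarrow> real" and x b :: 'a assume "\<exists>f. g = conv K f \<and> test_fun UNIV f"
  then obtain f where f: "g = conv K f" "test_fun UNIV f" by auto
  then obtain C where C: "smooth f" "compact C" "\<And>x. x \<notin> C \<Longrightarrow> f x = 0" by (auto elim: test_funE)
  show "g differentiable at x"
    using conv_has_derivative[OF assms(1) C, of x] f unfolding differentiable_def by blast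
  assume "b \<in> Basis"
  then show "\<exists>f. pd b g = conv K f \<and> test_fun UNIV f"
    using pd_conv[OF assms(1) f(2)] test_fun_pd[OF f(2)] f(1) by auto
qed

lemma compact_diff_set:
  fixes A B :: "'a::euclidean_space set"
  assumes "compact A" "compact B"
  shows "compact {x - y | x y. x \<in> A \<and> y \<in> B}"
  using compact_differences[OF assms] by (simp add: conj_commute)

lemma test_fun_conv:
  assumes K: "integrable lborel K" "compact S" "\<And>w. w \<notin> S \<Longrightarrow> K w = 0"
    and f: "smooth f" "compact C" "\<And>x. x \<notin> C \<Longrightarrow> f x = 0"
    and U: "\<And>x w. x \<in> C \<Longrightarrow> w \<in> S \<Longrightarrow> x - w \<in> U"
  shows "test_fun U (conv K f)"
proof (rule test_funI)
  show "smooth (conv K f)" using f by (intro smooth_conv K test_funI[of _ C]) auto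
  show "compact {x - w | x w. x \<in> C \<and> w \<in> S}" by (rule compact_diff_set) fact+
  show "{x - w | x w. x \<in> C \<and> w \<in> S} \<subseteq> U" using U by auto
  fix z assume z: "z \<notin> {x - w | x w. x \<in> C \<and> w \<in> S}"
  have "K w * f (z + w) = 0" for w
  proof (rule ccontr)
    assume "K w * f (z + w) \<noteq> 0"
    then have "w \<in> S" "z + w \<in> C" using K(3) f(3) by force+
    moreover have "z = z + w - w" by simp
    ultimately show False using z by blast
  qed
  then have "(\<lambda>w. K w * f (z + w)) = (\<lambda>w. 0)" by blast
  then show "conv K f z = 0" by (simp add: conv_def)
qed

lemma pd_shift:
  assumes "f differentiable at (z + x)"
  shows "((\<lambda>x. f (z + x)) has_derivative (\<lambda>h. \<Sum>b\<in>Basis. (h \<bullet> b) * pd b f (z + x))) (at x)"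
    and "pd b (\<lambda>x. f (z + x)) x = pd b f (z + x)"
proof -
  have s: "((\<lambda>x. z + x) has_derivative (\<lambda>h. h)) (at x)"
    by (auto intro!: derivative_eq_intros)
  show "((\<lambda>x. f (z + x)) has_derivative (\<lambda>h. \<Sum>b\<in>Basis. (h \<bullet> b) * pd b f (z + x))) (at x)"
    using has_derivative_compose[OF s differentiable_has_derivative_pd[OF assms]] .
  show "pd b (\<lambda>x. f (z + x)) x = pd b f (z + x)"
    using has_derivative_compose[OF s assms[unfolded frechet_derivative_works]]
    by (subst pd_eqI) (auto simp: pd_def)
qed

lemma test_fun_shift:
  assumes "test_fun UNIV f" shows "test_fun UNIV (\<lambda>x. f (z + x))"
proof -
  obtain C where C: "smooth f" "compact C" "\<And>x. x \<notin> C \<Longrightarrow> f x = 0"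
    using assms(1) by (auto elim: test_funE)
  show "test_fun UNIV (\<lambda>x. f (z + x))"
  proof (rule test_funI)
    show "smooth (\<lambda>x. f (z + x))"
    proof (rule smooth_coinduct[of "\<lambda>g. \<exists>f. smooth f \<and> g = (\<lambda>x. f (z + x))"])
      show "\<exists>g. smooth g \<and> (\<lambda>x. f (z + x)) = (\<lambda>x. g (z + x))" using C by auto
      fix g and x b :: 'a assume "\<exists>f. smooth f \<and> g = (\<lambda>x. f (z + x))"
      then obtain f where f: "smooth f" "g = (\<lambda>x. f (z + x))" by auto
      show "g differentiable at x"
        using pd_shift(1)[OF smooth_differentiable[OF f(1)]] f(2) unfolding differentiable_def by blast
      assume b: "b \<in> Basis"
      have "pd b g = (\<lambda>x. pd b f (z + x))"
        using pd_shift(2)[OF smooth_differentiable[OF f(1)]] f(2) by auto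
      then show "\<exists>f. smooth f \<and> pd b g = (\<lambda>x. f (z + x))" using smooth_pd[OF f(1) b] by auto
    qed
    show "compact ((\<lambda>x. - z + x) ` C)" by (rule compact_translation) fact
    fix x assume x: "x \<notin> (\<lambda>x. - z + x) ` C"
    have "z + x \<notin> C" using x image_eqI[of x "\<lambda>x. - z + x" "z + x" C] by auto
    then show "f (z + x) = 0" by (rule C(3))
  qed simp
qed

lemma integrable_compact_support:
  fixes f :: "'a::euclidean_space \<Rightarrow> real"
  assumes "continuous_on UNIV f" "compact C" "\<And>x. x \<notin> C \<Longrightarrow> f x = 0"
  shows "integrable lborel f"
proof -
  have "integrable lborel (\<lambda>x. indicator C x *\<^sub>R f x)"
    using assms by (intro borel_integrable_compact) (auto intro: continuous_on_subset)
  moreover have "(\<lambda>x. indicator C x *\<^sub>R f x) = f"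
    using assms(3) by (auto simp: indicator_def fun_eq_iff)
  ultimately show ?thesis by simp
qed

lemma test_fun_integrable: "test_fun U f \<Longrightarrow> integrable lborel f"
  by (elim test_funE, rule integrable_compact_support) (auto intro: smooth_continuous)

lemma lborel_integral_translate:
  fixes f :: "'a::euclidean_space \<Rightarrow> real"
  shows "(LINT x|lborel. f (x + a)) = (LINT x|lborel. f x)"
    and "integrable lborel f \<Longrightarrow> integrable lborel (\<lambda>x. f (x + a))"
proof -
  have d: "lborel = distr lborel borel (\<lambda>x. a + x)" using lborel_distr_plus by metis
  show "(LINT x|lborel. f (x + a)) = (LINT x|lborel. f x)"
  proof (cases "f \<in> borel_measurable borel")
    case True
    then show ?thesis by (subst (2) d, subst integral_distr) (auto simp: add.commute)
  next
    \<comment> \<open>Without measurability neither function is integrable, and both integrals have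
      the default value 0.\<close>
    case False
    have "(\<lambda>x. f (x + a)) \<notin> borel_measurable borel"
    proof
      assume [measurable]: "(\<lambda>x. f (x + a)) \<in> borel_measurable borel"
      have "(\<lambda>x. (\<lambda>x. f (x + a)) (x - a)) \<in> borel_measurable borel" by measurable
      then show False using False by simp
    qed
    then have "\<not> integrable lborel (\<lambda>x. f (x + a))" "\<not> integrable lborel f"
      using False borel_measurable_integrable[of lborel] by auto
    then show ?thesis by (simp add: not_integrable_integral_eq)
  qed
  show "integrable lborel (\<lambda>x. f (x + a))" if "integrable lborel f"
    using that by (subst (asm) d, subst (asm) integrable_distr_eq) (auto simp: add.commute)
qed

text \<open>Translation invariance gives each difference quotient of \<open>F\<close> integral 0,
  and dominated convergence passes to the limit. A continuous derivative in the single direction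
  \<open>b\<close> is enough, so the lemma applies to time slices of the cut-off kernels, which are
  not known to be \<open>smooth\<close>.\<close>

lemma integral_directional_derivative_zero:
  fixes F :: "'a::euclidean_space \<Rightarrow> real"
  assumes D: "\<And>x t. ((\<lambda>t. F (x + t *\<^sub>R b)) has_real_derivative D (x + t *\<^sub>R b)) (at t)"
    and c: "continuous_on UNIV F" "continuous_on UNIV D"
    and C: "compact C" "\<And>x. x \<notin> C \<Longrightarrow> F x = 0" "\<And>x. x \<notin> C \<Longrightarrow> D x = 0"
  shows "(LINT x|lborel. D x) = 0"
proof -
  obtain r where r: "C \<subseteq> cball 0 r"
    using compact_imp_bounded[OF C(1)] bounded_subset_ballD[of C 0] ball_subset_cball[of 0]
    by (metis order_trans)
  obtain B where B: "B > 0" "\<And>x. \<bar>D x\<bar> \<le> B"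
    using continuous_compact_support_bounded[OF c(2) C(1,3)] by blast
  define h where "h n = 1 / real (Suc n)" for n
  have h: "h n > 0" "h n \<le> 1" for n by (auto simp: h_def)
  have iF: "integrable lborel F" by (rule integrable_compact_support[OF c(1) C(1,2)])
  define g where "g n x = (F (x + h n *\<^sub>R b) - F x) / h n" for n x
  have mvt: "\<bar>F (x + h n *\<^sub>R b) - F x\<bar> \<le> B * h n" for n x
  proof -
    obtain z where "F (x + h n *\<^sub>R b) - F (x + 0 *\<^sub>R b) = (h n - 0) * D (x + z *\<^sub>R b)"
      using MVT2[of 0 "h n" "\<lambda>t. F (x + t *\<^sub>R b)" "\<lambda>t. D (x + t *\<^sub>R b)"] D h(1)[of n] by auto
    then show ?thesis using B(2)[of "x + z *\<^sub>R b"] h(1)[of n]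
      by (auto simp: abs_mult mult.commute intro!: mult_right_mono)
  qed
  have "(\<lambda>n. LINT x|lborel. g n x) \<longlonglongrightarrow> (LINT x|lborel. D x)"
  \<comment> \<open>The steps \<open>h n\<close> are at most 1, so all difference quotients vanish
    outside this enlarged ball.\<close>
  proof (rule integral_dominated_convergence[where w = "\<lambda>x. B * indicator (cball 0 (r + norm b)) x"])
    have [measurable]: "F \<in> borel_measurable borel" "D \<in> borel_measurable borel"
      using c by (auto intro: borel_measurable_continuous_onI)
    show "D \<in> borel_measurable lborel" by simp
    show "g n \<in> borel_measurable lborel" for n unfolding g_def by measurable
    show "integrable lborel (\<lambda>x. B * indicator (cball 0 (r + norm b)) x)"
      by (intro integrable_mult_right integrable_real_indicator emeasure_lborel_cball_finite) auto
    show "AE x in lborel. (\<lambda>n. g n x) \<longlonglongrightarrow> D x"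
    proof (intro AE_I2)
      fix x
      have "((\<lambda>t. (F (x + t *\<^sub>R b) - F x) / t) \<longlongrightarrow> D x) (at 0)"
        using D[of x 0] by (simp add: DERIV_def)
      moreover have "filterlim h (at 0) sequentially"
        unfolding filterlim_at h_def using LIMSEQ_inverse_real_of_nat
        by (auto simp: inverse_eq_divide)
      ultimately show "(\<lambda>n. g n x) \<longlonglongrightarrow> D x"
        unfolding g_def by (rule filterlim_compose)
    qed
    show "AE x in lborel. norm (g n x) \<le> B * indicator (cball 0 (r + norm b)) x" for n
    proof (intro AE_I2)
      fix x
      show "norm (g n x) \<le> B * indicator (cball 0 (r + norm b)) x"
      proof (cases "x \<in> cball 0 (r + norm b)")
        case True
        then show ?thesis using mvt[of x n] h(1)[of n] by (simp add: g_def field_simps)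
      next
        case False
        then have "norm x > r + norm b" by simp
        moreover have "norm (h n *\<^sub>R b) \<le> norm b" using h[of n] by (simp add: mult_left_le_one_le)
        moreover have "norm x \<le> norm (x + h n *\<^sub>R b) + norm (h n *\<^sub>R b)"
          using norm_triangle_ineq4[of "x + h n *\<^sub>R b" "h n *\<^sub>R b"] by simp
        ultimately have "norm (x + h n *\<^sub>R b) > r" "norm x > r" using norm_ge_zero[of b] by linarith+
        then have "x + h n *\<^sub>R b \<notin> C" "x \<notin> C" using r by auto
        then show ?thesis using C B(1) by (simp add: g_def)
      qed
    qed
  qed
  moreover have "(LINT x|lborel. g n x) = 0" for n
    using iF lborel_integral_translate[of F "h n *\<^sub>R b"] by (simp add: g_def)
  ultimately show ?thesis by (simp add: LIMSEQ_const_iff)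
qed

lemma smooth_line_derivative:
  assumes "smooth f" "b \<in> Basis"
  shows "((\<lambda>t. f (x + t *\<^sub>R b)) has_real_derivative pd b f (x + t *\<^sub>R b)) (at t)"
proof -
  have "((\<lambda>t. x + t *\<^sub>R b) has_derivative (\<lambda>h. h *\<^sub>R b)) (at t)"
    by (auto intro!: derivative_eq_intros)
  from has_derivative_compose[OF this smooth_has_derivative[OF assms(1)]]
  show ?thesis using assms(2)
    by (simp add: has_field_derivative_def sum_Basis_inner mult.assoc sum_distrib_left[symmetric] mult_commute_abs)
qed

lemma test_fun_mult: "test_fun U f \<Longrightarrow> smooth g \<Longrightarrow> test_fun U (\<lambda>x. f x * g x)"
  by (elim test_funE, rule test_funI) (auto intro: smooth_mult)

lemma test_fun_integral_pd:
  assumes "test_fun U f" "b \<in> Basis" shows "(LINT x|lborel. pd b f x) = 0"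
proof -
  obtain C where C: "smooth f" "compact C" "\<And>x. x \<notin> C \<Longrightarrow> f x = 0"
    using assms(1) by (auto elim: test_funE)
  show ?thesis
    by (rule integral_directional_derivative_zero[OF smooth_line_derivative[OF C(1) assms(2)], of C])
      (use C assms in \<open>auto intro: smooth_continuous smooth_pd pd_eq_0_outside compact_imp_closed\<close>)
qed

lemma test_fun_integral_by_parts:
  assumes "test_fun U f" "smooth g" "b \<in> Basis"
  shows "(LINT x|lborel. f x * pd b g x) = - (LINT x|lborel. pd b f x * g x)"
proof -
  have "(LINT x|lborel. f x * pd b g x + pd b f x * g x) = 0"
    using test_fun_integral_pd[OF test_fun_mult[OF assms(1,2)] assms(3)] assms(2) test_fun_smooth[OF assms(1)]
    by (simp add: pd_mult smooth_differentiable)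
  moreover have "integrable lborel (\<lambda>x. f x * pd b g x)" "integrable lborel (\<lambda>x. pd b f x * g x)"
    using assms by (auto intro!: test_fun_integrable test_fun_mult test_fun_pd smooth_pd)
  ultimately show ?thesis by simp
qed

section \<open>The heat operator on space-time and its L2 estimate\<close>

definition dt :: "('a::euclidean_space \<times> real \<Rightarrow> real) \<Rightarrow> 'a \<times> real \<Rightarrow> real" where
  "dt = pd (0, 1)"

definition lap :: "('a::euclidean_space \<times> real \<Rightarrow> real) \<Rightarrow> 'a \<times> real \<Rightarrow> real" where
  "lap f z = (\<Sum>b\<in>Basis. pd (b, 0) (pd (b, 0) f) z)"

lemma time_in_Basis [simp]: "(0, 1::real) \<in> Basis"
  and space_in_Basis [simp]: "b \<in> Basis \<Longrightarrow> (b, 0::real) \<in> Basis"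
  by (auto simp: Basis_prod_def)

lemma test_fun_dt: "test_fun U f \<Longrightarrow> test_fun U (dt f)"
  unfolding dt_def by (rule test_fun_pd) auto

lemma test_fun_zero: "test_fun U (\<lambda>x. 0)"
  by (rule test_funI[of _ "{}"]) auto

lemma test_fun_add:
  assumes "test_fun U f" "test_fun U g" shows "test_fun U (\<lambda>x. f x + g x)"
proof -
  obtain C where C: "smooth f" "compact C" "C \<subseteq> U" "\<And>x. x \<notin> C \<Longrightarrow> f x = 0"
    using assms(1) by (auto elim: test_funE)
  obtain D where D: "smooth g" "compact D" "D \<subseteq> U" "\<And>x. x \<notin> D \<Longrightarrow> g x = 0"
    using assms(2) by (auto elim: test_funE)
  show ?thesis by (rule test_funI[of _ "C \<union> D"]) (use C D in \<open>auto intro: smooth_add\<close>)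
qed

lemma test_fun_sum: "finite I \<Longrightarrow> (\<And>i. i \<in> I \<Longrightarrow> test_fun U (f i)) \<Longrightarrow> test_fun U (\<lambda>x. \<Sum>i\<in>I. f i x)"
  by (induction I rule: finite_induct) (auto intro: test_fun_add test_fun_zero)

lemma test_fun_lap: "test_fun U f \<Longrightarrow> test_fun U (lap f)"
  unfolding lap_def[abs_def] by (intro test_fun_sum test_fun_pd) auto

lemma test_fun_cmult: "test_fun U f \<Longrightarrow> test_fun U (\<lambda>x. c * f x)"
  using test_fun_mult[of U f "\<lambda>x. c"] by (simp add: mult.commute)

text \<open>With a difference quotient in place of \<open>pd e f\<close>, one integration by parts
  leaves the squared norm of \<open>pd b f\<close> minus its product with a translate, which is
  nonnegative. In this way the order of mixed derivatives never has to be exchanged; only the sign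
  survives, and only the sign is used.\<close>

lemma integral_dt_pd2_nonneg:
  fixes f :: "'a::euclidean_space \<times> real \<Rightarrow> real"
  assumes f: "test_fun UNIV f" and b: "b \<in> Basis" and e: "e \<in> Basis"
  shows "0 \<le> (LINT z|lborel. pd e f z * pd b (pd b f) z)"
proof -
  define h where "h n = 1 / real (Suc n)" for n
  have h: "h n > 0" for n by (auto simp: h_def)
  define g where "g n z = (f (h n *\<^sub>R e + z) + (-1) * f z)" for n z
  have g: "test_fun UNIV (g n)" for n
    unfolding g_def by (intro test_fun_add test_fun_shift f test_fun_cmult)
  have df: "f differentiable at z" for z using f by (auto intro: smooth_differentiable test_fun_smooth)
  have tG: "test_fun UNIV (pd b f)" by (rule test_fun_pd) fact+
  have pdm: "pd b (\<lambda>z. - f z) z = - pd b f z" for z using pd_cmult[OF df, of b "-1" z] by simp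
  have pdg: "pd b (g n) z = pd b f (h n *\<^sub>R e + z) + (-1) * pd b f z" for n z
  proof -
    have "(\<lambda>x. f (h n *\<^sub>R e + x)) differentiable at z" "(\<lambda>x. (-1) * f x) differentiable at z"
      by (rule smooth_differentiable[OF test_fun_smooth[OF test_fun_shift[OF f]]])
        (rule smooth_differentiable[OF test_fun_smooth[OF test_fun_cmult[OF f]]])
    from pd_add[OF this] show ?thesis
      unfolding g_def by (simp add: pdm pd_shift(2)[OF df])
  qed
  have "0 \<le> (LINT z|lborel. g n z * pd b (pd b f) z)" for n
  proof -
    let ?G = "pd b f"
    define G where "G z = ?G (z + h n *\<^sub>R e)" for z
    have i: "integrable lborel (\<lambda>z. (?G z)\<^sup>2)"
      unfolding power2_eq_square by (rule test_fun_integrable[OF test_fun_mult[OF tG test_fun_smooth[OF tG]]])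
    have i2: "integrable lborel (\<lambda>z. (G z)\<^sup>2)" "(LINT z|lborel. (G z)\<^sup>2) = (LINT z|lborel. (?G z)\<^sup>2)"
      using lborel_integral_translate[of "\<lambda>z. (?G z)\<^sup>2"] i by (auto simp: G_def)
    have tG2: "test_fun UNIV G"
      using test_fun_shift[OF tG, of "h n *\<^sub>R e"] by (simp add: G_def[abs_def] add.commute)
    have i3: "integrable lborel (\<lambda>z. G z * ?G z)"
      by (rule test_fun_integrable[OF test_fun_mult[OF tG2 test_fun_smooth[OF tG]]])
    have "(LINT z|lborel. g n z * pd b ?G z) = - (LINT z|lborel. pd b (g n) z * ?G z)"
      by (rule test_fun_integral_by_parts[OF g test_fun_smooth[OF tG] b])
    moreover have "(\<lambda>z. pd b (g n) z * ?G z) = (\<lambda>z. G z * ?G z - (?G z)\<^sup>2)"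
      by (simp add: fun_eq_iff pdg G_def power2_eq_square algebra_simps)
    moreover have "(LINT z|lborel. G z * ?G z - (?G z)\<^sup>2) = (LINT z|lborel. G z * ?G z) - (LINT z|lborel. (?G z)\<^sup>2)"
      using i i3 by simp
    moreover have "(LINT z|lborel. G z * ?G z) \<le> (LINT z|lborel. ((G z)\<^sup>2 + (?G z)\<^sup>2) / 2)"
    proof (rule integral_mono)
      show "G z * ?G z \<le> ((G z)\<^sup>2 + (?G z)\<^sup>2) / 2" for z
        using sum_squares_bound[of "G z" "?G z"] by simp
    qed (use i i2(1) i3 in auto)
    moreover have "(LINT z|lborel. ((G z)\<^sup>2 + (?G z)\<^sup>2) / 2) = (LINT z|lborel. (?G z)\<^sup>2)"
      using i i2 by simp
    ultimately show ?thesis by simp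
  qed
  then have pos: "0 \<le> (LINT z|lborel. g n z / h n * pd b (pd b f) z)" for n
  proof -
    have "(LINT z|lborel. g n z / h n * pd b (pd b f) z) = (LINT z|lborel. g n z * pd b (pd b f) z) / h n"
      unfolding integral_divide_zero[symmetric] by simp
    then show ?thesis using h[of n] \<open>0 \<le> (LINT z|lborel. g n z * pd b (pd b f) z)\<close> by simp
  qed
  have tGG: "test_fun UNIV (pd b (pd b f))" by (intro test_fun_pd tG b)
  obtain C where C: "smooth f" "compact C" "\<And>x. x \<notin> C \<Longrightarrow> f x = 0" using f by (auto elim: test_funE)
  obtain B where B: "\<And>x. \<bar>pd e f x\<bar> \<le> B"
  proof (rule continuous_compact_support_bounded)
    show "continuous_on UNIV (pd e f)" "compact C" using C e by (auto intro: smooth_continuous smooth_pd)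
  qed (use C in \<open>auto intro: pd_eq_0_outside compact_imp_closed\<close>)
  have bound: "\<bar>g n z / h n\<bar> \<le> B" for n z
  proof -
    obtain t where "f (z + h n *\<^sub>R e) - f (z + 0 *\<^sub>R e) = (h n - 0) * pd e f (z + t *\<^sub>R e)"
      using MVT2[of 0 "h n" "\<lambda>t. f (z + t *\<^sub>R e)" "\<lambda>t. pd e f (z + t *\<^sub>R e)"]
        smooth_line_derivative[OF C(1) e] h[of n] by auto
    then have "g n z = h n * pd e f (z + t *\<^sub>R e)" by (simp add: g_def add.commute)
    then show ?thesis using B[of "z + t *\<^sub>R e"] h[of n] by simp
  qed
  have "(\<lambda>n. LINT z|lborel. g n z / h n * pd b (pd b f) z) \<longlonglongrightarrow> (LINT z|lborel. pd e f z * pd b (pd b f) z)"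
  proof (rule integral_dominated_convergence[where w = "\<lambda>z. B * \<bar>pd b (pd b f) z\<bar>"])
    have [measurable]: "f \<in> borel_measurable borel" "pd e f \<in> borel_measurable borel" "pd b (pd b f) \<in> borel_measurable borel"
      using C b e by (auto intro!: borel_measurable_continuous_onI smooth_continuous smooth_pd)
    show "(\<lambda>z. pd e f z * pd b (pd b f) z) \<in> borel_measurable lborel" by measurable
    show "(\<lambda>z. g n z / h n * pd b (pd b f) z) \<in> borel_measurable lborel" for n unfolding g_def by measurable
    show "integrable lborel (\<lambda>z. B * \<bar>pd b (pd b f) z\<bar>)"
      using test_fun_integrable[OF tGG] by auto
    show "AE z in lborel. (\<lambda>n. g n z / h n * pd b (pd b f) z) \<longlonglongrightarrow> pd e f z * pd b (pd b f) z"
    proof (intro AE_I2 tendsto_mult tendsto_const)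
      fix z
      have "((\<lambda>t. (f (z + t *\<^sub>R e) - f z) / t) \<longlongrightarrow> pd e f z) (at 0)"
        using smooth_line_derivative[OF C(1) e, of z 0] by (simp add: DERIV_def)
      moreover have "filterlim h (at 0) sequentially"
        unfolding filterlim_at h_def using LIMSEQ_inverse_real_of_nat
        by (auto simp: inverse_eq_divide)
      ultimately have "(\<lambda>n. (f (z + h n *\<^sub>R e) - f z) / h n) \<longlonglongrightarrow> pd e f z"
        by (rule filterlim_compose)
      then show "(\<lambda>n. g n z / h n) \<longlonglongrightarrow> pd e f z"
        by (simp add: g_def add.commute)
    qed
    show "AE z in lborel. norm (g n z / h n * pd b (pd b f) z) \<le> B * \<bar>pd b (pd b f) z\<bar>" for n
      unfolding real_norm_def abs_mult by (intro AE_I2 mult_right_mono bound) auto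
  qed
  then show ?thesis by (rule LIMSEQ_le_const) (use pos in auto)
qed

text \<open>Expanding the square leaves a cross term that is nonnegative by
  \<open>integral_dt_pd2_nonneg\<close>. The lemma later controls the Laplacian of a potential in L2
  by its density.\<close>

lemma heat_energy:
  fixes f :: "'a::euclidean_space \<times> real \<Rightarrow> real"
  assumes f: "test_fun UNIV f"
  shows "(LINT z|lborel. (lap f z)\<^sup>2) \<le> (LINT z|lborel. (dt f z + lap f z)\<^sup>2)"
proof -
  note sm = test_fun_smooth[OF test_fun_dt[OF f]] test_fun_smooth[OF test_fun_lap[OF f]]
  have i1: "integrable lborel (\<lambda>z. (lap f z)\<^sup>2)" "integrable lborel (\<lambda>z. (dt f z)\<^sup>2)"
    "integrable lborel (\<lambda>z. dt f z * lap f z)"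
    unfolding power2_eq_square
    using test_fun_dt[OF f] test_fun_lap[OF f] sm
    by (auto intro!: test_fun_integrable[OF test_fun_mult])
  have "0 \<le> (\<Sum>b\<in>Basis. LINT z|lborel. dt f z * pd (b, 0) (pd (b, 0) f) z)"
    unfolding dt_def using f by (intro sum_nonneg integral_dt_pd2_nonneg) auto
  also have "\<dots> = (LINT z|lborel. dt f z * lap f z)"
    unfolding lap_def sum_distrib_left
    using f by (subst Bochner_Integration.integral_sum)
      (auto intro!: test_fun_integrable test_fun_mult test_fun_dt test_fun_smooth test_fun_pd)
  finally have "0 \<le> (LINT z|lborel. dt f z * lap f z)" .
  moreover have "0 \<le> (LINT z|lborel. (dt f z)\<^sup>2)" by simp
  moreover have "(LINT z|lborel. (dt f z + lap f z)\<^sup>2) =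
      (LINT z|lborel. (dt f z)\<^sup>2) + (LINT z|lborel. (lap f z)\<^sup>2) + 2 * (LINT z|lborel. dt f z * lap f z)"
    using i1 by (simp add: power2_sum mult.assoc)
  ultimately show ?thesis by linarith
qed

section \<open>Parabolic scaling and the very weak formulation\<close>

text \<open>Space and time scale independently: \<open>T = R\<^sup>2\<close> is the parabolic case,
  and \<open>T = A powr (1 - m) * R\<^sup>2\<close> belongs to the intrinsic cylinders.\<close>

definition aff :: "'a::euclidean_space \<times> real \<Rightarrow> real \<Rightarrow> real \<Rightarrow> 'a \<times> real \<Rightarrow> 'a \<times> real" where
  "aff z R T w = (fst z + R *\<^sub>R fst w, snd z + T * snd w)"

lemma aff_continuous [continuous_intros]:
  "continuous_on S g \<Longrightarrow> continuous_on S (\<lambda>x. aff z R T (g x))"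
  unfolding aff_def by (intro continuous_intros)

lemma aff_measurable [measurable]: "aff z R T \<in> borel_measurable borel"
  by (rule borel_measurable_continuous_onI) (rule aff_continuous[OF continuous_on_id, unfolded id_def])

definition aff_inv :: "'a::euclidean_space \<times> real \<Rightarrow> real \<Rightarrow> real \<Rightarrow> 'a \<times> real \<Rightarrow> 'a \<times> real" where
  "aff_inv z R T = aff (- (1 / R) *\<^sub>R fst z, - snd z / T) (1 / R) (1 / T)"

lemma aff_inv:
  assumes "R \<noteq> 0" "T \<noteq> 0"
  shows "aff_inv z R T (aff z R T w) = w" "aff z R T (aff_inv z R T w) = w"
  using assms by (auto simp: aff_def aff_inv_def prod_eq_iff scaleR_add_right field_simps)

lemma aff_compose: "aff z R T (aff w R' T' x) = aff (aff z R T w) (R * R') (T * T') x"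
  by (simp add: aff_def scaleR_add_right algebra_simps)

lemma lborel_aff:
  fixes z :: "'a::euclidean_space \<times> real"
  assumes "R > 0" "T > 0"
  shows "lborel = density (distr lborel borel (aff z R T)) (\<lambda>_. ennreal (R ^ DIM('a) * T))"
proof -
  define c :: "'a \<times> real \<Rightarrow> real" where "c j = (if snd j = 0 then R else T)" for j
  have c: "c j \<noteq> 0" for j using assms by (simp add: c_def)
  have "(\<lambda>x. z + (\<Sum>j\<in>Basis. (c j * (x \<bullet> j)) *\<^sub>R j)) = aff z R T"
  proof
    fix x :: "'a \<times> real"
    have "(\<Sum>j\<in>Basis. (c j * (x \<bullet> j)) *\<^sub>R j) = (\<Sum>i\<in>Basis. (R * (fst x \<bullet> i)) *\<^sub>R (i, 0)) + (T * snd x) *\<^sub>R (0, 1)"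
      by (subst sum_Basis_prod_eq) (simp add: c_def inner_prod_def)
    also have "(\<Sum>i\<in>Basis. (R * (fst x \<bullet> i)) *\<^sub>R (i, 0::real)) = (R *\<^sub>R fst x, 0)"
      by (simp add: prod_eq_iff fst_sum snd_sum scaleR_sum_right[symmetric] scaleR_scaleR[symmetric]
          euclidean_representation del: scaleR_scaleR)
    finally show "z + (\<Sum>j\<in>Basis. (c j * (x \<bullet> j)) *\<^sub>R j) = aff z R T x"
      by (simp add: aff_def prod_eq_iff)
  qed
  moreover have "(\<Prod>j\<in>(Basis::('a \<times> real) set). \<bar>c j\<bar>) = R ^ DIM('a) * T"
  proof -
    have "(\<Prod>j\<in>(Basis::('a \<times> real) set). \<bar>c j\<bar>) =
        (\<Prod>j\<in>(\<lambda>i::'a. (i, 0::real)) ` Basis. \<bar>c j\<bar>) * (\<Prod>j\<in>(\<lambda>i. (0::'a, i::real)) ` Basis. \<bar>c j\<bar>)"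
      unfolding Basis_prod_def by (rule prod.union_disjoint) auto
    also have "\<dots> = R ^ DIM('a) * T"
      using assms by (simp add: prod.reindex inj_on_def c_def)
    finally show ?thesis .
  qed
  ultimately show ?thesis using lborel_affine_euclidean[of c z] c by simp
qed

lemma nn_integral_aff:
  fixes z :: "'a::euclidean_space \<times> real"
  assumes "R > 0" "T > 0" and [measurable]: "f \<in> borel_measurable borel"
  shows "(\<integral>\<^sup>+w. f w \<partial>lborel) = ennreal (R ^ DIM('a) * T) * (\<integral>\<^sup>+w. f (aff z R T w) \<partial>lborel)"
  by (subst lborel_aff[OF assms(1,2), of z])
    (simp add: nn_integral_density nn_integral_distr nn_integral_cmult)

lemma integrable_aff:
  fixes z :: "'a::euclidean_space \<times> real" and f :: "'a \<times> real \<Rightarrow> real"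
  assumes "R > 0" "T > 0" "integrable lborel f"
  shows "integrable lborel (\<lambda>w. f (aff z R T w))"
proof -
  have "R ^ DIM('a) * T > 0" using assms by simp
  then show ?thesis
  using assms borel_measurable_integrable[OF assms(3)]
  by (subst (asm) lborel_aff[OF assms(1,2), of z])
    (simp add: integrable_density integrable_distr_eq)
qed

lemma integral_aff:
  fixes z :: "'a::euclidean_space \<times> real" and f :: "'a \<times> real \<Rightarrow> real"
  assumes "R > 0" "T > 0" and [measurable]: "f \<in> borel_measurable borel"
  shows "(LINT w|lborel. f w) = R ^ DIM('a) * T * (LINT w|lborel. f (aff z R T w))"
proof -
  have "R ^ DIM('a) * T > 0" using assms by simp
  then show ?thesis
  by (subst lborel_aff[OF assms(1,2), of z]) (simp add: integral_density integral_distr)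
qed

lemma smooth_aff:
  fixes z :: "'a::euclidean_space \<times> real"
  assumes "f differentiable at (aff z R T w)"
  shows "((\<lambda>w. f (aff z R T w)) has_derivative (\<lambda>h. \<Sum>b\<in>Basis. ((R *\<^sub>R fst h, T * snd h) \<bullet> b) * pd b f (aff z R T w))) (at w)"
    and "b \<in> Basis \<Longrightarrow> pd (b, 0) (\<lambda>w. f (aff z R T w)) w = R * pd (b, 0) f (aff z R T w)"
    and "pd (0, 1) (\<lambda>w. f (aff z R T w)) w = T * pd (0, 1) f (aff z R T w)"
proof -
  have d: "(aff z R T has_derivative (\<lambda>h. (R *\<^sub>R fst h, T * snd h))) (at w)"
    unfolding aff_def[abs_def] by (auto intro!: derivative_eq_intros)
  show 1: "((\<lambda>w. f (aff z R T w)) has_derivative (\<lambda>h. \<Sum>b\<in>Basis. ((R *\<^sub>R fst h, T * snd h) \<bullet> b) * pd b f (aff z R T w))) (at w)"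
    using has_derivative_compose[OF d differentiable_has_derivative_pd[OF assms]] .
  show "pd (b, 0) (\<lambda>w. f (aff z R T w)) w = R * pd (b, 0) f (aff z R T w)" if b: "b \<in> Basis"
  proof -
    have "pd (b, 0) (\<lambda>w. f (aff z R T w)) w = R * (\<Sum>i\<in>Basis. ((b, 0) \<bullet> i) * pd i f (aff z R T w))"
      by (subst pd_eqI[OF 1]) (simp add: sum_distrib_left inner_prod_def mult_ac)
    then show ?thesis using sum_Basis_inner[OF space_in_Basis[OF b]] by simp
  qed
  show "pd (0, 1) (\<lambda>w. f (aff z R T w)) w = T * pd (0, 1) f (aff z R T w)"
  proof -
    have "pd (0, 1) (\<lambda>w. f (aff z R T w)) w = T * (\<Sum>i\<in>Basis. ((0, 1) \<bullet> i) * pd i f (aff z R T w))"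
      by (subst pd_eqI[OF 1]) (simp add: sum_distrib_left inner_prod_def mult_ac)
    then show ?thesis using sum_Basis_inner[OF time_in_Basis[where 'a='a]] by simp
  qed
qed

lemma Basis_prod_cases:
  assumes "b \<in> (Basis :: ('a::euclidean_space \<times> real) set)"
  obtains i where "i \<in> Basis" "b = (i, 0)" | "b = (0, 1)"
  using assms by (auto simp: Basis_prod_def)

lemma test_fun_aff:
  fixes z :: "'a::euclidean_space \<times> real"
  assumes "test_fun U f" "R > 0" "T > 0"
  shows "test_fun (aff_inv z R T ` U) (\<lambda>w. f (aff z R T w))"
proof -
  obtain C where C: "smooth f" "compact C" "C \<subseteq> U" "\<And>x. x \<notin> C \<Longrightarrow> f x = 0"
    using assms(1) by (auto elim: test_funE)
  show ?thesis
  proof (rule test_funI)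
    show "smooth (\<lambda>w. f (aff z R T w))"
    proof (rule smooth_coinduct[of "\<lambda>g. \<exists>c f. smooth f \<and> g = (\<lambda>w. c * f (aff z R T w))"])
      show "\<exists>c g. smooth g \<and> (\<lambda>w. f (aff z R T w)) = (\<lambda>w. c * g (aff z R T w))"
        using C(1) by (intro exI[of _ 1] exI[of _ f]) auto
      fix g and w b :: "'a \<times> real" assume "\<exists>c f. smooth f \<and> g = (\<lambda>w. c * f (aff z R T w))"
      then obtain c f where f: "smooth f" "g = (\<lambda>w. c * f (aff z R T w))" by auto
      have d: "(\<lambda>w. f (aff z R T w)) differentiable at w" for w
        using smooth_aff(1)[OF smooth_differentiable[OF f(1)]] unfolding differentiable_def by blast
      then show "g differentiable at w" unfolding f by simp
      assume b: "b \<in> Basis"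
      show "\<exists>c f. smooth f \<and> pd b g = (\<lambda>w. c * f (aff z R T w))"
      proof (rule Basis_prod_cases[OF b])
        fix i :: 'a assume i: "i \<in> Basis" "b = (i, 0)"
        have "pd b g = (\<lambda>w. (c * R) * pd b f (aff z R T w))"
          unfolding f(2) i(2) by (simp add: fun_eq_iff pd_cmult[OF d] smooth_aff(2)[OF smooth_differentiable[OF f(1)] i(1)])
        then show ?thesis using smooth_pd[OF f(1) b] by blast
      next
        assume i: "b = (0, 1)"
        have "pd b g = (\<lambda>w. (c * T) * pd b f (aff z R T w))"
          unfolding f(2) i by (simp add: fun_eq_iff pd_cmult[OF d] smooth_aff(3)[OF smooth_differentiable[OF f(1)]])
        then show ?thesis using smooth_pd[OF f(1) b] by blast
      qed
    qed
    show "compact (aff_inv z R T ` C)"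
      unfolding aff_inv_def by (intro compact_continuous_image C aff_continuous) (auto intro: continuous_intros)
    show "aff_inv z R T ` C \<subseteq> aff_inv z R T ` U" using C by auto
    fix x assume "x \<notin> aff_inv z R T ` C"
    then have "aff z R T x \<notin> C" using aff_inv(1)[of R T z x] assms by (metis image_eqI less_irrefl)
    then show "f (aff z R T x) = 0" by (rule C(4))
  qed
qed

lemma dt_aff: "f differentiable at (aff z R T w) \<Longrightarrow> dt (\<lambda>w. f (aff z R T w)) w = T * dt f (aff z R T w)"
  unfolding dt_def by (rule smooth_aff(3))

lemma lap_aff:
  assumes "smooth f"
  shows "lap (\<lambda>w. f (aff z R T w)) w = R\<^sup>2 * lap f (aff z R T w)"
proof -
  have "pd (b, 0) (pd (b, 0) (\<lambda>w. f (aff z R T w))) w = R\<^sup>2 * pd (b, 0) (pd (b, 0) f) (aff z R T w)"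
    if b: "b \<in> Basis" for b
  proof -
    let ?g = "\<lambda>w. pd (b, 0) f (aff z R T w)"
    have s: "smooth (pd (b, 0) f)" using smooth_pd[OF assms space_in_Basis[OF b]] .
    have d: "?g differentiable at w"
      using smooth_aff(1)[OF smooth_differentiable[OF s]] unfolding differentiable_def by blast
    have "pd (b, 0) (\<lambda>w. f (aff z R T w)) = (\<lambda>w. R * ?g w)"
      by (simp add: fun_eq_iff smooth_aff(2)[OF smooth_differentiable[OF assms] b])
    then show ?thesis
      by (simp add: pd_cmult[OF d] smooth_aff(2)[OF smooth_differentiable[OF s] b] power2_eq_square)
  qed
  then show ?thesis by (simp add: lap_def sum_distrib_left)
qed

text \<open>The very weak form of \<open>a\<^sub>t = \<Delta> b + f\<close> in \<open>U\<close>.\<close>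
definition pv :: "('a::euclidean_space \<times> real) set \<Rightarrow> ('a \<times> real \<Rightarrow> real) \<Rightarrow> ('a \<times> real \<Rightarrow> real) \<Rightarrow> ('a \<times> real \<Rightarrow> real) \<Rightarrow> bool" where
  "pv U a b f \<longleftrightarrow> (\<forall>\<phi>. test_fun U \<phi> \<longrightarrow> (LINT z|lborel. a z * dt \<phi> z + b z * lap \<phi> z + f z * \<phi> z) = 0)"

text \<open>The free factor \<open>c\<close> later divides the solution by its height while the
  nonlinearity remains a pure power.\<close>

lemma pv_aff:
  fixes z :: "'a::euclidean_space \<times> real"
  assumes "pv U a b f" "R > 0" "T > 0"
    and [measurable]: "a \<in> borel_measurable borel" "b \<in> borel_measurable borel" "f \<in> borel_measurable borel"
    and U: "aff z R T ` V \<subseteq> U"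
  shows "pv V (\<lambda>w. (c / T) * a (aff z R T w)) (\<lambda>w. (c / R\<^sup>2) * b (aff z R T w)) (\<lambda>w. c * f (aff z R T w))"
  unfolding pv_def
proof (intro allI impI)
  fix \<phi> :: "'a \<times> real \<Rightarrow> real" assume \<phi>: "test_fun V \<phi>"
  define z' R' T' where "z' = (- (1 / R) *\<^sub>R fst z, - snd z / T)" "R' = 1 / R" "T' = 1 / T"
  have inv: "aff z' R' T' (aff z R T w) = w" for w
    using aff_inv(1)[of R T z w] assms by (simp add: aff_inv_def z'_R'_T'_def)
  define \<psi> where "\<psi> w = \<phi> (aff z' R' T' w)" for w
  have sm: "smooth \<phi>" using \<phi> by (rule test_fun_smooth)
  have inv2: "aff_inv z' R' T' = aff z R T"
    unfolding z'_R'_T'_def aff_inv_def aff_def[abs_def] using assms by (auto simp: fun_eq_iff)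
  have t: "test_fun U \<psi>"
    using test_fun_aff[OF \<phi>, of R' T' z'] assms unfolding inv2 \<psi>_def[abs_def]
    by (intro test_fun_mono[OF _ U]) (auto simp: z'_R'_T'_def)
  define F where "F w = a w * dt \<psi> w + b w * lap \<psi> w + f w * \<psi> w" for w
  have [measurable]: "\<psi> \<in> borel_measurable borel" "dt \<psi> \<in> borel_measurable borel" "lap \<psi> \<in> borel_measurable borel"
    using t by (auto intro!: borel_measurable_continuous_onI smooth_continuous test_fun_smooth test_fun_dt test_fun_lap)
  have F0: "(LINT w|lborel. F w) = 0"
    using assms(1) t by (simp add: pv_def F_def)
  have "F \<in> borel_measurable borel" unfolding F_def[abs_def] by measurable
  then have "0 = (LINT w|lborel. F (aff z R T w))"
    using integral_aff[of R T F z] F0 assms by simp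
  then have "0 = c * (LINT w|lborel. F (aff z R T w))" by simp
  also have "\<dots> = (LINT w|lborel. c * F (aff z R T w))" by simp
  also have "(\<lambda>w. c * F (aff z R T w)) = (\<lambda>w. c / T * a (aff z R T w) * dt \<phi> w + c / R\<^sup>2 * b (aff z R T w) * lap \<phi> w + c * f (aff z R T w) * \<phi> w)"
    unfolding F_def \<psi>_def[abs_def]
    by (simp add: fun_eq_iff dt_aff[OF smooth_differentiable[OF sm]] lap_aff[OF sm] inv)
      (simp add: z'_R'_T'_def power_divide algebra_simps)
  finally show "(LINT w|lborel. c / T * a (aff z R T w) * dt \<phi> w + c / R\<^sup>2 * b (aff z R T w) * lap \<phi> w + c * f (aff z R T w) * \<phi> w) = 0"
    by simp
qed

section \<open>Bump functions and mollification\<close>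

lemma integral_pos_continuous:
  fixes f :: "'a::euclidean_space \<Rightarrow> real"
  assumes "continuous_on UNIV f" "integrable lborel f" "\<And>x. 0 \<le> f x" "0 < f x0"
  shows "0 < (LINT x|lborel. f x)"
proof -
  have "(LINT x|lborel. f x) \<noteq> 0"
  proof
    assume "(LINT x|lborel. f x) = 0"
    then have ae: "AE x in lborel. f x = 0"
      using integral_nonneg_eq_0_iff_AE[OF assms(2)] assms(3) by auto
    have op: "open {x. 0 < f x}"
      using assms(1) by (intro open_Collect_less) (auto intro: continuous_intros)
    then obtain r where r: "r > 0" "ball x0 r \<subseteq> {x. 0 < f x}"
      using assms(4) by (auto elim: openE)
    have "AE x in lborel. x \<notin> ball x0 r" using ae by eventually_elim (use r in auto)
    then have "emeasure lborel (ball x0 r) = 0"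
      by (subst (asm) AE_iff_measurable[OF _ refl]) (auto simp: ball_def)
    then show False using r(1) content_ball_pos[of r x0] by (simp add: measure_def)
  qed
  moreover have "0 \<le> (LINT x|lborel. f x)" using assms(3) by simp
  ultimately show ?thesis by linarith
qed

lemma bump_exists:
  fixes x0 :: "'a::euclidean_space"
  assumes "r > 0"
  obtains \<eta> where "smooth \<eta>" "\<And>x. 0 \<le> \<eta> x" "\<And>x. x \<notin> cball x0 r \<Longrightarrow> \<eta> x = 0" "(LINT x|lborel. \<eta> x) = 1"
proof -
  define p where "p x = r\<^sup>2 + (-1) * (\<Sum>b\<in>Basis. ((x - x0) \<bullet> b) * ((x - x0) \<bullet> b))" for x :: 'a
  have p: "p x = r\<^sup>2 - (norm (x - x0))\<^sup>2" for x
    by (simp add: p_def power2_norm_eq_inner euclidean_inner[symmetric])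
  have "smooth (\<lambda>x. x \<bullet> b + (- (x0 \<bullet> b)))" for b :: 'a
    by (rule smooth_add[OF smooth_inner smooth_const])
  then have s1: "smooth (\<lambda>x. (x - x0) \<bullet> b)" for b by (simp add: inner_diff_left)
  have "smooth p" unfolding p_def[abs_def]
    by (intro smooth_add smooth_const smooth_mult smooth_sum s1) auto
  then have s: "smooth (\<lambda>x. flat 0 (p x))" by (rule smooth_flat_comp)
  have z: "flat 0 (p x) = 0" if "x \<notin> cball x0 r" for x
  proof -
    have "r < norm (x - x0)" using that by (simp add: dist_norm norm_minus_commute)
    then have "r\<^sup>2 < (norm (x - x0))\<^sup>2" using assms by (intro power_strict_mono) auto
    then show ?thesis by (simp add: p flat_def)
  qed
  define I where "I = (LINT x|lborel. flat 0 (p x))"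
  have "I > 0" unfolding I_def
    by (rule integral_pos_continuous[of _ x0])
      (use s z assms in \<open>auto intro!: smooth_continuous integrable_compact_support[of _ "cball x0 r"] simp: flat_nonneg flat_def p\<close>)
  moreover have "smooth (\<lambda>x. (1 / I) * flat 0 (p x))" by (intro smooth_mult s smooth_const)
  ultimately show ?thesis
    by (intro that[of "\<lambda>x. (1 / I) * flat 0 (p x)"]) (auto simp: flat_nonneg z I_def)
qed

text \<open>The compact set \<open>C'\<close> is obtained before the accuracy \<open>e\<close>. All
  approximations thus share one support inside \<open>U\<close>, which dominated convergence in
  \<open>duality_continuous\<close> relies on.\<close>

lemma mollify:
  fixes \<psi> :: "'a::euclidean_space \<Rightarrow> real"
  assumes "continuous_on UNIV \<psi>" "compact C" "\<And>x. x \<notin> C \<Longrightarrow> \<psi> x = 0" "C \<subseteq> U" "open U"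
  obtains C' where "compact C'" "C' \<subseteq> U"
    "\<And>e. e > 0 \<Longrightarrow> \<exists>\<phi>. smooth \<phi> \<and> (\<forall>x. x \<notin> C' \<longrightarrow> \<phi> x = 0) \<and> (\<forall>x. \<bar>\<phi> x - \<psi> x\<bar> \<le> e)"
proof -
  obtain r0 where r0: "r0 > 0" "(\<Union>x\<in>C. cball x r0) \<subseteq> U"
    using compact_subset_open_imp_cball_epsilon_subset[OF assms(2,5,4)] by blast
  define C' where "C' = {x + y | x y. x \<in> C \<and> y \<in> cball 0 r0}"
  have "compact C'" unfolding C'_def by (rule compact_sums[OF assms(2)]) auto
  moreover have "C' \<subseteq> U"
  proof
    fix w assume "w \<in> C'"
    then obtain x y where "w = x + y" "x \<in> C" "norm y \<le> r0" by (auto simp: C'_def)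
    then have "w \<in> (\<Union>x\<in>C. cball x r0)" by (auto simp: dist_norm intro!: bexI[of _ x])
    then show "w \<in> U" using r0 by blast
  qed
  moreover have "\<exists>\<phi>. smooth \<phi> \<and> (\<forall>x. x \<notin> C' \<longrightarrow> \<phi> x = 0) \<and> (\<forall>x. \<bar>\<phi> x - \<psi> x\<bar> \<le> e)" if e: "e > 0" for e
  proof -
    obtain d where d: "d > 0" "\<And>x y. dist x y < d \<Longrightarrow> \<bar>\<psi> x - \<psi> y\<bar> < e"
      using continuous_compact_support_uniform[OF assms(1,2) _ e] assms(3) by blast
    define r where "r = min r0 (d / 2)"
    have r: "r > 0" "r \<le> r0" "r < d" using d r0 by (auto simp: r_def)
    obtain \<eta> :: "'a \<Rightarrow> real" where \<eta>: "smooth \<eta>" "\<And>x. 0 \<le> \<eta> x" "\<And>x. x \<notin> cball 0 r \<Longrightarrow> \<eta> x = 0" "(LINT x|lborel. \<eta> x) = 1"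
      using bump_exists[OF r(1), of 0] by blast
    have t\<eta>: "test_fun UNIV \<eta>" using \<eta> by (intro test_funI[of _ "cball 0 r"]) auto
    have i\<eta>: "integrable lborel \<eta>" using t\<eta> by (rule test_fun_integrable)
    have i\<psi>: "integrable lborel \<psi>" by (rule integrable_compact_support[OF assms(1-3)])
    have i\<psi>2: "integrable lborel (\<lambda>w. \<psi> (- w))"
      by (rule integrable_compact_support[of _ "uminus ` C"])
        (use assms in \<open>auto intro!: continuous_on_compose2[OF assms(1)] continuous_intros compact_negations\<close>,
          metis image_eqI minus_minus)
    \<comment> \<open>\<open>conv\<close> differentiates its second argument, hence the bump is
      taken as the function and the reflected \<open>\<psi>\<close> as the kernel.\<close>
    define \<phi> where "\<phi> = conv (\<lambda>w. \<psi> (- w)) \<eta>"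
    have eq: "\<phi> z = (LINT w|lborel. \<psi> (z - w) * \<eta> w)" for z
    proof -
      have "\<phi> z = (LINT w|lborel. (\<lambda>w. \<psi> (z - w) * \<eta> w) (w + z))"
        by (simp add: \<phi>_def conv_def add.commute)
      then show ?thesis by (subst (asm) lborel_integral_translate(1))
    qed
    have "smooth \<phi>" unfolding \<phi>_def by (rule smooth_conv[OF i\<psi>2 t\<eta>])
    moreover have "\<phi> x = 0" if "x \<notin> C'" for x
    proof -
      have "\<psi> (x - w) * \<eta> w = 0" for w
      proof (rule ccontr)
        assume "\<psi> (x - w) * \<eta> w \<noteq> 0"
        then have "x - w \<in> C" "w \<in> cball 0 r" using assms(3)[of "x - w"] \<eta>(3)[of w] by auto
        then have "x - w \<in> C" "w \<in> cball 0 r0" using r(2) by auto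
        then have "x \<in> C'" unfolding C'_def by force
        then show False using that by blast
      qed
      then have "(\<lambda>w. \<psi> (x - w) * \<eta> w) = (\<lambda>w. 0)" by blast
      then show ?thesis by (simp add: eq)
    qed
    moreover have "\<bar>\<phi> x - \<psi> x\<bar> \<le> e" for x
    proof -
      obtain B where B: "\<And>x. \<bar>\<psi> x\<bar> \<le> B" using continuous_compact_support_bounded[OF assms(1-3)] by blast
      have i1: "integrable lborel (\<lambda>w. \<psi> (x - w) * \<eta> w)"
      proof (rule Bochner_Integration.integrable_bound[of _ "\<lambda>w. B * \<eta> w"])
        have [measurable]: "\<psi> \<in> borel_measurable borel" "\<eta> \<in> borel_measurable borel" using i\<psi> i\<eta> by auto
        show "(\<lambda>w. \<psi> (x - w) * \<eta> w) \<in> borel_measurable lborel" by measurable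
        show "AE w in lborel. norm (\<psi> (x - w) * \<eta> w) \<le> norm (B * \<eta> w)"
          using mult_right_mono[OF B \<eta>(2)] \<eta>(2) B[of 0] by (intro AE_I2) (auto simp: abs_mult)
      qed (use i\<eta> in auto)
      have "\<phi> x - \<psi> x = (LINT w|lborel. \<psi> (x - w) * \<eta> w) - (LINT w|lborel. \<psi> x * \<eta> w)"
        using \<eta>(4) by (simp add: eq)
      also have "\<dots> = (LINT w|lborel. (\<psi> (x - w) - \<psi> x) * \<eta> w)"
        using i1 i\<eta> by (simp add: left_diff_distrib)
      finally have "\<bar>\<phi> x - \<psi> x\<bar> \<le> (LINT w|lborel. \<bar>(\<psi> (x - w) - \<psi> x) * \<eta> w\<bar>)"
        using integral_abs_bound by metis
      also have "\<dots> \<le> (LINT w|lborel. e * \<eta> w)"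
      proof (rule integral_mono)
        show "integrable lborel (\<lambda>w. \<bar>(\<psi> (x - w) - \<psi> x) * \<eta> w\<bar>)"
          using i1 i\<eta> by (simp add: left_diff_distrib)
        show "\<bar>(\<psi> (x - w) - \<psi> x) * \<eta> w\<bar> \<le> e * \<eta> w" for w
        proof (cases "w \<in> cball 0 r")
          case True
          then have "dist (x - w) x < d" using r by (simp add: dist_norm)
          then show ?thesis using d(2)[of "x - w" x] \<eta>(2)[of w] by (auto simp: abs_mult intro!: mult_right_mono)
        qed (use \<eta>(3) in auto)
      qed (use i\<eta> in auto)
      finally show ?thesis using \<eta>(4) by simp
    qed
    ultimately show ?thesis by blast
  qed
  ultimately show ?thesis using that by blast
qed

section \<open>Cut-off heat kernels\<close>

lemma fst_snd_borel [measurable]: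
  "fst \<in> borel_measurable (borel :: ('a::euclidean_space \<times> 'b::euclidean_space) measure)"
  "snd \<in> borel_measurable (borel :: ('a::euclidean_space \<times> 'b::euclidean_space) measure)"
  by (auto intro!: borel_measurable_continuous_onI continuous_intros)

definition heat :: "'a::euclidean_space \<Rightarrow> real \<Rightarrow> real" where
  "heat y s = (1 / sqrt (4 * pi * s)) ^ DIM('a) * exp (- (y \<bullet> y) / (4 * s))"

lemma heat_nonneg: "0 \<le> heat y s" if "s > 0"
  using that by (simp add: heat_def)

lemma heat_eq_prod:
  assumes "s > 0"
  shows "heat y s = (\<Prod>b\<in>Basis. normal_density 0 (sqrt (2 * s)) (y \<bullet> b))"
proof -
  have "(\<Prod>b\<in>Basis. normal_density 0 (sqrt (2 * s)) (y \<bullet> b)) =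
      (\<Prod>b\<in>(Basis::'a set). (1 / sqrt (4 * pi * s)) * exp (- ((y \<bullet> b) * (y \<bullet> b)) / (4 * s)))"
    using assms by (intro prod.cong) (auto simp: normal_density_def power2_eq_square mult_ac)
  also have "\<dots> = (1 / sqrt (4 * pi * s)) ^ DIM('a) * exp (\<Sum>b\<in>(Basis::'a set). - ((y \<bullet> b) * (y \<bullet> b)) / (4 * s))"
    by (subst prod.distrib) (simp add: exp_sum)
  also have "(\<Sum>b\<in>(Basis::'a set). - ((y \<bullet> b) * (y \<bullet> b)) / (4 * s)) = - (y \<bullet> y) / (4 * s)"
    by (simp add: sum_negf sum_divide_distrib[symmetric] euclidean_inner[symmetric])
  finally show ?thesis by (simp add: heat_def)
qed

lemma heat_integral:
  assumes "s > 0"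
  shows "integrable lborel (\<lambda>y::'a::euclidean_space. heat y s)"
    and "(LINT y|lborel. heat (y::'a) s) = 1" and "(\<integral>\<^sup>+y. heat (y::'a) s \<partial>lborel) = 1"
proof -
  have n1: "(\<integral>\<^sup>+x. ennreal (normal_density 0 (sqrt (2 * s)) x) \<partial>lborel) = 1"
    using integrable_normal_density[of "sqrt (2 * s)" 0] integral_normal_density[of "sqrt (2 * s)" 0] assms
    by (subst nn_integral_eq_integral) auto
  have m: "(\<lambda>y::'a. heat y s) \<in> borel_measurable borel"
    unfolding heat_def by measurable
  have "(\<integral>\<^sup>+y. heat (y::'a) s \<partial>lborel) = (\<integral>\<^sup>+y. (\<Prod>b\<in>Basis. ennreal (normal_density 0 (sqrt (2 * s)) ((y::'a) \<bullet> b))) \<partial>lborel)"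
    using assms by (simp add: heat_eq_prod prod_ennreal)
  also have "\<dots> = 1"
    by (subst nn_integral_lborel_prod) (auto simp: n1)
  finally show *: "(\<integral>\<^sup>+y. heat (y::'a) s \<partial>lborel) = 1" .
  then show i: "integrable lborel (\<lambda>y::'a. heat y s)"
    using m assms by (intro integrableI_bounded) (auto simp: heat_nonneg)
  show "(LINT y|lborel. heat (y::'a) s) = 1"
    using * m assms by (subst integral_eq_nn_integral) (auto simp: heat_nonneg)
qed

lemma integral_scale:
  fixes f :: "'a::euclidean_space \<Rightarrow> real"
  assumes "c > 0" and [measurable]: "f \<in> borel_measurable borel"
  shows "(LINT y|lborel. f y) = c ^ DIM('a) * (LINT y|lborel. f (c *\<^sub>R y))"
proof -
  have "lborel = density (distr lborel borel (\<lambda>x. 0 + c *\<^sub>R (x::'a))) (\<lambda>_. ennreal (c ^ DIM('a)))"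
    using lborel_affine[of c 0] assms by simp
  then have "(LINT y|lborel. f y) = (LINT y|density (distr lborel borel (\<lambda>x. 0 + c *\<^sub>R (x::'a))) (\<lambda>_. ennreal (c ^ DIM('a))). f y)"
    by simp
  then show ?thesis using assms by (simp add: integral_density integral_distr)
qed

text \<open>Substituting a multiple \<open>sqrt s\<close> of the space variable turns the kernel
  into the fixed density at time 1. Then only the argument of \<open>g\<close> depends on
  \<open>s\<close>, and dominated convergence applies.\<close>

lemma heat_initial_limit:
  fixes g :: "'a::euclidean_space \<times> real \<Rightarrow> real"
  assumes "continuous_on UNIV g" "\<And>z. \<bar>g z\<bar> \<le> B"
    and \<sigma>: "\<And>n. \<sigma> n > 0" "\<sigma> \<longlonglongrightarrow> 0"
  shows "(\<lambda>n. LINT y|lborel. heat y (\<sigma> n) * g (y, \<sigma> n)) \<longlonglongrightarrow> g (0, 0)"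
proof -
  have cg: "continuous_on UNIV (\<lambda>y. g (f y))" if "continuous_on UNIV f" for f :: "'a \<Rightarrow> 'a \<times> real"
    by (rule continuous_on_compose2[OF assms(1) that]) auto
  have [measurable]: "(\<lambda>y. g (c *\<^sub>R y, s)) \<in> borel_measurable borel" for c s
    by (intro borel_measurable_continuous_onI cg continuous_intros)
  have [measurable]: "(\<lambda>y. g (y, s)) \<in> borel_measurable borel" for s
    by (intro borel_measurable_continuous_onI cg continuous_intros)
  have [measurable]: "(\<lambda>y::'a. heat y s) \<in> borel_measurable borel" for s
    unfolding heat_def by measurable
  have eq: "(LINT y|lborel. heat y s * g (y, s)) = (LINT y|lborel. heat y 1 * g (sqrt s *\<^sub>R y, s))" if "s > 0" for s
  proof -
    have h: "sqrt s ^ DIM('a) * heat (sqrt s *\<^sub>R (y::'a)) s = heat y 1" for y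
      using that by (simp add: heat_def power_divide real_sqrt_mult power_mult_distrib mult.assoc[symmetric])
    have "(LINT y|lborel. heat y s * g (y, s)) = sqrt s ^ DIM('a) * (LINT y|lborel. heat (sqrt s *\<^sub>R y) s * g (sqrt s *\<^sub>R y, s))"
      using that by (intro integral_scale) auto
    also have "\<dots> = (LINT y|lborel. heat y 1 * g (sqrt s *\<^sub>R y, s))"
      by (subst integral_mult_right_zero[symmetric]) (simp add: mult.assoc[symmetric] h)
    finally show ?thesis .
  qed
  have "(\<lambda>n. LINT y|lborel. heat y 1 * g (sqrt (\<sigma> n) *\<^sub>R y, \<sigma> n)) \<longlonglongrightarrow> (LINT y|lborel. heat (y::'a) 1 * g (0, 0))"
  proof (rule integral_dominated_convergence[where w = "\<lambda>y::'a. B * heat y 1"])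
    show "integrable lborel (\<lambda>y::'a. B * heat y 1)" using heat_integral(1)[of 1, where 'a='a] by simp
    show "AE y in lborel. (\<lambda>n. heat y 1 * g (sqrt (\<sigma> n) *\<^sub>R y, \<sigma> n)) \<longlonglongrightarrow> heat y 1 * g (0, 0)"
    proof (intro AE_I2 tendsto_mult tendsto_const)
      fix y :: 'a
      have "isCont g (0, 0)" using assms(1) by (simp add: continuous_on_eq_continuous_at)
      moreover have "(\<lambda>n. (sqrt (\<sigma> n) *\<^sub>R y, \<sigma> n)) \<longlonglongrightarrow> (0, 0)"
        using \<sigma>(2) by (auto intro!: tendsto_eq_intros)
      ultimately show "(\<lambda>n. g (sqrt (\<sigma> n) *\<^sub>R y, \<sigma> n)) \<longlonglongrightarrow> g (0, 0)"
        by (rule isCont_tendsto_compose)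
    qed
    show "AE y in lborel. norm (heat y 1 * g (sqrt (\<sigma> n) *\<^sub>R y, \<sigma> n)) \<le> B * heat y 1" for n
    proof (intro AE_I2)
      fix y :: 'a
      have "heat y 1 * \<bar>g (sqrt (\<sigma> n) *\<^sub>R y, \<sigma> n)\<bar> \<le> heat y 1 * B"
        by (intro mult_left_mono assms(2) heat_nonneg) simp
      then show "norm (heat y 1 * g (sqrt (\<sigma> n) *\<^sub>R y, \<sigma> n)) \<le> B * heat y 1"
        using heat_nonneg[of 1 y] by (simp add: abs_mult mult.commute)
    qed
  qed auto
  then show ?thesis using eq \<sigma>(1) heat_integral(2)[of 1, where 'a='a] by simp
qed

text \<open>\<open>P\<close> acts on the squared distance, which keeps the kernel differentiable at
  the spatial origin, and \<open>T\<close> acts on time. Two continuous derivatives of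
  \<open>P\<close> and one of \<open>T\<close> suffice, since the smoothness of potentials comes
  from the density. The condition \<open>P 0 * T 0 = 1\<close> gives the pole unit strength.\<close>

locale parametrix =
  fixes P P' P'' T T' :: "real \<Rightarrow> real" and r0 t0 :: real
  assumes P: "\<And>x. (P has_real_derivative P' x) (at x)" "\<And>x. (P' has_real_derivative P'' x) (at x)"
    and T: "\<And>x. (T has_real_derivative T' x) (at x)"
    and cont: "continuous_on UNIV P''" "continuous_on UNIV T'"
    and suppP: "\<And>x. r0\<^sup>2 \<le> x \<Longrightarrow> P x = 0" "\<And>x. r0\<^sup>2 \<le> x \<Longrightarrow> P' x = 0" "\<And>x. r0\<^sup>2 \<le> x \<Longrightarrow> P'' x = 0"
    and suppT: "\<And>s. t0 \<le> s \<Longrightarrow> T s = 0" "\<And>s. t0 \<le> s \<Longrightarrow> T' s = 0"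
    and norm1: "P 0 * T 0 = 1" and r0: "r0 > 0" and t0: "t0 > 0"
begin

definition E :: "'a::euclidean_space \<times> real \<Rightarrow> real" where
  "E w = (if 0 < snd w then heat (fst w) (snd w) * P (fst w \<bullet> fst w) * T (snd w) else 0)"

text \<open>The error of the cut-off: \<open>dt (conv E \<psi>) + lap (conv E \<psi>) = - \<psi> + conv k \<psi>\<close>.\<close>
definition k :: "'a::euclidean_space \<times> real \<Rightarrow> real" where
  "k w = (let \<xi> = fst w \<bullet> fst w; s = snd w in if 0 < s then heat (fst w) s *
     (T s * (4 * \<xi> * P'' \<xi> + 2 * DIM('a) * P' \<xi> - 2 * \<xi> * P' \<xi> / s) - P \<xi> * T' s) else 0)"

lemma contP [continuous_intros]: "continuous_on S f \<Longrightarrow> continuous_on S (\<lambda>x. P (f x))"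
  "continuous_on S f \<Longrightarrow> continuous_on S (\<lambda>x. P' (f x))"
  "continuous_on S f \<Longrightarrow> continuous_on S (\<lambda>x. P'' (f x))"
  "continuous_on S f \<Longrightarrow> continuous_on S (\<lambda>x. T (f x))"
  "continuous_on S f \<Longrightarrow> continuous_on S (\<lambda>x. T' (f x))"
proof -
  have "continuous_on UNIV P" "continuous_on UNIV P'" "continuous_on UNIV T"
    using P T DERIV_continuous_on by (metis DERIV_subset subset_UNIV)+
  with cont show "continuous_on S f \<Longrightarrow> continuous_on S (\<lambda>x. P (f x))"
  "continuous_on S f \<Longrightarrow> continuous_on S (\<lambda>x. P' (f x))"
  "continuous_on S f \<Longrightarrow> continuous_on S (\<lambda>x. P'' (f x))"
  "continuous_on S f \<Longrightarrow> continuous_on S (\<lambda>x. T (f x))"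
  "continuous_on S f \<Longrightarrow> continuous_on S (\<lambda>x. T' (f x))"
    by (auto intro: continuous_on_compose2)
qed

lemma meas [measurable]: "P \<in> borel_measurable borel" "P' \<in> borel_measurable borel"
  "P'' \<in> borel_measurable borel" "T \<in> borel_measurable borel" "T' \<in> borel_measurable borel"
  by (auto intro!: borel_measurable_continuous_onI continuous_intros contP[of UNIV "\<lambda>x. x"])

lemma heat_cont: "S \<subseteq> {w. snd w > 0} \<Longrightarrow> continuous_on S (\<lambda>w. heat (fst w) (snd w))"
  unfolding heat_def by (intro continuous_intros) auto

lemma heat_meas [measurable]: "(\<lambda>w. heat (fst w) (snd w)) \<in> borel_measurable borel"
  unfolding heat_def by measurable

lemma E_cont: "S \<subseteq> {w. snd w > 0} \<Longrightarrow> continuous_on S E"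
proof -
  assume S: "S \<subseteq> {w. snd w > 0}"
  have "continuous_on S (\<lambda>w. heat (fst w) (snd w) * P (fst w \<bullet> fst w) * T (snd w))"
    by (intro continuous_intros heat_cont S)
  then show ?thesis using S by (subst continuous_on_cong[OF refl]) (auto simp: E_def)
qed

lemma k_cont: "S \<subseteq> {w. snd w > 0} \<Longrightarrow> continuous_on S k"
proof -
  assume S: "S \<subseteq> {w::'a \<times> real. snd w > 0}"
  have "continuous_on S (\<lambda>w. heat (fst w) (snd w) * (T (snd w) * (4 * (fst w \<bullet> fst w) * P'' (fst w \<bullet> fst w)
    + 2 * DIM('a) * P' (fst w \<bullet> fst w) - 2 * (fst w \<bullet> fst w) * P' (fst w \<bullet> fst w) / snd w) - P (fst w \<bullet> fst w) * T' (snd w)))"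
    using S by (intro continuous_intros heat_cont S) auto
  then show ?thesis using S by (subst continuous_on_cong[OF refl]) (auto simp: k_def Let_def)
qed

lemma E_meas [measurable]: "E \<in> borel_measurable borel"
  unfolding E_def[abs_def] by measurable

lemma norm_ge_r0: "r0 \<le> norm y \<Longrightarrow> r0\<^sup>2 \<le> y \<bullet> y"
  using r0 by (simp add: dot_square_norm power_mono)

lemma E_supp: "w \<notin> cball 0 r0 \<times> {0..t0} \<Longrightarrow> E w = 0"
  using norm_ge_r0[of "fst w"] by (cases w) (auto simp: E_def suppP suppT)

lemma k_supp: "w \<notin> cball 0 r0 \<times> {0..t0} \<Longrightarrow> k w = 0"
  using norm_ge_r0[of "fst w"] by (cases w) (auto simp: k_def Let_def suppP suppT)

text \<open>The heat kernel as a function of the squared length, so that its time derivative can be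
  taken with \<open>\<xi>\<close> fixed. The type argument carries the dimension.\<close>

definition N :: "'a::euclidean_space itself \<Rightarrow> real \<Rightarrow> real \<Rightarrow> real" where
  "N a \<xi> s = (1 / sqrt (4 * pi * s)) ^ DIM('a) * exp (- \<xi> / (4 * s))"

lemma heat_N: "heat (y::'a) s = N TYPE('a::euclidean_space) (y \<bullet> y) s"
  by (simp add: heat_def N_def)

definition Es :: "'a::euclidean_space \<times> real \<Rightarrow> real" where
  "Es w = (let \<xi> = fst w \<bullet> fst w; s = snd w in
     heat (fst w) s * P \<xi> * (T' s + T s * (\<xi> / (4 * s\<^sup>2) - DIM('a) / (2 * s))))"

lemma Es_cont: "S \<subseteq> {w. snd w > 0} \<Longrightarrow> continuous_on S Es"
  unfolding Es_def Let_def by (intro continuous_intros heat_cont) auto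

lemma N_deriv_s:
  assumes "s > 0"
  shows "(N TYPE('a::euclidean_space) \<xi> has_real_derivative N TYPE('a) \<xi> s * (\<xi> / (4 * s\<^sup>2) - DIM('a) / (2 * s))) (at s)"
proof -
  obtain n where n: "DIM('a) = Suc n" using DIM_positive[where 'a='a] by (metis Suc_pred)
  have s: "sqrt (4 * pi * s) > 0" "sqrt (4 * pi * s) * sqrt (4 * pi * s) = 4 * pi * s" using assms by auto
  have "((\<lambda>s. 1 / sqrt (4 * pi * s)) has_real_derivative - (1 / sqrt (4 * pi * s)) / (2 * s)) (at s)"
    using assms s by (auto intro!: derivative_eq_intros simp: field_simps mult_less_0_iff)
  then have a: "((\<lambda>s. (1 / sqrt (4 * pi * s)) ^ DIM('a)) has_real_derivative
      - (real DIM('a) / (2 * s)) * (1 / sqrt (4 * pi * s)) ^ DIM('a)) (at s)"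
    by (rule DERIV_cong[OF DERIV_power]) (simp add: n)
  have b: "((\<lambda>s. exp (- \<xi> / (4 * s))) has_real_derivative exp (- \<xi> / (4 * s)) * (\<xi> / (4 * s\<^sup>2))) (at s)"
    using assms by (auto intro!: derivative_eq_intros simp: field_simps power2_eq_square)
  show ?thesis unfolding N_def
    by (rule DERIV_cong[OF DERIV_mult[OF a b]]) (simp add: algebra_simps)
qed

lemma E_deriv_s:
  assumes "s > 0"
  shows "((\<lambda>s. E (y, s)) has_real_derivative Es (y, s)) (at s)"
proof -
  have "((\<lambda>s. heat y s * P (y \<bullet> y) * T s) has_real_derivative Es (y, s)) (at s)"
    unfolding heat_N using assms
    by (auto intro!: derivative_eq_intros N_deriv_s T simp: Es_def Let_def heat_N algebra_simps)
  moreover have "\<forall>\<^sub>F s in nhds s. E (y, s) = heat y s * P (y \<bullet> y) * T s"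
    using eventually_nhds_in_open[of "{0<..}" s] assms by (auto simp: E_def elim!: eventually_mono)
  ultimately show ?thesis by (subst DERIV_cong_ev[OF refl _ refl]) auto
qed

text \<open>A Gaussian in front turns differentiation in \<open>\<xi>\<close> into differentiation
  minus multiplication by \<open>1 / (4 * s)\<close>. \<open>Q1\<close> and \<open>Q2\<close> are
  the results of applying this operator to \<open>P\<close> once and twice.\<close>

definition Q1 :: "real \<Rightarrow> real \<Rightarrow> real" where "Q1 s \<xi> = P' \<xi> - P \<xi> / (4 * s)"
definition Q2 :: "real \<Rightarrow> real \<Rightarrow> real" where "Q2 s \<xi> = P'' \<xi> - P' \<xi> / (2 * s) + P \<xi> / (16 * s\<^sup>2)"

definition Ei :: "'a::euclidean_space \<Rightarrow> 'a \<times> real \<Rightarrow> real" where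
  "Ei i w = heat (fst w) (snd w) * T (snd w) * (2 * (fst w \<bullet> i) * Q1 (snd w) (fst w \<bullet> fst w))"
definition Eii :: "'a::euclidean_space \<Rightarrow> 'a \<times> real \<Rightarrow> real" where
  "Eii i w = heat (fst w) (snd w) * T (snd w) * (2 * Q1 (snd w) (fst w \<bullet> fst w) + 4 * (fst w \<bullet> i)\<^sup>2 * Q2 (snd w) (fst w \<bullet> fst w))"

lemma square_deriv: "i \<in> Basis \<Longrightarrow> ((\<lambda>t. (y + t *\<^sub>R i) \<bullet> (y + t *\<^sub>R i)) has_real_derivative 2 * ((y + t *\<^sub>R i) \<bullet> i)) (at t)"
  by (auto intro!: derivative_eq_intros simp: inner_add_left inner_add_right inner_commute algebra_simps)

lemma heat_deriv_line:
  assumes "i \<in> Basis" "s > 0"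
  shows "((\<lambda>t. heat (y + t *\<^sub>R i) s) has_real_derivative
    heat (y + t *\<^sub>R i) s * (- (2 * ((y + t *\<^sub>R i) \<bullet> i)) / (4 * s))) (at t)"
  unfolding heat_def
  using assms by (auto intro!: derivative_eq_intros square_deriv)

lemma P_deriv_line:
  assumes "i \<in> Basis"
  shows "((\<lambda>t. P ((y + t *\<^sub>R i) \<bullet> (y + t *\<^sub>R i))) has_real_derivative
     P' ((y + t *\<^sub>R i) \<bullet> (y + t *\<^sub>R i)) * (2 * ((y + t *\<^sub>R i) \<bullet> i))) (at t)"
   "((\<lambda>t. P' ((y + t *\<^sub>R i) \<bullet> (y + t *\<^sub>R i))) has_real_derivative
     P'' ((y + t *\<^sub>R i) \<bullet> (y + t *\<^sub>R i)) * (2 * ((y + t *\<^sub>R i) \<bullet> i))) (at t)"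
  using DERIV_chain2[OF P(1) square_deriv[OF assms]] DERIV_chain2[OF P(2) square_deriv[OF assms]] by auto

lemma E_deriv_line:
  assumes i: "i \<in> Basis" and s: "s > 0"
  shows "((\<lambda>t. E (y + t *\<^sub>R i, s)) has_real_derivative Ei i (y + t *\<^sub>R i, s)) (at t)"
    "((\<lambda>t. Ei i (y + t *\<^sub>R i, s)) has_real_derivative Eii i (y + t *\<^sub>R i, s)) (at t)"
proof -
  have l: "((\<lambda>t. (y + t *\<^sub>R i) \<bullet> i) has_real_derivative 1) (at t)"
    using i by (auto intro!: derivative_eq_intros simp: inner_add_left)
  note h = heat_deriv_line[OF i s] and P = P_deriv_line[OF i]
  show "((\<lambda>t. E (y + t *\<^sub>R i, s)) has_real_derivative Ei i (y + t *\<^sub>R i, s)) (at t)"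
  proof -
    have "(\<lambda>t. E (y + t *\<^sub>R i, s)) = (\<lambda>t. heat (y + t *\<^sub>R i) s * P ((y + t *\<^sub>R i) \<bullet> (y + t *\<^sub>R i)) * T s)"
      using s by (simp add: E_def)
    then show ?thesis unfolding Ei_def Q1_def fst_conv snd_conv
      by (simp only:, intro DERIV_cong[OF DERIV_cmult_right[OF DERIV_mult[OF h P(1)]]])
        (use s in \<open>simp add: field_simps\<close>)
  qed
  have q: "((\<lambda>t. Q1 s ((y + t *\<^sub>R i) \<bullet> (y + t *\<^sub>R i))) has_real_derivative
     (P'' ((y + t *\<^sub>R i) \<bullet> (y + t *\<^sub>R i)) - P' ((y + t *\<^sub>R i) \<bullet> (y + t *\<^sub>R i)) / (4 * s)) * (2 * ((y + t *\<^sub>R i) \<bullet> i))) (at t)"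
    unfolding Q1_def
    by (rule DERIV_cong[OF DERIV_diff[OF P(2) DERIV_cdivide[OF P(1)]]]) (simp add: field_simps)
  show "((\<lambda>t. Ei i (y + t *\<^sub>R i, s)) has_real_derivative Eii i (y + t *\<^sub>R i, s)) (at t)"
    unfolding Ei_def Eii_def fst_conv snd_conv
    by (rule DERIV_cong[OF DERIV_mult[OF DERIV_cmult_right[OF h] DERIV_mult[OF DERIV_cmult[OF l] q]]])
      (use s in \<open>simp add: Q1_def Q2_def field_simps power2_eq_square\<close>)
qed

text \<open>The Gaussian solves the heat equation, so in the Laplacian of \<open>E\<close> minus its
  time derivative only terms with a derivative of a cut-off survive. These terms make up
  \<open>k\<close>.\<close>

lemma sum_Eii:
  assumes "0 < snd w"
  shows "(\<Sum>i\<in>Basis. Eii i w) = Es w + k (w :: 'a::euclidean_space \<times> real)"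
proof -
  let ?h = "heat (fst w) (snd w)" and ?\<xi> = "fst w \<bullet> fst w" and ?s = "snd w"
  have "(\<Sum>i\<in>Basis. Eii i w) = ?h * T ?s * (\<Sum>i\<in>(Basis::'a set). 2 * Q1 ?s ?\<xi> + 4 * (fst w \<bullet> i)\<^sup>2 * Q2 ?s ?\<xi>)"
    by (simp add: Eii_def sum_distrib_left)
  also have "(\<Sum>i\<in>(Basis::'a set). 2 * Q1 ?s ?\<xi> + 4 * (fst w \<bullet> i)\<^sup>2 * Q2 ?s ?\<xi>) =
      2 * DIM('a) * Q1 ?s ?\<xi> + 4 * ?\<xi> * Q2 ?s ?\<xi>"
    by (simp add: sum.distrib sum_distrib_left[symmetric] sum_distrib_right[symmetric]
        power2_eq_square euclidean_inner[symmetric])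
  also have "?h * T ?s * \<dots> = Es w + k w"
    using assms by (simp add: Es_def k_def Let_def Q1_def Q2_def field_simps power2_eq_square)
  finally show ?thesis .
qed

end

lemma lap_line_derivative:
  fixes \<eta> :: "'a::euclidean_space \<times> real \<Rightarrow> real"
  assumes "smooth \<eta>" "i \<in> Basis"
  shows "((\<lambda>t. \<eta> (y + t *\<^sub>R i, s)) has_real_derivative pd (i, 0) \<eta> (y + t *\<^sub>R i, s)) (at t)"
  using smooth_line_derivative[OF assms(1) space_in_Basis[OF assms(2)], of "(y, s)" t] by simp

lemma dt_line_derivative:
  fixes \<eta> :: "'a::euclidean_space \<times> real \<Rightarrow> real"
  assumes "smooth \<eta>"
  shows "((\<lambda>s. \<eta> (y, s)) has_real_derivative dt \<eta> (y, s)) (at s)"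
  using smooth_line_derivative[OF assms time_in_Basis, of "(y, 0)" s] by (simp add: dt_def)

lemma smooth_slice_cont:
  fixes \<eta> :: "'a::euclidean_space \<times> real \<Rightarrow> real"
  shows "smooth \<eta> \<Longrightarrow> continuous_on UNIV (\<lambda>y. \<eta> (y, s))" "smooth \<eta> \<Longrightarrow> continuous_on UNIV (\<lambda>s. \<eta> (y, s))"
  by (auto intro!: continuous_on_compose2[OF smooth_continuous[of \<eta> UNIV]] continuous_intros)

lemma smooth_lap: "smooth \<eta> \<Longrightarrow> smooth (lap \<eta>)"
  unfolding lap_def[abs_def] by (intro smooth_sum smooth_pd) auto

lemma smooth_dt: "smooth \<eta> \<Longrightarrow> smooth (dt \<eta>)"
  unfolding dt_def by (intro smooth_pd) auto

context parametrix begin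

lemma slice_zero:
  assumes "y \<notin> cball 0 r0"
  shows "E (y, s) = 0" "Ei i (y, s) = 0" "Eii i (y, s) = 0" "Es (y, s) = 0" "k (y, s) = 0"
  using norm_ge_r0[of y] assms
  by (auto simp: E_def Ei_def Eii_def Es_def k_def Let_def Q1_def Q2_def suppP)

lemma slice_cont:
  assumes "s > 0"
  shows "continuous_on UNIV (\<lambda>y. E (y, s))" "continuous_on UNIV (\<lambda>y. Ei i (y, s))"
    "continuous_on UNIV (\<lambda>y. Eii i (y, s))" "continuous_on UNIV (\<lambda>y. Es (y, s))" "continuous_on UNIV (\<lambda>y. k (y, s))"
proof -
  have h: "continuous_on UNIV (\<lambda>y. heat y s)"
    using assms unfolding heat_def by (auto intro!: continuous_intros)
  show "continuous_on UNIV (\<lambda>y. E (y, s))" using assms h unfolding E_def by (auto intro!: continuous_intros)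
  show "continuous_on UNIV (\<lambda>y. k (y, s))" using assms h unfolding k_def Let_def by (auto intro!: continuous_intros)
  show "continuous_on UNIV (\<lambda>y. Es (y, s))" using assms h unfolding Es_def Let_def by (auto intro!: continuous_intros)
  show "continuous_on UNIV (\<lambda>y. Ei i (y, s))" using assms h unfolding Ei_def Q1_def by (auto intro!: continuous_intros)
  show "continuous_on UNIV (\<lambda>y. Eii i (y, s))" using assms h unfolding Eii_def Q1_def Q2_def by (auto intro!: continuous_intros)
qed

text \<open>By \<open>sum_Eii\<close> the integrand on a time slice is a sum of directional
  derivatives of compactly supported functions, each with integral 0.\<close>

lemma green_slice:
  fixes \<eta> :: "'a::euclidean_space \<times> real \<Rightarrow> real"
  assumes \<eta>: "smooth \<eta>" and s: "s > 0"
  shows "(LINT y|lborel. E (y, s) * lap \<eta> (y, s) - (Es (y, s) + k (y, s)) * \<eta> (y, s)) = 0"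
proof -
  let ?\<eta>i = "\<lambda>i. pd (i, 0) \<eta>" and ?\<eta>ii = "\<lambda>i. pd (i, 0) (pd (i, 0) \<eta>)"
  note c = slice_cont[OF s]
  have sm: "smooth (?\<eta>i i)" "smooth (?\<eta>ii i)" if "i \<in> Basis" for i
    using \<eta> that by (auto intro!: smooth_pd)
  have int0: "(LINT y|lborel. E (y, s) * ?\<eta>ii i (y, s) - Eii i (y, s) * \<eta> (y, s)) = 0"
    and int: "integrable lborel (\<lambda>y. E (y, s) * ?\<eta>ii i (y, s) - Eii i (y, s) * \<eta> (y, s))" if i: "i \<in> Basis" for i :: 'a
  proof -
    have cD: "continuous_on UNIV (\<lambda>y. E (y, s) * ?\<eta>ii i (y, s) - Eii i (y, s) * \<eta> (y, s))"
      by (intro continuous_intros c smooth_slice_cont sm i \<eta>)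
    show "(LINT y|lborel. E (y, s) * ?\<eta>ii i (y, s) - Eii i (y, s) * \<eta> (y, s)) = 0"
    proof (rule integral_directional_derivative_zero[where F = "\<lambda>y. E (y, s) * ?\<eta>i i (y, s) - Ei i (y, s) * \<eta> (y, s)"
          and b = i and C = "cball 0 r0"])
      fix x t
      show "((\<lambda>t. E (x + t *\<^sub>R i, s) * ?\<eta>i i (x + t *\<^sub>R i, s) - Ei i (x + t *\<^sub>R i, s) * \<eta> (x + t *\<^sub>R i, s))
        has_real_derivative E (x + t *\<^sub>R i, s) * ?\<eta>ii i (x + t *\<^sub>R i, s) - Eii i (x + t *\<^sub>R i, s) * \<eta> (x + t *\<^sub>R i, s)) (at t)"
        by (rule DERIV_cong[OF DERIV_diff[OF DERIV_mult[OF E_deriv_line(1)[OF i s] lap_line_derivative[OF sm(1)[OF i] i]]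
            DERIV_mult[OF E_deriv_line(2)[OF i s] lap_line_derivative[OF \<eta> i]]]]) simp
      show "continuous_on UNIV (\<lambda>y. E (y, s) * ?\<eta>i i (y, s) - Ei i (y, s) * \<eta> (y, s))"
        by (intro continuous_intros c smooth_slice_cont sm i \<eta>)
    qed (use cD in \<open>simp_all add: slice_zero\<close>)
    show "integrable lborel (\<lambda>y. E (y, s) * ?\<eta>ii i (y, s) - Eii i (y, s) * \<eta> (y, s))"
      by (rule integrable_compact_support[OF cD, of "cball 0 r0"]) (simp_all add: slice_zero)
  qed
  have "E (y, s) * lap \<eta> (y, s) - (Es (y, s) + k (y, s)) * \<eta> (y, s) =
      (\<Sum>i\<in>Basis. E (y, s) * ?\<eta>ii i (y, s) - Eii i (y, s) * \<eta> (y, s))" for y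
    using s by (simp add: lap_def sum_subtractf sum_distrib_left sum_distrib_right[symmetric] sum_Eii)
  then show ?thesis using int int0 by simp
qed

lemma cutoff_integrable:
  fixes H :: "'a::euclidean_space \<times> real \<Rightarrow> real"
  assumes "continuous_on {w. snd w > 0} H" "\<And>w. w \<notin> cball 0 r0 \<times> {0..t0} \<Longrightarrow> H w = 0" "\<sigma> > 0"
  shows "integrable lborel (\<lambda>w. indicator {w. \<sigma> \<le> snd w} w * H w)"
proof -
  have "integrable lborel (\<lambda>w. indicator (cball 0 r0 \<times> {\<sigma>..t0}) w *\<^sub>R H w)"
    by (intro borel_integrable_compact compact_Times continuous_on_subset[OF assms(1)]) (use assms(3) in auto)
  moreover have "(\<lambda>w. indicator (cball 0 r0 \<times> {\<sigma>..t0}) w *\<^sub>R H w) = (\<lambda>w. indicator {w. \<sigma> \<le> snd w} w * H w)"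
  proof
    fix w show "indicator (cball 0 r0 \<times> {\<sigma>..t0}) w *\<^sub>R H w = indicator {w. \<sigma> \<le> snd w} w * H w"
      using assms(2)[of w] assms(3) by (cases w) (auto simp: indicator_def)
  qed
  ultimately show ?thesis by simp
qed

lemma Es_supp: "0 < snd w \<Longrightarrow> w \<notin> cball 0 r0 \<times> {0..t0} \<Longrightarrow> Es w = 0"
  using norm_ge_r0[of "fst w"] by (cases w) (auto simp: Es_def Let_def suppP suppT)

text \<open>The pole is removed by discarding times below \<open>\<sigma>\<close>. Apart from the
  term with \<open>k\<close>, the integrand splits into \<open>H1\<close>, which vanishes slice by
  slice by Green's identity, and \<open>H2\<close>, the time derivative of
  \<open>E * \<eta>\<close>, whose only boundary contribution comes from time
  \<open>\<sigma>\<close>.\<close>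

lemma cutoff_identity:
  fixes \<eta> :: "'a::euclidean_space \<times> real \<Rightarrow> real"
  assumes \<eta>: "smooth \<eta>" and \<sigma>: "\<sigma> > 0"
  defines "I \<equiv> \<lambda>w::'a \<times> real. indicator {w. \<sigma> \<le> snd w} w :: real"
  shows "(LINT w|lborel. I w * (E w * (dt \<eta> w + lap \<eta> w))) =
    - (LINT y|lborel. E (y, \<sigma>) * \<eta> (y, \<sigma>)) + (LINT w|lborel. I w * (k w * \<eta> w))"
proof -
  \<comment> \<open>The maximum covers the case \<open>t0 < \<sigma>\<close>, in which the end
    points for the fundamental theorem of calculus would be reversed.\<close>
  define t1 where "t1 = max t0 \<sigma>"
  note sc = smooth_continuous[OF \<eta>] smooth_continuous[OF smooth_dt[OF \<eta>]] smooth_continuous[OF smooth_lap[OF \<eta>]]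
  let ?J = "\<lambda>w::'a \<times> real. if snd w > 0 then Es w else 0"
  have J_cont: "continuous_on {w. snd w > 0} ?J"
    using Es_cont[of "{w. snd w > 0}"] by (subst continuous_on_cong[OF refl]) auto
  have i0: "integrable lborel (\<lambda>w. I w * (E w * (dt \<eta> w + lap \<eta> w)))"
    unfolding I_def by (intro cutoff_integrable continuous_intros E_cont sc \<sigma>) (auto simp: E_supp)
  have ik: "integrable lborel (\<lambda>w. I w * (k w * \<eta> w))"
    unfolding I_def by (intro cutoff_integrable continuous_intros k_cont sc \<sigma>) (auto simp: k_supp)
  define H1 where "H1 w = E w * lap \<eta> w - (?J w + k w) * \<eta> w" for w
  define H2 where "H2 w = ?J w * \<eta> w + E w * dt \<eta> w" for w
  have i1: "integrable lborel (\<lambda>w. I w * H1 w)" unfolding I_def H1_def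
    by (intro cutoff_integrable continuous_intros E_cont k_cont J_cont sc \<sigma>) (auto simp: E_supp k_supp Es_supp)
  have i2: "integrable lborel (\<lambda>w. I w * H2 w)" unfolding I_def H2_def
    by (intro cutoff_integrable continuous_intros E_cont k_cont J_cont sc \<sigma>) (auto simp: E_supp k_supp Es_supp)
  have "(LINT w|lborel. I w * H1 w) = (LINT s|lborel. LINT y|lborel. I (y, s) * H1 (y, s))"
    using lborel_pair.integral_snd[of "\<lambda>y s. I (y, s) * H1 (y, s)"] i1 by (simp add: lborel_prod case_prod_unfold)
  also have "\<dots> = (LINT s::real|lborel. 0)"
  proof (rule Bochner_Integration.integral_cong[OF refl])
    fix s
    show "(LINT y|lborel. I (y, s) * H1 (y, s)) = 0"
    proof (cases "\<sigma> \<le> s")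
      case True
      then show ?thesis using green_slice[OF \<eta>, of s] \<sigma> by (simp add: I_def H1_def)
    qed (simp add: I_def)
  qed
  finally have z1: "(LINT w|lborel. I w * H1 w) = 0" by simp
  have "(LINT w|lborel. I w * H2 w) = (LINT y|lborel. LINT s|lborel. I (y, s) * H2 (y, s))"
    using lborel_pair.integral_fst[of "\<lambda>y s. I (y, s) * H2 (y, s)"] i2 by (simp add: lborel_prod case_prod_unfold)
  also have "\<dots> = (LINT y|lborel. - (E (y, \<sigma>) * \<eta> (y, \<sigma>)))"
  proof (rule Bochner_Integration.integral_cong[OF refl])
    fix y
    have eq: "I (y, s) * H2 (y, s) = H2 (y, s) * indicator {\<sigma>..t1} s" for s
    proof (cases "t1 < s")
      case True
      then have "t0 \<le> s" by (simp add: t1_def)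
      then have "H2 (y, s) = 0" by (simp add: H2_def E_def Es_def suppT)
      then show ?thesis by simp
    next
      case False
      then show ?thesis by (auto simp: I_def indicator_def)
    qed
    have "(LINT s|lborel. H2 (y, s) * indicator {\<sigma>..t1} s) = E (y, t1) * \<eta> (y, t1) - E (y, \<sigma>) * \<eta> (y, \<sigma>)"
    proof (rule integral_FTC_Icc_real)
      show "\<sigma> \<le> t1" by (simp add: t1_def)
      fix s assume s: "\<sigma> \<le> s" "s \<le> t1"
      then have s0: "s > 0" using \<sigma> by simp
      show "((\<lambda>s. E (y, s) * \<eta> (y, s)) has_real_derivative H2 (y, s)) (at s)"
        by (rule DERIV_cong[OF DERIV_mult[OF E_deriv_s[OF s0] dt_line_derivative[OF \<eta>]]])
          (use s0 in \<open>simp add: H2_def\<close>)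
      have "continuous_on {0<..} (\<lambda>s. H2 (y, s))"
        unfolding H2_def using smooth_slice_cont(2)[OF \<eta>] smooth_slice_cont(2)[OF smooth_dt[OF \<eta>]]
        by (intro continuous_intros continuous_on_compose2[OF J_cont] continuous_on_compose2[OF E_cont[OF subset_refl]]
            continuous_on_compose2[OF sc(1)] continuous_on_compose2[OF sc(2)]) auto
      then show "isCont (\<lambda>s. H2 (y, s)) s"
        using s0 by (simp add: continuous_on_eq_continuous_at)
    qed
    moreover have "E (y, t1) = 0" by (simp add: E_def t1_def suppT)
    ultimately show "(LINT s|lborel. I (y, s) * H2 (y, s)) = - (E (y, \<sigma>) * \<eta> (y, \<sigma>))"
      by (simp add: eq)
  qed
  finally have z2: "(LINT w|lborel. I w * H2 w) = - (LINT y|lborel. E (y, \<sigma>) * \<eta> (y, \<sigma>))" by simp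
  have "(LINT w|lborel. I w * (E w * (dt \<eta> w + lap \<eta> w))) =
      (LINT w|lborel. I w * H1 w + I w * H2 w + I w * (k w * \<eta> w))"
    by (rule Bochner_Integration.integral_cong) (auto simp: H1_def H2_def algebra_simps)
  then show ?thesis using z1 z2 i1 i2 ik by simp
qed

lemma PT_bound: obtains M where "M > 0" "\<And>x. 0 \<le> x \<Longrightarrow> \<bar>P x\<bar> \<le> M" "\<And>x. 0 \<le> x \<Longrightarrow> \<bar>T x\<bar> \<le> M"
proof -
  have "bounded (P ` {0..r0\<^sup>2})" "bounded (T ` {0..t0})"
    by (intro compact_imp_bounded compact_continuous_image contP[of _ "\<lambda>x. x"] continuous_on_id compact_Icc)+
  then obtain a b where "\<forall>y\<in>P ` {0..r0\<^sup>2}. norm y \<le> a" "\<forall>y\<in>T ` {0..t0}. norm y \<le> b"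
    unfolding bounded_iff by blast
  then have ab: "\<And>x. x \<in> {0..r0\<^sup>2} \<Longrightarrow> \<bar>P x\<bar> \<le> a" "\<And>x. x \<in> {0..t0} \<Longrightarrow> \<bar>T x\<bar> \<le> b"
    by auto
  show ?thesis
  proof (rule that[of "max 1 (max a b)"])
    show "\<bar>P x\<bar> \<le> max 1 (max a b)" if "0 \<le> x" for x
      using ab(1)[of x] suppP(1)[of x] that by (cases "x \<le> r0\<^sup>2") auto
    show "\<bar>T x\<bar> \<le> max 1 (max a b)" if "0 \<le> x" for x
      using ab(2)[of x] suppT(1)[of x] that by (cases "x \<le> t0") auto
  qed auto
qed

text \<open>The Gaussian has mass 1 at every positive time, so the mass of \<open>E\<close> is at
  most the product of the bounds for both cut-offs times \<open>t0\<close>.\<close>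

lemma E_integrable: "integrable lborel (E :: 'a::euclidean_space \<times> real \<Rightarrow> real)"
proof -
  obtain M where M: "M > 0" "\<And>x. 0 \<le> x \<Longrightarrow> \<bar>P x\<bar> \<le> M" "\<And>x. 0 \<le> x \<Longrightarrow> \<bar>T x\<bar> \<le> M" using PT_bound by blast
  define G where "G w = ennreal (M * M) * (ennreal (heat (fst w) (snd w)) * indicator {0<..t0} (snd w))" for w :: "'a \<times> real"
  have bound: "ennreal (norm (E w)) \<le> G w" for w
  proof (cases "0 < snd w \<and> snd w \<le> t0")
    case True
    have "norm (E w) = \<bar>P (fst w \<bullet> fst w)\<bar> * \<bar>T (snd w)\<bar> * heat (fst w) (snd w)"
      using True heat_nonneg[of "snd w" "fst w"] by (simp add: E_def abs_mult)
    also have "\<dots> \<le> M * M * heat (fst w) (snd w)"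
      using M True heat_nonneg[of "snd w" "fst w"] by (intro mult_right_mono mult_mono) auto
    finally have "ennreal (norm (E w)) \<le> ennreal (M * M * heat (fst w) (snd w))" by (rule ennreal_leI)
    then show ?thesis using True M(1) heat_nonneg[of "snd w" "fst w"]
      by (simp add: G_def indicator_def ennreal_mult')
  next
    case False
    then have "E w = 0" using suppT(1)[of "snd w"] by (auto simp: E_def)
    then show ?thesis by simp
  qed
  have [measurable]: "G \<in> borel_measurable borel" unfolding G_def[abs_def] by measurable
  have [measurable]: "(\<lambda>y::'a. heat y s) \<in> borel_measurable borel" for s unfolding heat_def by measurable
  have "(\<integral>\<^sup>+w. G w \<partial>lborel) = (\<integral>\<^sup>+s. \<integral>\<^sup>+y. G (y, s) \<partial>lborel \<partial>lborel)"
    using lborel_pair.nn_integral_snd[of G] by (simp add: lborel_prod)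
  also have "\<dots> = (\<integral>\<^sup>+s. ennreal (M * M) * indicator {0<..t0} s \<partial>lborel)"
  proof (rule nn_integral_cong)
    fix s
    show "(\<integral>\<^sup>+y. G (y, s) \<partial>lborel) = ennreal (M * M) * indicator {0<..t0} s"
      using heat_integral(3)[of s, where 'a='a]
      by (auto simp: G_def nn_integral_cmult indicator_def)
  qed
  also have "\<dots> < \<infinity>" using t0 by (simp add: nn_integral_cmult_indicator ennreal_mult_less_top)
  finally have "(\<integral>\<^sup>+w. G w \<partial>lborel) < \<infinity>" .
  moreover have "(\<integral>\<^sup>+w. ennreal (norm (E (w :: 'a \<times> real))) \<partial>lborel) \<le> (\<integral>\<^sup>+w. G w \<partial>lborel)"
    by (intro nn_integral_mono bound)
  ultimately show ?thesis by (intro integrableI_bounded) auto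
qed

lemma E_times_integrable:
  fixes g :: "'a::euclidean_space \<times> real \<Rightarrow> real"
  assumes "test_fun U g" shows "integrable lborel (\<lambda>w. E w * g w)"
proof -
  obtain C where C: "smooth g" "compact C" "\<And>x. x \<notin> C \<Longrightarrow> g x = 0" using assms by (auto elim: test_funE)
  obtain B where "\<And>x. \<bar>g x\<bar> \<le> B"
    using continuous_compact_support_bounded[OF smooth_continuous[OF C(1)] C(2,3)] by blast
  from conv_integrable[OF E_integrable smooth_continuous[OF C(1)] this, of 0] show ?thesis by simp
qed

lemma cutoff_tendsto:
  fixes g :: "'a::euclidean_space \<times> real \<Rightarrow> real"
  assumes "integrable lborel g" "\<And>w. snd w \<le> 0 \<Longrightarrow> g w = 0"
  shows "(\<lambda>n. LINT w|lborel. indicator {w. 1 / real (Suc n) \<le> snd w} w * g w) \<longlonglongrightarrow> (LINT w|lborel. g w)"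
proof (rule integral_dominated_convergence[where w = "\<lambda>w. \<bar>g w\<bar>"])
  have [measurable]: "g \<in> borel_measurable borel" using assms(1) by auto
  show "g \<in> borel_measurable lborel" by simp
  show "(\<lambda>w. indicator {w. 1 / real (Suc n) \<le> snd w} w * g w) \<in> borel_measurable lborel" for n
    by measurable
  show "AE w in lborel. (\<lambda>n. indicator {w. 1 / real (Suc n) \<le> snd w} w * g w) \<longlonglongrightarrow> g w"
  proof (intro AE_I2)
    fix w :: "'a \<times> real"
    show "(\<lambda>n. indicator {w. 1 / real (Suc n) \<le> snd w} w * g w) \<longlonglongrightarrow> g w"
    proof (cases "snd w \<le> 0")
      case False
      have "(\<lambda>n. 1 / real (Suc n)) \<longlonglongrightarrow> 0" using LIMSEQ_inverse_real_of_nat by (simp add: inverse_eq_divide)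
      then have "\<forall>\<^sub>F n in sequentially. 1 / real (Suc n) < snd w" using False by (intro order_tendstoD) auto
      then have "\<forall>\<^sub>F n in sequentially. indicator {w. 1 / real (Suc n) \<le> snd w} w * g w = g w"
        by eventually_elim auto
      then show ?thesis by (rule tendsto_eventually)
    qed (simp add: assms(2))
  qed
  show "AE w in lborel. norm (indicator {w. 1 / real (Suc n) \<le> snd w} w * g w) \<le> \<bar>g w\<bar>" for n
    by (intro AE_I2) (auto simp: indicator_def)
qed (use assms in auto)

lemma initial_limit:
  fixes \<eta> :: "'a::euclidean_space \<times> real \<Rightarrow> real"
  assumes "test_fun UNIV \<eta>"
  shows "(\<lambda>n. LINT y|lborel. E (y, 1 / real (Suc n)) * \<eta> (y, 1 / real (Suc n))) \<longlonglongrightarrow> \<eta> 0"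
proof -
  obtain C where C: "smooth \<eta>" "compact C" "\<And>x. x \<notin> C \<Longrightarrow> \<eta> x = 0" using assms by (auto elim: test_funE)
  define g where "g w = P (fst w \<bullet> fst w) * T (snd w) * \<eta> w" for w :: "'a \<times> real"
  have cg: "continuous_on UNIV g" unfolding g_def by (intro continuous_intros smooth_continuous C)
  obtain B where B: "\<And>w. \<bar>g w\<bar> \<le> B"
  proof -
    have "g w = 0" if "w \<notin> C" for w using C(3)[OF that] by (simp add: g_def)
    then show ?thesis using continuous_compact_support_bounded[OF cg C(2)] that by blast
  qed
  have "(\<lambda>n. LINT y|lborel. heat y (1 / real (Suc n)) * g (y, 1 / real (Suc n))) \<longlonglongrightarrow> g (0, 0)"
    by (rule heat_initial_limit[OF cg B]) (use LIMSEQ_inverse_real_of_nat in \<open>auto simp: inverse_eq_divide\<close>)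
  moreover have "g (0, 0) = \<eta> 0" using norm1 by (simp add: g_def zero_prod_def)
  moreover have "heat y (1 / real (Suc n)) * g (y, 1 / real (Suc n)) = E (y, 1 / real (Suc n)) * \<eta> (y, 1 / real (Suc n))" for y n
    by (simp add: g_def E_def)
  ultimately show ?thesis by simp
qed

lemma E_heat_integrable:
  assumes "test_fun UNIV \<eta>"
  shows "integrable lborel (\<lambda>w. E w * (dt \<eta> w + lap \<eta> w))"
  using E_times_integrable[OF test_fun_add[OF test_fun_dt[OF assms] test_fun_lap[OF assms]]] .

text \<open>As the cut-off time tends to 0, the slice integral tends to \<open>\<eta> 0\<close>, and
  integrability of \<open>k\<close> makes the error integral converge.\<close>

lemma pole_identity:
  fixes \<eta> :: "'a::euclidean_space \<times> real \<Rightarrow> real"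
  assumes \<eta>: "test_fun UNIV \<eta>" and k: "integrable lborel (k :: 'a \<times> real \<Rightarrow> real)"
  shows "(LINT w|lborel. E w * (dt \<eta> w + lap \<eta> w)) = - \<eta> 0 + (LINT w|lborel. k w * \<eta> w)"
proof -
  obtain C where C: "smooth \<eta>" "compact C" "\<And>x. x \<notin> C \<Longrightarrow> \<eta> x = 0" using \<eta> by (auto elim: test_funE)
  obtain B where "\<And>x. \<bar>\<eta> x\<bar> \<le> B"
    using continuous_compact_support_bounded[OF smooth_continuous[OF C(1)] C(2,3)] by blast
  from conv_integrable[OF k smooth_continuous[OF C(1)] this, of 0]
  have "(\<lambda>n. LINT w|lborel. indicator {w. 1 / real (Suc n) \<le> snd w} w * (k w * \<eta> w)) \<longlonglongrightarrow> (LINT w|lborel. k w * \<eta> w)"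
    by (intro cutoff_tendsto) (auto simp: k_def Let_def)
  from tendsto_add[OF tendsto_minus[OF initial_limit[OF \<eta>]] this]
  have "(\<lambda>n. LINT w|lborel. indicator {w. 1 / real (Suc n) \<le> snd w} w * (E w * (dt \<eta> w + lap \<eta> w)))
      \<longlonglongrightarrow> - \<eta> 0 + (LINT w|lborel. k w * \<eta> w)"
    by (subst cutoff_identity[OF C(1)]) auto
  moreover have "(\<lambda>n. LINT w|lborel. indicator {w. 1 / real (Suc n) \<le> snd w} w * (E w * (dt \<eta> w + lap \<eta> w)))
      \<longlonglongrightarrow> (LINT w|lborel. E w * (dt \<eta> w + lap \<eta> w))"
    by (intro cutoff_tendsto E_heat_integrable[OF \<eta>]) (auto simp: E_def)
  ultimately show ?thesis using LIMSEQ_unique by blast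
qed

text \<open>With \<open>k\<close> nonnegative, the error integral over times below
  \<open>\<sigma>\<close> can be discarded before passing to the limit. The result is only an
  inequality, but no bound on \<open>k\<close> near the pole enters.\<close>

lemma pole_inequality:
  fixes \<eta> :: "'a::euclidean_space \<times> real \<Rightarrow> real"
  assumes \<eta>: "test_fun UNIV \<eta>" "\<And>w. 0 \<le> \<eta> w" and k: "\<And>w::'a \<times> real. 0 \<le> k w" and \<sigma>: "\<sigma> > 0"
  shows "- \<eta> 0 + (LINT w|lborel. indicator {w. \<sigma> \<le> snd w} w * (k w * \<eta> w)) \<le> (LINT w|lborel. E w * (dt \<eta> w + lap \<eta> w))"
proof -
  have C: "smooth \<eta>" using \<eta> by (auto elim: test_funE)
  have int: "integrable lborel (\<lambda>w. indicator {w. \<sigma> \<le> snd w} w * (k w * \<eta> w))" if "\<sigma> > 0" for \<sigma>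
    by (intro cutoff_integrable continuous_intros k_cont smooth_continuous C that) (auto simp: k_supp)
  have l1: "(\<lambda>n. LINT w|lborel. indicator {w. 1 / real (Suc n) \<le> snd w} w * (E w * (dt \<eta> w + lap \<eta> w)))
      \<longlonglongrightarrow> (LINT w|lborel. E w * (dt \<eta> w + lap \<eta> w))"
    by (intro cutoff_tendsto E_heat_integrable[OF \<eta>(1)]) (auto simp: E_def)
  have l2: "(\<lambda>n. - (LINT y|lborel. E (y, 1 / real (Suc n)) * \<eta> (y, 1 / real (Suc n)))
       + (LINT w|lborel. indicator {w. \<sigma> \<le> snd w} w * (k w * \<eta> w)))
    \<longlonglongrightarrow> - \<eta> 0 + (LINT w|lborel. indicator {w. \<sigma> \<le> snd w} w * (k w * \<eta> w))"
    by (intro tendsto_intros initial_limit \<eta>)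
  have "(\<lambda>n. 1 / real (Suc n)) \<longlonglongrightarrow> 0" using LIMSEQ_inverse_real_of_nat by (simp add: inverse_eq_divide)
  then have "\<forall>\<^sub>F n in sequentially. 1 / real (Suc n) < \<sigma>" using \<sigma> by (intro order_tendstoD) auto
  then have "\<forall>\<^sub>F n in sequentially. - (LINT y|lborel. E (y, 1 / real (Suc n)) * \<eta> (y, 1 / real (Suc n)))
       + (LINT w|lborel. indicator {w. \<sigma> \<le> snd w} w * (k w * \<eta> w))
    \<le> (LINT w|lborel. indicator {w. 1 / real (Suc n) \<le> snd w} w * (E w * (dt \<eta> w + lap \<eta> w)))"
  proof eventually_elim
    case (elim n)
    show ?case unfolding cutoff_identity[OF C, of "1 / real (Suc n)", simplified]
    proof (subst cutoff_identity[OF C])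
      have "(LINT w|lborel. indicator {w. \<sigma> \<le> snd w} w * (k w * \<eta> w))
        \<le> (LINT w|lborel. indicator {w. 1 / real (Suc n) \<le> snd w} w * (k w * \<eta> w))"
        using \<eta>(2) k elim by (intro integral_mono int \<sigma>) (auto simp: indicator_def intro: mult_nonneg_nonneg)
      then show "- (LINT y|lborel. E (y, 1 / real (Suc n)) * \<eta> (y, 1 / real (Suc n)))
       + (LINT w|lborel. indicator {w. \<sigma> \<le> snd w} w * (k w * \<eta> w)) \<le>
        - (LINT y|lborel. E (y, 1 / real (Suc n)) * \<eta> (y, 1 / real (Suc n))) +
        (LINT w|lborel. indicator {w. 1 / real (Suc n) \<le> snd w} w * (k w * \<eta> w))" by simp
    qed auto
  qed
  then show ?thesis by (intro tendsto_le[OF _ l1 l2]) auto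
qed

lemma conv_heat:
  fixes \<psi> :: "'a::euclidean_space \<times> real \<Rightarrow> real"
  assumes \<psi>: "test_fun UNIV \<psi>"
  shows "dt (conv E \<psi>) z + lap (conv E \<psi>) z = (LINT w|lborel. E w * (dt (\<lambda>x. \<psi> (z + x)) w + lap (\<lambda>x. \<psi> (z + x)) w))"
    and "lap (conv E \<psi>) = conv E (lap \<psi>)"
proof -
  have p2: "pd (b, 0) (pd (b, 0) (conv E \<psi>)) = conv E (pd (b, 0) (pd (b, 0) \<psi>))" if "b \<in> Basis" for b :: 'a
    using that \<psi> by (simp add: pd_conv[OF E_integrable] test_fun_pd)
  have d: "dt (conv E \<psi>) = conv E (dt \<psi>)"
    unfolding dt_def using \<psi> by (simp add: pd_conv[OF E_integrable])
  have int: "integrable lborel (\<lambda>w. E w * g (z + w))" if "test_fun UNIV g" for g z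
    using E_times_integrable[OF test_fun_shift[OF that, of z]] .
  show l: "lap (conv E \<psi>) = conv E (lap \<psi>)"
  proof
    fix z
    have "lap (conv E \<psi>) z = (\<Sum>b\<in>Basis. conv E (pd (b, 0) (pd (b, 0) \<psi>)) z)"
      by (simp add: lap_def p2)
    also have "\<dots> = conv E (lap \<psi>) z"
      unfolding conv_def lap_def sum_distrib_left using \<psi>
      by (subst Bochner_Integration.integral_sum) (auto intro!: int test_fun_pd)
    finally show "lap (conv E \<psi>) z = conv E (lap \<psi>) z" .
  qed
  have sm: "smooth \<psi>" using \<psi> by (rule test_fun_smooth)
  have e1: "dt (\<lambda>x. \<psi> (z + x)) w = dt \<psi> (z + w)" for w
    unfolding dt_def by (rule pd_shift(2)) (rule smooth_differentiable[OF sm])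
  have e2: "lap (\<lambda>x. \<psi> (z + x)) w = lap \<psi> (z + w)" for w
    unfolding lap_def
  proof (rule sum.cong[OF refl])
    fix b :: 'a assume b: "b \<in> Basis"
    have "pd (b, 0) (\<lambda>x. \<psi> (z + x)) = (\<lambda>x. pd (b, 0) \<psi> (z + x))"
      by (rule ext, rule pd_shift(2), rule smooth_differentiable[OF sm])
    then show "pd (b, 0) (pd (b, 0) (\<lambda>x. \<psi> (z + x))) w = pd (b, 0) (pd (b, 0) \<psi>) (z + w)"
      using b by (simp add: pd_shift(2) smooth_differentiable smooth_pd sm)
  qed
  show "dt (conv E \<psi>) z + lap (conv E \<psi>) z = (LINT w|lborel. E w * (dt (\<lambda>x. \<psi> (z + x)) w + lap (\<lambda>x. \<psi> (z + x)) w))"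
    unfolding d l e1 e2 using int[OF test_fun_dt[OF \<psi>], of z] int[OF test_fun_lap[OF \<psi>], of z]
    by (simp add: conv_def distrib_left)
qed

lemma conv_heat_identity:
  fixes \<psi> :: "'a::euclidean_space \<times> real \<Rightarrow> real"
  assumes "test_fun UNIV \<psi>" "integrable lborel (k :: 'a \<times> real \<Rightarrow> real)"
  shows "dt (conv E \<psi>) z + lap (conv E \<psi>) z = - \<psi> z + conv k \<psi> z"
  using pole_identity[OF test_fun_shift[OF assms(1)] assms(2), of z] conv_heat(1)[OF assms(1), of z]
  by (simp add: conv_def)

lemma conv_heat_inequality:
  fixes \<psi> :: "'a::euclidean_space \<times> real \<Rightarrow> real"
  assumes "test_fun UNIV \<psi>" "\<And>w. 0 \<le> \<psi> w" "\<And>w::'a \<times> real. 0 \<le> k w" "\<sigma> > 0"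
  shows "- \<psi> z + (LINT w|lborel. indicator {w. \<sigma> \<le> snd w} w * (k w * \<psi> (z + w))) \<le> dt (conv E \<psi>) z + lap (conv E \<psi>) z"
  using pole_inequality[OF test_fun_shift[OF assms(1), of z] _ assms(3,4)] conv_heat(1)[OF assms(1), of z] assms(2)
  by simp

end

section \<open>Concrete cut-offs and the two kernels\<close>

definition pos_power :: "nat \<Rightarrow> real \<Rightarrow> real" where "pos_power n x = (max 0 x) ^ n"

lemma pos_power_cont [continuous_intros]: "continuous_on S f \<Longrightarrow> continuous_on S (\<lambda>x. pos_power n (f x))"
  unfolding pos_power_def by (intro continuous_intros)

lemma pos_power_deriv: "(pos_power (Suc (Suc n)) has_real_derivative (real n + 2) * pos_power (Suc n) x) (at x)"
proof -
  consider "x > 0" | "x < 0" | "x = 0" by linarith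
  then show ?thesis
  proof cases
    case 1
    have "((\<lambda>x. x ^ Suc (Suc n)) has_real_derivative (real n + 2) * pos_power (Suc n) x) (at x)"
      by (rule DERIV_cong[OF DERIV_pow]) (use 1 in \<open>simp add: pos_power_def\<close>)
    moreover have "\<forall>\<^sub>F y in nhds x. pos_power (Suc (Suc n)) y = y ^ Suc (Suc n)"
      using eventually_nhds_in_open[of "{0<..}" x] 1 by (auto simp: pos_power_def elim!: eventually_mono)
    ultimately show ?thesis by (subst DERIV_cong_ev[OF refl _ refl]) auto
  next
    case 2
    have "\<forall>\<^sub>F y in nhds x. pos_power (Suc (Suc n)) y = 0"
      using eventually_nhds_in_open[of "{..<0}" x] 2 by (auto simp: pos_power_def elim!: eventually_mono)
    then have "(pos_power (Suc (Suc n)) has_real_derivative 0) (at x)"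
      by (subst DERIV_cong_ev[OF refl _ refl]) auto
    then show ?thesis using 2 by (simp add: pos_power_def)
  next
    case 3
    have "((\<lambda>h. pos_power (Suc (Suc n)) h / h) \<longlongrightarrow> 0) (at 0)"
    proof (rule Lim_null_comparison)
      show "\<forall>\<^sub>F h in at 0. norm (pos_power (Suc (Suc n)) h / h) \<le> pos_power (Suc n) h"
        by (intro always_eventually allI) (auto simp: pos_power_def max_def divide_simps)
      have "isCont (pos_power (Suc n)) 0"
        using pos_power_cont[of UNIV "\<lambda>x. x" "Suc n"] by (auto simp: continuous_on_eq_continuous_at)
      then show "(pos_power (Suc n) \<longlongrightarrow> 0) (at 0)" by (simp add: isCont_def pos_power_def)
    qed
    then show ?thesis using 3 by (simp add: DERIV_def pos_power_def)
  qed
qed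

lemma pp_deriv_comp:
  assumes "(f has_real_derivative f') (at x)"
  shows "((\<lambda>x. pos_power 3 (f x)) has_real_derivative 3 * pos_power 2 (f x) * f') (at x)"
    and "((\<lambda>x. pos_power 2 (f x)) has_real_derivative 2 * pos_power 1 (f x) * f') (at x)"
  using DERIV_chain2[OF pos_power_deriv[of 1] assms] DERIV_chain2[OF pos_power_deriv[of 0] assms]
  by (simp_all add: numeral_3_eq_3 numeral_2_eq_2)

text \<open>\<open>cut_arg\<close> maps the transition interval from 1/16 to 1/4 onto the unit
  interval. In the squared distance \<open>cut\<close> is 1 up to radius 1/4 and 0 from radius 1/2
  on; the cubes of positive parts give two continuous derivatives at both ends.\<close>

definition cut_arg :: "real \<Rightarrow> real" where "cut_arg x = (x - 1/16) * (16/3)"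
definition cut :: "real \<Rightarrow> real" where "cut x = pos_power 3 (1 - pos_power 3 (cut_arg x))"
definition cut' :: "real \<Rightarrow> real" where "cut' x = 3 * pos_power 2 (1 - pos_power 3 (cut_arg x)) * (- (3 * pos_power 2 (cut_arg x) * (16/3)))"
definition cut'' :: "real \<Rightarrow> real" where
  "cut'' x = 3 * (2 * pos_power 1 (1 - pos_power 3 (cut_arg x)) * (- (3 * pos_power 2 (cut_arg x) * (16/3)))) * (- (3 * pos_power 2 (cut_arg x) * (16/3)))
     + 3 * pos_power 2 (1 - pos_power 3 (cut_arg x)) * (- (3 * (2 * pos_power 1 (cut_arg x) * (16/3)) * (16/3)))"

lemma cut_deriv: "(cut has_real_derivative cut' x) (at x)" "(cut' has_real_derivative cut'' x) (at x)"
proof -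
  have c: "(cut_arg has_real_derivative 16/3) (at x)"
    unfolding cut_arg_def[abs_def] by (auto intro!: derivative_eq_intros)
  have i: "((\<lambda>x. 1 - pos_power 3 (cut_arg x)) has_real_derivative - (3 * pos_power 2 (cut_arg x) * (16/3))) (at x)"
    by (rule DERIV_cong[OF DERIV_diff[OF DERIV_const pp_deriv_comp(1)[OF c]]]) simp
  show "(cut has_real_derivative cut' x) (at x)"
    unfolding cut_def[abs_def] cut'_def by (rule pp_deriv_comp(1)[OF i])
  have j: "((\<lambda>x. - (3 * pos_power 2 (cut_arg x) * (16/3))) has_real_derivative - (3 * (2 * pos_power 1 (cut_arg x) * (16/3)) * (16/3))) (at x)"
    by (rule DERIV_minus[OF DERIV_cmult_right[OF DERIV_cmult[OF pp_deriv_comp(2)[OF c]]]])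
  show "(cut' has_real_derivative cut'' x) (at x)"
    unfolding cut'_def[abs_def] cut''_def
    by (rule DERIV_cong[OF DERIV_mult[OF DERIV_cmult[OF pp_deriv_comp(2)[OF i]] j]]) simp
qed

lemma cut_cont: "continuous_on UNIV cut'" "continuous_on UNIV cut''"
  unfolding cut'_def[abs_def] cut''_def[abs_def] cut_arg_def by (intro continuous_intros)+

lemma cut_low: assumes "x \<le> 1/16" shows "cut x = 1" "cut' x = 0" "cut'' x = 0"
proof -
  have "cut_arg x \<le> 0" using assms by (simp add: cut_arg_def)
  then show "cut x = 1" "cut' x = 0" "cut'' x = 0" by (auto simp: cut_def cut'_def cut''_def pos_power_def)
qed

lemma cut_high: assumes "1/4 \<le> x" shows "cut x = 0" "cut' x = 0" "cut'' x = 0"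
proof -
  have "cut_arg x \<ge> 1" using assms by (simp add: cut_arg_def)
  then have "pos_power 3 (cut_arg x) \<ge> 1" by (simp add: pos_power_def)
  then have "pos_power (Suc n) (1 - pos_power 3 (cut_arg x)) = 0" for n by (simp add: pos_power_def)
  from this[of 0] this[of 1] this[of 2] show "cut x = 0" "cut' x = 0" "cut'' x = 0"
    by (auto simp: cut_def cut'_def cut''_def numeral_3_eq_3 numeral_2_eq_2)
qed

lemma bounded_on_nonneg:
  fixes f :: "real \<Rightarrow> real"
  assumes "continuous_on UNIV f" "\<And>x. a \<le> x \<Longrightarrow> f x = 0"
  obtains M where "M > 0" "\<And>x. 0 \<le> x \<Longrightarrow> \<bar>f x\<bar> \<le> M"
proof -
  have "bounded (f ` {0..a})"
    by (intro compact_imp_bounded compact_continuous_image continuous_on_subset[OF assms(1)]) auto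
  then obtain M where "\<forall>y\<in>f ` {0..a}. norm y \<le> M" unfolding bounded_iff by blast
  then have M: "\<And>x. x \<in> {0..a} \<Longrightarrow> \<bar>f x\<bar> \<le> M" by auto
  show ?thesis
  proof (rule that[of "max 1 M"])
    show "\<bar>f x\<bar> \<le> max 1 M" if "0 \<le> x" for x
      using M[of x] assms(2)[of x] that by (cases "x \<le> a") auto
  qed auto
qed

text \<open>Away from the pole the exponential beats the negative power of \<open>s\<close> with a
  factor \<open>s\<^sup>2\<close> to spare. One power compensates the division by \<open>s\<close>
  in \<open>k\<close>, the other lets \<open>k\<close> tend to 0 with time.\<close>

lemma heat_decay:
  fixes y :: "'a::euclidean_space"
  assumes "0 < s" "s < 1" "1/16 \<le> y \<bullet> y"
  shows "heat y s \<le> fact (DIM('a) + 2) * 64 ^ (DIM('a) + 2) * s\<^sup>2"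
proof -
  let ?n = "DIM('a)"
  have "s * s \<le> 1 * s" using assms by (intro mult_right_mono) auto
  also have "\<dots> \<le> (4 * pi) * s" using assms pi_gt3 by (intro mult_right_mono) auto
  finally have "s \<le> sqrt (4 * pi * s)" using assms by (intro real_le_rsqrt) (auto simp: power2_eq_square)
  then have "1 / sqrt (4 * pi * s) \<le> 1 / s" using assms by (intro divide_left_mono) auto
  then have a: "(1 / sqrt (4 * pi * s)) ^ ?n \<le> (1 / s) ^ ?n" using assms by (intro power_mono) auto
  have "(1 / (64 * s)) ^ (?n + 2) \<le> fact (?n + 2) * exp (1 / (64 * s))"
    using assms by (intro power_le_fact_exp) auto
  then have "exp (- (1 / (64 * s))) \<le> fact (?n + 2) * (64 * s) ^ (?n + 2)"
    using assms by (simp add: exp_minus field_simps power_divide del: fact_Suc power_Suc)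
  moreover have "exp (- (y \<bullet> y) / (4 * s)) \<le> exp (- (1 / (64 * s)))"
    using assms by (simp add: field_simps)
  ultimately have b: "exp (- (y \<bullet> y) / (4 * s)) \<le> fact (?n + 2) * (64 * s) ^ (?n + 2)" by linarith
  have "heat y s \<le> (1 / s) ^ ?n * (fact (?n + 2) * (64 * s) ^ (?n + 2))"
    unfolding heat_def using assms by (intro mult_mono a b) auto
  also have "\<dots> = fact (?n + 2) * 64 ^ (?n + 2) * s\<^sup>2"
    using assms by (simp add: power_mult_distrib power_add power_divide power2_eq_square field_simps del: fact_Suc)
  finally show ?thesis .
qed

lemma parametrix_cut: "parametrix cut cut' cut'' cut cut' (1/2) (1/4)"
  by unfold_locales
    (use cut_deriv cut_cont cut_high cut_low[of 0] in \<open>auto simp: power2_eq_square\<close>)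

text \<open>Both cut-offs are constant near the pole, so at early times the error kernel lives where
  the Gaussian decays by \<open>heat_decay\<close>. Hence \<open>k\<close> is continuous across time
  0.\<close>

lemma regular_parametrix:
  obtains E k :: "'a::euclidean_space \<times> real \<Rightarrow> real" where
    "integrable lborel E" "\<And>w. w \<notin> cball 0 (1/2) \<times> {0..1/4} \<Longrightarrow> E w = 0"
    "continuous_on UNIV k" "\<And>w. w \<notin> cball 0 (1/2) \<times> {0..1/4} \<Longrightarrow> k w = 0"
    "\<And>\<psi> z. test_fun UNIV \<psi> \<Longrightarrow> dt (conv E \<psi>) z + lap (conv E \<psi>) z = - \<psi> z + conv k \<psi> z"
proof -
  interpret parametrix cut cut' cut'' cut cut' "1/2" "1/4" by (rule parametrix_cut)
  let ?d = "real DIM('a)"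
  obtain M1 where M1: "M1 > 0" "\<And>x. 0 \<le> x \<Longrightarrow> \<bar>cut' x\<bar> \<le> M1"
    using bounded_on_nonneg[OF cut_cont(1) cut_high(2)] by blast
  obtain M2 where M2: "M2 > 0" "\<And>x. 0 \<le> x \<Longrightarrow> \<bar>cut'' x\<bar> \<le> M2"
    using bounded_on_nonneg[OF cut_cont(2) cut_high(3)] by blast
  define C where "C = (M2 + 2 * ?d * M1 + M1) * (fact (DIM('a) + 2) * 64 ^ (DIM('a) + 2))"
  have C: "0 \<le> C" using M1 M2 by (simp add: C_def)
  have bound: "\<bar>k w\<bar> \<le> C * \<bar>snd w\<bar>" if "snd w < 1/16" for w :: "'a \<times> real"
  proof (cases "0 < snd w \<and> 1/16 < fst w \<bullet> fst w \<and> fst w \<bullet> fst w < 1/4")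
    case True
    define \<xi> s where "\<xi> = fst w \<bullet> fst w" "s = snd w"
    have b: "0 < s" "s < 1/16" "1/16 < \<xi>" "\<xi> < 1/4" using True that by (auto simp: \<xi>_s_def)
    have keq: "k w = heat (fst w) s * (4 * \<xi> * cut'' \<xi> + 2 * ?d * cut' \<xi> - 2 * \<xi> * cut' \<xi> / s)"
      using b cut_low[of s] by (simp add: k_def Let_def \<xi>_s_def)
    have h: "0 \<le> heat (fst w) s" "heat (fst w) s \<le> fact (DIM('a) + 2) * 64 ^ (DIM('a) + 2) * s\<^sup>2"
      using b heat_nonneg heat_decay[of s "fst w"] by (auto simp: \<xi>_s_def)
    have e1: "\<bar>4 * \<xi> * cut'' \<xi>\<bar> \<le> 1 * M2"
      unfolding abs_mult[of "4 * \<xi>"] using b M2 by (intro mult_mono) auto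
    have e2: "\<bar>2 * ?d * cut' \<xi>\<bar> \<le> 2 * ?d * M1"
      unfolding abs_mult[of "2 * ?d"] using b M1 by (intro mult_mono) auto
    have e3: "\<bar>2 * \<xi> * cut' \<xi> / s\<bar> \<le> M1 / s"
    proof -
      have "\<bar>2 * \<xi> * cut' \<xi>\<bar> \<le> 1 * M1"
        unfolding abs_mult[of "2 * \<xi>"] using b M1 by (intro mult_mono) auto
      then show ?thesis using b by (simp add: divide_right_mono)
    qed
    have "\<bar>4 * \<xi> * cut'' \<xi> + 2 * ?d * cut' \<xi> - 2 * \<xi> * cut' \<xi> / s\<bar> \<le> M2 + 2 * ?d * M1 + M1 / s"
      using e1 e2 e3 by linarith
    also have "\<dots> \<le> (M2 + 2 * ?d * M1 + M1) / s"
    proof -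
      have "M2 + 2 * ?d * M1 \<le> (M2 + 2 * ?d * M1) / s"
        using b M1 M2 mult_right_mono[of s 1 "M2 + 2 * ?d * M1"] by (simp add: pos_le_divide_eq mult.commute)
      then show ?thesis by (simp add: add_divide_distrib)
    qed
    finally have e: "\<bar>4 * \<xi> * cut'' \<xi> + 2 * ?d * cut' \<xi> - 2 * \<xi> * cut' \<xi> / s\<bar> \<le> (M2 + 2 * ?d * M1 + M1) / s" .
    have "\<bar>k w\<bar> \<le> (fact (DIM('a) + 2) * 64 ^ (DIM('a) + 2) * s\<^sup>2) * ((M2 + 2 * ?d * M1 + M1) / s)"
      unfolding keq abs_mult using h by (intro mult_mono e) auto
    also have "\<dots> = C * s" using b unfolding C_def
      by (simp add: power2_eq_square mult_ac del: fact_Suc)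
    finally show ?thesis using b by (simp add: \<xi>_s_def)
  next
    case False
    have "k w = 0"
    proof (cases "0 < snd w")
      case True
      then consider "fst w \<bullet> fst w \<le> 1/16" | "1/4 \<le> fst w \<bullet> fst w" using False by linarith
      then show ?thesis
        by cases (use that True in \<open>auto simp: k_def Let_def cut_low cut_high\<close>)
    qed (simp add: k_def)
    then show ?thesis using C by simp
  qed
  have kc: "continuous_on UNIV (k :: 'a \<times> real \<Rightarrow> real)"
    unfolding continuous_on_eq_continuous_at[OF open_UNIV]
  proof
    fix w :: "'a \<times> real"
    show "isCont k w"
    proof (cases "0 < snd w")
      case True
      have "open {w :: 'a \<times> real. 0 < snd w}" by (intro open_Collect_less continuous_intros)
      then show ?thesis using k_cont[OF subset_refl] True
        by (metis continuous_on_eq_continuous_at mem_Collect_eq)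
    next
      case False
      then have k0: "k w = 0" by (simp add: k_def)
      have "(k \<longlongrightarrow> 0) (at w)"
      proof (rule Lim_null_comparison)
        have "open {w :: 'a \<times> real. snd w < 1/16}" by (intro open_Collect_less continuous_intros)
        then have "\<forall>\<^sub>F v in at w. v \<in> {w :: 'a \<times> real. snd w < 1/16}"
          using False by (intro eventually_at_in_open') auto
        then show "\<forall>\<^sub>F v in at w. norm (k v) \<le> C * max 0 (snd v)"
        proof eventually_elim
          case (elim v)
          then show ?case using bound[of v] by (cases "0 < snd v") (auto simp: k_def)
        qed
        have "isCont (\<lambda>v :: 'a \<times> real. C * max 0 (snd v)) w" by (intro continuous_intros)
        then show "((\<lambda>v. C * max 0 (snd v)) \<longlongrightarrow> 0) (at w)"
          using False by (simp add: isCont_def max_absorb1)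
      qed
      then show ?thesis using k0 by (simp add: isCont_def)
    qed
  qed
  have ki: "integrable lborel (k :: 'a \<times> real \<Rightarrow> real)"
    by (rule integrable_compact_support[OF kc, of "cball 0 (1/2) \<times> {0..1/4}"])
      (auto intro: compact_Times k_supp)
  show ?thesis
    by (rule that[OF E_integrable E_supp kc k_supp conv_heat_identity[OF _ ki]])
qed

text \<open>The exponential decay in time outweighs the negative contributions of the spatial cut-off,
  so that the error kernel becomes nonnegative.\<close>
definition decay_rate :: "real \<Rightarrow> real" where "decay_rate d = ((128 + 32 * d) / 3)\<^sup>2"
definition space_cutoff :: "real \<Rightarrow> real" where "space_cutoff x = pos_power 3 (1 - x * (16/9))"
definition space_cutoff' :: "real \<Rightarrow> real" where "space_cutoff' x = 3 * pos_power 2 (1 - x * (16/9)) * (- (16/9))"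
definition space_cutoff'' :: "real \<Rightarrow> real" where "space_cutoff'' x = 3 * (2 * pos_power 1 (1 - x * (16/9)) * (- (16/9))) * (- (16/9))"
definition time_weight :: "real \<Rightarrow> real \<Rightarrow> real" where "time_weight d s = exp (- decay_rate d * s) * pos_power 2 (1 - s * (4/3))"
definition time_weight' :: "real \<Rightarrow> real \<Rightarrow> real" where
  "time_weight' d s = exp (- decay_rate d * s) * (- decay_rate d) * pos_power 2 (1 - s * (4/3)) + 2 * pos_power 1 (1 - s * (4/3)) * (- (4/3)) * exp (- decay_rate d * s)"

lemma parametrix_pos: "parametrix space_cutoff space_cutoff' space_cutoff'' (time_weight d) (time_weight' d) (3/4) (3/4)"
proof
  have i: "((\<lambda>x. 1 - x * (16/9)) has_real_derivative - (16/9)) (at x)" for x :: real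
    by (auto intro!: derivative_eq_intros)
  have j: "((\<lambda>s. 1 - s * (4/3)) has_real_derivative - (4/3)) (at s)" for s :: real
    by (auto intro!: derivative_eq_intros)
  show "(space_cutoff has_real_derivative space_cutoff' x) (at x)" for x
    unfolding space_cutoff_def[abs_def] space_cutoff'_def by (rule pp_deriv_comp(1)[OF i])
  show "(space_cutoff' has_real_derivative space_cutoff'' x) (at x)" for x
    unfolding space_cutoff'_def[abs_def] space_cutoff''_def by (rule DERIV_cmult_right[OF DERIV_cmult[OF pp_deriv_comp(2)[OF i]]])
  show "(time_weight d has_real_derivative time_weight' d x) (at x)" for x
    unfolding time_weight_def[abs_def] time_weight'_def
    by (rule DERIV_mult[OF _ pp_deriv_comp(2)[OF j]]) (auto intro!: derivative_eq_intros)
  show "continuous_on UNIV space_cutoff''" "continuous_on UNIV (time_weight' d)"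
    unfolding space_cutoff''_def[abs_def] time_weight'_def[abs_def] by (intro continuous_intros)+
  have "pos_power (Suc n) (1 - x * (16/9)) = 0" if "(3/4)\<^sup>2 \<le> x" for x n
    using that by (simp add: pos_power_def power2_eq_square)
  from this[of _ 0] this[of _ 1] this[of _ 2]
  show "space_cutoff x = 0" "space_cutoff' x = 0" "space_cutoff'' x = 0" if "(3/4)\<^sup>2 \<le> x" for x using that
    by (auto simp: space_cutoff_def space_cutoff'_def space_cutoff''_def numeral_3_eq_3 numeral_2_eq_2)
  have "pos_power (Suc n) (1 - x * (4/3)) = 0" if "3/4 \<le> x" for x n
    using that by (simp add: pos_power_def)
  from this[of _ 0] this[of _ 1]
  show "time_weight d x = 0" "time_weight' d x = 0" if "3/4 \<le> x" for x using that
    by (auto simp: time_weight_def time_weight'_def numeral_2_eq_2)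
qed (auto simp: space_cutoff_def time_weight_def pos_power_def)

text \<open>Here the profiles vary right up to the pole, which makes \<open>k\<close> positive
  throughout the interior of its support. The price is an inequality with a truncated error integral
  in place of an identity.\<close>

lemma positive_parametrix:
  obtains E k :: "'a::euclidean_space \<times> real \<Rightarrow> real" where
    "integrable lborel E" "\<And>w. w \<notin> cball 0 (3/4) \<times> {0..3/4} \<Longrightarrow> E w = 0"
    "continuous_on {w. 0 < snd w} k" "\<And>w. 0 \<le> k w"
    "\<And>w. norm (fst w) < 3/4 \<Longrightarrow> 0 < snd w \<Longrightarrow> snd w < 3/4 \<Longrightarrow> 0 < k w"
    "\<And>\<psi> z \<sigma>. test_fun UNIV \<psi> \<Longrightarrow> (\<And>w. 0 \<le> \<psi> w) \<Longrightarrow> \<sigma> > 0 \<Longrightarrow>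
      - \<psi> z + (LINT w|lborel. indicator {w. \<sigma> \<le> snd w} w * (k w * \<psi> (z + w))) \<le> dt (conv E \<psi>) z + lap (conv E \<psi>) z"
    "\<And>\<psi>. test_fun UNIV \<psi> \<Longrightarrow> lap (conv E \<psi>) = conv E (lap \<psi>)"
    "\<And>\<psi> \<sigma>. test_fun UNIV \<psi> \<Longrightarrow> \<sigma> > 0 \<Longrightarrow> integrable lborel (\<lambda>w. indicator {w. \<sigma> \<le> snd w} w * (k w * \<psi> w))"
proof -
  let ?d = "real DIM('a)"
  interpret parametrix space_cutoff space_cutoff' space_cutoff'' "time_weight ?d" "time_weight' ?d" "3/4" "3/4" by (rule parametrix_pos)
  have key: "0 \<le> k w \<and> (norm (fst w) < 3/4 \<longrightarrow> 0 < snd w \<longrightarrow> snd w < 3/4 \<longrightarrow> 0 < k w)" for w :: "'a \<times> real"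
  proof (cases "norm (fst w) < 3/4 \<and> 0 < snd w \<and> snd w < 3/4")
    case False
    then have "w \<notin> cball 0 (3/4) \<times> {0..3/4} \<or> norm (fst w) = 3/4 \<or> snd w = 3/4 \<or> snd w \<le> 0"
      by (cases w) auto
    moreover have "k w = 0" if "norm (fst w) = 3/4"
    proof -
      have "(3/4)\<^sup>2 \<le> fst w \<bullet> fst w" using that by (simp add: dot_square_norm)
      then show ?thesis by (simp add: k_def Let_def suppP)
    qed
    moreover have "k w = 0" if "snd w = 3/4" using that by (simp add: k_def Let_def suppT)
    moreover have "k w = 0" if "snd w \<le> 0" using that by (simp add: k_def Let_def)
    ultimately have "k w = 0" using k_supp by blast
    then show ?thesis using False by auto
  next
    case True
    define \<xi> s where "\<xi> = fst w \<bullet> fst w" "s = snd w"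
    define q where "q = 1 - \<xi> * (16/9)"
    have s: "0 < s" "s < 3/4" using True by (auto simp: \<xi>_s_def)
    have "\<xi> = (norm (fst w))\<^sup>2" by (simp add: \<xi>_s_def dot_square_norm)
    also have "\<dots> < (3/4)\<^sup>2" using True by (intro power_strict_mono) auto
    finally have \<xi>: "0 \<le> \<xi>" "\<xi> < 9/16" by (auto simp: power2_eq_square \<xi>_s_def)
    have q: "0 < q" "q \<le> 1" "\<xi> = (1 - q) * (9/16)" using \<xi> by (auto simp: q_def)
    have h: "0 < heat (fst w) s" using s by (simp add: heat_def)
    have Pq: "space_cutoff \<xi> = q ^ 3" "space_cutoff' \<xi> = - (16/3) * q\<^sup>2" "space_cutoff'' \<xi> = (512/27) * q"
      using q(1) unfolding space_cutoff_def space_cutoff'_def space_cutoff''_def pos_power_def q_def[symmetric] by simp_all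
    have p: "0 < 1 - s * (4/3)" using s by simp
    have T: "0 < time_weight ?d s" using p by (simp add: time_weight_def pos_power_def)
    have T': "time_weight' ?d s \<le> - decay_rate ?d * time_weight ?d s"
    proof -
      have "0 \<le> exp (- decay_rate ?d * s) * (1 - s * (4/3))" using p by simp
      then show ?thesis using p by (simp add: time_weight_def time_weight'_def pos_power_def)
    qed
    \<comment> \<open>In terms of \<open>q\<close>, which vanishes at the edge of the support, the
      spatial terms are \<open>q\<close> times the affine function \<open>128/3 - B * q\<close>.
      Near the edge the constant dominates; elsewhere the decay in time contributes
      \<open>decay_rate * q ^ 3\<close>, and the choice of \<open>decay_rate\<close> as the square
      of \<open>B\<close> completes the square.\<close>
    define B where "B = (128 + 32 * ?d) / 3"
    have N: "decay_rate ?d = B\<^sup>2" by (simp add: decay_rate_def B_def)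
    have "0 < 128/3 - B * q + B\<^sup>2 * q\<^sup>2"
    proof -
      have "128/3 - B * q + B\<^sup>2 * q\<^sup>2 = (B * q - 1/2)\<^sup>2 + (128/3 - 1/4)"
        by (simp add: power2_eq_square algebra_simps)
      then show ?thesis using zero_le_power2[of "B * q - 1/2"] by linarith
    qed
    then have "0 < time_weight ?d s * (q * (128/3 - B * q + B\<^sup>2 * q\<^sup>2))" using T q by simp
    also have "\<dots> = time_weight ?d s * (4 * \<xi> * space_cutoff'' \<xi> + 2 * ?d * space_cutoff' \<xi>) + space_cutoff \<xi> * (decay_rate ?d * time_weight ?d s)"
      unfolding Pq unfolding N q(3) by (simp add: B_def field_simps power2_eq_square power3_eq_cube)
    also have "\<dots> \<le> time_weight ?d s * (4 * \<xi> * space_cutoff'' \<xi> + 2 * ?d * space_cutoff' \<xi> - 2 * \<xi> * space_cutoff' \<xi> / s) - space_cutoff \<xi> * time_weight' ?d s"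
    proof -
      have "space_cutoff \<xi> * time_weight' ?d s \<le> space_cutoff \<xi> * (- decay_rate ?d * time_weight ?d s)" using q by (intro mult_left_mono T') (simp add: Pq)
      moreover have "0 \<le> time_weight ?d s * (- 2 * \<xi> * space_cutoff' \<xi> / s)" using T \<xi> s q by (simp add: Pq)
      ultimately show ?thesis by (simp add: algebra_simps)
    qed
    finally have "0 < k w" using h s by (simp add: k_def Let_def \<xi>_s_def)
    then show ?thesis by simp
  qed
  have int: "integrable lborel (\<lambda>w. indicator {w. \<sigma> \<le> snd w} w * (k w * \<psi> w))"
    if "test_fun UNIV \<psi>" "\<sigma> > 0" for \<psi> :: "'a \<times> real \<Rightarrow> real" and \<sigma>
    by (intro cutoff_integrable continuous_intros k_cont smooth_continuous test_fun_smooth that)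
      (use that in \<open>auto simp: k_supp\<close>)
  show ?thesis
    by (rule that[OF E_integrable E_supp k_cont[OF subset_refl] _ _ conv_heat_inequality conv_heat(2) int])
      (use key in auto)
qed

section \<open>Improvement of flatness\<close>

text \<open>The backward cylinder with top centre \<open>z\<close>. Being open it does not contain
  \<open>z\<close> itself; values at the top are read off in the half closed \<open>cQ\<close>
  introduced later.\<close>

definition Cq :: "'a::euclidean_space \<times> real \<Rightarrow> real \<Rightarrow> ('a \<times> real) set" where
  "Cq z r = ball (fst z) r \<times> {snd z - r\<^sup>2 <..< snd z}"

lemma open_Cq [simp, intro]: "open (Cq z r)"
  unfolding Cq_def by (intro open_Times) auto

lemma bounded_Cq: "bounded (Cq z r)"
  unfolding Cq_def by (intro bounded_Times) auto

lemma Cq_finite: "emeasure lborel (Cq z r) < \<infinity>"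
  using bounded_Cq by (rule emeasure_bounded_finite)

lemma Cq_integrable: "integrable lborel (indicator (Cq z r) :: _ \<Rightarrow> real)"
  using Cq_finite[of z r] by (intro integrable_real_indicator) auto

lemma Cq_aff:
  assumes "R > 0"
  shows "aff z R (R\<^sup>2) w \<in> Cq (aff z R (R\<^sup>2) w0) (R * r) \<longleftrightarrow> w \<in> Cq w0 r"
proof -
  have 1: "dist (fst z + R *\<^sub>R fst w0) (fst z + R *\<^sub>R fst w) = R * dist (fst w0) (fst w)"
    using assms by (simp add: dist_norm scaleR_diff_right[symmetric])
  have 2: "snd z + R\<^sup>2 * snd w0 - (R * r)\<^sup>2 < snd z + R\<^sup>2 * snd w \<longleftrightarrow> R\<^sup>2 * (snd w0 - r\<^sup>2) < R\<^sup>2 * snd w"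
    by (simp add: algebra_simps power_mult_distrib)
  show ?thesis
    unfolding Cq_def aff_def using assms 1 2 by (cases w) auto
qed

lemma Cq_aff0: "R > 0 \<Longrightarrow> aff z R (R\<^sup>2) w \<in> Cq z R \<longleftrightarrow> w \<in> Cq 0 1"
  using Cq_aff[of R z w 0 1] by (simp add: aff_def)

abbreviation QQ :: "('a::euclidean_space \<times> real) set" where "QQ \<equiv> Cq 0 1"

lemma QQ_def2: "QQ = ball 0 1 \<times> {-1<..<0}" by (simp add: Cq_def)

definition vQ :: "'a::euclidean_space itself \<Rightarrow> real" where
  "vQ a = measure lborel (QQ :: ('a \<times> real) set)"

lemma vQ_pos: "0 < vQ TYPE('a::euclidean_space)"
proof -
  have "(0, -1/2) \<in> (QQ :: ('a \<times> real) set)" by (simp add: Cq_def)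
  then obtain r where r: "r > 0" "ball (0, -1/2) r \<subseteq> (QQ :: ('a \<times> real) set)"
    using openE[OF open_Cq] by metis
  have "0 < measure lborel (ball (0::'a, -1/2::real) r)" using r(1) by (rule content_ball_pos)
  also have "\<dots> \<le> vQ TYPE('a)" unfolding vQ_def
    using Cq_finite[of 0 1] by (intro measure_mono_fmeasurable r) (auto simp: fmeasurable_def)
  finally show ?thesis .
qed

lemma integral_Cq_scale:
  fixes h :: "'a::euclidean_space \<times> real \<Rightarrow> real"
  assumes R: "R > 0" and [measurable]: "(\<lambda>w. indicator (Cq z R) w * h w) \<in> borel_measurable borel"
  shows "(LINT w|lborel. indicator (Cq z R) w * h w) = R ^ (DIM('a) + 2) * (LINT w|lborel. indicator QQ w * h (aff z R (R\<^sup>2) w))"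
proof -
  have "indicator (Cq z R) (aff z R (R\<^sup>2) w) = (indicator QQ w :: real)" for w
    using Cq_aff0[OF R, of z w] by (simp add: indicator_def)
  then show ?thesis
    using R by (subst integral_aff[of R "R\<^sup>2" _ z]) (auto simp: power_add power2_eq_square)
qed

lemma measure_Cq:
  assumes "R > 0" shows "measure lborel (Cq (z :: 'a::euclidean_space \<times> real) R) = R ^ (DIM('a) + 2) * vQ TYPE('a)"
  using integral_Cq_scale[OF assms, of z "\<lambda>w. 1"] by (simp add: vQ_def)

text \<open>Test functions vanish outside \<open>U\<close> together with their derivatives. Thus
  coefficients may be extended by 0, which is how measurability on the whole space is
  arranged.\<close>

lemma pv_cong:
  fixes a b f :: "'a::euclidean_space \<times> real \<Rightarrow> real"
  assumes "\<And>w. w \<in> U \<Longrightarrow> a w = a' w" "\<And>w. w \<in> U \<Longrightarrow> b w = b' w" "\<And>w. w \<in> U \<Longrightarrow> f w = f' w"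
  shows "pv U a b f \<longleftrightarrow> pv U a' b' f'"
proof -
  have "(LINT z|lborel. a z * dt \<phi> z + b z * lap \<phi> z + f z * \<phi> z) = (LINT z|lborel. a' z * dt \<phi> z + b' z * lap \<phi> z + f' z * \<phi> z)"
    if "test_fun U \<phi>" for \<phi>
  proof (rule Bochner_Integration.integral_cong[OF refl])
    fix z
    have t: "test_fun U \<phi>" "test_fun U (dt \<phi>)" "test_fun U (lap \<phi>)" using that by (auto intro: test_fun_dt test_fun_lap)
    have z0: "z \<notin> U \<Longrightarrow> h z = 0" if "test_fun U h" for h using that by (auto elim: test_funE)
    then show "a z * dt \<phi> z + b z * lap \<phi> z + f z * \<phi> z = a' z * dt \<phi> z + b' z * lap \<phi> z + f' z * \<phi> z"
      using z0[OF t(1)] z0[OF t(2)] z0[OF t(3)] assms[of z] by (cases "z \<in> U") auto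
  qed
  then show ?thesis unfolding pv_def by auto
qed

lemma indicator_measurable:
  fixes a :: "'a::euclidean_space \<Rightarrow> real"
  assumes "continuous_on U a" "U \<in> sets borel"
  shows "(\<lambda>w. indicator U w * a w) \<in> borel_measurable borel"
  using borel_measurable_continuous_on_indicator[OF assms(2,1)] by simp

lemma Cq_mult_integrable:
  fixes a :: "'a::euclidean_space \<times> real \<Rightarrow> real"
  assumes "(\<lambda>w. indicator (Cq z r) w * a w) \<in> borel_measurable borel" "\<And>w. w \<in> Cq z r \<Longrightarrow> \<bar>a w\<bar> \<le> B"
  shows "integrable lborel (\<lambda>w. indicator (Cq z r) w * a w)"
proof (rule Bochner_Integration.integrable_bound)
  show "integrable lborel (\<lambda>w. B * indicator (Cq z r) w)" using Cq_integrable[of z r] by simp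
  show "AE w in lborel. norm (indicator (Cq z r) w * a w) \<le> norm (B * indicator (Cq z r) w)"
    using assms(2) by (intro AE_I2) (auto simp: indicator_def intro: order_trans[OF _ abs_ge_self])
qed (use assms in auto)

text \<open>Cauchy-Schwarz against the indicator of \<open>A\<close>, read off from the nonnegative
  variance about the mean.\<close>

lemma square_integral_le:
  fixes h :: "'a::euclidean_space \<Rightarrow> real"
  assumes [measurable]: "A \<in> sets borel" and fin: "emeasure lborel A < \<infinity>"
    and h: "integrable lborel h" "integrable lborel (\<lambda>w. (h w)\<^sup>2)" "\<And>w. w \<notin> A \<Longrightarrow> h w = 0"
  shows "(LINT w|lborel. h w)\<^sup>2 \<le> measure lborel A * (LINT w|lborel. (h w)\<^sup>2)"
proof (cases "measure lborel A = 0")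
  case True
  then have "AE w in lborel. w \<notin> A" using fin
    by (intro AE_not_in) (auto simp: null_sets_def emeasure_eq_ennreal_measure)
  then have "AE w in lborel. h w = 0" by eventually_elim (rule h(3))
  then have "(LINT w|lborel. h w) = 0" by (rule integral_eq_zero_AE)
  then show ?thesis by simp
next
  case False
  then have V: "measure lborel A > 0" using measure_nonneg[of lborel A] by linarith
  define m where "m = (LINT w|lborel. h w) / measure lborel A"
  have iA: "integrable lborel (indicator A :: 'a \<Rightarrow> real)" using fin by (intro integrable_real_indicator) auto
  have "0 \<le> (LINT w|lborel. (h w - m * indicator A w)\<^sup>2)" by simp
  also have "(\<lambda>w. (h w - m * indicator A w)\<^sup>2) = (\<lambda>w. (h w)\<^sup>2 - 2 * m * h w + m\<^sup>2 * indicator A w)"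
    using h(3) by (auto simp: fun_eq_iff power2_eq_square algebra_simps indicator_def)
  also have "(LINT w|lborel. (h w)\<^sup>2 - 2 * m * h w + m\<^sup>2 * indicator A w)
      = (LINT w|lborel. (h w)\<^sup>2) - 2 * m * (LINT w|lborel. h w) + m\<^sup>2 * measure lborel A"
    using h iA by simp
  also have "\<dots> = (LINT w|lborel. (h w)\<^sup>2) - (LINT w|lborel. h w)\<^sup>2 / measure lborel A"
    using V by (simp add: m_def field_simps power2_eq_square)
  finally show ?thesis using V by (simp add: field_simps)
qed

lemma amgm: "0 < V \<Longrightarrow> x * y \<le> x\<^sup>2 * V + y\<^sup>2 / (4 * V)" for x y V :: real
proof -
  assume V: "0 < V"
  have "0 \<le> (2 * V * x - y)\<^sup>2 / (4 * V)" using V by simp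
  also have "\<dots> = x\<^sup>2 * V + y\<^sup>2 / (4 * V) - x * y" using V by (simp add: field_simps power2_eq_square)
  finally show ?thesis by simp
qed

lemma continuous_extend_by_zero:
  fixes h \<xi> :: "'a::euclidean_space \<Rightarrow> real"
  assumes "continuous_on U h" "open U" "continuous_on UNIV \<xi>" "compact C" "C \<subseteq> U" "\<And>x. x \<notin> C \<Longrightarrow> \<xi> x = 0"
  shows "continuous_on UNIV (\<lambda>x. h x * \<xi> x)"
proof -
  have "continuous_on (U \<union> - C) (\<lambda>x. h x * \<xi> x)"
  proof (rule continuous_on_open_Un)
    show "open (- C)" using assms(4) by (simp add: compact_imp_closed open_Compl)
    show "continuous_on U (\<lambda>x. h x * \<xi> x)"
      by (intro continuous_intros assms(1) continuous_on_subset[OF assms(3)]) auto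
    show "continuous_on (- C) (\<lambda>x. h x * \<xi> x)"
      by (subst continuous_on_cong[OF refl, of _ _ "\<lambda>x. 0"]) (use assms(6) in auto)
  qed fact
  moreover have "U \<union> - C = UNIV" using assms(5) by auto
  ultimately show ?thesis by simp
qed

section \<open>Duality with heat potentials\<close>

lemma conv_alt:
  fixes K f :: "'a::euclidean_space \<Rightarrow> real"
  shows "conv K f z = (LINT w|lborel. K (w - z) * f w)"
proof -
  have "conv K f z = (LINT w|lborel. (\<lambda>w. K (w - z) * f w) (w + z))"
    by (simp add: conv_def add.commute)
  then show ?thesis by (subst (asm) lborel_integral_translate(1))
qed

lemma bounded_times_integrable:
  fixes a f :: "'a \<Rightarrow> real"
  assumes "integrable M f" "a \<in> borel_measurable M" "\<And>w. \<bar>a w\<bar> \<le> B"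
  shows "integrable M (\<lambda>w. a w * f w)"
proof (rule Bochner_Integration.integrable_bound)
  show "integrable M (\<lambda>w. B * f w)" using assms by simp
  show "(\<lambda>w. a w * f w) \<in> borel_measurable M" using assms by measurable
  have "0 \<le> B" using assms(3)[of undefined] by linarith
  then show "AE w in M. norm (a w * f w) \<le> norm (B * f w)"
    using assms(3) by (intro AE_I2) (auto simp: abs_mult intro: mult_right_mono)
qed

text \<open>\<open>a\<close> and \<open>g\<close> vanish outside \<open>QQ\<close>, so all integrals
  run over the whole space. \<open>e\<close> bounds the oscillation of the error kernel over
  \<open>Cq 0 \<rho>\<close>, and the bound 1/4 for \<open>\<rho>\<close> keeps potentials of
  densities supported there inside \<open>QQ\<close>.\<close>

locale dual_setting =
  fixes E k :: "'a::euclidean_space \<times> real \<Rightarrow> real" and a g f :: "'a \<times> real \<Rightarrow> real" and K0 \<rho> e B :: real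
  assumes E: "integrable lborel E" "\<And>w. w \<notin> cball 0 (1/2) \<times> {0..1/4} \<Longrightarrow> E w = 0"
    and k: "continuous_on UNIV k" "\<And>w. w \<notin> cball 0 (1/2) \<times> {0..1/4} \<Longrightarrow> k w = 0" "\<And>w. \<bar>k w\<bar> \<le> K0"
    and id: "\<And>\<psi> z. test_fun UNIV \<psi> \<Longrightarrow> dt (conv E \<psi>) z + lap (conv E \<psi>) z = - \<psi> z + conv k \<psi> z"
    and \<rho>: "0 < \<rho>" "\<rho> \<le> 1/4" and e: "0 \<le> e"
    and kmod: "\<And>w z. w \<in> Cq 0 \<rho> \<Longrightarrow> \<bar>k (w - z) - k (- z)\<bar> \<le> e"
    and a: "a \<in> borel_measurable borel" "\<And>w. \<bar>a w\<bar> \<le> B" "\<And>w. w \<notin> QQ \<Longrightarrow> a w = 0"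
    and ac: "continuous_on QQ a"
    and g: "g \<in> borel_measurable borel" "\<And>w. \<bar>g w\<bar> \<le> B" "\<And>w. w \<notin> QQ \<Longrightarrow> g w = 0"
    and f: "integrable lborel f" and pv: "pv QQ a (\<lambda>w. a w + g w) f"
begin

text \<open>The errors independent of the test density: the oscillation of the error kernel and the
  L2 norm of \<open>g\<close>. The coefficient of the latter is the constant \<open>C2\<close> of
  the Laplacian bound in \<open>duality_smooth\<close>.\<close>

definition W :: real where
  "W = (e * (LINT w|lborel. \<bar>a w\<bar>))\<^sup>2 * measure lborel (Cq (0::'a \<times> real) \<rho>)
     + (2 + 2 * K0\<^sup>2 * (vQ TYPE('a))\<^sup>2) * (LINT w|lborel. (g w)\<^sup>2)"

text \<open>If \<open>g\<close> and \<open>f\<close> vanish, testing with potentials shows that on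
  \<open>Cq 0 \<rho>\<close> the value \<open>a w\<close> is the integral of
  \<open>a z * k (w - z)\<close> over \<open>z\<close>. \<open>b\<close> is this integral at
  \<open>w = 0\<close> and serves as the constant near \<open>a\<close>.\<close>

definition b where "b = (LINT w|lborel. a w * k (- w))"

lemma a_integrable: "integrable lborel a"
proof -
  have "integrable lborel (\<lambda>w. indicator QQ w * a w)" by (rule Cq_mult_integrable[where B = B]) (use a in auto)
  moreover have "(\<lambda>w. indicator QQ w * a w) = a" using a(3) by (auto simp: fun_eq_iff indicator_def)
  ultimately show ?thesis by simp
qed

text \<open>The estimate obtained by testing the equation with a parametrix potential of \<open>\<psi>\<close>.\<close>
lemma duality_smooth:
  assumes \<psi>: "smooth \<psi>" "compact C" "C \<subseteq> Cq 0 \<rho>" "\<And>w. w \<notin> C \<Longrightarrow> \<psi> w = 0" "\<And>w. \<bar>\<psi> w\<bar> \<le> M"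
  shows "(LINT w|lborel. a w * \<psi> w) - b * (LINT w|lborel. \<psi> w) \<le>
     W + (LINT w|lborel. \<bar>E w\<bar>) * M * (LINT w|lborel. \<bar>f w\<bar>) + 1/2 * (LINT w|lborel. (\<psi> w)\<^sup>2)"
proof -
  define \<phi> where "\<phi> = conv E \<psi>"
  define V where "V = measure lborel (Cq (0::'a \<times> real) \<rho>)"
  define A1 where "A1 = (LINT w|lborel. \<bar>a w\<bar>)"
  define L where "L = (LINT w|lborel. \<bar>E w\<bar>)"
  define P1 where "P1 = (LINT w|lborel. \<bar>\<psi> w\<bar>)"
  \<comment> \<open>In this proof \<open>space_cutoff\<close> denotes the squared L2 norm of the
    density, not the cut-off profile of the same name.\<close>
  define space_cutoff where "space_cutoff = (LINT w|lborel. (\<psi> w)\<^sup>2)"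
  \<comment> \<open>From the square of \<open>- \<psi> + conv k \<psi>\<close>: the second summand
    collects the bound \<open>K0 * P1\<close> for \<open>conv k \<psi>\<close>, its integration over
    \<open>QQ\<close> and Cauchy-Schwarz for \<open>P1\<close>, the last two contributing one factor
    \<open>vQ\<close> each.\<close>
  define C2 where "C2 = 2 + 2 * K0\<^sup>2 * (vQ TYPE('a))\<^sup>2"
  have V: "0 < V" "V \<le> vQ TYPE('a)"
  proof -
    have "\<rho> ^ (DIM('a) + 2) \<le> 1" using \<rho> by (intro power_le_one) auto
    then show "0 < V" "V \<le> vQ TYPE('a)"
      using vQ_pos[where 'a='a] \<rho> unfolding V_def by (auto simp: measure_Cq)
  qed
  have C2: "C2 > 0" unfolding C2_def by (intro add_pos_nonneg) auto
  have t\<psi>: "test_fun UNIV \<psi>" using \<psi> by (intro test_funI[of _ C]) auto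
  have c\<psi>: "continuous_on UNIV \<psi>" by (rule smooth_continuous) fact
  have i\<psi>: "integrable lborel \<psi>" using t\<psi> by (rule test_fun_integrable)
  have sub: "x - w \<in> QQ" if "x \<in> C" "w \<in> cball 0 (1/2) \<times> {0..1/4}" for x w
  proof -
    have "norm (fst x) < \<rho>" "- \<rho>\<^sup>2 < snd x" "snd x < 0" using that \<psi>(3) by (auto simp: Cq_def)
    moreover have "norm (fst w) \<le> 1/2" "0 \<le> snd w" "snd w \<le> 1/4" using that by auto
    moreover have "norm (fst x - fst w) \<le> norm (fst x) + norm (fst w)" by (rule norm_triangle_ineq4)
    moreover have "\<rho>\<^sup>2 \<le> (1/4)\<^sup>2" using \<rho> by (intro power_mono) auto
    moreover have "(1/4)\<^sup>2 = (1/16::real)" by (simp add: power2_eq_square)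
    ultimately have "norm (fst x - fst w) < 1" "-1 < snd x - snd w" "snd x - snd w < 0" using \<rho> by linarith+
    then show ?thesis by (cases x; cases w) (simp add: Cq_def dist_norm norm_minus_commute)
  qed
  have t\<phi>: "test_fun QQ \<phi>" unfolding \<phi>_def
    by (rule test_fun_conv[OF E(1) _ E(2) \<psi>(1,2,4) sub]) (auto intro: compact_Times)
  have ki: "integrable lborel k"
    by (rule integrable_compact_support[OF k(1) _ k(2)]) (auto intro: compact_Times)
  have tk: "test_fun QQ (conv k \<psi>)"
    by (rule test_fun_conv[OF ki _ k(2) \<psi>(1,2,4) sub]) (auto intro: compact_Times)
  have [measurable]: "\<phi> \<in> borel_measurable borel" "lap \<phi> \<in> borel_measurable borel" "dt \<phi> \<in> borel_measurable borel"
    "\<psi> \<in> borel_measurable borel" "conv k \<psi> \<in> borel_measurable borel" "k \<in> borel_measurable borel"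
    using t\<phi> tk t\<psi> k(1) by (auto intro!: borel_measurable_continuous_onI smooth_continuous[OF test_fun_smooth] test_fun_lap test_fun_dt)
  note [measurable] = a(1) g(1)
  have i\<psi>2: "integrable lborel (\<lambda>w. (\<psi> w)\<^sup>2)"
    unfolding power2_eq_square by (rule test_fun_integrable[OF test_fun_mult[OF t\<psi> \<psi>(1)]])
  have QV: "emeasure lborel (Cq (0::'a \<times> real) \<rho>) < \<infinity>" by (rule Cq_finite)
  have P1: "P1\<^sup>2 \<le> V * space_cutoff"
  proof -
    have "(LINT w|lborel. \<bar>\<psi> w\<bar>)\<^sup>2 \<le> measure lborel (Cq (0::'a \<times> real) \<rho>) * (LINT w|lborel. \<bar>\<psi> w\<bar>\<^sup>2)"
      by (rule square_integral_le[OF _ QV]) (use i\<psi> i\<psi>2 \<psi>(3,4) in auto)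
    then show ?thesis by (simp add: P1_def space_cutoff_def V_def)
  qed
  have conv_k: "\<bar>conv k \<psi> z - k (- z) * (LINT w|lborel. \<psi> w)\<bar> \<le> e * P1" for z
  proof -
    have i1: "integrable lborel (\<lambda>w. k (w - z) * \<psi> w)"
      by (rule bounded_times_integrable[OF i\<psi> _ k(3)]) measurable
    have "conv k \<psi> z - k (- z) * (LINT w|lborel. \<psi> w) = (LINT w|lborel. (k (w - z) - k (- z)) * \<psi> w)"
      using i1 i\<psi> by (simp add: conv_alt left_diff_distrib)
    then have "\<bar>conv k \<psi> z - k (- z) * (LINT w|lborel. \<psi> w)\<bar> \<le> (LINT w|lborel. \<bar>(k (w - z) - k (- z)) * \<psi> w\<bar>)"
      using integral_abs_bound by metis
    also have "\<dots> \<le> (LINT w|lborel. e * \<bar>\<psi> w\<bar>)"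
    proof (rule integral_mono)
      show "integrable lborel (\<lambda>w. \<bar>(k (w - z) - k (- z)) * \<psi> w\<bar>)"
        using i1 i\<psi> by (simp add: left_diff_distrib)
      show "\<bar>(k (w - z) - k (- z)) * \<psi> w\<bar> \<le> e * \<bar>\<psi> w\<bar>" for w
        using kmod[of w z] \<psi>(3) \<psi>(4)[of w] by (cases "w \<in> C") (auto simp: abs_mult intro!: mult_right_mono)
    qed (use i\<psi> in auto)
    finally show ?thesis by (simp add: P1_def)
  qed
  have conv_k0: "\<bar>conv k \<psi> z\<bar> \<le> K0 * P1" for z
  proof -
    have i1: "integrable lborel (\<lambda>w. k (w - z) * \<psi> w)"
      by (rule bounded_times_integrable[OF i\<psi> _ k(3)]) measurable
    have "\<bar>conv k \<psi> z\<bar> \<le> (LINT w|lborel. \<bar>k (w - z) * \<psi> w\<bar>)"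
      unfolding conv_alt by (rule integral_abs_bound)
    also have "\<dots> \<le> (LINT w|lborel. K0 * \<bar>\<psi> w\<bar>)"
    proof (rule integral_mono)
      show "integrable lborel (\<lambda>w. \<bar>k (w - z) * \<psi> w\<bar>)" by (rule integrable_abs[OF i1])
      show "\<bar>k (w - z) * \<psi> w\<bar> \<le> K0 * \<bar>\<psi> w\<bar>" for w
        using mult_right_mono[OF k(3)[of "w - z"], of "\<bar>\<psi> w\<bar>"] by (simp add: abs_mult)
    qed (use i\<psi> in auto)
    finally show ?thesis by (simp add: P1_def)
  qed
  have lap2: "(LINT w|lborel. (lap \<phi> w)\<^sup>2) \<le> C2 * space_cutoff"
  proof -
    have "(LINT w|lborel. (lap \<phi> w)\<^sup>2) \<le> (LINT w|lborel. (dt \<phi> w + lap \<phi> w)\<^sup>2)"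
      by (rule heat_energy) (rule test_fun_mono[OF t\<phi>], simp)
    also have "\<dots> = (LINT w|lborel. (- \<psi> w + conv k \<psi> w)\<^sup>2)"
      unfolding \<phi>_def id[OF t\<psi>] ..
    also have "\<dots> \<le> (LINT w|lborel. 2 * (\<psi> w)\<^sup>2 + 2 * (conv k \<psi> w)\<^sup>2)"
    proof (rule integral_mono)
      have ic: "integrable lborel (\<lambda>w. (conv k \<psi> w)\<^sup>2)"
        unfolding power2_eq_square by (rule test_fun_integrable[OF test_fun_mult[OF tk test_fun_smooth[OF tk]]])
      have ic2: "integrable lborel (\<lambda>w. \<psi> w * conv k \<psi> w)"
        by (rule test_fun_integrable[OF test_fun_mult[OF t\<psi> test_fun_smooth[OF tk]]])
      show "integrable lborel (\<lambda>w. 2 * (\<psi> w)\<^sup>2 + 2 * (conv k \<psi> w)\<^sup>2)" using ic i\<psi>2 by simp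
      have "(\<lambda>w. (- \<psi> w + conv k \<psi> w)\<^sup>2) = (\<lambda>w. (\<psi> w)\<^sup>2 - 2 * (\<psi> w * conv k \<psi> w) + (conv k \<psi> w)\<^sup>2)"
        by (simp add: fun_eq_iff power2_eq_square algebra_simps)
      then show "integrable lborel (\<lambda>w. (- \<psi> w + conv k \<psi> w)\<^sup>2)" using ic ic2 i\<psi>2 by simp
      show "(- \<psi> w + conv k \<psi> w)\<^sup>2 \<le> 2 * (\<psi> w)\<^sup>2 + 2 * (conv k \<psi> w)\<^sup>2" for w
        using zero_le_power2[of "\<psi> w + conv k \<psi> w"] by (simp add: power2_eq_square algebra_simps)
    qed
    also have "\<dots> = 2 * space_cutoff + 2 * (LINT w|lborel. (conv k \<psi> w)\<^sup>2)"
      using i\<psi>2 test_fun_integrable[OF test_fun_mult[OF tk test_fun_smooth[OF tk]]]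
      by (simp add: space_cutoff_def power2_eq_square)
    also have "(LINT w|lborel. (conv k \<psi> w)\<^sup>2) \<le> (LINT w|lborel. (K0 * P1)\<^sup>2 * indicator (QQ :: ('a \<times> real) set) w)"
    proof (rule integral_mono)
      show "integrable lborel (\<lambda>w. (conv k \<psi> w)\<^sup>2)"
        unfolding power2_eq_square by (rule test_fun_integrable[OF test_fun_mult[OF tk test_fun_smooth[OF tk]]])
      show "(conv k \<psi> w)\<^sup>2 \<le> (K0 * P1)\<^sup>2 * indicator QQ w" for w
      proof (cases "w \<in> QQ")
        case True
        have "\<bar>conv k \<psi> w\<bar>\<^sup>2 \<le> (K0 * P1)\<^sup>2" by (intro power_mono conv_k0) auto
        then show ?thesis using True by simp
      next
        case False
        then have "conv k \<psi> w = 0" using tk by (auto elim: test_funE)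
        then show ?thesis by simp
      qed
    qed (use Cq_integrable[of "0::'a \<times> real" 1] in simp)
    also have "\<dots> = K0\<^sup>2 * P1\<^sup>2 * vQ TYPE('a)" by (simp add: vQ_def power_mult_distrib)
    also have "\<dots> \<le> K0\<^sup>2 * (vQ TYPE('a) * space_cutoff) * vQ TYPE('a)"
    proof -
      have "0 \<le> space_cutoff" by (simp add: space_cutoff_def)
      then have "P1\<^sup>2 \<le> vQ TYPE('a) * space_cutoff" using P1 V by (meson mult_right_mono order_trans)
      then show ?thesis using vQ_pos[where 'a='a] by (intro mult_right_mono mult_left_mono) auto
    qed
    finally show ?thesis by (simp add: C2_def power2_eq_square algebra_simps)
  qed
  have ia: "integrable lborel (\<lambda>w. a w * h w)" "integrable lborel (\<lambda>w. g w * h w)" if "integrable lborel h" for h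
    using bounded_times_integrable[OF that _ a(2)] bounded_times_integrable[OF that _ g(2)] by auto
  have i\<phi>: "integrable lborel \<phi>" "integrable lborel (dt \<phi>)" "integrable lborel (lap \<phi>)" "integrable lborel (conv k \<psi>)"
    using t\<phi> tk by (auto intro: test_fun_integrable test_fun_dt test_fun_lap)
  have \<phi>_bound: "\<bar>\<phi> w\<bar> \<le> M * L" for w
    unfolding \<phi>_def L_def by (rule conv_bound[OF E(1) c\<psi> \<psi>(5)])
  have if\<phi>: "integrable lborel (\<lambda>w. f w * \<phi> w)"
    using bounded_times_integrable[where a = \<phi> and B = "M * L", OF f] \<phi>_bound by (simp add: mult.commute)
  have "0 = (LINT w|lborel. a w * dt \<phi> w + (a w + g w) * lap \<phi> w + f w * \<phi> w)"
    using pv t\<phi> by (simp add: pv_def)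
  also have "\<dots> = (LINT w|lborel. a w * conv k \<psi> w - a w * \<psi> w + g w * lap \<phi> w + f w * \<phi> w)"
  proof (rule Bochner_Integration.integral_cong[OF refl])
    fix w
    have "conv k \<psi> w = \<psi> w + dt \<phi> w + lap \<phi> w" using id[OF t\<psi>, of w] by (simp add: \<phi>_def)
    then show "a w * dt \<phi> w + (a w + g w) * lap \<phi> w + f w * \<phi> w = a w * conv k \<psi> w - a w * \<psi> w + g w * lap \<phi> w + f w * \<phi> w"
      by (simp add: algebra_simps)
  qed
  also have "\<dots> = (LINT w|lborel. a w * conv k \<psi> w) - (LINT w|lborel. a w * \<psi> w) + (LINT w|lborel. g w * lap \<phi> w) + (LINT w|lborel. f w * \<phi> w)"
    using ia i\<phi> i\<psi> if\<phi> by simp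
  finally have main: "(LINT w|lborel. a w * \<psi> w) = (LINT w|lborel. a w * conv k \<psi> w) + (LINT w|lborel. g w * lap \<phi> w) + (LINT w|lborel. f w * \<phi> w)"
    by simp
  note ai = a_integrable
  have gi: "integrable lborel (\<lambda>w. (g w)\<^sup>2)"
  proof -
    have "integrable lborel (\<lambda>w. indicator QQ w * (g w)\<^sup>2)"
      by (rule Cq_mult_integrable[where B = "B\<^sup>2"]) (use g(2) abs_le_square_iff[of _ B] in \<open>auto intro: order_trans[OF _ abs_ge_self]\<close>)
    moreover have "(\<lambda>w. indicator QQ w * (g w)\<^sup>2) = (\<lambda>w. (g w)\<^sup>2)" using g(3) by (auto simp: fun_eq_iff indicator_def)
    ultimately show ?thesis by simp
  qed
  have "\<bar>k (- w)\<bar> \<le> K0" for w by (rule k(3))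
  from bounded_times_integrable[OF ai _ this]
  have iak: "integrable lborel (\<lambda>w. a w * k (- w))" by (simp add: mult.commute)
  \<comment> \<open>Here and in \<open>t2\<close> the weights of Young's inequality are such that
    each estimate costs a quarter of the squared norm of the density. Together they give the 1/2
    that \<open>excess_estimate\<close> absorbs.\<close>
  have t1: "(LINT w|lborel. a w * conv k \<psi> w) - (LINT w|lborel. a w * k (- w)) * (LINT w|lborel. \<psi> w) \<le> (e * A1)\<^sup>2 * V + 1/4 * space_cutoff"
  proof -
    have "(LINT w|lborel. a w * conv k \<psi> w) - (LINT w|lborel. a w * k (- w)) * (LINT w|lborel. \<psi> w)
      = (LINT w|lborel. a w * (conv k \<psi> w - k (- w) * (LINT w|lborel. \<psi> w)))"
      using ia[OF i\<phi>(4)] iak by (simp add: right_diff_distrib mult.assoc[symmetric])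
    also have "\<dots> \<le> (LINT w|lborel. \<bar>a w\<bar> * (e * P1))"
    proof (rule integral_mono)
      show "integrable lborel (\<lambda>w. a w * (conv k \<psi> w - k (- w) * (LINT w|lborel. \<psi> w)))"
        using ia[OF i\<phi>(4)] iak by (simp add: right_diff_distrib mult.assoc[symmetric])
      show "a w * (conv k \<psi> w - k (- w) * (LINT w|lborel. \<psi> w)) \<le> \<bar>a w\<bar> * (e * P1)" for w
        using mult_left_mono[OF conv_k[of w], of "\<bar>a w\<bar>"] abs_ge_self[of "a w * (conv k \<psi> w - k (- w) * (LINT w|lborel. \<psi> w))"]
        by (simp add: abs_mult)
    qed (use ai in auto)
    also have "\<dots> = (e * A1) * P1" by (simp add: A1_def)
    also have "\<dots> \<le> (e * A1)\<^sup>2 * V + P1\<^sup>2 / (4 * V)" by (rule amgm) (rule V(1))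
    also have "P1\<^sup>2 / (4 * V) \<le> 1/4 * space_cutoff" using P1 V(1) by (simp add: field_simps)
    finally show ?thesis by simp
  qed
  have t2: "(LINT w|lborel. g w * lap \<phi> w) \<le> C2 * (LINT w|lborel. (g w)\<^sup>2) + 1/4 * space_cutoff"
  proof -
    have i: "integrable lborel (\<lambda>w. (lap \<phi> w)\<^sup>2)"
      unfolding power2_eq_square by (rule test_fun_integrable[OF test_fun_mult[OF test_fun_lap[OF t\<phi>] test_fun_smooth[OF test_fun_lap[OF t\<phi>]]]])
    have "(LINT w|lborel. g w * lap \<phi> w) \<le> (LINT w|lborel. C2 * (g w)\<^sup>2 + (lap \<phi> w)\<^sup>2 / (4 * C2))"
    proof (rule integral_mono[OF ia(2)[OF i\<phi>(3)]])
      show "g w * lap \<phi> w \<le> C2 * (g w)\<^sup>2 + (lap \<phi> w)\<^sup>2 / (4 * C2)" for w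
        using amgm[OF C2, of "g w" "lap \<phi> w"] by (simp add: mult.commute)
    qed (use gi i in auto)
    also have "\<dots> = C2 * (LINT w|lborel. (g w)\<^sup>2) + (LINT w|lborel. (lap \<phi> w)\<^sup>2) / (4 * C2)"
      using gi i by simp
    also have "(LINT w|lborel. (lap \<phi> w)\<^sup>2) / (4 * C2) \<le> 1/4 * space_cutoff"
      using lap2 C2 by (simp add: field_simps)
    finally show ?thesis by simp
  qed
  have t3: "(LINT w|lborel. f w * \<phi> w) \<le> L * M * (LINT w|lborel. \<bar>f w\<bar>)"
  proof -
    have "(LINT w|lborel. f w * \<phi> w) \<le> (LINT w|lborel. \<bar>f w\<bar> * (M * L))"
    proof (rule integral_mono[OF if\<phi>])
      show "f w * \<phi> w \<le> \<bar>f w\<bar> * (M * L)" for w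
        using mult_left_mono[OF \<phi>_bound[of w], of "\<bar>f w\<bar>"] abs_ge_self[of "f w * \<phi> w"] by (simp add: abs_mult)
    qed (use f in auto)
    then show ?thesis by (simp add: mult_ac)
  qed
  show ?thesis using main t1 t2 t3
    by (simp add: W_def b_def A1_def[symmetric] V_def[symmetric] C2_def[symmetric] L_def[symmetric] space_cutoff_def[symmetric])
qed


text \<open>The density wanted in \<open>excess_estimate\<close> is only continuous, as
  \<open>a\<close> is. The mollification error is kept at most 1, which explains
  \<open>M + 1\<close>.\<close>

lemma duality_continuous:
  assumes \<psi>: "continuous_on UNIV \<psi>" "compact C" "C \<subseteq> Cq 0 \<rho>" "\<And>w. w \<notin> C \<Longrightarrow> \<psi> w = 0" "\<And>w. \<bar>\<psi> w\<bar> \<le> M"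
  shows "(LINT w|lborel. a w * \<psi> w) - b * (LINT w|lborel. \<psi> w) \<le>
     W + (LINT w|lborel. \<bar>E w\<bar>) * (M + 1) * (LINT w|lborel. \<bar>f w\<bar>) + 1/2 * (LINT w|lborel. (\<psi> w)\<^sup>2)"
proof -
  obtain C' where C': "compact C'" "C' \<subseteq> Cq 0 \<rho>"
    "\<And>e. e > 0 \<Longrightarrow> \<exists>\<phi>. smooth \<phi> \<and> (\<forall>x. x \<notin> C' \<longrightarrow> \<phi> x = 0) \<and> (\<forall>x. \<bar>\<phi> x - \<psi> x\<bar> \<le> e)"
    using mollify[OF \<psi>(1,2) _ \<psi>(3) open_Cq] \<psi>(4) by blast
  define h where "h n = 1 / real (Suc n)" for n
  have h: "0 < h n" "h n \<le> 1" for n by (auto simp: h_def)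
  have hlim: "h \<longlonglongrightarrow> 0" using LIMSEQ_inverse_real_of_nat by (simp add: h_def[abs_def] inverse_eq_divide)
  have "\<exists>\<phi>. \<forall>n. smooth (\<phi> n) \<and> (\<forall>x. x \<notin> C' \<longrightarrow> \<phi> n x = 0) \<and> (\<forall>x. \<bar>\<phi> n x - \<psi> x\<bar> \<le> h n)"
    using C'(3)[OF h(1)] by (intro choice) blast
  then obtain \<phi> where \<phi>: "\<And>n. smooth (\<phi> n)" "\<And>n x. x \<notin> C' \<Longrightarrow> \<phi> n x = 0" "\<And>n x. \<bar>\<phi> n x - \<psi> x\<bar> \<le> h n"
    by blast
  have \<phi>M: "\<bar>\<phi> n x\<bar> \<le> M + 1" for n x
    using \<phi>(3)[of n x] \<psi>(5)[of x] h(2)[of n] by linarith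
  have lim: "(\<lambda>n. \<phi> n x) \<longlonglongrightarrow> \<psi> x" for x
    by (subst Lim_null, rule Lim_null_comparison[OF _ hlim]) (use \<phi>(3) in auto)
  have [measurable]: "\<phi> n \<in> borel_measurable borel" "\<psi> \<in> borel_measurable borel" for n
    using \<phi>(1) \<psi>(1) by (auto intro!: borel_measurable_continuous_onI smooth_continuous)
  note [measurable] = a(1)
  have iC: "integrable lborel (indicator C' :: _ \<Rightarrow> real)"
    using C'(1) emeasure_bounded_finite[OF compact_imp_bounded[OF C'(1)]]
    by (intro integrable_real_indicator) (auto simp: borel_compact)
  have l1: "(\<lambda>n. LINT w|lborel. a w * \<phi> n w) \<longlonglongrightarrow> (LINT w|lborel. a w * \<psi> w)"
  proof (rule integral_dominated_convergence[where w = "\<lambda>w. \<bar>a w\<bar> * (M + 1)"])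
    show "AE w in lborel. (\<lambda>n. a w * \<phi> n w) \<longlonglongrightarrow> a w * \<psi> w" by (intro AE_I2 tendsto_intros lim)
    show "AE w in lborel. norm (a w * \<phi> n w) \<le> \<bar>a w\<bar> * (M + 1)" for n
      using \<phi>M by (intro AE_I2) (auto simp: abs_mult intro!: mult_left_mono)
    show "integrable lborel (\<lambda>w. \<bar>a w\<bar> * (M + 1))" using a_integrable by auto
  qed auto
  have l2: "(\<lambda>n. LINT w|lborel. \<phi> n w) \<longlonglongrightarrow> (LINT w|lborel. \<psi> w)"
  proof (rule integral_dominated_convergence[where w = "\<lambda>w. indicator C' w * (M + 1)"])
    show "AE w in lborel. norm (\<phi> n w) \<le> indicator C' w * (M + 1)" for n
      using \<phi>M \<phi>(2) by (intro AE_I2) (auto simp: indicator_def)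
  qed (use iC lim in auto)
  have l3: "(\<lambda>n. LINT w|lborel. (\<phi> n w)\<^sup>2) \<longlonglongrightarrow> (LINT w|lborel. (\<psi> w)\<^sup>2)"
  proof (rule integral_dominated_convergence[where w = "\<lambda>w. indicator C' w * (M + 1)\<^sup>2"])
    show "AE w in lborel. norm ((\<phi> n w)\<^sup>2) \<le> indicator C' w * (M + 1)\<^sup>2" for n
    proof (intro AE_I2)
      fix w
      have "\<bar>\<phi> n w\<bar>\<^sup>2 \<le> (M + 1)\<^sup>2" by (intro power_mono \<phi>M) auto
      then show "norm ((\<phi> n w)\<^sup>2) \<le> indicator C' w * (M + 1)\<^sup>2"
        using \<phi>(2)[of w n] by (cases "w \<in> C'") auto
    qed
  qed (use iC lim in \<open>auto intro!: tendsto_intros\<close>)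
  have "(LINT w|lborel. a w * \<phi> n w) - b * (LINT w|lborel. \<phi> n w) \<le>
     W + (LINT w|lborel. \<bar>E w\<bar>) * (M + 1) * (LINT w|lborel. \<bar>f w\<bar>) + 1/2 * (LINT w|lborel. (\<phi> n w)\<^sup>2)" for n
    using \<phi>M by (intro duality_smooth[OF \<phi>(1) C'(1,2) \<phi>(2)]) auto
  then show ?thesis
    by (intro LIMSEQ_le[OF tendsto_diff[OF l1 tendsto_mult[OF tendsto_const l2]] tendsto_add[OF tendsto_const tendsto_mult[OF tendsto_const l3]]])
      auto
qed

text \<open>The density is \<open>a - b\<close> itself, cut off inside \<open>Cq 0 \<rho>\<close>.
  The left side of the duality estimate is then the weighted mean square deviation, which also
  dominates the squared norm of the density. Absorbing half of it produces the factor 2.\<close>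

lemma excess_estimate:
  "(LINT w|lborel. indicator (Cq 0 \<rho>) w * (a w - b)\<^sup>2) \<le>
    2 * (W + (LINT w|lborel. \<bar>E w\<bar>) * (B + \<bar>b\<bar> + 1) * (LINT w|lborel. \<bar>f w\<bar>))" (is "_ \<le> 2 * ?R")
proof -
  let ?U = "Cq (0::'a \<times> real) \<rho>"
  have UQ: "?U \<subseteq> QQ"
  proof -
    have "\<rho>\<^sup>2 \<le> 1" using \<rho> by (intro power_le_one) auto
    then show ?thesis using \<rho> by (auto simp: Cq_def)
  qed
  have ne: "- ?U \<noteq> {}" using bounded_Cq not_bounded_UNIV by (metis Compl_empty_eq double_compl)
  define D where "D w = infdist w (- ?U)" for w
  have D0: "D w = 0 \<longleftrightarrow> w \<notin> ?U" for w
    using in_closed_iff_infdist_zero[of "- ?U" w] ne by (simp add: D_def closed_Compl)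
  have Dpos: "0 \<le> D w" for w by (simp add: D_def infdist_nonneg)
  \<comment> \<open>The subtraction of 1 makes \<open>\<xi> n\<close> vanish near the complement, so
    its support is compact in the open cylinder, while the limit in \<open>n\<close> is still the
    indicator.\<close>
  define \<xi> where "\<xi> n w = min 1 (max 0 (real n * D w - 1))" for n w
  have \<xi>c: "continuous_on UNIV (\<xi> n)" for n
    unfolding \<xi>_def D_def by (intro continuous_intros)
  have \<xi>: "0 \<le> \<xi> n w" "\<xi> n w \<le> 1" for n w by (auto simp: \<xi>_def)
  define K where "K n = {w. 1 \<le> real n * D w}" for n
  have K0: "w \<notin> K n \<Longrightarrow> \<xi> n w = 0" for n w by (auto simp: K_def \<xi>_def)
  have KU: "K n \<subseteq> ?U" for n using D0 by (force simp: K_def)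
  have Kc: "compact (K n)" for n
  proof -
    have "closed (K n)" unfolding K_def D_def by (intro closed_Collect_le continuous_intros)
    moreover have "bounded (K n)" using KU bounded_Cq bounded_subset by metis
    ultimately show ?thesis by (simp add: compact_eq_bounded_closed)
  qed
  have \<xi>lim: "(\<lambda>n. \<xi> n w) \<longlonglongrightarrow> indicator ?U w" for w
  proof (cases "w \<in> ?U")
    case True
    then have "0 < D w" using D0[of w] Dpos[of w] by linarith
    then obtain m :: nat where m: "2 < real m * D w" using reals_Archimedean3 by blast
    have "\<xi> n w = 1" if "m \<le> n" for n
    proof -
      have "real m * D w \<le> real n * D w" using that Dpos[of w] by (intro mult_right_mono) auto
      then show ?thesis using m by (simp add: \<xi>_def)
    qed
    then have "\<forall>\<^sub>F n in sequentially. \<xi> n w = indicator ?U w"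
      using True by (auto simp: eventually_sequentially)
    then show ?thesis by (rule tendsto_eventually)
  next
    case False
    then have "\<xi> n w = 0" for n using K0[of w n] KU[of n] by blast
    then show ?thesis using False by simp
  qed
  note [measurable] = a(1)
  have [measurable]: "\<xi> n \<in> borel_measurable borel" for n by (rule borel_measurable_continuous_onI[OF \<xi>c])
  have iU: "integrable lborel (\<lambda>w. indicator ?U w * c)" for c :: real using Cq_integrable[of "0::'a \<times> real" \<rho>] by simp
  have ab: "\<bar>a w - b\<bar> \<le> B + \<bar>b\<bar>" for w using a(2)[of w] by linarith
  have ab2: "(a w - b)\<^sup>2 \<le> (B + \<bar>b\<bar>)\<^sup>2" for w
    using power_mono[OF ab, of w 2] by simp
  have dom: "\<xi> n w * (a w - b)\<^sup>2 \<le> indicator ?U w * (B + \<bar>b\<bar>)\<^sup>2" for n w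
  proof (cases "w \<in> ?U")
    case True
    have "\<xi> n w * (a w - b)\<^sup>2 \<le> 1 * (B + \<bar>b\<bar>)\<^sup>2" by (intro mult_mono \<xi> ab2) auto
    then show ?thesis using True by simp
  next
    case False
    then have "\<xi> n w = 0" using K0[of w n] KU[of n] by blast
    then show ?thesis by simp
  qed
  have "(LINT w|lborel. \<xi> n w * (a w - b)\<^sup>2) \<le> 2 * ?R" for n
  proof -
    define \<psi> where "\<psi> w = (a w - b) * \<xi> n w" for w
    have \<psi>c: "continuous_on UNIV \<psi>" unfolding \<psi>_def
      by (rule continuous_extend_by_zero[OF _ open_Cq \<xi>c Kc KU K0])
        (intro continuous_intros continuous_on_subset[OF ac UQ])
    have \<psi>0: "\<psi> w = 0" if "w \<notin> K n" for w using K0[OF that] by (simp add: \<psi>_def)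
    have \<psi>M: "\<bar>\<psi> w\<bar> \<le> B + \<bar>b\<bar>" for w
      using mult_mono[OF ab[of w] \<xi>(2)[of n w]] \<xi>[of n w] a(2)[of w] by (simp add: \<psi>_def abs_mult)
    have i\<psi>: "integrable lborel \<psi>" by (rule integrable_compact_support[OF \<psi>c Kc \<psi>0])
    have ia\<psi>: "integrable lborel (\<lambda>w. a w * \<psi> w)" by (rule bounded_times_integrable[OF i\<psi> _ a(2)]) simp
    have ix: "integrable lborel (\<lambda>w. \<xi> n w * (a w - b)\<^sup>2)"
      by (rule Bochner_Integration.integrable_bound[OF iU[of "(B + \<bar>b\<bar>)\<^sup>2"]])
        (use dom[of n] \<xi> in \<open>auto intro!: order_trans[OF dom] simp: abs_mult\<close>)
    have "(LINT w|lborel. (\<psi> w)\<^sup>2) \<le> (LINT w|lborel. \<xi> n w * (a w - b)\<^sup>2)"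
    proof (rule integral_mono[OF _ ix])
      have "continuous_on UNIV (\<lambda>w. (\<psi> w)\<^sup>2)" by (intro continuous_intros \<psi>c)
      then show "integrable lborel (\<lambda>w. (\<psi> w)\<^sup>2)"
        by (rule integrable_compact_support[OF _ Kc[of n]]) (simp add: \<psi>0)
      fix w
      have "(\<psi> w)\<^sup>2 = (\<xi> n w * (a w - b)\<^sup>2) * \<xi> n w" by (simp add: \<psi>_def power2_eq_square algebra_simps)
      also have "\<dots> \<le> (\<xi> n w * (a w - b)\<^sup>2) * 1" using \<xi>[of n w] by (intro mult_left_mono) auto
      finally show "(\<psi> w)\<^sup>2 \<le> \<xi> n w * (a w - b)\<^sup>2" by simp
    qed
    moreover have "(LINT w|lborel. \<xi> n w * (a w - b)\<^sup>2) = (LINT w|lborel. a w * \<psi> w) - b * (LINT w|lborel. \<psi> w)"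
    proof -
      have "(LINT w|lborel. a w * \<psi> w) - b * (LINT w|lborel. \<psi> w) = (LINT w|lborel. a w * \<psi> w - b * \<psi> w)"
        using ia\<psi> i\<psi> by simp
      also have "(\<lambda>w. a w * \<psi> w - b * \<psi> w) = (\<lambda>w. \<xi> n w * (a w - b)\<^sup>2)"
        by (simp add: fun_eq_iff \<psi>_def power2_eq_square algebra_simps)
      finally show ?thesis by simp
    qed
    moreover have "(LINT w|lborel. a w * \<psi> w) - b * (LINT w|lborel. \<psi> w) \<le> ?R + 1/2 * (LINT w|lborel. (\<psi> w)\<^sup>2)"
      by (rule duality_continuous[OF \<psi>c Kc[of n] KU[of n] _ \<psi>M]) (rule \<psi>0)
    moreover have "p \<le> x \<Longrightarrow> x = y \<Longrightarrow> y \<le> r + 1/2 * p \<Longrightarrow> x \<le> 2 * r" for p x y r :: real by linarith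
    ultimately show ?thesis by blast
  qed
  moreover have "(\<lambda>n. LINT w|lborel. \<xi> n w * (a w - b)\<^sup>2) \<longlonglongrightarrow> (LINT w|lborel. indicator ?U w * (a w - b)\<^sup>2)"
  proof (rule integral_dominated_convergence[where w = "\<lambda>w. indicator ?U w * (B + \<bar>b\<bar>)\<^sup>2", OF _ _ iU])
    show "AE w in lborel. (\<lambda>n. \<xi> n w * (a w - b)\<^sup>2) \<longlonglongrightarrow> indicator ?U w * (a w - b)\<^sup>2"
      by (intro AE_I2 tendsto_intros \<xi>lim)
    show "AE w in lborel. norm (\<xi> n w * (a w - b)\<^sup>2) \<le> indicator ?U w * (B + \<bar>b\<bar>)\<^sup>2" for n
      using dom[of n] \<xi> by (intro AE_I2) (auto simp: abs_mult)
  qed auto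
  ultimately show ?thesis by (intro LIMSEQ_le_const2) auto
qed

end

text \<open>The square of the L2 norm over \<open>QQ\<close>, without division by the volume; the
  volume \<open>vQ\<close> therefore appears in the constants.\<close>

definition nrm2 :: "('a::euclidean_space \<times> real \<Rightarrow> real) \<Rightarrow> real" where
  "nrm2 h = (LINT w|lborel. indicator QQ w * (h w)\<^sup>2)"

lemma nrm2_nonneg: "0 \<le> nrm2 h" unfolding nrm2_def by simp

lemma Cq_norm_less:
  assumes "w \<in> Cq 0 r" "r \<le> 1" shows "norm w < 2 * r"
proof -
  obtain x t where w: "w = (x, t)" by (cases w)
  have r: "norm x < r" "\<bar>t\<bar> < r\<^sup>2" using assms(1) by (auto simp: w Cq_def)
  then have "0 < r" using norm_ge_zero[of x] by linarith
  then have "r\<^sup>2 \<le> r" using assms(2) by (simp add: power2_eq_square mult_left_le_one_le)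
  moreover have "norm (x, t) \<le> norm x + norm t"
    using sqrt_sum_squares_le_sum_abs[of "norm x" "norm t"] by (simp add: norm_prod_def)
  ultimately show ?thesis using r w by simp
qed

text \<open>Here \<open>a\<^sub>t = \<Delta>(a + g) + f\<close>; in the applications \<open>g\<close> is \<open>a powr m - a\<close> up to normalising constants.\<close>
definition flatness_step :: "'a::euclidean_space itself \<Rightarrow> real \<Rightarrow> real \<Rightarrow> real \<Rightarrow> real \<Rightarrow> bool" where
  "flatness_step ty C1 \<omega> \<rho> C \<longleftrightarrow> 0 < \<rho> \<and> \<rho> \<le> 1/4 \<and> 0 < C \<and>
      (\<forall>a g f :: 'a \<times> real \<Rightarrow> real. continuous_on QQ a \<longrightarrow> continuous_on QQ g \<longrightarrow> (\<forall>w\<in>QQ. \<bar>a w\<bar> \<le> 2) \<longrightarrow> (\<forall>w\<in>QQ. \<bar>g w\<bar> \<le> 2) \<longrightarrow>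
        integrable lborel (\<lambda>w. indicator QQ w * f w) \<longrightarrow> pv QQ a (\<lambda>w. a w + g w) f \<longrightarrow>
        (\<exists>b. \<bar>b\<bar> \<le> C1 * sqrt (nrm2 a) \<and>
          nrm2 (\<lambda>w. a (aff 0 \<rho> (\<rho>\<^sup>2) w) - b) \<le> \<omega> * nrm2 a + C * nrm2 g + C * (LINT w|lborel. indicator QQ w * \<bar>f w\<bar>)))"

text \<open>\<open>C1\<close> depends on the error kernel only and is fixed before
  \<open>\<omega>\<close> and \<open>\<rho>m\<close>, whereas \<open>C\<close> deteriorates with
  \<open>\<rho>\<close>. This order of quantifiers allows \<open>core_estimate\<close> to apply the
  step a second time with an accuracy that depends on \<open>C1\<close>.\<close>

lemma one_step:
  obtains C1 :: real where "1 \<le> C1" "2 \<le> C1\<^sup>2 * vQ TYPE('a::euclidean_space)"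
    "\<And>\<omega> \<rho>m. 0 < \<omega> \<Longrightarrow> 0 < \<rho>m \<Longrightarrow> \<exists>\<rho> C. \<rho> \<le> \<rho>m \<and> flatness_step TYPE('a) C1 \<omega> \<rho> C"
proof -
  obtain E k :: "'a \<times> real \<Rightarrow> real" where Ek:
    "integrable lborel E" "\<And>w. w \<notin> cball 0 (1/2) \<times> {0..1/4} \<Longrightarrow> E w = 0"
    "continuous_on UNIV k" "\<And>w. w \<notin> cball 0 (1/2) \<times> {0..1/4} \<Longrightarrow> k w = 0"
    "\<And>\<psi> z. test_fun UNIV \<psi> \<Longrightarrow> dt (conv E \<psi>) z + lap (conv E \<psi>) z = - \<psi> z + conv k \<psi> z"
    using regular_parametrix by blast
  define S :: "('a \<times> real) set" where "S = cball 0 (1/2) \<times> {0..1/4}"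
  have S: "compact S" unfolding S_def by (intro compact_Times) auto
  have kS: "k w = 0" if "w \<notin> S" for w using Ek(4) that by (simp add: S_def)
  obtain K0 where K0: "K0 > 0" "\<And>w. \<bar>k w\<bar> \<le> K0"
    using continuous_compact_support_bounded[OF Ek(3) S kS] by blast
  define v where "v = vQ TYPE('a)"
  have v: "v > 0" using vQ_pos by (simp add: v_def)
  \<comment> \<open>The three summands serve the bound \<open>1 \<le> C1\<close>, the estimate of
    \<open>b\<close> by Cauchy-Schwarz, and the inequality \<open>2 \<le> C1\<^sup>2 * vQ\<close>,
    by which \<open>limit_bound\<close> compares constants with \<open>a 0\<close>.\<close>
  define C1 where "C1 = 1 + K0 * sqrt v + sqrt (2 / v)"
  define L where "L = (LINT w|lborel. \<bar>E w\<bar>)"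
  have L: "0 \<le> L" by (simp add: L_def)
  show ?thesis
  proof (rule that[of C1])
    show "1 \<le> C1" using K0 v by (simp add: C1_def)
    have "sqrt (2 / v) \<le> C1" using K0 v by (simp add: C1_def)
    then have "(sqrt (2 / v))\<^sup>2 \<le> C1\<^sup>2" using v by (intro power_mono) auto
    then show "2 \<le> C1\<^sup>2 * vQ TYPE('a)" using v by (simp add: v_def[symmetric] divide_le_eq)
    fix \<omega> \<rho>m :: real assume \<omega>: "0 < \<omega>" "0 < \<rho>m"
    \<comment> \<open>Chosen so that the kernel error, with the volume factors in \<open>W\<close>
      and the factor 2 of \<open>excess_estimate\<close>, contributes exactly
      \<open>\<omega>\<close> after renormalisation.\<close>
    define e where "e = sqrt (\<omega> / 2) / v"
    have e: "0 < e" "2 * e\<^sup>2 * v\<^sup>2 = \<omega>" using \<omega> v by (auto simp: e_def power_divide)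
    obtain d where d: "d > 0" "\<And>x y. dist x y < d \<Longrightarrow> \<bar>k x - k y\<bar> < e"
      using continuous_compact_support_uniform[OF Ek(3) S kS e(1)] by blast
    define \<rho> where "\<rho> = min \<rho>m (min (1/4) (d / 2))"
    have \<rho>: "0 < \<rho>" "\<rho> \<le> 1/4" "2 * \<rho> \<le> d" "\<rho> \<le> \<rho>m" using d(1) \<omega> by (auto simp: \<rho>_def)
    define s where "s = \<rho> ^ (DIM('a) + 2)"
    have s: "0 < s" using \<rho> by (simp add: s_def)
    define C2 where "C2 = 2 + 2 * K0\<^sup>2 * v\<^sup>2"
    \<comment> \<open>The division by \<open>s\<close>, the volume ratio of the two cylinders, is
      the cost of rescaling to \<open>QQ\<close>. The term with \<open>\<omega>\<close> escapes it
      because the kernel error carries the measure of the small cylinder. The factor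
      \<open>3 + 2 * K0 * v\<close> bounds the amplitude of the density plus 1.\<close>
    define C where "C = 2 * (C2 + L * (3 + 2 * K0 * v)) / s"
    have C2: "0 < C2" unfolding C2_def by (intro add_pos_nonneg) auto
    have "0 < C2 + L * (3 + 2 * K0 * v)" using C2 L K0 v by (intro add_pos_nonneg) auto
    then have C: "0 < C" using s by (simp add: C_def)
    have "\<exists>b. \<bar>b\<bar> \<le> C1 * sqrt (nrm2 a) \<and>
          nrm2 (\<lambda>w. a (aff 0 \<rho> (\<rho>\<^sup>2) w) - b) \<le> \<omega> * nrm2 a + C * nrm2 g + C * (LINT w|lborel. indicator QQ w * \<bar>f w\<bar>)"
      if ac: "continuous_on QQ a" and gc: "continuous_on QQ g" and ab: "\<forall>w\<in>QQ. \<bar>a w\<bar> \<le> 2" and gb: "\<forall>w\<in>QQ. \<bar>g w\<bar> \<le> 2"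
        and f: "integrable lborel (\<lambda>w. indicator QQ w * f w)" and pv: "pv QQ a (\<lambda>w. a w + g w) f"
      for a g f :: "'a \<times> real \<Rightarrow> real"
    proof -
      define a' g' f' where "a' w = indicator QQ w * a w" "g' w = indicator QQ w * g w" "f' w = indicator QQ w * f w" for w
      interpret D: dual_setting E k a' g' f' K0 \<rho> e 2
      proof
        show "\<bar>k (w - z) - k (- z)\<bar> \<le> e" if "w \<in> Cq 0 \<rho>" for w z
        proof -
          have "dist (w - z) (- z) < d" using Cq_norm_less[OF that] \<rho> by (simp add: dist_norm)
          then show ?thesis using d(2) by (meson less_imp_le)
        qed
        show "a' \<in> borel_measurable borel" "g' \<in> borel_measurable borel"
          unfolding a'_g'_f'_def by (intro indicator_measurable ac gc; simp)+
        show "continuous_on QQ a'"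
          using ac by (subst continuous_on_cong[OF refl]) (auto simp: a'_g'_f'_def)
        show "integrable lborel f'" using f by (simp add: a'_g'_f'_def[abs_def])
        show "pv QQ a' (\<lambda>w. a' w + g' w) f'"
          using pv by (subst pv_cong[of _ _ a _ "\<lambda>w. a w + g w" _ f]) (auto simp: a'_g'_f'_def)
      qed (use Ek K0 \<rho> e ab gb in \<open>auto simp: a'_g'_f'_def indicator_def\<close>)
      define A1 where "A1 = (LINT w|lborel. \<bar>a' w\<bar>)"
      have n2: "(LINT w|lborel. (a' w)\<^sup>2) = nrm2 a" "(LINT w|lborel. (g' w)\<^sup>2) = nrm2 g"
        unfolding nrm2_def a'_g'_f'_def by (auto simp: power_mult_distrib indicator_def intro!: Bochner_Integration.integral_cong)
      have n1: "(LINT w|lborel. \<bar>f' w\<bar>) = (LINT w|lborel. indicator QQ w * \<bar>f w\<bar>)"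
        unfolding a'_g'_f'_def by (auto simp: abs_mult intro!: Bochner_Integration.integral_cong)
      have ia2: "integrable lborel (\<lambda>w. (a' w)\<^sup>2)"
        unfolding power2_eq_square by (rule bounded_times_integrable[OF D.a_integrable _ D.a(2)]) (use D.a(1) in auto)
      have A12: "A1\<^sup>2 \<le> v * nrm2 a"
      proof -
        have "(LINT w|lborel. \<bar>a' w\<bar>)\<^sup>2 \<le> measure lborel (QQ :: ('a \<times> real) set) * (LINT w|lborel. \<bar>a' w\<bar>\<^sup>2)"
          by (rule square_integral_le[OF _ Cq_finite]) (use D.a_integrable ia2 D.a(3) in auto)
        then show ?thesis by (simp add: A1_def n2 v_def vQ_def)
      qed
      have A1v: "A1 \<le> 2 * v"
      proof -
        have "A1 \<le> (LINT w|lborel. 2 * indicator (QQ :: ('a \<times> real) set) w)" unfolding A1_def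
        proof (rule integral_mono)
          show "integrable lborel (\<lambda>w. 2 * indicator (QQ :: ('a \<times> real) set) w :: real)"
            using Cq_integrable[of "0::'a \<times> real" 1] by simp
          show "\<bar>a' w\<bar> \<le> 2 * indicator QQ w" for w
            using D.a(2)[of w] D.a(3)[of w] by (cases "w \<in> QQ") auto
        qed (use D.a_integrable in auto)
        then show ?thesis by (simp add: v_def vQ_def)
      qed
      have A10: "0 \<le> A1" by (simp add: A1_def)
      have bA: "\<bar>D.b\<bar> \<le> K0 * A1"
      proof -
        have "\<bar>D.b\<bar> \<le> (LINT w|lborel. \<bar>a' w * k (- w)\<bar>)" unfolding D.b_def by (rule integral_abs_bound)
        also have "\<dots> \<le> (LINT w|lborel. K0 * \<bar>a' w\<bar>)"
        proof (rule integral_mono)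
          have [measurable]: "k \<in> borel_measurable borel" using Ek(3) by (rule borel_measurable_continuous_onI)
          have "integrable lborel (\<lambda>w. k (- w) * a' w)"
            by (rule bounded_times_integrable[OF D.a_integrable _ K0(2)]) measurable
          then show "integrable lborel (\<lambda>w. \<bar>a' w * k (- w)\<bar>)" by (simp add: mult.commute)
          show "\<bar>a' w * k (- w)\<bar> \<le> K0 * \<bar>a' w\<bar>" for w
            using mult_left_mono[OF K0(2)[of "- w"], of "\<bar>a' w\<bar>"] by (simp add: abs_mult mult.commute)
        qed (use D.a_integrable in auto)
        finally show ?thesis by (simp add: A1_def)
      qed
      have "A1 \<le> sqrt (v * nrm2 a)" by (rule real_le_rsqrt[OF A12])
      then have "K0 * A1 \<le> K0 * (sqrt v * sqrt (nrm2 a))" using K0 by (simp add: real_sqrt_mult)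
      also have "\<dots> \<le> C1 * sqrt (nrm2 a)"
        using v unfolding C1_def mult.assoc[symmetric] by (intro mult_right_mono) (auto simp: nrm2_nonneg)
      finally have b1: "\<bar>D.b\<bar> \<le> C1 * sqrt (nrm2 a)" using bA by linarith
      define F1 where "F1 = (LINT w|lborel. indicator QQ w * \<bar>f w\<bar>)"
      have F1: "0 \<le> F1" unfolding F1_def by simp
      have meas: "(\<lambda>w. indicator (Cq 0 \<rho>) w * (a w - D.b)\<^sup>2) \<in> borel_measurable borel"
      proof (rule indicator_measurable)
        have "\<rho>\<^sup>2 \<le> 1" using \<rho> by (intro power_le_one) auto
        then have "Cq (0::'a \<times> real) \<rho> \<subseteq> QQ" using \<rho> by (auto simp: Cq_def)
        then show "continuous_on (Cq 0 \<rho>) (\<lambda>w. (a w - D.b)\<^sup>2)"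
          by (intro continuous_intros continuous_on_subset[OF ac])
      qed simp
      have "s * nrm2 (\<lambda>w. a (aff 0 \<rho> (\<rho>\<^sup>2) w) - D.b) = (LINT w|lborel. indicator (Cq 0 \<rho>) w * (a w - D.b)\<^sup>2)"
        using integral_Cq_scale[OF \<rho>(1) meas] by (simp add: nrm2_def s_def)
      also have "\<dots> = (LINT w|lborel. indicator (Cq 0 \<rho>) w * (a' w - D.b)\<^sup>2)"
      proof (rule Bochner_Integration.integral_cong[OF refl])
        fix w
        have "\<rho>\<^sup>2 \<le> 1" using \<rho> by (intro power_le_one) auto
        then have "Cq (0::'a \<times> real) \<rho> \<subseteq> QQ" using \<rho> by (auto simp: Cq_def)
        then show "indicator (Cq 0 \<rho>) w * (a w - D.b)\<^sup>2 = indicator (Cq 0 \<rho>) w * (a' w - D.b)\<^sup>2"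
          by (auto simp: a'_g'_f'_def indicator_def)
      qed
      also have "\<dots> \<le> 2 * (D.W + L * (2 + \<bar>D.b\<bar> + 1) * F1)"
        using D.excess_estimate by (simp add: L_def F1_def n1)
      also have "\<dots> \<le> 2 * ((e\<^sup>2 * (v * nrm2 a)) * (s * v) + C2 * nrm2 g + L * (3 + 2 * K0 * v) * F1)"
      proof -
        have DW: "D.W = e\<^sup>2 * A1\<^sup>2 * (s * v) + C2 * nrm2 g"
          unfolding D.W_def using \<rho> by (simp add: A1_def[symmetric] n2 measure_Cq s_def v_def C2_def power_mult_distrib)
        have i1: "e\<^sup>2 * A1\<^sup>2 * (s * v) \<le> e\<^sup>2 * (v * nrm2 a) * (s * v)"
          using A12 s v by (intro mult_right_mono mult_left_mono) auto
        have i2: "L * (2 + \<bar>D.b\<bar> + 1) * F1 \<le> L * (3 + 2 * K0 * v) * F1"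
        proof -
          have "K0 * A1 \<le> K0 * (2 * v)" using A1v K0 by (intro mult_left_mono) auto
          then show ?thesis using L F1 bA by (intro mult_right_mono mult_left_mono) auto
        qed
        show ?thesis unfolding DW by (intro mult_left_mono add_mono i1 i2 order_refl) auto
      qed
      also have "\<dots> \<le> s * (\<omega> * nrm2 a + C * nrm2 g + C * F1)"
      proof -
        define L' where "L' = L * (3 + 2 * K0 * v)"
        have 1: "s * C = 2 * (C2 + L')" using s by (simp add: C_def L'_def)
        have 2: "s * (\<omega> * nrm2 a + C * nrm2 g + C * F1) = s * \<omega> * nrm2 a + (s * C) * nrm2 g + (s * C) * F1"
          by (simp add: algebra_simps)
        have "2 * ((e\<^sup>2 * (v * nrm2 a)) * (s * v)) = s * (2 * e\<^sup>2 * v\<^sup>2) * nrm2 a"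
          by (simp add: power2_eq_square)
        then have 3: "2 * ((e\<^sup>2 * (v * nrm2 a)) * (s * v)) = s * \<omega> * nrm2 a" unfolding e(2) .
        have 4: "0 \<le> L' * nrm2 g" unfolding L'_def using L K0 v nrm2_nonneg by (intro mult_nonneg_nonneg add_nonneg_nonneg) auto
        have 5: "0 \<le> C2 * F1" using C2 F1 by simp
        show ?thesis unfolding 1 2 L'_def[symmetric] distrib_left[of 2] 3 using 4 5 by (simp add: algebra_simps)
      qed
      finally have "nrm2 (\<lambda>w. a (aff 0 \<rho> (\<rho>\<^sup>2) w) - D.b) \<le> \<omega> * nrm2 a + C * nrm2 g + C * F1"
        using s by simp
      then show ?thesis using b1 unfolding F1_def by blast
    qed
    then show "\<exists>\<rho> C. \<rho> \<le> \<rho>m \<and> flatness_step TYPE('a) C1 \<omega> \<rho> C"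
      using \<rho> C unfolding flatness_step_def by blast
  qed
qed

section \<open>Iteration over dyadic scales\<close>

text \<open>The base point \<open>c\<close> has to stay away from 0, where \<open>u powr m - u\<close> has slope -1 for every \<open>m > 1\<close>.\<close>
definition secant_close :: "real \<Rightarrow> real \<Rightarrow> real \<Rightarrow> bool" where
  "secant_close m \<kappa> \<delta> \<longleftrightarrow> (\<forall>u\<in>{0..1}. \<forall>c\<in>{\<kappa>..2}. \<bar>(u powr m - u) - (c powr m - c)\<bar> \<le> \<delta> * \<bar>u - c\<bar>)"

text \<open>Writing \<open>z powr m\<close> as \<open>z * z powr (m - 1)\<close> gives the lower
  slope bound at either end point without a loss of constant, even if the other end is 0. Hence one
  end of a secant at height at least \<open>\<kappa>\<close> suffices for a slope close to
  1.\<close>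

lemma powr_diff_bounds:
  fixes m x y c :: real
  assumes m: "1 < m" and xy: "0 \<le> x" "x < y" and c: "c = x \<or> c = y"
  shows "c powr (m - 1) * (y - x) \<le> y powr m - x powr m" "y powr m - x powr m \<le> m * y powr (m - 1) * (y - x)"
proof -
  have pm: "z powr m = z * z powr (m - 1)" if "0 \<le> z" for z :: real
    using that m powr_mult_base[of z "m - 1"] by (simp add: )
  have mono: "x powr (m - 1) \<le> y powr (m - 1)" using m xy by (intro powr_mono2) auto
  have x: "x * x powr (m - 1) \<le> x * y powr (m - 1)" using mono xy by (intro mult_left_mono) auto
  have y: "y * x powr (m - 1) \<le> y * y powr (m - 1)" using mono xy by (intro mult_left_mono) auto
  show "c powr (m - 1) * (y - x) \<le> y powr m - x powr m"
    using c x y xy by (auto simp: pm algebra_simps)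
  show "y powr m - x powr m \<le> m * y powr (m - 1) * (y - x)"
  proof (cases "x = 0")
    case True
    have "1 * (y * y powr (m - 1)) \<le> m * (y * y powr (m - 1))" using m xy by (intro mult_right_mono) auto
    then show ?thesis using True xy by (simp add: pm algebra_simps)
  next
    case False
    have "\<exists>z. x < z \<and> z < y \<and> y powr m - x powr m = (y - x) * (m * z powr (m - 1))"
      using False xy by (intro MVT2) (auto intro!: derivative_eq_intros simp: field_simps)
    then obtain z where z: "x < z" "z < y" "y powr m - x powr m = (y - x) * (m * z powr (m - 1))" by blast
    have "z powr (m - 1) \<le> y powr (m - 1)" using z xy m by (intro powr_mono2) auto
    then have "(y - x) * (m * z powr (m - 1)) \<le> (y - x) * (m * y powr (m - 1))" using m xy by (intro mult_left_mono) auto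
    then show ?thesis using z(3) by (simp add: algebra_simps)
  qed
qed

text \<open>The relevant secant slopes of the power lie between \<open>\<kappa> powr (m - 1)\<close>
  and \<open>m * 2 powr (m - 1)\<close>, and both bounds tend to 1 as \<open>m\<close> decreases to
  1.\<close>

lemma secant_close_exists:
  assumes "0 < \<kappa>" "\<kappa> < 1" "0 < \<delta>"
  shows "\<exists>\<epsilon>>0. \<forall>m. 0 < m - 1 \<and> m - 1 < \<epsilon> \<longrightarrow> secant_close m \<kappa> \<delta>"
proof -
  have "((\<lambda>m::real. m * 2 powr (m - 1)) \<longlongrightarrow> 1 * 2 powr (1 - 1)) (at_right 1)"
    by (intro tendsto_intros) auto
  then have "\<forall>\<^sub>F m in at_right 1. m * 2 powr (m - 1) < 1 + \<delta>"
    using assms by (intro order_tendstoD) auto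
  moreover have "((\<lambda>m. \<kappa> powr (m - 1)) \<longlongrightarrow> \<kappa> powr (1 - 1)) (at_right 1)"
    using assms by (intro tendsto_intros) auto
  then have "\<forall>\<^sub>F m in at_right 1. 1 - \<delta> < \<kappa> powr (m - 1)"
    using assms by (intro order_tendstoD) auto
  ultimately have "\<forall>\<^sub>F m in at_right 1. m * 2 powr (m - 1) < 1 + \<delta> \<and> 1 - \<delta> < \<kappa> powr (m - 1)"
    by eventually_elim auto
  then obtain b where b: "b > 1" "\<And>m. 1 < m \<Longrightarrow> m < b \<Longrightarrow> m * 2 powr (m - 1) < 1 + \<delta> \<and> 1 - \<delta> < \<kappa> powr (m - 1)"
    unfolding eventually_at_right_field by blast
  have "secant_close m \<kappa> \<delta>" if "0 < m - 1" "m - 1 < b - 1" for m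
    unfolding secant_close_def
  proof (intro ballI)
    fix u c :: real assume u: "u \<in> {0..1}" and c: "c \<in> {\<kappa>..2}"
    have m: "1 < m" using that by simp
    have bb: "m * 2 powr (m - 1) < 1 + \<delta>" "1 - \<delta> < \<kappa> powr (m - 1)" using b(2)[of m] that by auto
    have key: "\<bar>(y powr m - y) - (x powr m - x)\<bar> \<le> \<delta> * (y - x)"
      if xy: "0 \<le> x" "x < y" "y \<le> 2" and cc: "c = x \<or> c = y" for x y
    proof -
      have "\<kappa> powr (m - 1) \<le> c powr (m - 1)" using assms m c by (intro powr_mono2) auto
      then have "\<kappa> powr (m - 1) * (y - x) \<le> c powr (m - 1) * (y - x)" using xy by (intro mult_right_mono) auto
      then have 1: "\<kappa> powr (m - 1) * (y - x) \<le> y powr m - x powr m"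
        using powr_diff_bounds(1)[OF m xy(1,2) cc] by linarith
      have "y powr (m - 1) \<le> 2 powr (m - 1)" using m xy by (intro powr_mono2) auto
      then have "m * y powr (m - 1) * (y - x) \<le> m * 2 powr (m - 1) * (y - x)"
        using m xy by (intro mult_right_mono mult_left_mono) auto
      then have 2: "y powr m - x powr m \<le> m * 2 powr (m - 1) * (y - x)"
        using powr_diff_bounds(2)[OF m xy(1,2) cc] by linarith
      have "(1 - \<delta>) * (y - x) \<le> \<kappa> powr (m - 1) * (y - x)" "m * 2 powr (m - 1) * (y - x) \<le> (1 + \<delta>) * (y - x)"
        using bb xy by (intro mult_right_mono; simp)+
      then have "(1 - \<delta>) * (y - x) \<le> y powr m - x powr m" "y powr m - x powr m \<le> (1 + \<delta>) * (y - x)"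
        using 1 2 by linarith+
      then show ?thesis by (simp add: abs_le_iff algebra_simps)
    qed
    consider "u < c" | "c < u" | "u = c" by linarith
    then show "\<bar>(u powr m - u) - (c powr m - c)\<bar> \<le> \<delta> * \<bar>u - c\<bar>"
    proof cases
      case 1
      then show ?thesis using key[of u c] u c by (simp add: abs_minus_commute)
    next
      case 2
      then show ?thesis using key[of c u] u c assms by simp
    qed simp
  qed
  then show ?thesis using b(1) by (intro exI[of _ "b - 1"]) auto
qed

section \<open>Normalised solutions and one step of the iteration\<close>

abbreviation cQ :: "('a::euclidean_space \<times> real) set" where "cQ \<equiv> ball 0 1 \<times> {-1<..0}"

lemma QQ_cQ: "w \<in> QQ \<Longrightarrow> w \<in> cQ" by (auto simp: Cq_def)

text \<open>Continuity reaches up to time 0, where values at the top of cylinders are taken, while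
  the equation holds in the open cylinder only.\<close>

definition sol :: "real \<Rightarrow> ('a::euclidean_space \<times> real \<Rightarrow> real) \<Rightarrow> ('a \<times> real \<Rightarrow> real) \<Rightarrow> bool" where
  "sol m f a \<longleftrightarrow> continuous_on cQ a \<and> (\<forall>w\<in>cQ. 0 \<le> a w \<and> a w \<le> 1) \<and>
     integrable lborel (\<lambda>w. indicator QQ w * f w) \<and> pv QQ a (\<lambda>w. a w powr m) f"

lemma sol_bounds: "sol m f a \<Longrightarrow> w \<in> QQ \<Longrightarrow> 0 \<le> a w" "sol m f a \<Longrightarrow> w \<in> QQ \<Longrightarrow> a w \<le> 1"
  by (auto simp: sol_def dest: QQ_cQ)

lemma sol_cont: "sol m f a \<Longrightarrow> continuous_on QQ a"
  unfolding sol_def using QQ_cQ by (blast intro: continuous_on_subset)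

lemma continuous_on_powr_nonneg:
  fixes a :: "'a::topological_space \<Rightarrow> real"
  assumes "continuous_on S a" "\<And>w. w \<in> S \<Longrightarrow> 0 \<le> a w" "0 < m"
  shows "continuous_on S (\<lambda>w. a w powr m)"
  using assms by (intro continuous_on_powr') auto

lemma pv_aff_cont:
  fixes z :: "'a::euclidean_space \<times> real"
  assumes pv: "pv U a b f" and "R > 0" "T > 0" "open U"
    and c: "continuous_on U a" "continuous_on U b" "(\<lambda>w. indicator U w * f w) \<in> borel_measurable borel"
    and U: "aff z R T ` V \<subseteq> U"
  shows "pv V (\<lambda>w. (c / T) * a (aff z R T w)) (\<lambda>w. (c / R\<^sup>2) * b (aff z R T w)) (\<lambda>w. c * f (aff z R T w))"
proof -
  let ?i = "\<lambda>h w. indicator U w * h w"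
  have "pv U (?i a) (?i b) (?i f)" using pv by (subst pv_cong[of _ _ a _ b _ f]) auto
  moreover have "?i a \<in> borel_measurable borel" "?i b \<in> borel_measurable borel"
    using assms by (auto intro!: indicator_measurable)
  ultimately have "pv V (\<lambda>w. (c / T) * ?i a (aff z R T w)) (\<lambda>w. (c / R\<^sup>2) * ?i b (aff z R T w)) (\<lambda>w. c * ?i f (aff z R T w))"
    using assms by (intro pv_aff) auto
  then show ?thesis using U by (subst pv_cong) auto
qed

lemma integral_Cq_transfer:
  fixes f :: "'a::euclidean_space \<times> real \<Rightarrow> real"
  assumes "R > 0" "r > 0" "(\<lambda>w. indicator (Cq (aff z R (R\<^sup>2) w0) (R * r)) w * h w) \<in> borel_measurable borel"
  shows "(LINT w|lborel. indicator (Cq (aff z R (R\<^sup>2) w0) (R * r)) w * h w) =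
    R ^ (DIM('a) + 2) * (LINT w|lborel. indicator (Cq w0 r) (w :: 'a \<times> real) * h (aff z R (R\<^sup>2) w))"
proof -
  have "indicator (Cq (aff z R (R\<^sup>2) w0) (R * r)) (aff z R (R\<^sup>2) w) = (indicator (Cq w0 r) w :: real)" for w
    using Cq_aff[OF assms(1), of z w w0 r] by (simp add: indicator_def)
  then show ?thesis
    using assms by (subst integral_aff[of R "R\<^sup>2" _ z]) (auto simp: power_add power2_eq_square)
qed

lemma indicator_subset_measurable:
  fixes f :: "'a::euclidean_space \<Rightarrow> real"
  assumes "(\<lambda>w. indicator U w * f w) \<in> borel_measurable borel" "V \<subseteq> U" "V \<in> sets borel"
  shows "(\<lambda>w. indicator V w * f w) \<in> borel_measurable borel" "(\<lambda>w. indicator V w * \<bar>f w\<bar>) \<in> borel_measurable borel"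
proof -
  note [measurable] = assms(1,3)
  have "(\<lambda>w. indicator V w * (indicator U w * f w)) \<in> borel_measurable borel" by measurable
  moreover have "(\<lambda>w. indicator V w * (indicator U w * f w)) = (\<lambda>w. indicator V w * f w)"
    using assms(2) by (auto simp: indicator_def fun_eq_iff)
  ultimately show 1: "(\<lambda>w. indicator V w * f w) \<in> borel_measurable borel" by simp
  then have "(\<lambda>w. \<bar>indicator V w * f w\<bar>) \<in> borel_measurable borel" by measurable
  then show "(\<lambda>w. indicator V w * \<bar>f w\<bar>) \<in> borel_measurable borel" by (simp add: abs_mult)
qed

lemma sol_rescale:
  fixes z :: "'a::euclidean_space \<times> real"
  assumes s: "sol m f a" and m: "0 < m" and R: "R > 0"
    and z: "norm (fst z) + R \<le> 1" "-1 \<le> snd z - R\<^sup>2" "snd z \<le> 0"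
  shows "sol m (\<lambda>w. R\<^sup>2 * f (aff z R (R\<^sup>2) w)) (\<lambda>w. a (aff z R (R\<^sup>2) w))"
proof -
  have sub: "aff z R (R\<^sup>2) w \<in> cQ" if "w \<in> cQ" for w
  proof -
    obtain x t where "w = (x, t)" by (cases w)
    with that have w: "w = (x, t)" "norm x < 1" "-1 < t" "t \<le> 0" by auto
    have "norm (fst z + R *\<^sub>R x) \<le> norm (fst z) + R * norm x" using R norm_triangle_ineq[of "fst z" "R *\<^sub>R x"] by simp
    also have "\<dots> < norm (fst z) + R * 1" using w R by (intro add_strict_left_mono mult_strict_left_mono) auto
    finally have 1: "norm (fst z + R *\<^sub>R x) < 1" using z by simp
    have "R\<^sup>2 * (-1) < R\<^sup>2 * t" using w R by (intro mult_strict_left_mono) auto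
    moreover have "R\<^sup>2 * t \<le> 0" using w by (intro mult_nonneg_nonpos) auto
    ultimately have "R\<^sup>2 * (-1) < R\<^sup>2 * t" "R\<^sup>2 * t \<le> 0" .
    then show ?thesis using 1 z w(1) by (simp add: aff_def)
  qed
  have sub2: "aff z R (R\<^sup>2) ` QQ \<subseteq> QQ"
  proof
    fix y assume "y \<in> aff z R (R\<^sup>2) ` QQ"
    then obtain w where w: "w \<in> QQ" "y = aff z R (R\<^sup>2) w" by auto
    have "R\<^sup>2 * snd w < 0" using w R by (auto simp: Cq_def intro: mult_pos_neg)
    then show "y \<in> QQ" using sub[OF QQ_cQ[OF w(1)]] w z by (auto simp: Cq_def aff_def)
  qed
  have pw: "continuous_on QQ (\<lambda>w. a w powr m)"
    using s m by (intro continuous_on_powr_nonneg sol_cont[OF s] sol_bounds[OF s]) auto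
  have fm: "(\<lambda>w. indicator QQ w * f w) \<in> borel_measurable borel" using s by (auto simp: sol_def)
  have "pv QQ a (\<lambda>w. a w powr m) f" using s by (simp add: sol_def)
  from pv_aff_cont[OF this R _ open_Cq sol_cont[OF s] pw fm sub2, of "R\<^sup>2"]
  have pv: "pv QQ (\<lambda>w. a (aff z R (R\<^sup>2) w)) (\<lambda>w. a (aff z R (R\<^sup>2) w) powr m) (\<lambda>w. R\<^sup>2 * f (aff z R (R\<^sup>2) w))"
    using R by simp
  have "integrable lborel (\<lambda>w. (indicator QQ (aff z R (R\<^sup>2) w) * f (aff z R (R\<^sup>2) w)) :: real)"
    using s R by (intro integrable_aff) (auto simp: sol_def)
  then have "integrable lborel (\<lambda>w. indicator QQ w *\<^sub>R (indicator QQ (aff z R (R\<^sup>2) w) * f (aff z R (R\<^sup>2) w)))"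
    by (intro integrable_mult_indicator) auto
  then have i0: "integrable lborel (\<lambda>w. R\<^sup>2 * (indicator QQ w *\<^sub>R (indicator QQ (aff z R (R\<^sup>2) w) * f (aff z R (R\<^sup>2) w))))"
    by (rule integrable_mult_right)
  have i1: "R\<^sup>2 * (indicator QQ w *\<^sub>R (indicator QQ (aff z R (R\<^sup>2) w) * f (aff z R (R\<^sup>2) w))) =
     indicator QQ w * (R\<^sup>2 * f (aff z R (R\<^sup>2) w))" for w
    using sub2 by (auto simp: indicator_def)
  have i: "integrable lborel (\<lambda>w. indicator QQ w * (R\<^sup>2 * f (aff z R (R\<^sup>2) w)))"
    using i0 unfolding i1 .
  show ?thesis unfolding sol_def
  proof (intro conjI ballI)
    show "continuous_on cQ (\<lambda>w. a (aff z R (R\<^sup>2) w))"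
    proof (rule continuous_on_compose2[where g = a and t = cQ])
      show "continuous_on cQ a" using s by (simp add: sol_def)
      show "continuous_on cQ (aff z R (R\<^sup>2))" by (rule aff_continuous[OF continuous_on_id])
      show "aff z R (R\<^sup>2) ` cQ \<subseteq> cQ" using sub by blast
    qed
    show "0 \<le> a (aff z R (R\<^sup>2) w)" "a (aff z R (R\<^sup>2) w) \<le> 1" if "w \<in> cQ" for w
      using s sub[OF that] by (auto simp: sol_def)
  qed (fact i, fact pv)
qed

text \<open>\<open>dt \<phi>\<close> and \<open>lap \<phi>\<close> have integral 0. The two
  constants are independent because the base point is subtracted from \<open>a\<close> and the
  linearised nonlinearity at a possibly different base point from the power.\<close>

lemma pv_shift_const:
  fixes a b f :: "'a::euclidean_space \<times> real \<Rightarrow> real"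
  assumes pv: "pv QQ a b f" and "continuous_on QQ a" "continuous_on QQ b" "\<And>w. w \<in> QQ \<Longrightarrow> \<bar>a w\<bar> \<le> B" "\<And>w. w \<in> QQ \<Longrightarrow> \<bar>b w\<bar> \<le> B"
    and f: "integrable lborel (\<lambda>w. indicator QQ w * f w)"
  shows "pv QQ (\<lambda>w. a w - c1) (\<lambda>w. b w - c2) f"
  unfolding pv_def
proof (intro allI impI)
  fix \<phi> :: "'a \<times> real \<Rightarrow> real" assume t: "test_fun QQ \<phi>"
  have i: "integrable lborel (dt \<phi>)" "integrable lborel (lap \<phi>)"
    using test_fun_dt[OF t] test_fun_lap[OF t] by (auto intro: test_fun_integrable)
  have ii: "integrable lborel (\<lambda>w. h w * \<psi> w)" if "continuous_on QQ h" "\<And>w. w \<in> QQ \<Longrightarrow> \<bar>h w\<bar> \<le> B" "test_fun QQ \<psi>" for h \<psi>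
  proof -
    have B: "0 \<le> B" using that(2)[of "(0, -1/2)"] by (force simp: Cq_def)
    have "integrable lborel (\<lambda>w. (indicator QQ w * h w) * \<psi> w)"
    proof (rule bounded_times_integrable[where B = B, OF test_fun_integrable[OF that(3)]])
      show "(\<lambda>w. indicator QQ w * h w) \<in> borel_measurable lborel"
        using indicator_measurable[OF that(1)] by simp
      show "\<bar>indicator QQ w * h w\<bar> \<le> B" for w using that(2)[of w] B by (cases "w \<in> QQ") auto
    qed
    moreover have "(indicator QQ w * h w) * \<psi> w = h w * \<psi> w" for w
      using that(3) by (cases "w \<in> QQ") (auto elim: test_funE)
    ultimately show ?thesis by simp
  qed
  obtain C where C: "smooth \<phi>" "compact C" "C \<subseteq> QQ" "\<And>x. x \<notin> C \<Longrightarrow> \<phi> x = 0" using t by (auto elim: test_funE)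
  obtain M where M: "\<And>x. \<bar>\<phi> x\<bar> \<le> M"
    using continuous_compact_support_bounded[OF smooth_continuous[OF C(1)] C(2,4)] by blast
  have "integrable lborel (\<lambda>w. \<phi> w * (indicator QQ w * f w))"
    by (rule bounded_times_integrable[OF f _ M]) (auto intro!: borel_measurable_continuous_onI smooth_continuous C)
  moreover have "\<phi> w * (indicator QQ w * f w) = f w * \<phi> w" for w
    using C(3) C(4)[of w] by (cases "w \<in> QQ") (auto dest: subsetD)
  ultimately have if\<phi>: "integrable lborel (\<lambda>w. f w * \<phi> w)" by simp
  have z1: "(LINT w|lborel. dt \<phi> w) = 0" unfolding dt_def
    by (rule test_fun_integral_pd[OF t]) simp
  have z2: "(LINT w|lborel. lap \<phi> w) = 0" unfolding lap_def
    using t by (subst Bochner_Integration.integral_sum) (auto intro!: test_fun_integrable test_fun_pd sum.neutral test_fun_integral_pd)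
  have "(LINT w|lborel. (a w - c1) * dt \<phi> w + (b w - c2) * lap \<phi> w + f w * \<phi> w) =
     (LINT w|lborel. (a w * dt \<phi> w + b w * lap \<phi> w + f w * \<phi> w) - c1 * dt \<phi> w - c2 * lap \<phi> w)"
    by (rule Bochner_Integration.integral_cong) (auto simp: algebra_simps)
  also have "\<dots> = (LINT w|lborel. a w * dt \<phi> w + b w * lap \<phi> w + f w * \<phi> w) - c1 * (LINT w|lborel. dt \<phi> w) - c2 * (LINT w|lborel. lap \<phi> w)"
    using i if\<phi> ii[OF assms(2,4) test_fun_dt[OF t]] ii[OF assms(3,5) test_fun_lap[OF t]] by simp
  finally show "(LINT w|lborel. (a w - c1) * dt \<phi> w + (b w - c2) * lap \<phi> w + f w * \<phi> w) = 0"
    using pv t z1 z2 by (simp add: pv_def)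
qed

lemma nrm2_mono:
  fixes h h' :: "'a::euclidean_space \<times> real \<Rightarrow> real"
  assumes "continuous_on QQ h" "continuous_on QQ h'" "\<And>w. w \<in> QQ \<Longrightarrow> \<bar>h w\<bar> \<le> B" "\<And>w. w \<in> QQ \<Longrightarrow> \<bar>h' w\<bar> \<le> B"
    "\<And>w. w \<in> QQ \<Longrightarrow> (h w)\<^sup>2 \<le> p * (h' w)\<^sup>2 + q"
  shows "nrm2 h \<le> p * nrm2 h' + q * vQ TYPE('a)"
proof -
  have i: "integrable lborel (\<lambda>w. indicator QQ w * (h w)\<^sup>2)" if "continuous_on QQ h" "\<And>w. w \<in> QQ \<Longrightarrow> \<bar>h w\<bar> \<le> B" for h :: "'a \<times> real \<Rightarrow> real"
  proof (rule Cq_mult_integrable[where B = "B\<^sup>2"])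
    show "(\<lambda>w. indicator QQ w * (h w)\<^sup>2) \<in> borel_measurable borel"
      by (intro indicator_measurable continuous_intros that) simp
    show "\<bar>(h w)\<^sup>2\<bar> \<le> B\<^sup>2" if "w \<in> QQ" for w
      using power_mono[OF \<open>\<And>w. w \<in> QQ \<Longrightarrow> \<bar>h w\<bar> \<le> B\<close>[OF that], of 2] by simp
  qed
  have iq: "integrable lborel (\<lambda>w. indicator QQ (w :: 'a \<times> real) * q)" using Cq_integrable[of "0 :: 'a \<times> real" 1] by simp
  have "nrm2 h \<le> (LINT w|lborel. p * (indicator QQ w * (h' w)\<^sup>2) + indicator QQ w * q)"
    unfolding nrm2_def
  proof (rule integral_mono[OF i[OF assms(1,3)]])
    show "indicator QQ w * (h w)\<^sup>2 \<le> p * (indicator QQ w * (h' w)\<^sup>2) + indicator QQ w * q" for w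
      using assms(5)[of w] by (cases "w \<in> QQ") auto
  qed (use i[OF assms(2,4)] iq in auto)
  also have "\<dots> = p * nrm2 h' + q * vQ TYPE('a)"
    using i[OF assms(2,4)] iq by (simp add: nrm2_def vQ_def mult.commute)
  finally show ?thesis .
qed

lemma flatness_stepD:
  fixes a g f :: "'a::euclidean_space \<times> real \<Rightarrow> real"
  assumes "flatness_step TYPE('a) C1 \<omega> \<rho> C" "continuous_on QQ a" "continuous_on QQ g"
    "\<forall>w\<in>QQ. \<bar>a w\<bar> \<le> 2" "\<forall>w\<in>QQ. \<bar>g w\<bar> \<le> 2"
    "integrable lborel (\<lambda>w. indicator QQ w * f w)" "pv QQ a (\<lambda>w. a w + g w) f"
  shows "\<exists>b. \<bar>b\<bar> \<le> C1 * sqrt (nrm2 a) \<and>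
    nrm2 (\<lambda>w. a (aff 0 \<rho> (\<rho>\<^sup>2) w) - b) \<le> \<omega> * nrm2 a + C * nrm2 g + C * (LINT w|lborel. indicator QQ w * \<bar>f w\<bar>)"
  using assms unfolding flatness_step_def by blast

text \<open>The contraction 1/64 refers to squared norms. Together with an equal share coming from
  \<open>g\<close> it stays below 1/16, which is a factor 1/4 for the norm.\<close>

locale iteration =
  fixes ty :: "'a::euclidean_space itself" and C1 \<rho> C :: real
  assumes C1: "1 \<le> C1" "2 \<le> C1\<^sup>2 * vQ TYPE('a)" and flat: "flatness_step TYPE('a) C1 (1/64) \<rho> C"
begin

lemma \<rho>: "0 < \<rho>" "\<rho> \<le> 1/4" and C: "0 < C"
  using flat by (auto simp: flatness_step_def)

lemmas step = flatness_stepD[OF flat]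

text \<open>The two products are the coefficients of \<open>J / 64\<close> and of
  \<open>Z\<^sup>2 / 16\<close> in the estimate of \<open>C * nrm2 g\<close> in
  \<open>iteration_step\<close>.\<close>

definition small_slope :: "real \<Rightarrow> bool" where
  "small_slope \<delta> \<longleftrightarrow> 0 < \<delta> \<and> \<delta> \<le> 1 \<and> 128 * C * \<delta>\<^sup>2 \<le> 1 \<and> 32 * C * \<delta>\<^sup>2 * vQ TYPE('a) \<le> 1"

lemma small_slope_exists: "\<exists>\<delta>. small_slope \<delta>"
proof -
  define D where "D = 1 + 128 * C + 32 * C * vQ TYPE('a)"
  have v: "0 < vQ TYPE('a)" by (rule vQ_pos)
  have D: "1 \<le> D" "128 * C \<le> D" "32 * C * vQ TYPE('a) \<le> D" using C v by (auto simp: D_def)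
  have "(1/D)\<^sup>2 \<le> 1 / D" using D(1) by (simp add: power2_eq_square divide_simps)
  then have "128 * C * (1/D)\<^sup>2 \<le> D * (1 / D)" "(32 * C * vQ TYPE('a)) * (1/D)\<^sup>2 \<le> D * (1 / D)"
    using D C v by (intro mult_mono; simp)+
  then have "small_slope (1 / D)" using D(1) by (simp add: small_slope_def mult.assoc mult.commute mult.left_commute)
  then show ?thesis by blast
qed

text \<open>The nonlinearity is linearised at \<open>max c \<kappa>\<close>, where
  \<open>secant_close\<close> applies. For \<open>c < \<kappa>\<close> the base point is shifted by
  at most \<open>\<kappa>\<close>, and this shift appears as the penalty
  \<open>\<kappa> / 4\<close>.\<close>

lemma iteration_step:
  fixes a f :: "'a \<times> real \<Rightarrow> real"
  assumes s: "sol m f a" and m: "1 < m" and sec: "secant_close m \<kappa> \<delta>" and \<delta>: "small_slope \<delta>" and \<kappa>: "0 < \<kappa>" "\<kappa> < 1"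
    and c: "0 \<le> c" "c \<le> 1"
  defines "\<theta> \<equiv> sqrt (nrm2 (\<lambda>w. a w - c))"
  shows "\<exists>c'. 0 \<le> c' \<and> c' \<le> 1 \<and> \<bar>c' - c\<bar> \<le> C1 * \<theta> \<and> sqrt (nrm2 (\<lambda>w. a (aff 0 \<rho> (\<rho>\<^sup>2) w) - c')) \<le>
     \<theta> / 4 + (if c < \<kappa> then \<kappa> / 4 else 0) + sqrt (C * (LINT w|lborel. indicator QQ w * \<bar>f w\<bar>))"
proof -
  define k where "k = max c \<kappa>"
  have k: "k \<in> {\<kappa>..2}" "0 < k" "k \<le> 1" using \<kappa> c by (auto simp: k_def)
  define g where "g w = (a w powr m - a w) - (k powr m - k)" for w
  define F1 where "F1 = (LINT w|lborel. indicator QQ w * \<bar>f w\<bar>)"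
  have F1: "0 \<le> F1" by (simp add: F1_def)
  have \<delta>1: "0 < \<delta>" "\<delta> \<le> 1" using \<delta> by (auto simp: small_slope_def)
  note ab = sol_bounds[OF s] and ac = sol_cont[OF s]
  have pc: "continuous_on QQ (\<lambda>w. a w powr m)" using m ab by (intro continuous_on_powr_nonneg ac) auto
  have gb: "\<bar>g w\<bar> \<le> \<delta> * \<bar>a w - k\<bar>" if "w \<in> QQ" for w
    using sec ab[OF that] k unfolding secant_close_def g_def by simp
  have ak: "\<bar>a w - k\<bar> \<le> 1" "\<bar>a w - c\<bar> \<le> 1" if "w \<in> QQ" for w using ab[OF that] k c by auto
  have g1: "\<bar>g w\<bar> \<le> 1" if "w \<in> QQ" for w
    using gb[OF that] mult_mono[OF \<delta>1(2) ak(1)[OF that]] \<delta>1 by simp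
  have gc: "continuous_on QQ g" unfolding g_def by (intro continuous_intros pc ac)
  have pw1: "\<bar>a w powr m\<bar> \<le> 2" if "w \<in> QQ" for w
    using ab[OF that] powr_mono2[of m "a w" 1] m by simp
  have aw2: "\<bar>a w\<bar> \<le> 2" if "w \<in> QQ" for w using ab[OF that] by simp
  have "pv QQ (\<lambda>w. a w - c) (\<lambda>w. a w powr m - (c + (k powr m - k))) f"
    using s aw2 by (intro pv_shift_const[where B = 2] ac pc pw1) (auto simp: sol_def)
  moreover have "a w powr m - (c + (k powr m - k)) = (a w - c) + g w" for w by (simp add: g_def)
  ultimately have pv: "pv QQ (\<lambda>w. a w - c) (\<lambda>w. (a w - c) + g w) f" by simp
  have "\<exists>b. \<bar>b\<bar> \<le> C1 * sqrt (nrm2 (\<lambda>w. a w - c)) \<and>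
          nrm2 (\<lambda>w. (a (aff 0 \<rho> (\<rho>\<^sup>2) w) - c) - b) \<le> (1/64) * nrm2 (\<lambda>w. a w - c) + C * nrm2 g + C * F1"
    unfolding F1_def
    by (rule step[OF _ gc _ _ _ pv]) (use ak(2) g1 s in \<open>auto simp: sol_def intro!: continuous_intros ac order_trans[OF ak(2)] order_trans[OF g1]\<close>)
  then obtain b where b: "\<bar>b\<bar> \<le> C1 * \<theta>"
    "nrm2 (\<lambda>w. (a (aff 0 \<rho> (\<rho>\<^sup>2) w) - c) - b) \<le> (1/64) * nrm2 (\<lambda>w. a w - c) + C * nrm2 g + C * F1"
    unfolding \<theta>_def by blast
  define J where "J = nrm2 (\<lambda>w. a w - c)"
  have J: "0 \<le> J" "\<theta>\<^sup>2 = J" "0 \<le> \<theta>" by (auto simp: J_def \<theta>_def nrm2_nonneg)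
  define v where "v = vQ TYPE('a)"
  have v: "v > 0" using vQ_pos by (simp add: v_def)
  define Z where "Z = (if c < \<kappa> then \<kappa> else 0)"
  have "nrm2 g \<le> (2 * \<delta>\<^sup>2) * J + (2 * \<delta>\<^sup>2 * Z\<^sup>2) * vQ TYPE('a)"
    unfolding J_def
  proof (rule nrm2_mono[where B = 1])
    show "(g w)\<^sup>2 \<le> 2 * \<delta>\<^sup>2 * (a w - c)\<^sup>2 + 2 * \<delta>\<^sup>2 * Z\<^sup>2" if "w \<in> QQ" for w
    proof -
      have "\<bar>a w - k\<bar> \<le> \<bar>a w - c\<bar> + Z" using c \<kappa> by (auto simp: k_def Z_def max_def)
      then have "\<bar>g w\<bar> \<le> \<delta> * (\<bar>a w - c\<bar> + Z)" using gb[OF that] \<delta>1 by (meson mult_left_mono less_imp_le order_trans)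
      then have "\<bar>g w\<bar>\<^sup>2 \<le> (\<delta> * (\<bar>a w - c\<bar> + Z))\<^sup>2" by (intro power_mono) auto
      also have "\<dots> = \<delta>\<^sup>2 * (\<bar>a w - c\<bar> + Z)\<^sup>2" by (simp add: power_mult_distrib)
      also have "\<dots> \<le> \<delta>\<^sup>2 * (2 * \<bar>a w - c\<bar>\<^sup>2 + 2 * Z\<^sup>2)"
        using zero_le_power2[of "\<bar>a w - c\<bar> - Z"] by (intro mult_left_mono) (auto simp: power2_eq_square algebra_simps)
      finally show ?thesis by (simp add: algebra_simps)
    qed
  qed (use gc g1 ak in \<open>auto intro!: continuous_intros ac\<close>)
  then have "C * nrm2 g \<le> C * ((2 * \<delta>\<^sup>2) * J + (2 * \<delta>\<^sup>2 * Z\<^sup>2) * v)" using C by (simp add: v_def)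
  also have "\<dots> = (128 * C * \<delta>\<^sup>2) * (J / 64) + (32 * C * \<delta>\<^sup>2 * v) * (Z\<^sup>2 / 16)" by (simp add: algebra_simps)
  also have "\<dots> \<le> 1 * (J / 64) + 1 * (Z\<^sup>2 / 16)"
    using \<delta> J by (intro add_mono mult_right_mono) (auto simp: small_slope_def v_def)
  finally have n: "nrm2 (\<lambda>w. (a (aff 0 \<rho> (\<rho>\<^sup>2) w) - c) - b) \<le> J / 16 + Z\<^sup>2 / 16 + C * F1"
    using b(2) J by (simp add: J_def)
  \<comment> \<open>Projection to the unit interval does not increase the distance to the values of
    \<open>a\<close> and keeps the next step applicable.\<close>
  define c' where "c' = max 0 (min 1 (c + b))"
  have sub: "aff 0 \<rho> (\<rho>\<^sup>2) w \<in> QQ" if "w \<in> QQ" for w :: "'a \<times> real"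
  proof -
    have "\<rho>\<^sup>2 \<le> 1" using \<rho> by (intro power_le_one) auto
    then have "Cq (0::'a \<times> real) \<rho> \<subseteq> QQ" using \<rho> by (auto simp: Cq_def)
    then show ?thesis using Cq_aff0[OF \<rho>(1), of 0 w] that by blast
  qed
  have acs: "continuous_on QQ (\<lambda>w. a (aff 0 \<rho> (\<rho>\<^sup>2) w))"
    by (rule continuous_on_compose2[OF ac aff_continuous[OF continuous_on_id]]) (use sub in auto)
  have "nrm2 (\<lambda>w. a (aff 0 \<rho> (\<rho>\<^sup>2) w) - c') \<le> 1 * nrm2 (\<lambda>w. (a (aff 0 \<rho> (\<rho>\<^sup>2) w) - c) - b) + 0 * vQ TYPE('a)"
  proof (rule nrm2_mono[where B = "3 + \<bar>b\<bar>"])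
    fix w :: "'a \<times> real" assume w: "w \<in> QQ"
    note aw = ab[OF sub[OF w]]
    show "\<bar>a (aff 0 \<rho> (\<rho>\<^sup>2) w) - c'\<bar> \<le> 3 + \<bar>b\<bar>" "\<bar>a (aff 0 \<rho> (\<rho>\<^sup>2) w) - c - b\<bar> \<le> 3 + \<bar>b\<bar>"
      using aw c by (auto simp: c'_def)
    have "\<bar>a (aff 0 \<rho> (\<rho>\<^sup>2) w) - c'\<bar> \<le> \<bar>(a (aff 0 \<rho> (\<rho>\<^sup>2) w) - c) - b\<bar>"
      using aw by (auto simp: c'_def)
    from power_mono[OF this, of 2] show "(a (aff 0 \<rho> (\<rho>\<^sup>2) w) - c')\<^sup>2 \<le> 1 * (a (aff 0 \<rho> (\<rho>\<^sup>2) w) - c - b)\<^sup>2 + 0" by simp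
  qed (intro continuous_intros acs)+
  then have "sqrt (nrm2 (\<lambda>w. a (aff 0 \<rho> (\<rho>\<^sup>2) w) - c')) \<le> sqrt (J / 16 + Z\<^sup>2 / 16 + C * F1)"
    using n by (intro real_sqrt_le_mono) linarith
  also have "\<dots> \<le> sqrt (J / 16 + Z\<^sup>2 / 16) + sqrt (C * F1)"
    using J F1 C by (intro sqrt_add_le_add_sqrt) auto
  also have "sqrt (J / 16 + Z\<^sup>2 / 16) \<le> sqrt (J / 16) + sqrt (Z\<^sup>2 / 16)"
    using J by (intro sqrt_add_le_add_sqrt) auto
  also have "sqrt (J / 16) = \<theta> / 4" using J(2,3) by (simp add: real_sqrt_divide \<theta>_def J_def)
  also have "sqrt (Z\<^sup>2 / 16) = Z / 4" using \<kappa> by (simp add: real_sqrt_divide Z_def)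
  finally have "sqrt (nrm2 (\<lambda>w. a (aff 0 \<rho> (\<rho>\<^sup>2) w) - c')) \<le> \<theta> / 4 + (if c < \<kappa> then \<kappa> / 4 else 0) + sqrt (C * F1)"
    by (simp add: Z_def split: if_splits)
  moreover have "\<bar>c' - c\<bar> \<le> C1 * \<theta>" using b(1) c by (auto simp: c'_def)
  moreover have "0 \<le> c'" "c' \<le> 1" by (auto simp: c'_def)
  ultimately show ?thesis unfolding F1_def by blast
qed

end

lemma aff0_compose: "aff 0 R (R\<^sup>2) (aff 0 S (S\<^sup>2) w) = aff 0 (R * S) ((R * S)\<^sup>2) w"
  by (simp add: aff_compose aff_def power_mult_distrib)

lemma aff_0: "aff z R T 0 = z"
  by (simp add: aff_def)

lemma sol_rescale0:
  fixes f a :: "'a::euclidean_space \<times> real \<Rightarrow> real"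
  assumes "sol m f a" "0 < m" "0 < R" "R \<le> 1"
  shows "sol m (\<lambda>w. R\<^sup>2 * f (aff 0 R (R\<^sup>2) w)) (\<lambda>w. a (aff 0 R (R\<^sup>2) w))"
  using assms by (intro sol_rescale) (auto intro: power_le_one)

text \<open>The version of the later \<open>morrey\<close> for cylinders with top centre 0; it is
  all that the iteration at a single point consumes.\<close>

definition morrey0 :: "real \<Rightarrow> ('a::euclidean_space \<times> real \<Rightarrow> real) \<Rightarrow> bool" where
  "morrey0 F f \<longleftrightarrow> (\<forall>r. 0 < r \<and> r \<le> 1 \<longrightarrow> (LINT w|lborel. indicator (Cq 0 r) w * \<bar>f w\<bar>) \<le> F * r ^ DIM('a) * sqrt r)"

lemma Cq_subset: "0 < r \<Longrightarrow> r \<le> 1 \<Longrightarrow> Cq 0 r \<subseteq> QQ"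
  using power_le_one[of r 2] by (auto simp: Cq_def)

lemma sol_f_measurable: "sol m f a \<Longrightarrow> (\<lambda>w. indicator QQ w * f w) \<in> borel_measurable borel"
  by (auto simp: sol_def)

lemma morrey0_scaled:
  fixes f a :: "'a::euclidean_space \<times> real \<Rightarrow> real"
  assumes s: "sol m f a" and F: "morrey0 F f" and R: "0 < R" "R \<le> 1"
  shows "(LINT w|lborel. indicator QQ w * \<bar>R\<^sup>2 * f (aff 0 R (R\<^sup>2) w)\<bar>) \<le> F * sqrt R"
proof -
  have m: "(\<lambda>w. indicator (Cq 0 R) w * \<bar>f w\<bar>) \<in> borel_measurable borel"
    by (rule indicator_subset_measurable(2)[OF sol_f_measurable[OF s] Cq_subset[OF R]]) simp
  have "R ^ DIM('a) * (LINT w|lborel. indicator QQ w * \<bar>R\<^sup>2 * f (aff 0 R (R\<^sup>2) w)\<bar>) =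
      R ^ (DIM('a) + 2) * (LINT w|lborel. indicator QQ w * \<bar>f (aff 0 R (R\<^sup>2) w)\<bar>)"
    by (simp add: abs_mult mult.left_commute power_add power2_eq_square)
  also have "\<dots> = (LINT w|lborel. indicator (Cq 0 R) w * \<bar>f w\<bar>)"
    using integral_Cq_scale[OF R(1) m] by simp
  also have "\<dots> \<le> R ^ DIM('a) * (F * sqrt R)" using F R by (simp add: morrey0_def mult_ac)
  finally show ?thesis using R by simp
qed

context iteration begin

text \<open>By continuity \<open>a\<close> is within \<open>e\<close> of \<open>a 0\<close> on small
  cylinders, so the mean square distance of \<open>a\<close> to \<open>c\<close> there measures
  \<open>c - a 0\<close>. The second condition on \<open>C1\<close> lets the constant be the same as
  for the jumps of \<open>c\<close>.\<close>

lemma limit_bound: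
  fixes a f :: "'a \<times> real \<Rightarrow> real"
  assumes s: "sol m f a" and e: "e > 0"
  obtains k0 where "\<And>k c. k0 \<le> k \<Longrightarrow> 0 \<le> c \<Longrightarrow> c \<le> 1 \<Longrightarrow>
    \<bar>c - a 0\<bar> \<le> C1 * sqrt (nrm2 (\<lambda>w. a (aff 0 (\<rho> ^ k) ((\<rho> ^ k)\<^sup>2) w) - c)) + 2 * e"
proof -
  have z: "(0 :: 'a \<times> real) \<in> cQ" by (simp add: zero_prod_def)
  have "continuous_on cQ a" using s by (simp add: sol_def)
  then obtain d where d: "d > 0" "\<And>w. w \<in> cQ \<Longrightarrow> dist w 0 < d \<Longrightarrow> dist (a w) (a 0) < e"
    using z e unfolding continuous_on_iff by metis
  have "\<exists>k0. \<rho> ^ k0 < d / 2" using \<rho> d(1) by (intro real_arch_pow_inv) auto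
  then obtain k0 where k0: "\<rho> ^ k0 < d / 2" by blast
  show ?thesis
  proof (rule that)
    fix k c assume k: "k0 \<le> k" and c: "0 \<le> c" "c \<le> (1::real)"
    define r where "r = \<rho> ^ k"
    have r: "0 < r" "r \<le> 1" "r < d / 2"
    proof -
      show "0 < r" "r \<le> 1" using \<rho> by (auto simp: r_def power_le_one)
      have "r \<le> \<rho> ^ k0" unfolding r_def using \<rho> k by (intro power_decreasing) auto
      then show "r < d / 2" using k0 by simp
    qed
    let ?a = "\<lambda>w. a (aff 0 r (r\<^sup>2) w)"
    note sr = sol_rescale0[OF s, of r]
    have m: "0 < m \<or> \<not> 0 < m" by simp
    have near: "\<bar>?a w - a 0\<bar> \<le> e" and b: "0 \<le> ?a w" "?a w \<le> 1" if w: "w \<in> QQ" for w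
    proof -
      have i: "aff 0 r (r\<^sup>2) w \<in> Cq 0 r" using Cq_aff0[OF r(1), of 0 w] w by simp
      then have cq: "aff 0 r (r\<^sup>2) w \<in> QQ" using Cq_subset[OF r(1,2)] by blast
      have "norm (aff 0 r (r\<^sup>2) w) < d" using Cq_norm_less[OF i r(2)] r(3) by simp
      then show "\<bar>?a w - a 0\<bar> \<le> e" using d(2)[OF QQ_cQ[OF cq]] by (simp add: dist_norm)
      show "0 \<le> ?a w" "?a w \<le> 1" using sol_bounds[OF s cq] by auto
    qed
    have ac: "continuous_on QQ ?a"
    proof (rule continuous_on_compose2[OF sol_cont[OF s] aff_continuous[OF continuous_on_id]])
      show "aff 0 r (r\<^sup>2) ` QQ \<subseteq> QQ" using Cq_aff0[OF r(1), of 0] Cq_subset[OF r(1,2)] by blast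
    qed
    have "\<forall>w\<in>cQ. 0 \<le> a w \<and> a w \<le> 1" using s unfolding sol_def by (elim conjE)
    from bspec[OF this z] have a0: "0 \<le> a 0" "a 0 \<le> 1" by auto
    have "nrm2 (\<lambda>w::'a\<times>real. c - a 0) \<le> 2 * nrm2 (\<lambda>w. ?a w - c) + (2 * e\<^sup>2) * vQ TYPE('a)"
    proof (rule nrm2_mono[where B = 2])
      fix w :: "'a \<times> real" assume w: "w \<in> QQ"
      have "(c - a 0)\<^sup>2 = ((?a w - a 0) - (?a w - c))\<^sup>2" by simp
      also have "\<dots> \<le> 2 * (?a w - a 0)\<^sup>2 + 2 * (?a w - c)\<^sup>2"
        using zero_le_power2[of "(?a w - a 0) + (?a w - c)"] by (simp add: power2_eq_square algebra_simps)
      also have "(?a w - a 0)\<^sup>2 \<le> e\<^sup>2" using power_mono[OF near[OF w], of 2] by simp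
      finally show "(c - a 0)\<^sup>2 \<le> 2 * (?a w - c)\<^sup>2 + 2 * e\<^sup>2" by simp
      show "\<bar>?a w - c\<bar> \<le> 2" "\<bar>c - a 0\<bar> \<le> 2" using b[OF w] c a0 by auto
    qed (intro continuous_intros ac)+
    moreover have "nrm2 (\<lambda>w::'a\<times>real. c - a 0) = (c - a 0)\<^sup>2 * vQ TYPE('a)"
      by (simp add: nrm2_def vQ_def)
    ultimately have 1: "(c - a 0)\<^sup>2 * vQ TYPE('a) \<le> 2 * nrm2 (\<lambda>w. ?a w - c) + (2 * e\<^sup>2) * vQ TYPE('a)" by simp
    define \<theta> where "\<theta> = sqrt (nrm2 (\<lambda>w. ?a w - c))"
    have \<theta>: "0 \<le> \<theta>" "\<theta>\<^sup>2 = nrm2 (\<lambda>w. ?a w - c)" by (auto simp: \<theta>_def nrm2_nonneg)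
    have v: "0 < vQ TYPE('a)" by (rule vQ_pos)
    have "2 * \<theta>\<^sup>2 \<le> (C1\<^sup>2 * vQ TYPE('a)) * \<theta>\<^sup>2" using C1(2) by (intro mult_right_mono) auto
    then have "(c - a 0)\<^sup>2 * vQ TYPE('a) \<le> (C1\<^sup>2 * \<theta>\<^sup>2 + 2 * e\<^sup>2) * vQ TYPE('a)"
      using 1 \<theta>(2) by (simp add: algebra_simps)
    then have "(c - a 0)\<^sup>2 \<le> C1\<^sup>2 * \<theta>\<^sup>2 + 2 * e\<^sup>2" using v by simp
    also have "\<dots> \<le> (C1 * \<theta> + 2 * e)\<^sup>2"
    proof -
      have "0 \<le> C1 * \<theta> * e" using C1 \<theta> e by simp
      then show ?thesis using e by (simp add: power2_eq_square algebra_simps)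
    qed
    finally have "\<bar>c - a 0\<bar>\<^sup>2 \<le> (C1 * \<theta> + 2 * e)\<^sup>2" by simp
    then have "\<bar>c - a 0\<bar> \<le> C1 * \<theta> + 2 * e"
      by (rule power2_le_imp_le) (use C1 \<theta> e in auto)
    then show "\<bar>c - a 0\<bar> \<le> C1 * sqrt (nrm2 (\<lambda>w. a (aff 0 (\<rho> ^ k) ((\<rho> ^ k)\<^sup>2) w) - c)) + 2 * e"
      by (simp add: \<theta>_def r_def)
  qed
qed

text \<open>The source error at scale \<open>\<rho> ^ k\<close> is the square root of a multiple of
  \<open>sqrt (\<rho> ^ k)\<close>, hence geometric with the fourth root of \<open>\<rho>\<close> as
  ratio. \<open>tail\<close> is the whole budget for these errors in both pointwise bounds.\<close>

definition q :: real where "q = sqrt (sqrt \<rho>)"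
definition tail :: "real \<Rightarrow> real" where "tail F = 2 * C1 * sqrt (C * F) / (1 - q)"

lemma q: "0 < q" "q < 1"
proof -
  show "0 < q" using \<rho> by (simp add: q_def)
  have "sqrt \<rho> < sqrt 1" using \<rho> by (intro real_sqrt_less_mono) auto
  then have "sqrt (sqrt \<rho>) < sqrt 1" by (intro real_sqrt_less_mono) auto
  then show "q < 1" by (simp add: q_def)
qed

definition partial_tail :: "real \<Rightarrow> nat \<Rightarrow> real" where
  "partial_tail F k = 2 * C1 * sqrt (C * F) * (\<Sum>j<k. q ^ j)"

lemma partial_tail_le: "0 \<le> F \<Longrightarrow> partial_tail F k \<le> tail F"
proof -
  assume F: "0 \<le> F"
  have "(\<Sum>j<k. q ^ j) \<le> 1 / (1 - q)"
  proof -
    have "(\<Sum>j<k. q ^ j) = (1 - q ^ k) / (1 - q)" using q by (simp add: sum_gp_strict)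
    also have "\<dots> \<le> 1 / (1 - q)" using q by (intro divide_right_mono) auto
    finally show ?thesis .
  qed
  then have "2 * C1 * sqrt (C * F) * (\<Sum>j<k. q ^ j) \<le> 2 * C1 * sqrt (C * F) * (1 / (1 - q))"
    using C1 C F by (intro mult_left_mono) auto
  then show ?thesis by (simp add: partial_tail_def tail_def)
qed

lemma scaled_step:
  fixes a f :: "'a \<times> real \<Rightarrow> real"
  assumes s: "sol m f a" and m: "1 < m" and sec: "secant_close m \<kappa> \<delta>" and \<delta>: "small_slope \<delta>" and \<kappa>: "0 < \<kappa>" "\<kappa> < 1"
    and F: "morrey0 F f" "0 \<le> F" and c: "0 \<le> c" "c \<le> 1"
  defines "\<theta> \<equiv> \<lambda>k c. sqrt (nrm2 (\<lambda>w. a (aff 0 (\<rho> ^ k) ((\<rho> ^ k)\<^sup>2) w) - c))"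
  shows "\<exists>c'. 0 \<le> c' \<and> c' \<le> 1 \<and> \<bar>c' - c\<bar> \<le> C1 * \<theta> k c \<and>
    \<theta> (Suc k) c' \<le> \<theta> k c / 4 + (if c < \<kappa> then \<kappa> / 4 else 0) + sqrt (C * F) * q ^ k"
proof -
  define r where "r = \<rho> ^ k"
  have r: "0 < r" "r \<le> 1" using \<rho> by (auto simp: r_def power_le_one)
  have sr: "sol m (\<lambda>w. r\<^sup>2 * f (aff 0 r (r\<^sup>2) w)) (\<lambda>w. a (aff 0 r (r\<^sup>2) w))"
    using m by (intro sol_rescale0[OF s _ r]) auto
  from iteration_step[OF sr m sec \<delta> \<kappa> c]
  obtain c' where c': "0 \<le> c'" "c' \<le> 1" "\<bar>c' - c\<bar> \<le> C1 * \<theta> k c"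
    "sqrt (nrm2 (\<lambda>w. a (aff 0 r (r\<^sup>2) (aff 0 \<rho> (\<rho>\<^sup>2) w)) - c')) \<le> \<theta> k c / 4 + (if c < \<kappa> then \<kappa> / 4 else 0)
       + sqrt (C * (LINT w|lborel. indicator QQ w * \<bar>r\<^sup>2 * f (aff 0 r (r\<^sup>2) w)\<bar>))"
    unfolding \<theta>_def r_def by blast
  have "sqrt (nrm2 (\<lambda>w. a (aff 0 r (r\<^sup>2) (aff 0 \<rho> (\<rho>\<^sup>2) w)) - c')) = \<theta> (Suc k) c'"
    unfolding aff0_compose \<theta>_def r_def by (simp add: mult.commute)
  moreover have "sqrt (C * (LINT w|lborel. indicator QQ w * \<bar>r\<^sup>2 * f (aff 0 r (r\<^sup>2) w)\<bar>)) \<le> sqrt (C * F) * q ^ k"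
  proof -
    have "sqrt (C * (LINT w|lborel. indicator QQ w * \<bar>r\<^sup>2 * f (aff 0 r (r\<^sup>2) w)\<bar>)) \<le> sqrt (C * (F * sqrt r))"
      using morrey0_scaled[OF s F(1) r] C by (intro real_sqrt_le_mono mult_left_mono) auto
    also have "\<dots> = sqrt (C * F) * q ^ k"
      by (simp add: real_sqrt_mult r_def q_def real_sqrt_power)
    finally show ?thesis .
  qed
  ultimately show ?thesis using c' by (intro exI[of _ c']) auto
qed

text \<open>The quantity \<open>c + 2 * C1 * \<theta>\<close> stays below \<open>M\<close> plus the
  accumulated source errors: the jump \<open>C1 * \<theta>\<close> of the constant is paid by the
  reduction of \<open>\<theta>\<close> to a quarter. What is left also absorbs the penalty if
  \<open>\<kappa> \<le> \<theta>\<close>. If both \<open>c\<close> and \<open>\<theta>\<close> are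
  below \<open>\<kappa>\<close>, the new quantity is at most \<open>3 * C1 * \<kappa>\<close> plus
  the error, which explains the maximum in \<open>M\<close>.\<close>

lemma upper_bound:
  fixes a f :: "'a \<times> real \<Rightarrow> real"
  assumes s: "sol m f a" and m: "1 < m" and sec: "secant_close m \<kappa> \<delta>" and \<delta>: "small_slope \<delta>" and \<kappa>: "0 < \<kappa>" "\<kappa> < 1"
    and F: "morrey0 F f" "0 \<le> F" and c: "0 \<le> c" "c \<le> 1"
  shows "a 0 \<le> c + 2 * C1 * sqrt (nrm2 (\<lambda>w. a w - c)) + 3 * C1 * \<kappa> + tail F"
proof -
  define \<theta> where "\<theta> k c = sqrt (nrm2 (\<lambda>w. a (aff 0 (\<rho> ^ k) ((\<rho> ^ k)\<^sup>2) w) - c))" for k c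
  have \<theta>0: "0 \<le> \<theta> k c" for k c by (simp add: \<theta>_def nrm2_nonneg)
  define M where "M = max (c + 2 * C1 * \<theta> 0 c) (3 * C1 * \<kappa>)"
  note st = scaled_step[OF s m sec \<delta> \<kappa> F, folded \<theta>_def]
  have claim: "\<exists>c. 0 \<le> c \<and> c \<le> 1 \<and> c + 2 * C1 * \<theta> k c \<le> M + partial_tail F k" for k
  proof (induction k)
    case 0
    show ?case using c by (intro exI[of _ c]) (auto simp: M_def partial_tail_def)
  next
    case (Suc k)
    then obtain c where c: "0 \<le> c" "c \<le> 1" "c + 2 * C1 * \<theta> k c \<le> M + partial_tail F k" by blast
    obtain c' where c': "0 \<le> c'" "c' \<le> 1" "\<bar>c' - c\<bar> \<le> C1 * \<theta> k c"
      "\<theta> (Suc k) c' \<le> \<theta> k c / 4 + (if c < \<kappa> then \<kappa> / 4 else 0) + sqrt (C * F) * q ^ k"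
      using st[OF c(1,2), of k] by blast
    have pt: "partial_tail F (Suc k) = partial_tail F k + 2 * C1 * (sqrt (C * F) * q ^ k)"
      by (simp add: partial_tail_def algebra_simps)
    have pt0: "0 \<le> partial_tail F k" unfolding partial_tail_def using C1 C F(2) q
      by (intro mult_nonneg_nonneg sum_nonneg) auto
    have CC: "2 * C1 * \<theta> (Suc k) c' \<le> 2 * C1 * (\<theta> k c / 4 + (if c < \<kappa> then \<kappa> / 4 else 0) + sqrt (C * F) * q ^ k)"
      using C1 by (intro mult_left_mono c'(4)) auto
    have C\<theta>: "0 \<le> C1 * \<theta> k c" using C1 \<theta>0 by simp
    have "c' + 2 * C1 * \<theta> (Suc k) c' \<le> M + partial_tail F (Suc k)"
    proof (cases "c < \<kappa>")
      case False
      then have "2 * C1 * \<theta> (Suc k) c' \<le> C1 * \<theta> k c / 2 + 2 * C1 * (sqrt (C * F) * q ^ k)"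
        using CC by (simp add: algebra_simps)
      then show ?thesis using c'(3) c(3) C\<theta> pt by linarith
    next
      case True
      then have b: "2 * C1 * \<theta> (Suc k) c' \<le> C1 * \<theta> k c / 2 + C1 * \<kappa> / 2 + 2 * C1 * (sqrt (C * F) * q ^ k)"
        using CC by (simp add: algebra_simps)
      show ?thesis
      proof (cases "\<kappa> \<le> \<theta> k c")
        case True
        then have "C1 * \<kappa> \<le> C1 * \<theta> k c" using C1 by simp
        then show ?thesis using c'(3) c(3) C\<theta> pt b by linarith
      next
        case False
        then have "C1 * \<theta> k c \<le> C1 * \<kappa>" using C1 by simp
        moreover have "\<kappa> \<le> C1 * \<kappa>" using C1 \<kappa> by simp
        moreover have "3 * (C1 * \<kappa>) \<le> M" by (simp add: M_def)
        ultimately show ?thesis using c'(3) \<open>c < \<kappa>\<close> pt b pt0 by linarith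
      qed
    qed
    then show ?case using c' by blast
  qed
  have "a 0 \<le> M + tail F + e" if e: "e > 0" for e
  proof -
    obtain k0 where k0: "\<And>k c. k0 \<le> k \<Longrightarrow> 0 \<le> c \<Longrightarrow> c \<le> 1 \<Longrightarrow> \<bar>c - a 0\<bar> \<le> C1 * \<theta> k c + 2 * (e / 2)"
      using limit_bound[OF s, of "e / 2"] e unfolding \<theta>_def by (metis half_gt_zero)
    obtain c where c: "0 \<le> c" "c \<le> 1" "c + 2 * C1 * \<theta> k0 c \<le> M + partial_tail F k0" using claim by blast
    have "0 \<le> C1 * \<theta> k0 c" using C1 \<theta>0 by simp
    then show ?thesis using k0[OF order_refl c(1,2)] c(3) partial_tail_le[OF F(2), of k0] by linarith
  qed
  then have "a 0 \<le> M + tail F" by (rule field_le_epsilon)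
  moreover have "\<theta> 0 c = sqrt (nrm2 (\<lambda>w. a w - c))" by (simp add: \<theta>_def aff_def)
  moreover have "0 \<le> c + 2 * C1 * \<theta> 0 c" "0 \<le> 3 * C1 * \<kappa>" using c C1 \<theta>0 \<kappa> by auto
  ultimately show ?thesis by (simp add: M_def max_def split: if_splits)
qed

text \<open>The barrier is \<open>\<kappa>\<close> plus the errors still to come,
  \<open>tail F - partial_tail F k\<close>. All constants therefore stay at or above
  \<open>\<kappa>\<close>, the penalty never arises, and \<open>\<kappa>\<close> survives in the
  limit.\<close>

lemma lower_bound:
  fixes a f :: "'a \<times> real \<Rightarrow> real"
  assumes s: "sol m f a" and m: "1 < m" and sec: "secant_close m \<kappa> \<delta>" and \<delta>: "small_slope \<delta>" and \<kappa>: "0 < \<kappa>" "\<kappa> < 1"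
    and F: "morrey0 F f" "0 \<le> F" and c: "0 \<le> c" "c \<le> 1"
    and low: "\<kappa> \<le> c - 2 * C1 * sqrt (nrm2 (\<lambda>w. a w - c)) - tail F"
  shows "\<kappa> \<le> a 0"
proof -
  define \<theta> where "\<theta> k c = sqrt (nrm2 (\<lambda>w. a (aff 0 (\<rho> ^ k) ((\<rho> ^ k)\<^sup>2) w) - c))" for k c
  have \<theta>0: "0 \<le> \<theta> k c" for k c by (simp add: \<theta>_def nrm2_nonneg)
  have \<theta>00: "\<theta> 0 c = sqrt (nrm2 (\<lambda>w. a w - c))" by (simp add: \<theta>_def aff_def)
  note st = scaled_step[OF s m sec \<delta> \<kappa> F, folded \<theta>_def]
  have claim: "\<exists>c. 0 \<le> c \<and> c \<le> 1 \<and> \<kappa> + tail F - partial_tail F k \<le> c - 2 * C1 * \<theta> k c" for k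
  proof (induction k)
    case 0
    show ?case using c low \<theta>00 by (intro exI[of _ c]) (auto simp: partial_tail_def)
  next
    case (Suc k)
    then obtain c where c: "0 \<le> c" "c \<le> 1" "\<kappa> + tail F - partial_tail F k \<le> c - 2 * C1 * \<theta> k c" by blast
    obtain c' where c': "0 \<le> c'" "c' \<le> 1" "\<bar>c' - c\<bar> \<le> C1 * \<theta> k c"
      "\<theta> (Suc k) c' \<le> \<theta> k c / 4 + (if c < \<kappa> then \<kappa> / 4 else 0) + sqrt (C * F) * q ^ k"
      using st[OF c(1,2), of k] by blast
    have C\<theta>: "0 \<le> C1 * \<theta> k c" using C1 \<theta>0 by simp
    then have ck: "\<not> c < \<kappa>" using c(3) partial_tail_le[OF F(2), of k] by linarith
    have pt: "partial_tail F (Suc k) = partial_tail F k + 2 * C1 * (sqrt (C * F) * q ^ k)"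
      by (simp add: partial_tail_def algebra_simps)
    have "2 * C1 * \<theta> (Suc k) c' \<le> 2 * C1 * (\<theta> k c / 4 + sqrt (C * F) * q ^ k)"
      using C1 ck c'(4) by (intro mult_left_mono) auto
    then have "2 * C1 * \<theta> (Suc k) c' \<le> C1 * \<theta> k c / 2 + 2 * C1 * (sqrt (C * F) * q ^ k)"
      by (simp add: algebra_simps)
    then have "\<kappa> + tail F - partial_tail F (Suc k) \<le> c' - 2 * C1 * \<theta> (Suc k) c'"
      using c'(3) c(3) C\<theta> pt by linarith
    then show ?case using c' by blast
  qed
  have "\<kappa> \<le> a 0 + e" if e: "e > 0" for e
  proof -
    obtain k0 where k0: "\<And>k c. k0 \<le> k \<Longrightarrow> 0 \<le> c \<Longrightarrow> c \<le> 1 \<Longrightarrow> \<bar>c - a 0\<bar> \<le> C1 * \<theta> k c + 2 * (e / 2)"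
      using limit_bound[OF s, of "e / 2"] e unfolding \<theta>_def by (metis half_gt_zero)
    obtain c where c: "0 \<le> c" "c \<le> 1" "\<kappa> + tail F - partial_tail F k0 \<le> c - 2 * C1 * \<theta> k0 c" using claim by blast
    have "0 \<le> C1 * \<theta> k0 c" using C1 \<theta>0 by simp
    then show ?thesis using k0[OF order_refl c(1,2)] c(3) partial_tail_le[OF F(2), of k0] by linarith
  qed
  then show ?thesis by (rule field_le_epsilon)
qed

lemma tail_small:
  assumes "e > 0" shows "\<exists>F0>0. \<forall>F. 0 \<le> F \<and> F \<le> F0 \<longrightarrow> tail F \<le> e"
proof -
  have "(\<lambda>F. tail F) \<midarrow>0\<rightarrow> tail 0" unfolding tail_def using q by (intro tendsto_intros) auto
  moreover have "tail 0 = 0" by (simp add: tail_def)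
  ultimately have "\<forall>\<^sub>F F in at 0. tail F < e" using assms by (intro order_tendstoD) auto
  then obtain d where d: "d > 0" "\<And>F. F \<noteq> 0 \<Longrightarrow> \<bar>F\<bar> < d \<Longrightarrow> tail F < e"
    unfolding eventually_at by (auto simp: dist_real_def)
  have "tail F \<le> e" if "0 \<le> F" "F \<le> d / 2" for F
    using d(2)[of F] d(1) that assms by (cases "F = 0") (auto simp: tail_def)
  then show ?thesis using d(1) by (intro exI[of _ "d / 2"]) auto
qed

end

section \<open>Zeros and smallness in a smaller cylinder\<close>

lemma conv_scaled_bump:
  fixes \<psi>1 :: "'a::euclidean_space \<times> real \<Rightarrow> real"
  assumes t: "test_fun QQ \<psi>1" and \<rho>: "0 < \<rho>"
  defines "\<psi> \<equiv> \<lambda>w. (1 / \<rho> ^ (DIM('a) + 2)) * \<psi>1 (aff 0 (1 / \<rho>) ((1 / \<rho>)\<^sup>2) w)"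
  shows "test_fun (Cq 0 \<rho>) \<psi>"
    and "\<And>h. (\<lambda>w. indicator (Cq 0 \<rho>) w * h w) \<in> borel_measurable borel \<Longrightarrow>
       (LINT w|lborel. h w * \<psi> w) = (LINT w|lborel. h (aff 0 \<rho> (\<rho>\<^sup>2) w) * \<psi>1 w)"
proof -
  have sub: "aff_inv 0 (1 / \<rho>) ((1 / \<rho>)\<^sup>2) ` QQ \<subseteq> Cq (0 :: 'a \<times> real) \<rho>"
  proof
    fix x :: "'a \<times> real" assume "x \<in> aff_inv 0 (1 / \<rho>) ((1 / \<rho>)\<^sup>2) ` QQ"
    then obtain w where w: "w \<in> QQ" "x = aff_inv 0 (1 / \<rho>) ((1 / \<rho>)\<^sup>2) w" by auto
    then have "aff 0 (1 / \<rho>) ((1 / \<rho>)\<^sup>2) x = w" using aff_inv(2)[of "1 / \<rho>" "(1 / \<rho>)\<^sup>2" 0 w] \<rho> by simp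
    then show "x \<in> Cq 0 \<rho>" using Cq_aff[of "1 / \<rho>" 0 x 0 \<rho>] w \<rho> by (simp add: aff_0)
  qed
  have "test_fun (aff_inv 0 (1 / \<rho>) ((1 / \<rho>)\<^sup>2) ` QQ) (\<lambda>w. \<psi>1 (aff 0 (1 / \<rho>) ((1 / \<rho>)\<^sup>2) w))"
    using \<rho> by (intro test_fun_aff t) auto
  from test_fun_cmult[OF test_fun_mono[OF this sub]] show tf: "test_fun (Cq 0 \<rho>) \<psi>"
    unfolding \<psi>_def .
  have \<psi>1_0: "\<psi>1 w = 0" if "w \<notin> QQ" for w using t that by (auto elim: test_funE)
  have \<psi>_0: "\<psi> w = 0" if "w \<notin> Cq 0 \<rho>" for w using tf that by (auto elim: test_funE)
  have \<psi>a: "\<psi> (aff 0 \<rho> (\<rho>\<^sup>2) w) = (1 / \<rho> ^ (DIM('a) + 2)) * \<psi>1 w" for w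
    using \<rho> unfolding \<psi>_def aff0_compose by (simp add: aff_def)
  fix h :: "'a \<times> real \<Rightarrow> real" assume h: "(\<lambda>w. indicator (Cq 0 \<rho>) w * h w) \<in> borel_measurable borel"
  have [measurable]: "\<psi> \<in> borel_measurable borel"
    using tf by (intro borel_measurable_continuous_onI smooth_continuous test_fun_smooth)
  have "(\<lambda>w. (indicator (Cq 0 \<rho>) w * h w) * \<psi> w) \<in> borel_measurable borel" using h by measurable
  then have m: "(\<lambda>w. indicator (Cq 0 \<rho>) w * (h w * \<psi> w)) \<in> borel_measurable borel" by (simp add: mult.assoc)
  have "(LINT w|lborel. h w * \<psi> w) = (LINT w|lborel. indicator (Cq 0 \<rho>) w * (h w * \<psi> w))"
    using \<psi>_0 by (intro Bochner_Integration.integral_cong) (auto simp: indicator_def)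
  also have "\<dots> = \<rho> ^ (DIM('a) + 2) * (LINT w|lborel. indicator QQ w * (h (aff 0 \<rho> (\<rho>\<^sup>2) w) * ((1 / \<rho> ^ (DIM('a) + 2)) * \<psi>1 w)))"
    using integral_Cq_scale[OF \<rho> m] unfolding \<psi>a .
  also have "(\<lambda>w. indicator QQ w * (h (aff 0 \<rho> (\<rho>\<^sup>2) w) * ((1 / \<rho> ^ (DIM('a) + 2)) * \<psi>1 w))) =
      (\<lambda>w. (1 / \<rho> ^ (DIM('a) + 2)) * (h (aff 0 \<rho> (\<rho>\<^sup>2) w) * \<psi>1 w))"
    using \<psi>1_0 by (auto simp: fun_eq_iff indicator_def)
  finally show "(LINT w|lborel. h w * \<psi> w) = (LINT w|lborel. h (aff 0 \<rho> (\<rho>\<^sup>2) w) * \<psi>1 w)"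
    using \<rho> by simp
qed

text \<open>Together with a top slab of height \<open>\<tau>\<close> this covers every
  \<open>Cq z (1/4)\<close> with \<open>norm (fst z) < 1/4\<close> and
  \<open>- 1/16 < snd z \<le> 0\<close>, hence the numbers 1/2 and 1/8.\<close>

definition past :: "real \<Rightarrow> ('a::euclidean_space \<times> real) set" where
  "past \<tau> = ball 0 (1/2) \<times> {-1/8 <..< - \<tau>}"

text \<open>A weak form of the Harnack inequality: the average near the final time controls the mass at
  earlier times.\<close>
definition past_control :: "'a::euclidean_space itself \<Rightarrow> real \<Rightarrow> real \<Rightarrow> real \<Rightarrow> real \<Rightarrow> real \<Rightarrow> bool" where
  "past_control ty \<tau> c0 M1 \<rho> K \<longleftrightarrow> (\<forall>(v :: 'a \<times> real \<Rightarrow> real) g f \<delta>.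
      continuous_on QQ v \<longrightarrow> continuous_on QQ g \<longrightarrow> (\<forall>w\<in>QQ. 0 \<le> v w \<and> v w \<le> 1) \<longrightarrow> (\<forall>w\<in>QQ. \<bar>g w\<bar> \<le> \<delta>) \<longrightarrow>
      integrable lborel (\<lambda>w. indicator QQ w * f w) \<longrightarrow> pv QQ v (\<lambda>w. v w + g w) f \<longrightarrow>
      c0 * (LINT w|lborel. indicator (past \<tau>) w * v w) \<le>
        M1 * (LINT w|lborel. indicator QQ w * v (aff 0 \<rho> (\<rho>\<^sup>2) w)) + K * (\<delta> + (LINT w|lborel. indicator QQ w * \<bar>f w\<bar>)))"

lemma past_controlD:
  fixes v g f :: "'a::euclidean_space \<times> real \<Rightarrow> real"
  assumes "past_control TYPE('a) \<tau> c0 M1 \<rho> K" "continuous_on QQ v" "continuous_on QQ g"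
    "\<forall>w\<in>QQ. 0 \<le> v w \<and> v w \<le> 1" "\<forall>w\<in>QQ. \<bar>g w\<bar> \<le> \<delta>"
    "integrable lborel (\<lambda>w. indicator QQ w * f w)" "pv QQ v (\<lambda>w. v w + g w) f"
  shows "c0 * (LINT w|lborel. indicator (past \<tau>) w * v w) \<le>
        M1 * (LINT w|lborel. indicator QQ w * v (aff 0 \<rho> (\<rho>\<^sup>2) w)) + K * (\<delta> + (LINT w|lborel. indicator QQ w * \<bar>f w\<bar>))"
  using assms unfolding past_control_def by blast

text \<open>The potential \<open>\<phi>\<close> of a unit mass \<open>\<psi>\<close> near the top
  satisfies \<open>dt \<phi> + lap \<phi> \<ge> - \<psi> + c0 * indicator (past \<tau>)\<close>,
  since the error kernel is bounded below on the relevant differences. Testing a nonnegative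
  solution with it gives the claim. \<open>c0\<close> and \<open>M1\<close> do not depend on
  \<open>\<rho>\<close>, so the accuracy needed near the top is known before \<open>\<rho>\<close>
  is selected; only \<open>K\<close> depends on it.\<close>

lemma past_estimate:
  assumes \<tau>: "0 < \<tau>"
  obtains c0 \<rho>0 M1 :: real where "0 < c0" "0 < \<rho>0" "0 < M1"
    "\<And>\<rho>. 0 < \<rho> \<Longrightarrow> \<rho> \<le> \<rho>0 \<Longrightarrow> \<exists>K>0. past_control TYPE('a::euclidean_space) \<tau> c0 M1 \<rho> K"
proof -
  obtain E k :: "'a \<times> real \<Rightarrow> real" where E: "integrable lborel E" "\<And>w. w \<notin> cball 0 (3/4) \<times> {0..3/4} \<Longrightarrow> E w = 0"
    and k: "continuous_on {w. 0 < snd w} k" "\<And>w. 0 \<le> k w"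
    "\<And>w. norm (fst w) < 3/4 \<Longrightarrow> 0 < snd w \<Longrightarrow> snd w < 3/4 \<Longrightarrow> 0 < k w"
    and ineq: "\<And>\<psi> z \<sigma>. test_fun UNIV \<psi> \<Longrightarrow> (\<And>w. 0 \<le> \<psi> w) \<Longrightarrow> \<sigma> > 0 \<Longrightarrow>
      - \<psi> z + (LINT w|lborel. indicator {w. \<sigma> \<le> snd w} w * (k w * \<psi> (z + w))) \<le> dt (conv E \<psi>) z + lap (conv E \<psi>) z"
    and lapE: "\<And>\<psi>. test_fun UNIV \<psi> \<Longrightarrow> lap (conv E \<psi>) = conv E (lap \<psi>)"
    and kint: "\<And>\<psi> \<sigma>. test_fun UNIV \<psi> \<Longrightarrow> \<sigma> > 0 \<Longrightarrow> integrable lborel (\<lambda>w. indicator {w. \<sigma> \<le> snd w} w * (k w * \<psi> w))"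
    using positive_parametrix by blast
  \<comment> \<open>Contains all differences of a point of \<open>Cq 0 \<rho>\<close> and a point of
    \<open>past \<tau>\<close> as long as \<open>\<rho>\<close> is at most 1/8 and
    \<open>\<tau>/2\<close>.\<close>
  define S :: "('a \<times> real) set" where "S = cball 0 (5/8) \<times> {\<tau>/2..1/2}"
  have S: "compact S" unfolding S_def by (intro compact_Times) auto
  have "\<exists>c0>0. \<forall>w\<in>S. c0 \<le> k w"
  proof (cases "S = {}")
    case False
    have "continuous_on S k" using \<tau> by (intro continuous_on_subset[OF k(1)]) (auto simp: S_def)
    then obtain w where w: "w \<in> S" "\<And>x. x \<in> S \<Longrightarrow> k w \<le> k x"
      using continuous_attains_inf[OF S False] by blast
    moreover have "0 < k w" using w(1) \<tau> by (intro k(3)) (auto simp: S_def)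
    ultimately show ?thesis by blast
  next
    \<comment> \<open>For \<open>\<tau> > 1\<close> no such difference has to be controlled, and any
      positive constant serves.\<close>
    case True
    then show ?thesis by (intro exI[of _ 1]) auto
  qed
  then obtain c0 where c0: "c0 > 0" "\<And>w. w \<in> S \<Longrightarrow> c0 \<le> k w" by blast
  define \<rho>0 where "\<rho>0 = min (1/8) (\<tau>/2)"
  obtain \<psi>1 :: "'a \<times> real \<Rightarrow> real" where \<psi>1: "smooth \<psi>1" "\<And>x. 0 \<le> \<psi>1 x" "\<And>x. x \<notin> cball (0, -1/2) (1/4) \<Longrightarrow> \<psi>1 x = 0" "(LINT x|lborel. \<psi>1 x) = 1"
    using bump_exists[of "1/4" "(0, -1/2) :: 'a \<times> real"] by force
  have t1: "test_fun QQ \<psi>1"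
  proof (rule test_funI[OF \<psi>1(1) compact_cball _ \<psi>1(3)])
    show "cball (0, -1/2) (1/4) \<subseteq> (QQ :: ('a \<times> real) set)"
    proof
      fix w :: "'a \<times> real" assume "w \<in> cball (0, -1/2) (1/4)"
      then have d: "dist (0, -1/2) w \<le> 1/4" by simp
      have "dist 0 (fst w) \<le> 1/4" using dist_fst_le[of "(0, -1/2)" w] d by simp
      moreover have "dist (-1/2) (snd w) \<le> 1/4" using dist_snd_le[of "(0, -1/2)" w] d by simp
      ultimately have "norm (fst w) \<le> 1/4" "\<bar>-1/2 - snd w\<bar> \<le> 1/4" by (simp_all add: dist_real_def)
      then have "norm (fst w) < 1" "-1 < snd w" "snd w < 0" by linarith+
      then show "w \<in> QQ" by (cases w) (auto simp: Cq_def dist_real_def)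
    qed
  qed
  obtain M1 where M1: "M1 > 0" "\<And>x. \<bar>\<psi>1 x\<bar> \<le> M1"
    using continuous_compact_support_bounded[OF smooth_continuous[OF \<psi>1(1)] compact_cball \<psi>1(3)] by blast
  show ?thesis
  proof (rule that[of c0 \<rho>0 M1])
    show "0 < c0" "0 < \<rho>0" "0 < M1" using c0 M1 \<tau> by (auto simp: \<rho>0_def)
    fix \<rho> :: real assume \<rho>: "0 < \<rho>" "\<rho> \<le> \<rho>0"
    then have \<rho>': "\<rho> \<le> 1/8" "\<rho> \<le> \<tau>/2" by (auto simp: \<rho>0_def)
    have \<rho>2: "\<rho>\<^sup>2 \<le> \<rho>" using \<rho> \<rho>' by (simp add: power2_eq_square mult_left_le_one_le)
    define \<psi> where "\<psi> = (\<lambda>w. (1 / \<rho> ^ (DIM('a) + 2)) * \<psi>1 (aff 0 (1 / \<rho>) ((1 / \<rho>)\<^sup>2) w))"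
    have sb1: "test_fun (Cq 0 \<rho>) \<psi>"
      unfolding \<psi>_def by (rule conv_scaled_bump(1)[OF t1 \<rho>(1)])
    have sb2: "(LINT w|lborel. h w * \<psi> w) = (LINT w|lborel. h (aff 0 \<rho> (\<rho>\<^sup>2) w) * \<psi>1 w)"
      if "(\<lambda>w. indicator (Cq 0 \<rho>) w * h w) \<in> borel_measurable borel" for h
      unfolding \<psi>_def by (rule conv_scaled_bump(2)[OF t1 \<rho>(1) that])
    have t\<psi>: "test_fun UNIV \<psi>" using sb1 by (rule test_fun_mono) simp
    have \<psi>0: "0 \<le> \<psi> w" for w using \<psi>1(2) \<rho> by (simp add: \<psi>_def)
    have \<psi>int: "(LINT w|lborel. \<psi> w) = 1"
      using sb2[of "\<lambda>w. 1"] \<psi>1(4) by simp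
    obtain C where C: "smooth \<psi>" "compact C" "C \<subseteq> Cq 0 \<rho>" "\<And>w. w \<notin> C \<Longrightarrow> \<psi> w = 0" using sb1 by (auto elim: test_funE)
    define \<phi> where "\<phi> = conv E \<psi>"
    have t\<phi>: "test_fun QQ \<phi>" unfolding \<phi>_def
    proof (rule test_fun_conv[OF E(1) _ E(2) C(1,2,4)])
      show "compact (cball (0::'a) (3/4) \<times> {0..3/4::real})" by (intro compact_Times) auto
      fix x w :: "'a \<times> real" assume "x \<in> C" "w \<in> cball 0 (3/4) \<times> {0..3/4}"
      then have "norm (fst x) < \<rho>" "- \<rho>\<^sup>2 < snd x" "snd x < 0" "norm (fst w) \<le> 3/4" "0 \<le> snd w" "snd w \<le> 3/4"
        using C(3) by (auto simp: Cq_def)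
      moreover have "norm (fst x - fst w) \<le> norm (fst x) + norm (fst w)" by (rule norm_triangle_ineq4)
      ultimately have "norm (fst x - fst w) < 1" "-1 < snd x - snd w" "snd x - snd w < 0" using \<rho>' \<rho>2 by linarith+
      then show "x - w \<in> QQ" by (cases x; cases w) (simp add: Cq_def dist_norm norm_minus_commute)
    qed
    obtain K1 where K1: "K1 > 0" "\<And>w. \<bar>lap \<phi> w\<bar> \<le> K1"
    proof -
      obtain D where D: "smooth (lap \<phi>)" "compact D" "\<And>w. w \<notin> D \<Longrightarrow> lap \<phi> w = 0" using test_fun_lap[OF t\<phi>] by (auto elim: test_funE)
      show ?thesis using continuous_compact_support_bounded[OF smooth_continuous[OF D(1)] D(2,3)] that by blast
    qed
    obtain K2 where K2: "K2 > 0" "\<And>w. \<bar>\<phi> w\<bar> \<le> K2"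
    proof -
      obtain D where D: "smooth \<phi>" "compact D" "\<And>w. w \<notin> D \<Longrightarrow> \<phi> w = 0" using t\<phi> by (auto elim: test_funE)
      show ?thesis using continuous_compact_support_bounded[OF smooth_continuous[OF D(1)] D(2,3)] that by blast
    qed
    define K where "K = K1 * vQ TYPE('a) + K2"
    have K: "K > 0" using K1 K2 vQ_pos[where 'a='a] by (simp add: K_def add_pos_pos)
    have lower: "- \<psi> z + c0 * indicator (past \<tau>) z \<le> dt \<phi> z + lap \<phi> z" for z
    proof -
      have i1: "integrable lborel (\<lambda>w. indicator {w. \<tau>/2 \<le> snd w} w * (k w * \<psi> (z + w)))"
        by (rule kint[OF test_fun_shift[OF t\<psi>]]) (use \<tau> in simp)
      have i2: "integrable lborel (\<lambda>w. \<psi> (z + w))"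
        by (rule test_fun_integrable[OF test_fun_shift[OF t\<psi>]])
      have "c0 * indicator (past \<tau>) z \<le> (LINT w|lborel. indicator {w. \<tau>/2 \<le> snd w} w * (k w * \<psi> (z + w)))"
      proof (cases "z \<in> past \<tau>")
        case False
        then show ?thesis using k(2) \<psi>0 by simp
      next
        case True
        have "(LINT w|lborel. \<psi> (z + w)) = 1"
          using lborel_integral_translate(1)[of \<psi> z] \<psi>int by (simp add: add.commute)
        then have "c0 = (LINT w|lborel. c0 * \<psi> (z + w))" by simp
        also have "\<dots> \<le> (LINT w|lborel. indicator {w. \<tau>/2 \<le> snd w} w * (k w * \<psi> (z + w)))"
        proof (rule integral_mono[OF _ i1])
          show "c0 * \<psi> (z + w) \<le> indicator {w. \<tau>/2 \<le> snd w} w * (k w * \<psi> (z + w))" for w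
          proof (cases "z + w \<in> C")
            case False
            then show ?thesis using C(4) by simp
          next
            case inC: True
            obtain x t y s where xy: "z = (x, t)" "w = (y, s)" by (cases z; cases w)
            have "norm x < 1/2" "-1/8 < t" "t < - \<tau>" using True by (auto simp: past_def xy)
            moreover have "norm (x + y) < \<rho>" "- \<rho>\<^sup>2 < t + s" "t + s < 0" using inC C(3) by (auto simp: xy Cq_def)
            moreover have "norm y \<le> norm (x + y) + norm x" using norm_triangle_ineq4[of "x + y" x] by simp
            ultimately have "norm y \<le> 5/8" "\<tau>/2 \<le> s" "s \<le> 1/2" using \<rho>' \<rho>2 by linarith+
            then have "w \<in> S" "w \<in> {w. \<tau>/2 \<le> snd w}" by (auto simp: S_def xy)
            then show ?thesis using mult_right_mono[OF c0(2)[of w] \<psi>0[of "z + w"]] by simp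
          qed
        qed (use i2 in auto)
        finally show ?thesis using True by simp
      qed
      then show ?thesis using ineq[OF t\<psi> \<psi>0, of "\<tau>/2" z] \<tau> by (simp add: \<phi>_def)
    qed
    have main: "c0 * (LINT w|lborel. indicator (past \<tau>) w * v w) \<le>
        M1 * (LINT w|lborel. indicator QQ w * v (aff 0 \<rho> (\<rho>\<^sup>2) w)) + K * (\<delta> + (LINT w|lborel. indicator QQ w * \<bar>f w\<bar>))"
      if vc: "continuous_on QQ v" and gc: "continuous_on QQ g" and v: "\<forall>w\<in>QQ. 0 \<le> v w \<and> v w \<le> 1" and g: "\<forall>w\<in>QQ. \<bar>g w\<bar> \<le> \<delta>"
        and f: "integrable lborel (\<lambda>w. indicator QQ w * f w)" and pv: "pv QQ v (\<lambda>w. v w + g w) f"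
      for v g f :: "'a \<times> real \<Rightarrow> real" and \<delta>
    proof -
      have \<delta>: "0 \<le> \<delta>"
      proof -
        have "(0, -1/2) \<in> (QQ :: ('a \<times> real) set)" by (simp add: Cq_def)
        then show ?thesis using g abs_ge_zero order_trans by blast
      qed
      define v' g' f' where "v' w = indicator QQ w * v w" "g' w = indicator QQ w * g w" "f' w = indicator QQ w * f w" for w
      have v'm: "v' \<in> borel_measurable borel" unfolding v'_g'_f'_def[abs_def] by (rule indicator_measurable[OF vc]) simp
      have g'm: "g' \<in> borel_measurable borel" unfolding v'_g'_f'_def[abs_def] by (rule indicator_measurable[OF gc]) simp
      note [measurable] = v'm g'm
      have v'b: "0 \<le> v' w" "v' w \<le> 1" "\<bar>v' w\<bar> \<le> 1" for w using v by (auto simp: v'_g'_f'_def indicator_def)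
      have g'b: "\<bar>g' w\<bar> \<le> \<delta> * indicator QQ w" "\<bar>g' w\<bar> \<le> \<delta>" for w using g \<delta> by (auto simp: v'_g'_f'_def indicator_def)
      have f'i: "integrable lborel f'" using f by (simp add: v'_g'_f'_def[abs_def])
      have pv': "pv QQ v' (\<lambda>w. v' w + g' w) f'"
        using pv by (subst pv_cong[of _ _ v _ "\<lambda>w. v w + g w" _ f]) (auto simp: v'_g'_f'_def)
      have vi: "integrable lborel v'"
        unfolding v'_g'_f'_def[abs_def] using v by (intro Cq_mult_integrable[where B = 1] indicator_measurable vc) auto
      have i\<phi>: "integrable lborel (dt \<phi>)" "integrable lborel (lap \<phi>)"
        using test_fun_dt[OF t\<phi>] test_fun_lap[OF t\<phi>] by (auto intro: test_fun_integrable)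
      have ia: "integrable lborel (\<lambda>w. v' w * (dt \<phi> w + lap \<phi> w))" "integrable lborel (\<lambda>w. g' w * lap \<phi> w)"
        by (rule bounded_times_integrable[OF _ _ v'b(3)]; use i\<phi> in auto)
          (rule bounded_times_integrable[OF i\<phi>(2) _ g'b(2)]; simp)
      have [measurable]: "\<phi> \<in> borel_measurable borel" "\<psi> \<in> borel_measurable borel"
        using t\<phi> C(1) by (auto intro!: borel_measurable_continuous_onI smooth_continuous test_fun_smooth)
      have if\<phi>: "integrable lborel (\<lambda>w. f' w * \<phi> w)"
        using bounded_times_integrable[where a = \<phi> and B = K2, OF f'i] K2(2) by (simp add: mult.commute)
      have "0 = (LINT w|lborel. v' w * dt \<phi> w + (v' w + g' w) * lap \<phi> w + f' w * \<phi> w)"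
        using pv' t\<phi> by (simp add: pv_def)
      also have "\<dots> = (LINT w|lborel. v' w * (dt \<phi> w + lap \<phi> w) + g' w * lap \<phi> w + f' w * \<phi> w)"
        by (rule Bochner_Integration.integral_cong) (auto simp: algebra_simps)
      also have "\<dots> = (LINT w|lborel. v' w * (dt \<phi> w + lap \<phi> w)) + (LINT w|lborel. g' w * lap \<phi> w) + (LINT w|lborel. f' w * \<phi> w)"
        using ia if\<phi> by simp
      finally have id0: "0 = (LINT w|lborel. v' w * (dt \<phi> w + lap \<phi> w)) + (LINT w|lborel. g' w * lap \<phi> w) + (LINT w|lborel. f' w * \<phi> w)" .
      have iv\<psi>: "integrable lborel (\<lambda>w. v' w * \<psi> w)"
        by (rule bounded_times_integrable[OF test_fun_integrable[OF t\<psi>] _ v'b(3)]) simp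
      have pm: "past \<tau> \<in> sets borel" unfolding past_def by (intro borel_open open_Times) auto
      have ivp: "integrable lborel (\<lambda>w. indicator (past \<tau>) w * v' w)"
        using integrable_mult_indicator[OF _ vi, of "past \<tau>"] pm by simp
      have p1: "- (LINT w|lborel. v' w * \<psi> w) + c0 * (LINT w|lborel. indicator (past \<tau>) w * v' w) \<le> (LINT w|lborel. v' w * (dt \<phi> w + lap \<phi> w))"
      proof -
        have "- (LINT w|lborel. v' w * \<psi> w) + c0 * (LINT w|lborel. indicator (past \<tau>) w * v' w) =
          (LINT w|lborel. - (v' w * \<psi> w) + c0 * (indicator (past \<tau>) w * v' w))"
          using iv\<psi> ivp by simp
        also have "\<dots> \<le> (LINT w|lborel. v' w * (dt \<phi> w + lap \<phi> w))"
        proof (rule integral_mono[OF _ ia(1)])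
          show "- (v' w * \<psi> w) + c0 * (indicator (past \<tau>) w * v' w) \<le> v' w * (dt \<phi> w + lap \<phi> w)" for w
            using mult_left_mono[OF lower[of w] v'b(1)[of w]] by (simp add: algebra_simps)
        qed (use iv\<psi> ivp in auto)
        finally show ?thesis .
      qed
      have p2: "- (LINT w|lborel. g' w * lap \<phi> w) \<le> \<delta> * K1 * vQ TYPE('a)"
      proof -
        have "- (LINT w|lborel. g' w * lap \<phi> w) = (LINT w|lborel. - (g' w * lap \<phi> w))" by simp
        also have "\<dots> \<le> (LINT w|lborel. (\<delta> * K1) * indicator (QQ :: ('a \<times> real) set) w)"
        proof (rule integral_mono)
          show "- (g' w * lap \<phi> w) \<le> (\<delta> * K1) * indicator QQ w" for w
          proof -
            have "\<bar>g' w * lap \<phi> w\<bar> \<le> (\<delta> * indicator QQ w) * K1"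
              unfolding abs_mult using K1 \<delta> by (intro mult_mono g'b) auto
            then show ?thesis by (simp add: abs_le_iff mult_ac)
          qed
          show "integrable lborel (\<lambda>w. (\<delta> * K1) * indicator (QQ :: ('a \<times> real) set) w)"
            using Cq_integrable[of "0::'a \<times> real" 1] by (rule integrable_mult_right)
        qed (use ia in auto)
        also have "\<dots> = \<delta> * K1 * vQ TYPE('a)" by (simp add: vQ_def)
        finally show ?thesis .
      qed
      have p3: "- (LINT w|lborel. f' w * \<phi> w) \<le> K2 * (LINT w|lborel. \<bar>f' w\<bar>)"
      proof -
        have "- (LINT w|lborel. f' w * \<phi> w) = (LINT w|lborel. - (f' w * \<phi> w))" by simp
        also have "\<dots> \<le> (LINT w|lborel. K2 * \<bar>f' w\<bar>)"
        proof (rule integral_mono)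
          show "- (f' w * \<phi> w) \<le> K2 * \<bar>f' w\<bar>" for w
          proof -
            have "\<bar>f' w * \<phi> w\<bar> \<le> \<bar>f' w\<bar> * K2" unfolding abs_mult by (intro mult_left_mono K2) auto
            then show ?thesis by (simp add: abs_le_iff mult_ac)
          qed
        qed (use if\<phi> f'i in auto)
        finally show ?thesis by simp
      qed
      have p4: "(LINT w|lborel. v' w * \<psi> w) \<le> M1 * (LINT w|lborel. indicator QQ w * v (aff 0 \<rho> (\<rho>\<^sup>2) w))"
      proof -
        have sub: "Cq 0 \<rho> \<subseteq> (QQ :: ('a \<times> real) set)" using \<rho> \<rho>' by (intro Cq_subset) auto
        have subw: "aff 0 \<rho> (\<rho>\<^sup>2) w \<in> QQ" if "w \<in> QQ" for w :: "'a \<times> real" using Cq_aff0[OF \<rho>(1), of 0 w] sub that by blast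
        have "(LINT w|lborel. v' w * \<psi> w) = (LINT w|lborel. v' (aff 0 \<rho> (\<rho>\<^sup>2) w) * \<psi>1 w)"
          by (rule sb2) measurable
        also have "\<dots> \<le> (LINT w|lborel. M1 * (indicator QQ w * v' (aff 0 \<rho> (\<rho>\<^sup>2) w)))"
        proof (rule integral_mono)
          show "v' (aff 0 \<rho> (\<rho>\<^sup>2) w) * \<psi>1 w \<le> M1 * (indicator QQ w * v' (aff 0 \<rho> (\<rho>\<^sup>2) w))" for w
          proof (cases "w \<in> QQ")
            case True
            have "v' (aff 0 \<rho> (\<rho>\<^sup>2) w) * \<psi>1 w \<le> v' (aff 0 \<rho> (\<rho>\<^sup>2) w) * M1"
              using M1(2)[of w] v'b by (intro mult_left_mono) auto
            then show ?thesis using True by (simp add: mult.commute)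
          next
            case False
            then have "\<psi>1 w = 0" using t1 by (auto elim: test_funE)
            then show ?thesis using False by simp
          qed
          have "(\<lambda>w. v' (aff 0 \<rho> (\<rho>\<^sup>2) w)) \<in> borel_measurable borel" by measurable
          then show "integrable lborel (\<lambda>w. v' (aff 0 \<rho> (\<rho>\<^sup>2) w) * \<psi>1 w)"
            by (intro bounded_times_integrable[where B = 1] test_fun_integrable[OF t1] v'b) simp
          show "integrable lborel (\<lambda>w. M1 * (indicator QQ w * v' (aff 0 \<rho> (\<rho>\<^sup>2) w)))"
            by (intro integrable_mult_right Cq_mult_integrable[where B = 1] v'b) measurable
        qed
        also have "\<dots> = M1 * (LINT w|lborel. indicator QQ w * v' (aff 0 \<rho> (\<rho>\<^sup>2) w))" by simp
        also have "(LINT w|lborel. indicator QQ w * v' (aff 0 \<rho> (\<rho>\<^sup>2) w)) = (LINT w|lborel. indicator QQ w * v (aff 0 \<rho> (\<rho>\<^sup>2) w))"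
          using subw by (intro Bochner_Integration.integral_cong) (auto simp: v'_g'_f'_def indicator_def)
        finally show ?thesis .
      qed
      have past_sub: "past \<tau> \<subseteq> (QQ :: ('a \<times> real) set)" using \<tau> by (auto simp: past_def Cq_def)
      have e1: "(LINT w|lborel. indicator (past \<tau>) w * v' w) = (LINT w|lborel. indicator (past \<tau>) w * v w)"
        using past_sub by (intro Bochner_Integration.integral_cong) (auto simp: v'_g'_f'_def indicator_def)
      have e2: "(LINT w|lborel. \<bar>f' w\<bar>) = (LINT w|lborel. indicator QQ w * \<bar>f w\<bar>)"
        by (intro Bochner_Integration.integral_cong) (auto simp: v'_g'_f'_def abs_mult)
      define Fn where "Fn = (LINT w|lborel. indicator QQ w * \<bar>f w\<bar>)"
      have Fn: "0 \<le> Fn" by (simp add: Fn_def)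
      have "\<delta> * K1 * vQ TYPE('a) + K2 * Fn \<le> K * (\<delta> + Fn)"
      proof -
        have "0 \<le> K2 * \<delta>" "0 \<le> K1 * vQ TYPE('a) * Fn" using K1 K2 \<delta> Fn vQ_pos[where 'a='a] by auto
        then show ?thesis by (simp add: K_def algebra_simps)
      qed
      then show ?thesis using id0 p1 p2 p3 p4 unfolding e1 e2 Fn_def[symmetric] by linarith
    qed
    show "\<exists>K>0. past_control TYPE('a) \<tau> c0 M1 \<rho> K"
      using K main unfolding past_control_def by blast
  qed
qed

text \<open>The scale invariant growth would be \<open>r ^ d\<close>; the additional factor \<open>sqrt r\<close> makes the errors
  summable over dyadic scales.\<close>
definition morrey :: "real \<Rightarrow> ('a::euclidean_space \<times> real \<Rightarrow> real) \<Rightarrow> bool" where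
  "morrey F f \<longleftrightarrow> (\<forall>z r. 0 < r \<and> norm (fst z) + r \<le> 1 \<and> -1 \<le> snd z - r\<^sup>2 \<and> snd z \<le> 0 \<longrightarrow>
     (LINT w|lborel. indicator (Cq z r) w * \<bar>f w\<bar>) \<le> F * r ^ DIM('a) * sqrt r)"

lemma Cq_subset_QQ:
  assumes "norm (fst z) + r \<le> 1" "-1 \<le> snd z - r\<^sup>2" "snd z \<le> 0"
  shows "Cq z r \<subseteq> (QQ :: ('a::euclidean_space \<times> real) set)"
proof
  fix w assume w: "w \<in> Cq z r"
  obtain x t where xt: "w = (x, t)" by (cases w)
  have "norm (x - fst z) < r" "snd z - r\<^sup>2 < t" "t < snd z" using w by (auto simp: xt Cq_def dist_norm norm_minus_commute)
  moreover have "norm x \<le> norm (fst z) + norm (x - fst z)" using norm_triangle_ineq[of "fst z" "x - fst z"] by simp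
  ultimately show "w \<in> QQ" using assms by (simp add: xt Cq_def dist_norm)
qed

lemma morrey_rescale:
  fixes f a :: "'a::euclidean_space \<times> real \<Rightarrow> real"
  assumes s: "sol m f a" and F: "morrey F f" "0 \<le> F" and R: "0 < R" "R \<le> 1"
    and z: "norm (fst z) + R \<le> 1" "-1 \<le> snd z - R\<^sup>2" "snd z \<le> 0"
  shows "morrey0 F (\<lambda>w. R\<^sup>2 * f (aff z R (R\<^sup>2) w))"
  unfolding morrey0_def
proof (intro allI impI)
  fix r :: real assume r: "0 < r \<and> r \<le> 1"
  have Rr: "0 < R * r" "R * r \<le> R" using R r by (auto simp: mult_left_le)
  have "(R * r)\<^sup>2 \<le> R\<^sup>2" using Rr R by (intro power_mono) auto
  then have zr: "norm (fst z) + R * r \<le> 1" "-1 \<le> snd z - (R * r)\<^sup>2" using z Rr by linarith+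
  have m: "(\<lambda>w. indicator (Cq (aff z R (R\<^sup>2) 0) (R * r)) w * \<bar>f w\<bar>) \<in> borel_measurable borel"
    unfolding aff_0 by (rule indicator_subset_measurable(2)[OF sol_f_measurable[OF s] Cq_subset_QQ[OF zr z(3)]]) simp
  have "R ^ DIM('a) * (LINT w|lborel. indicator (Cq 0 r) w * \<bar>R\<^sup>2 * f (aff z R (R\<^sup>2) w)\<bar>) =
      R ^ (DIM('a) + 2) * (LINT w|lborel. indicator (Cq 0 r) w * \<bar>f (aff z R (R\<^sup>2) w)\<bar>)"
    by (simp add: abs_mult mult.left_commute power_add power2_eq_square)
  also have "\<dots> = (LINT w|lborel. indicator (Cq z (R * r)) w * \<bar>f w\<bar>)"
    using integral_Cq_transfer[OF R(1) _ m] r by (simp add: aff_0)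
  also have "\<dots> \<le> F * (R * r) ^ DIM('a) * sqrt (R * r)"
    using F Rr zr z unfolding morrey_def by blast
  also have "\<dots> \<le> F * (R * r) ^ DIM('a) * sqrt r"
    using F r R by (intro mult_left_mono real_sqrt_le_mono) (auto simp: mult_left_le_one_le)
  also have "\<dots> = R ^ DIM('a) * (F * r ^ DIM('a) * sqrt r)" by (simp add: power_mult_distrib)
  finally show "(LINT w|lborel. indicator (Cq 0 r) w * \<bar>R\<^sup>2 * f (aff z R (R\<^sup>2) w)\<bar>) \<le> F * r ^ DIM('a) * sqrt r"
    using R by simp
qed

context iteration begin

lemma small_slope_mono: "small_slope \<delta> \<Longrightarrow> 0 < \<delta>' \<Longrightarrow> \<delta>' \<le> \<delta> \<Longrightarrow> small_slope \<delta>'"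
proof -
  assume a: "small_slope \<delta>" "0 < \<delta>'" "\<delta>' \<le> \<delta>"
  then have p: "\<delta>'\<^sup>2 \<le> \<delta>\<^sup>2" by (intro power_mono) auto
  have v: "0 < vQ TYPE('a)" by (rule vQ_pos)
  have "128 * C * \<delta>'\<^sup>2 \<le> 128 * C * \<delta>\<^sup>2" "32 * C * \<delta>'\<^sup>2 * vQ TYPE('a) \<le> 32 * C * \<delta>\<^sup>2 * vQ TYPE('a)"
    using p C v by (intro mult_left_mono mult_right_mono; simp)+
  then show ?thesis using a by (auto simp: small_slope_def)
qed

end

lemma integral_le_sqrt_nrm2:
  fixes h :: "'a::euclidean_space \<times> real \<Rightarrow> real"
  assumes "continuous_on QQ h" "\<And>w. w \<in> QQ \<Longrightarrow> \<bar>h w\<bar> \<le> B"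
  shows "(LINT w|lborel. indicator QQ w * h w) \<le> sqrt (vQ TYPE('a) * nrm2 h)"
proof -
  have m: "(\<lambda>w. indicator QQ w * h w) \<in> borel_measurable borel" using assms by (intro indicator_measurable) auto
  have i: "integrable lborel (\<lambda>w. indicator QQ w * h w)" by (rule Cq_mult_integrable[OF m assms(2)])
  have i2: "integrable lborel (\<lambda>w. (indicator QQ w * h w)\<^sup>2)"
  proof -
    have "integrable lborel (\<lambda>w. (indicator QQ w * h w) * (indicator QQ w * h w))"
      by (rule bounded_times_integrable[OF i, where B = "max B 0"]) (use m assms(2) in \<open>auto simp: indicator_def le_max_iff_disj\<close>)
    then show ?thesis by (simp add: power2_eq_square)
  qed
  have "(LINT w|lborel. indicator QQ w * h w)\<^sup>2 \<le> measure lborel (QQ :: ('a \<times> real) set) * (LINT w|lborel. (indicator QQ w * h w)\<^sup>2)"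
    by (rule square_integral_le[OF _ Cq_finite i i2]) auto
  also have "\<dots> = vQ TYPE('a) * nrm2 h"
  proof -
    have "(indicator QQ w * h w)\<^sup>2 = indicator QQ w * (h w)\<^sup>2" for w by (simp add: indicator_def)
    then show ?thesis by (simp add: vQ_def nrm2_def)
  qed
  finally show ?thesis by (rule real_le_rsqrt)
qed

text \<open>The constants are chosen backwards from \<open>\<eta>\<close>: \<open>\<nu>\<close> is
  the mass in \<open>Cq z (1/4)\<close> that \<open>upper_bound\<close> tolerates,
  \<open>\<tau>\<close> makes the top slab carry at most half of it, \<open>\<mu>\<close> is the
  integral near the top that \<open>past_control\<close> allows in turn, and \<open>x\<close> the
  flatness that guarantees it. Only then are the radius \<open>\<rho>1\<close>, the constant
  \<open>K\<close> belonging to it and the remaining smallness parameters selected, with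
  \<open>\<epsilon>\<close> last.\<close>

lemma core_estimate:
  assumes \<eta>: "0 < \<eta>" "\<eta> < 1"
  shows "\<exists>\<epsilon> F0. 0 < \<epsilon> \<and> 0 < F0 \<and> (\<forall>m (f :: 'a::euclidean_space \<times> real \<Rightarrow> real) a. 0 < m - 1 \<and> m - 1 < \<epsilon> \<longrightarrow> sol m f a \<longrightarrow> a 0 = 0 \<longrightarrow> morrey F0 f \<longrightarrow>
     (\<forall>z. norm (fst z) < 1/4 \<longrightarrow> -1/16 < snd z \<longrightarrow> snd z \<le> 0 \<longrightarrow> a z \<le> \<eta>))"
proof -
  define v where "v = vQ TYPE('a)"
  have v: "0 < v" using vQ_pos by (simp add: v_def)
  obtain C1 :: real where C1: "1 \<le> C1" "2 \<le> C1\<^sup>2 * vQ TYPE('a)"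
    and os: "\<And>\<omega> \<rho>m. 0 < \<omega> \<Longrightarrow> 0 < \<rho>m \<Longrightarrow> \<exists>\<rho> C. \<rho> \<le> \<rho>m \<and> flatness_step TYPE('a) C1 \<omega> \<rho> C"
    using one_step[where 'a='a] by blast
  obtain \<rho> C where it: "iteration TYPE('a) C1 \<rho> C"
    using os[of "1/64" 1] C1 unfolding iteration_def by auto
  interpret iteration "TYPE('a)" C1 \<rho> C by (rule it)
  define d where "d = DIM('a)"
  define B where "B = measure lborel (ball 0 (1/2) :: 'a set)"
  have B: "0 \<le> B" by (simp add: B_def)
  \<comment> \<open>\<open>4 ^ (d + 2)\<close> is the volume factor of the rescaling by 1/4; with it
    the square root in \<open>upper_bound\<close> becomes \<open>\<eta> / (4 * C1)\<close>.\<close>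
  define \<nu> where "\<nu> = (\<eta> / (4 * C1))\<^sup>2 / 4 ^ (d + 2)"
  have \<nu>: "0 < \<nu>" using \<eta> C1 by (simp add: \<nu>_def)
  define \<tau> where "\<tau> = min (1/16) (\<nu> / (2 * (B + 1)))"
  have \<tau>: "0 < \<tau>" "\<tau> \<le> 1/16" "\<tau> * B \<le> \<nu> / 2"
  proof -
    show "0 < \<tau>" using \<nu> B by (simp add: \<tau>_def)
    show "\<tau> \<le> 1/16" unfolding \<tau>_def by (rule min.cobounded1)
    have "\<tau> * B \<le> \<nu> / (2 * (B + 1)) * (B + 1)" using B \<nu> by (intro mult_mono) (auto simp: \<tau>_def)
    also have "\<nu> / (2 * (B + 1)) * (B + 1) = \<nu> / 2" using B by (simp add: divide_simps)
    finally show "\<tau> * B \<le> \<nu> / 2" .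
  qed
  obtain c0 \<rho>0 M1 :: real where c0: "0 < c0" "0 < \<rho>0" "0 < M1" and
    past: "\<And>\<rho>. 0 < \<rho> \<Longrightarrow> \<rho> \<le> \<rho>0 \<Longrightarrow> \<exists>K>0. past_control TYPE('a) \<tau> c0 M1 \<rho> K"
    using past_estimate[OF \<tau>(1), where 'a='a] by blast
  define \<mu> where "\<mu> = c0 * \<nu> / (4 * M1)"
  have \<mu>: "0 < \<mu>" using c0 \<nu> by (simp add: \<mu>_def)
  define x where "x = \<mu> / (2 * (sqrt v + 2 * C1 * v))"
  have sv: "0 < sqrt v + 2 * C1 * v" using v C1 by (simp add: add_pos_pos)
  have x: "0 < x" "x * (sqrt v + 2 * C1 * v) = \<mu> / 2"
    using \<mu> sv by (simp_all add: x_def) (simp add: divide_simps algebra_simps)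
  \<comment> \<open>As \<open>nrm2 a\<close> is at most \<open>v\<close>, this choice lets flatness,
    \<open>g\<close> and \<open>f\<close> contribute at most a third of \<open>x\<^sup>2\<close>
    each.\<close>
  have "0 < x\<^sup>2 / (3 * v)" using x v by simp
  then obtain \<rho>1 C' where \<rho>1': "\<rho>1 \<le> \<rho>0" and os1: "flatness_step TYPE('a) C1 (x\<^sup>2 / (3 * v)) \<rho>1 C'"
    using os c0(2) by blast
  then have \<rho>1: "0 < \<rho>1" "\<rho>1 \<le> 1/4" "\<rho>1 \<le> \<rho>0" "0 < C'" by (auto simp: flatness_step_def)
  obtain K where K: "0 < K" and past1: "past_control TYPE('a) \<tau> c0 M1 \<rho>1 K"
    using past[OF \<rho>1(1,3)] by blast
  define \<kappa> where "\<kappa> = min (1/2) (min (\<mu> / (4 * v)) (\<eta> / (12 * C1)))"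
  have "0 < \<kappa> \<and> \<kappa> \<le> 1/2 \<and> \<kappa> \<le> \<mu> / (4 * v) \<and> \<kappa> \<le> \<eta> / (12 * C1)"
    unfolding \<kappa>_def using \<mu> v \<eta> C1 by (auto simp del: times_divide_eq_right le_divide_eq_numeral divide_le_eq_numeral)
  then have \<kappa>: "0 < \<kappa>" "\<kappa> < 1" "\<kappa> * v \<le> \<mu> / 4" "3 * C1 * \<kappa> \<le> \<eta> / 4"
    using v C1 by (auto simp: field_simps)
  obtain \<delta>s where \<delta>s: "small_slope \<delta>s" using small_slope_exists by blast
  define \<delta> where "\<delta> = min (min \<delta>s (x / (sqrt (3 * C' * v)))) (c0 * \<nu> / (8 * K))"
  have \<delta>0: "0 < \<delta>" using \<delta>s x \<rho>1 v c0 \<nu> K by (simp add: \<delta>_def small_slope_def)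
  have \<delta>: "small_slope \<delta>" using small_slope_mono[OF \<delta>s \<delta>0] by (simp add: \<delta>_def)
  have \<delta>1: "\<delta> \<le> 1" using \<delta> by (simp add: small_slope_def)
  have \<delta>x: "C' * (\<delta>\<^sup>2 * v) \<le> x\<^sup>2 / 3"
  proof -
    have "\<delta> \<le> x / sqrt (3 * C' * v)" by (simp add: \<delta>_def)
    then have "\<delta>\<^sup>2 \<le> (x / sqrt (3 * C' * v))\<^sup>2" using \<delta>0 by (intro power_mono) auto
    also have "\<dots> = x\<^sup>2 / (3 * C' * v)" using \<rho>1 v by (simp add: power_divide)
    finally show ?thesis using \<rho>1 v by (simp add: field_simps)
  qed
  have \<delta>K: "K * \<delta> \<le> c0 * \<nu> / 8"
  proof -
    have "\<delta> \<le> c0 * \<nu> / (8 * K)" by (simp add: \<delta>_def)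
    then show ?thesis using K by (simp add: field_simps)
  qed
  have "0 < min (\<mu> / (4 * v)) (\<eta> / 8)" using \<mu> v \<eta> by simp
  then obtain Ft where Ft: "0 < Ft" "\<And>F. 0 \<le> F \<Longrightarrow> F \<le> Ft \<Longrightarrow> tail F \<le> min (\<mu> / (4 * v)) (\<eta> / 8)"
    using tail_small by blast
  define F0 where "F0 = min Ft (min (x\<^sup>2 / (3 * C')) (c0 * \<nu> / (8 * K)))"
  have F0: "0 < F0" using Ft x \<rho>1 c0 \<nu> K by (simp add: F0_def zero_less_power)
  have "tail F0 \<le> min (\<mu> / (4 * v)) (\<eta> / 8)" using F0 by (intro Ft(2)) (auto simp: F0_def)
  then have F0t: "tail F0 * v \<le> \<mu> / 4" "tail F0 \<le> \<eta> / 8" using v by (auto simp: field_simps)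
  have F0x: "C' * F0 \<le> x\<^sup>2 / 3"
  proof -
    have "F0 \<le> x\<^sup>2 / (3 * C')" by (simp add: F0_def)
    then show ?thesis using \<rho>1 by (simp add: field_simps)
  qed
  have F0K: "K * F0 \<le> c0 * \<nu> / 8"
  proof -
    have "F0 \<le> c0 * \<nu> / (8 * K)" by (simp add: F0_def)
    then show ?thesis using K by (simp add: field_simps)
  qed
  obtain \<epsilon> where \<epsilon>: "0 < \<epsilon>" "\<And>m. 0 < m - 1 \<Longrightarrow> m - 1 < \<epsilon> \<Longrightarrow> secant_close m \<kappa> \<delta>"
    using secant_close_exists[OF \<kappa>(1,2) \<delta>0] by blast
  have main: "a z \<le> \<eta>" if m: "0 < m - 1" "m - 1 < \<epsilon>" and s: "sol m f a" and a0: "a 0 = 0" and F: "morrey F0 f"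
    and z: "norm (fst z) < 1/4" "-1/16 < snd z" "snd z \<le> 0" for m and f a :: "'a \<times> real \<Rightarrow> real" and z
  proof -
    have m1: "1 < m" using m by simp
    note sec = \<epsilon>(2)[OF m]
    note ab = sol_bounds[OF s] and ac = sol_cont[OF s]
    have fi: "integrable lborel (\<lambda>w. indicator QQ w * f w)" using s by (simp add: sol_def)
    define g where "g w = a w powr m - a w" for w
    have gb: "\<bar>g w\<bar> \<le> \<delta>" if w: "w \<in> QQ" for w
    proof -
      \<comment> \<open>At the base point 1 the function \<open>u powr m - u\<close> vanishes, so
        the secant bound becomes a bound for \<open>g\<close> itself.\<close>
      have "1 \<in> {\<kappa>..2::real}" "a w \<in> {0..1}" using \<kappa> ab[OF w] by auto
      then have "\<bar>(a w powr m - a w) - (1 powr m - 1)\<bar> \<le> \<delta> * \<bar>a w - 1\<bar>" using sec unfolding secant_close_def by blast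
      also have "\<dots> \<le> \<delta> * 1" using ab[OF w] \<delta>0 by (intro mult_left_mono) auto
      finally show ?thesis by (simp add: g_def)
    qed
    have gc: "continuous_on QQ g" unfolding g_def
      using m1 ab by (intro continuous_intros continuous_on_powr_nonneg ac) auto
    have pv: "pv QQ a (\<lambda>w. a w + g w) f" using s by (simp add: sol_def g_def)
    define F1 where "F1 = (LINT w|lborel. indicator QQ w * \<bar>f w\<bar>)"
    have F1: "F1 \<le> F0"
      using F[unfolded morrey_def, rule_format, of 1 0] by (simp add: F1_def)
    have n2a: "nrm2 a \<le> v"
      using nrm2_mono[of a "\<lambda>w. 0" 1 0 1] ac ab by (fastforce simp: v_def power_le_one continuous_intros)
    have n2g: "nrm2 g \<le> \<delta>\<^sup>2 * v"
    proof -
      have "nrm2 g \<le> 0 * nrm2 (\<lambda>w::'a\<times>real. 0) + \<delta>\<^sup>2 * vQ TYPE('a)"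
      proof (rule nrm2_mono[where B = \<delta>])
        show "(g w)\<^sup>2 \<le> 0 * 0\<^sup>2 + \<delta>\<^sup>2" if "w \<in> QQ" for w using power_mono[OF gb[OF that], of 2] by simp
      qed (use gc gb \<delta>0 in \<open>auto intro!: continuous_intros\<close>)
      then show ?thesis by (simp add: v_def)
    qed
    let ?a1 = "\<lambda>w. a (aff 0 \<rho>1 (\<rho>1\<^sup>2) w)"
    have s1: "sol m (\<lambda>w. \<rho>1\<^sup>2 * f (aff 0 \<rho>1 (\<rho>1\<^sup>2) w)) ?a1" using m1 \<rho>1 by (intro sol_rescale0[OF s]) auto
    note a1b = sol_bounds[OF s1] and a1c = sol_cont[OF s1]
    have "\<rho>1\<^sup>2 \<le> 1" using \<rho>1 by (intro power_le_one) auto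
    then have mo1: "morrey0 F0 (\<lambda>w. \<rho>1\<^sup>2 * f (aff 0 \<rho>1 (\<rho>1\<^sup>2) w))"
      using \<rho>1 F0 by (intro morrey_rescale[OF s F]) auto
    have "\<exists>b. \<bar>b\<bar> \<le> C1 * sqrt (nrm2 a) \<and> nrm2 (\<lambda>w. ?a1 w - b) \<le> (x\<^sup>2 / (3 * v)) * nrm2 a + C' * nrm2 g + C' * F1"
      unfolding F1_def
    proof (rule flatness_stepD[OF os1 ac gc _ _ fi pv]; intro ballI)
      fix w :: "'a \<times> real" assume "w \<in> QQ"
      then show "\<bar>a w\<bar> \<le> 2" "\<bar>g w\<bar> \<le> 2" using ab[of w] gb[of w] \<delta>1 by auto
    qed
    then obtain b where b: "nrm2 (\<lambda>w. ?a1 w - b) \<le> (x\<^sup>2 / (3 * v)) * nrm2 a + C' * nrm2 g + C' * F1" by blast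
    define c where "c = max 0 (min 1 b)"
    have c: "0 \<le> c" "c \<le> 1" by (auto simp: c_def)
    have "nrm2 (\<lambda>w. ?a1 w - c) \<le> 1 * nrm2 (\<lambda>w. ?a1 w - b) + 0 * vQ TYPE('a)"
    proof (rule nrm2_mono[where B = "1 + \<bar>b\<bar>"])
      fix w :: "'a \<times> real" assume w: "w \<in> QQ"
      show "\<bar>?a1 w - c\<bar> \<le> 1 + \<bar>b\<bar>" "\<bar>?a1 w - b\<bar> \<le> 1 + \<bar>b\<bar>" using a1b[OF w] c by auto
      have "\<bar>?a1 w - c\<bar> \<le> \<bar>?a1 w - b\<bar>" using a1b[OF w] by (auto simp: c_def)
      from power_mono[OF this, of 2] show "(?a1 w - c)\<^sup>2 \<le> 1 * (?a1 w - b)\<^sup>2 + 0" by simp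
    qed (intro continuous_intros a1c)+
    also have "\<dots> \<le> x\<^sup>2"
    proof -
      have "(x\<^sup>2 / (3 * v)) * nrm2 a \<le> (x\<^sup>2 / (3 * v)) * v" using n2a x v by (intro mult_left_mono) auto
      moreover have "(x\<^sup>2 / (3 * v)) * v = x\<^sup>2 / 3" using v by simp
      moreover have "C' * nrm2 g \<le> C' * (\<delta>\<^sup>2 * v)" using n2g \<rho>1 by (intro mult_left_mono) auto
      moreover have "C' * F1 \<le> C' * F0" using F1 \<rho>1 by (intro mult_left_mono) auto
      ultimately show ?thesis using b \<delta>x F0x by simp
    qed
    finally have nc: "nrm2 (\<lambda>w. ?a1 w - c) \<le> x\<^sup>2" .
    have sx: "sqrt (nrm2 (\<lambda>w. ?a1 w - c)) \<le> x"
      using real_sqrt_le_mono[OF nc] x by simp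
    \<comment> \<open>This is where the zero enters: a constant clearly above
      \<open>\<kappa>\<close> would propagate to the top by \<open>lower_bound\<close> and give
      \<open>\<kappa> \<le> a 0\<close>.\<close>
    have cle: "c \<le> \<kappa> + 2 * C1 * x + tail F0"
    proof (rule ccontr)
      assume "\<not> c \<le> \<kappa> + 2 * C1 * x + tail F0"
      moreover have "2 * C1 * sqrt (nrm2 (\<lambda>w. ?a1 w - c)) \<le> 2 * C1 * x" using sx C1 by (intro mult_left_mono) auto
      ultimately have "\<kappa> \<le> c - 2 * C1 * sqrt (nrm2 (\<lambda>w. ?a1 w - c)) - tail F0" by linarith
      from lower_bound[OF s1 m1 sec \<delta> \<kappa>(1,2) mo1 less_imp_le[OF F0] c this]
      show False using a0 \<kappa> by (simp add: aff_0)
    qed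
    have "(LINT w|lborel. indicator QQ w * ?a1 w) \<le> \<mu>"
    proof -
      have "(LINT w|lborel. indicator QQ w * (?a1 w - c)) \<le> sqrt (vQ TYPE('a) * nrm2 (\<lambda>w. ?a1 w - c))"
        using a1b c by (intro integral_le_sqrt_nrm2[where B = 1] continuous_intros a1c) force+
      also have "\<dots> \<le> sqrt v * x"
        using sx v by (simp add: real_sqrt_mult v_def[symmetric])
      finally have "(LINT w|lborel. indicator QQ w * (?a1 w - c)) \<le> sqrt v * x" .
      moreover have "(LINT w|lborel. indicator QQ w * (?a1 w - c)) = (LINT w|lborel. indicator QQ w * ?a1 w) - c * v"
      proof -
        have "integrable lborel (\<lambda>w. indicator QQ w * ?a1 w)"
          using a1b by (intro Cq_mult_integrable[where B = 1] indicator_measurable a1c) auto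
        moreover have "integrable lborel (\<lambda>w. indicator QQ (w::'a\<times>real) * c)" using Cq_integrable[of "0::'a \<times> real" 1] by simp
        ultimately show ?thesis by (simp add: right_diff_distrib v_def vQ_def mult.commute)
      qed
      moreover have "c * v \<le> (\<kappa> + 2 * C1 * x + tail F0) * v" using cle v by simp
      moreover have "sqrt v * x + (\<kappa> + 2 * C1 * x + tail F0) * v = x * (sqrt v + 2 * C1 * v) + \<kappa> * v + tail F0 * v"
        by (simp add: algebra_simps)
      ultimately show ?thesis using x(2) \<kappa>(3) F0t(1) by linarith
    qed
    then have "M1 * (LINT w|lborel. indicator QQ w * ?a1 w) \<le> M1 * \<mu>" using c0 by simp
    also have "M1 * \<mu> = c0 * \<nu> / 4" using c0 by (simp add: \<mu>_def)
    finally have am: "M1 * (LINT w|lborel. indicator QQ w * ?a1 w) \<le> c0 * \<nu> / 4" .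
    define pm where "pm = (LINT w|lborel. indicator (past \<tau>) w * a w)"
    have "c0 * pm \<le> M1 * (LINT w|lborel. indicator QQ w * ?a1 w) + K * (\<delta> + F1)"
      unfolding pm_def F1_def using ab gb by (intro past_controlD[OF past1 ac gc _ _ fi pv]) auto
    also have "\<dots> \<le> c0 * \<nu> / 4 + (c0 * \<nu> / 8 + c0 * \<nu> / 8)"
    proof -
      have "K * F1 \<le> K * F0" using F1 K by simp
      then show ?thesis using am \<delta>K F0K unfolding distrib_left by linarith
    qed
    finally have "c0 * pm \<le> c0 * (\<nu> / 2)" by (simp add: mult.commute[of \<nu>])
    then have pm: "pm \<le> \<nu> / 2" using c0 by simp
    have zz: "norm (fst z) + 1/4 \<le> 1" "-1 \<le> snd z - (1/4)\<^sup>2" "snd z \<le> 0" using z by (auto simp: power2_eq_square)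
    let ?az = "\<lambda>w. a (aff z (1/4) ((1/4)\<^sup>2) w)"
    have sz: "sol m (\<lambda>w. (1/4)\<^sup>2 * f (aff z (1/4) ((1/4)\<^sup>2) w)) ?az"
      using m1 by (intro sol_rescale[OF s _ _ zz]) auto
    have moz: "morrey0 F0 (\<lambda>w. (1/4)\<^sup>2 * f (aff z (1/4) ((1/4)\<^sup>2) w))"
      using F0 by (intro morrey_rescale[OF s F _ _ _ zz]) auto
    note azb = sol_bounds[OF sz] and azc = sol_cont[OF sz]
    have Cz: "Cq z (1/4) \<subseteq> QQ" by (rule Cq_subset_QQ[OF zz])
    have mz: "(\<lambda>w. indicator (Cq z (1/4)) w * a w) \<in> borel_measurable borel"
      by (intro indicator_measurable continuous_on_subset[OF ac Cz]) simp
    \<comment> \<open>Since \<open>a\<close> takes values between 0 and 1, its square is at most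
      \<open>a\<close>, and in the top slab \<open>a\<close> is replaced by 1.\<close>
    have nz: "nrm2 ?az \<le> 4 ^ (d + 2) * \<nu>"
    proof -
      have iz: "integrable lborel (\<lambda>w. indicator QQ w * ?az w)"
        using azb by (intro Cq_mult_integrable[where B = 1] indicator_measurable azc) auto
      have "nrm2 ?az \<le> (LINT w|lborel. indicator QQ w * ?az w)"
        unfolding nrm2_def
      proof (rule integral_mono[OF _ iz])
        show "integrable lborel (\<lambda>w. indicator QQ w * (?az w)\<^sup>2)"
          using azb by (intro Cq_mult_integrable[where B = 1] indicator_measurable continuous_intros azc) (auto intro: power_le_one)
        show "indicator QQ w * (?az w)\<^sup>2 \<le> indicator QQ w * ?az w" for w
          using azb[of w] by (cases "w \<in> QQ") (auto simp: power2_eq_square mult_left_le)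
      qed
      also have "\<dots> = 4 ^ (d + 2) * (LINT w|lborel. indicator (Cq z (1/4)) w * a w)"
        using integral_Cq_scale[OF _ mz] by (simp add: d_def power_divide)
      also have "(LINT w|lborel. indicator (Cq z (1/4)) w * a w) \<le> pm + \<tau> * B"
      proof -
        let ?S = "ball (0::'a) (1/2) \<times> {-\<tau>..0}"
        have pS: "past \<tau> \<in> sets borel" unfolding past_def by (intro borel_open open_Times) auto
        have SS: "?S \<in> sets borel" unfolding borel_prod[symmetric] by (intro pair_measureI) auto
        have iP: "integrable lborel (\<lambda>w. indicator (past \<tau>) w * a w)"
        proof -
          have "past \<tau> \<subseteq> (QQ :: ('a \<times> real) set)" using \<tau> by (auto simp: past_def Cq_def)
          then have eq: "indicator (past \<tau>) w *\<^sub>R (indicator QQ w * a w) = indicator (past \<tau>) w * a w" for w by (auto simp: indicator_def)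
          have "integrable lborel (\<lambda>w. indicator QQ w * a w)"
            using ab by (intro Cq_mult_integrable[where B = 1] indicator_measurable ac) auto
          from integrable_mult_indicator[OF _ this, of "past \<tau>"] show ?thesis using pS unfolding eq by simp
        qed
        have em: "emeasure lborel ?S = ennreal (B * \<tau>)"
        proof -
          have "emeasure lborel ?S = emeasure lborel (ball (0::'a) (1/2)) * emeasure lborel {-\<tau>..0}"
            unfolding lborel_prod[symmetric] by (rule lborel.emeasure_pair_measure_Times) auto
          then show ?thesis using \<tau> B emeasure_lborel_ball_finite[of "0::'a" "1/2"]
            by (simp add: B_def emeasure_eq_ennreal_measure ennreal_mult less_top)
        qed
        have iS: "integrable lborel (indicator ?S :: 'a \<times> real \<Rightarrow> real)"
          using SS em by (intro integrable_real_indicator) auto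
        have "(LINT w|lborel. indicator (Cq z (1/4)) w * a w) \<le> (LINT w|lborel. indicator (past \<tau>) w * a w + indicator ?S w)"
        proof (rule integral_mono)
          show "integrable lborel (\<lambda>w. indicator (Cq z (1/4)) w * a w)"
            using ab Cz by (intro Cq_mult_integrable[where B = 1] mz) auto
          show "indicator (Cq z (1/4)) w * a w \<le> indicator (past \<tau>) w * a w + indicator ?S w" for w
          proof (cases "w \<in> Cq z (1/4)")
            case True
            then have wQ: "w \<in> QQ" using Cz by blast
            obtain y t where yt: "w = (y, t)" by (cases w)
            have "norm (y - fst z) < 1/4" "snd z - (1/4)\<^sup>2 < t" "t < snd z"
              using True by (auto simp: yt Cq_def dist_norm norm_minus_commute)
            moreover have "norm y \<le> norm (fst z) + norm (y - fst z)" using norm_triangle_ineq[of "fst z" "y - fst z"] by simp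
            moreover have "(1/4)\<^sup>2 = (1/16::real)" by (simp add: power2_eq_square)
            ultimately have y: "norm y < 1/2" "-1/8 < t" "t \<le> 0" using z by linarith+
            have "w \<in> past \<tau> \<or> w \<in> ?S" using y by (auto simp: yt past_def)
            moreover have "a w \<le> 1" "0 \<le> a w" using ab[OF wQ] by auto
            ultimately show ?thesis using True by (auto simp: indicator_def)
          next
            case False
            have "past \<tau> \<subseteq> (QQ :: ('a \<times> real) set)" using \<tau> by (auto simp: past_def Cq_def)
            then show ?thesis using False ab(1)[of w] by (auto simp: indicator_def)
          qed
        qed (use iP iS in auto)
        also have "\<dots> = pm + B * \<tau>" using iP iS em \<tau> B by (simp add: pm_def measure_def)
        finally show ?thesis by (simp add: mult.commute)
      qed
      also have "pm + \<tau> * B \<le> \<nu>" using pm \<tau>(3) by linarith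
      finally show ?thesis by simp
    qed
    have "a z = ?az 0" by (simp add: aff_0)
    also have "\<dots> \<le> 0 + 2 * C1 * sqrt (nrm2 (\<lambda>w. ?az w - 0)) + 3 * C1 * \<kappa> + tail F0"
      by (rule upper_bound[OF sz m1 sec \<delta> \<kappa>(1,2) moz less_imp_le[OF F0]]) auto
    also have "sqrt (nrm2 (\<lambda>w. ?az w - 0)) \<le> \<eta> / (4 * C1)"
    proof -
      have "sqrt (nrm2 ?az) \<le> sqrt ((\<eta> / (4 * C1))\<^sup>2)"
        using nz by (intro real_sqrt_le_mono) (simp add: \<nu>_def)
      then show ?thesis using \<eta> C1 by simp
    qed
    finally have "a z \<le> 2 * C1 * (\<eta> / (4 * C1)) + 3 * C1 * \<kappa> + tail F0" using C1 by simp
    moreover have "2 * C1 * (\<eta> / (4 * C1)) = \<eta> / 2" using C1 by simp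
    \<comment> \<open>The three contributions are at most \<open>\<eta> / 2\<close>,
      \<open>\<eta> / 4\<close> and \<open>\<eta> / 8\<close>.\<close>
    ultimately show ?thesis using \<kappa>(4) F0t(2) \<eta> by linarith
  qed
  show ?thesis using \<epsilon>(1) F0 main by blast
qed

section \<open>From weak to very weak solutions\<close>

lemma pd_slice:
  fixes f :: "'a::euclidean_space \<times> real \<Rightarrow> real"
  assumes "f differentiable at (x, t)" "b \<in> Basis"
  shows "(\<lambda>y. f (y, t)) differentiable at x" "pd b (\<lambda>y. f (y, t)) x = pd (b, 0) f (x, t)"
proof -
  have "((\<lambda>y. (y, t)) has_derivative (\<lambda>h. (h, 0))) (at x)" by (auto intro!: derivative_eq_intros)
  from has_derivative_compose[OF this differentiable_has_derivative_pd[OF assms(1)]]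
  have 1: "((\<lambda>y. f (y, t)) has_derivative (\<lambda>h. \<Sum>i\<in>Basis. ((h, 0) \<bullet> i) * pd i f (x, t))) (at x)" .
  then show "(\<lambda>y. f (y, t)) differentiable at x" by (auto simp: differentiable_def)
  show "pd b (\<lambda>y. f (y, t)) x = pd (b, 0) f (x, t)"
    by (subst pd_eqI[OF 1]) (use assms(2) in \<open>simp add: sum_Basis_inner\<close>)
qed

lemma test_fun_slice:
  fixes f :: "'a::euclidean_space \<times> real \<Rightarrow> real"
  assumes "test_fun (U \<times> V) f"
  shows "test_fun U (\<lambda>x. f (x, t))"
proof -
  obtain C where C: "smooth f" "compact C" "C \<subseteq> U \<times> V" "\<And>x. x \<notin> C \<Longrightarrow> f x = 0"
    using assms by (auto elim: test_funE)
  show ?thesis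
  proof (rule test_funI)
    show "smooth (\<lambda>x. f (x, t))"
    proof (rule smooth_coinduct[of "\<lambda>g. \<exists>f. smooth f \<and> g = (\<lambda>x. f (x, t))"])
      show "\<exists>g. smooth g \<and> (\<lambda>x. f (x, t)) = (\<lambda>x. g (x, t))" using C(1) by blast
      fix g :: "'a \<Rightarrow> real" and x b :: 'a assume "\<exists>f. smooth f \<and> g = (\<lambda>x. f (x, t))"
      then obtain h where h: "smooth h" "g = (\<lambda>x. h (x, t))" by blast
      obtain i where i: "i \<in> (Basis :: 'a set)" using nonempty_Basis by blast
      show "g differentiable at x" unfolding h using pd_slice(1)[OF smooth_differentiable[OF h(1)] i] .
      assume b: "b \<in> Basis"
      have "pd b g = (\<lambda>x. pd (b, 0) h (x, t))"
        unfolding h using pd_slice(2)[OF smooth_differentiable[OF h(1)] b] by (simp add: fun_eq_iff)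
      then show "\<exists>f. smooth f \<and> pd b g = (\<lambda>x. f (x, t))" using smooth_pd[OF h(1) space_in_Basis[OF b]] by blast
    qed
    show "compact (fst ` C)" by (intro compact_continuous_image C continuous_intros)
    show "fst ` C \<subseteq> U" using C(3) by auto
    show "f (x, t) = 0" if "x \<notin> fst ` C" for x using C(4)[of "(x, t)"] that by force
  qed
qed

lemma deriv_time_slice:
  assumes "smooth \<phi>"
  shows "deriv (\<lambda>s. \<phi> (x, s)) t = dt \<phi> (x, t)"
proof (rule DERIV_imp_deriv)
  show "((\<lambda>s. \<phi> (x, s)) has_real_derivative dt \<phi> (x, t)) (at t)"
    using smooth_line_derivative[OF assms time_in_Basis, of "(x, 0)" t] by (simp add: dt_def)
qed

lemma grad_space_slice:
  fixes \<phi> :: "'a::euclidean_space \<times> real \<Rightarrow> real"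
  assumes "smooth \<phi>"
  shows "grad (\<lambda>y. \<phi> (y, t)) x = (\<Sum>b\<in>Basis. pd (b, 0) \<phi> (x, t) *\<^sub>R b)"
  unfolding grad_def pd_def[symmetric]
  by (intro sum.cong refl) (simp add: pd_slice(2)[OF smooth_differentiable[OF assms]])

lemma lebesgue_integral_lborel:
  fixes f :: "'a::euclidean_space \<Rightarrow> 'b::{banach, second_countable_topology}"
  shows "f \<in> borel_measurable borel \<Longrightarrow> (LINT x|lebesgue. f x) = (LINT x|lborel. f x)"
    and "integrable lborel f \<Longrightarrow> integrable lebesgue f"
    using integral_completion[of f lborel] integrable_completion[of f lborel]
    by (auto dest: borel_measurable_integrable)

lemma continuous_mult_test_fun_integrable:
  fixes v :: "'a::euclidean_space \<Rightarrow> real"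
  assumes v: "continuous_on U v" and h: "test_fun U h"
  shows "integrable lborel (\<lambda>x. v x * h x)"
proof -
  obtain K where K: "smooth h" "compact K" "K \<subseteq> U" "\<And>x. x \<notin> K \<Longrightarrow> h x = 0" using h by (auto elim: test_funE)
  have "integrable lborel (\<lambda>x. indicator K x *\<^sub>R (v x * h x))"
    by (intro borel_integrable_compact K(2) continuous_on_mult smooth_continuous[OF K(1)] continuous_on_subset[OF v K(3)])
  moreover have "(\<lambda>x. indicator K x *\<^sub>R (v x * h x)) = (\<lambda>x. v x * h x)" using K(4) by (auto simp: fun_eq_iff indicator_def)
  ultimately show ?thesis by simp
qed

lemma slice_weak_integrable:
  fixes v :: "'a::euclidean_space \<Rightarrow> real"
  assumes w: "has_weak_grad (ball 0 1) v g" and \<psi>: "test_fun (ball 0 1) \<psi>"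
  shows "integrable lebesgue (\<lambda>x. \<psi> x *\<^sub>R g x)" "integrable lebesgue (\<lambda>x. g x \<bullet> (\<Sum>b\<in>Basis. pd b \<psi> x *\<^sub>R b))"
proof -
  have gi: "loc_integrable (ball 0 1) g" using w by (simp add: has_weak_grad_def)
  have each: "integrable lebesgue (\<lambda>x. h x *\<^sub>R g x)" if h: "test_fun (ball 0 1) h" for h
  proof -
    obtain K where K: "smooth h" "compact K" "K \<subseteq> ball 0 1" "\<And>x. x \<notin> K \<Longrightarrow> h x = 0" using h by (auto elim: test_funE)
    obtain B where B: "\<And>x. \<bar>h x\<bar> \<le> B"
      using continuous_compact_support_bounded[OF smooth_continuous[OF K(1)] K(2,4)] by metis
    have hm: "h \<in> borel_measurable lebesgue"
      by (rule measurable_completion) (use smooth_continuous[OF K(1)] in \<open>auto intro: borel_measurable_continuous_onI\<close>)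
    have i: "integrable lebesgue (\<lambda>x. indicator K x *\<^sub>R g x)"
      using gi K by (auto simp: loc_integrable_def set_integrable_def)
    have "integrable lebesgue (\<lambda>x. h x *\<^sub>R (indicator K x *\<^sub>R g x))"
    proof (rule Bochner_Integration.integrable_bound)
      show "integrable lebesgue (\<lambda>x. B *\<^sub>R (indicator K x *\<^sub>R g x))" using i by (rule integrable_scaleR_right)
      show "(\<lambda>x. h x *\<^sub>R indicator K x *\<^sub>R g x) \<in> borel_measurable lebesgue"
        by (rule borel_measurable_scaleR[OF hm borel_measurable_integrable[OF i]])
      show "AE x in lebesgue. norm (h x *\<^sub>R (indicator K x *\<^sub>R g x)) \<le> norm (B *\<^sub>R (indicator K x *\<^sub>R g x))"
      proof (rule AE_I2)
        fix x
        have "\<bar>h x\<bar> * norm (indicator K x *\<^sub>R g x) \<le> \<bar>B\<bar> * norm (indicator K x *\<^sub>R g x)"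
          using B[of x] by (intro mult_right_mono) auto
        then show "norm (h x *\<^sub>R (indicator K x *\<^sub>R g x)) \<le> norm (B *\<^sub>R (indicator K x *\<^sub>R g x))"
          unfolding norm_scaleR by simp
      qed
    qed
    moreover have "(\<lambda>x. h x *\<^sub>R (indicator K x *\<^sub>R g x)) = (\<lambda>x. h x *\<^sub>R g x)" using K(4) by (auto simp: fun_eq_iff indicator_def)
    ultimately show ?thesis by simp
  qed
  show "integrable lebesgue (\<lambda>x. \<psi> x *\<^sub>R g x)" by (rule each[OF \<psi>])
  have "integrable lebesgue (\<lambda>x. \<Sum>b\<in>Basis. (pd b \<psi> x *\<^sub>R g x) \<bullet> b)"
    by (intro Bochner_Integration.integrable_sum integrable_inner_left each test_fun_pd \<psi>)
  then show "integrable lebesgue (\<lambda>x. g x \<bullet> (\<Sum>b\<in>Basis. pd b \<psi> x *\<^sub>R b))" by (simp add: inner_sum_right)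
qed

text \<open>The weak gradient identity is vector valued. It is applied to each test function
  \<open>pd b \<psi>\<close>, and only the component in direction \<open>b\<close> is kept.\<close>

lemma slice_divergence:
  fixes v :: "'a::euclidean_space \<Rightarrow> real"
  assumes w: "has_weak_grad (ball 0 1) v g" and v: "continuous_on (ball 0 1) v"
    and \<psi>: "test_fun (ball 0 1) \<psi>"
  shows "(LINT x|lebesgue. g x \<bullet> (\<Sum>b\<in>Basis. pd b \<psi> x *\<^sub>R b)) = - (LINT x|lborel. v x * (\<Sum>b\<in>Basis. pd b (pd b \<psi>) x))"
proof -
  note each = slice_weak_integrable(1)[OF w]
  note vi = continuous_mult_test_fun_integrable[OF v]
  have comp: "(LINT x|lborel. v x * pd b h x) = - (LINT x|lebesgue. h x * (g x \<bullet> b))"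
    if h: "test_fun (ball 0 1) h" and b: "b \<in> Basis" for h b
  proof -
    have eq: "(LINT x:ball 0 1|lebesgue. v x *\<^sub>R grad h x) = - (LINT x:ball 0 1|lebesgue. h x *\<^sub>R g x)"
      using w h by (simp add: has_weak_grad_def)
    have h0: "h x = 0" "pd i h x = 0" if "x \<notin> ball 0 1" "i \<in> Basis" for x i
      using h test_fun_pd[OF h that(2)] that(1) by (auto elim!: test_funE)
    obtain i :: 'a where i: "i \<in> Basis" using nonempty_Basis by blast
    have 1: "(\<lambda>x. indicator (ball 0 1) x *\<^sub>R (v x *\<^sub>R grad h x)) = (\<lambda>x. \<Sum>i\<in>Basis. (v x * pd i h x) *\<^sub>R i)"
      using h0(2) by (auto simp: fun_eq_iff indicator_def grad_def pd_def[symmetric] scaleR_sum_right)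
    have 2: "(\<lambda>x. indicator (ball 0 1) x *\<^sub>R (h x *\<^sub>R g x)) = (\<lambda>x. h x *\<^sub>R g x)"
      using h0(1)[OF _ i] by (auto simp: fun_eq_iff indicator_def)
    have eq2: "(LINT x|lebesgue. (\<Sum>i\<in>Basis. (v x * pd i h x) *\<^sub>R i)) = - (LINT x|lebesgue. h x *\<^sub>R g x)"
      using eq unfolding set_lebesgue_integral_def 1 2 .
    have I: "integrable lebesgue (\<lambda>x. (v x * pd i h x) *\<^sub>R i)" if "i \<in> Basis" for i
      by (intro integrable_scaleR_left lebesgue_integral_lborel(2) vi test_fun_pd h that)
    have "(LINT x|lebesgue. (\<Sum>i\<in>Basis. (v x * pd i h x) *\<^sub>R i)) \<bullet> b = (LINT x|lebesgue. (\<Sum>i\<in>Basis. (v x * pd i h x) *\<^sub>R i) \<bullet> b)"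
      using I by (intro integral_inner_left[symmetric] Bochner_Integration.integrable_sum)
    also have "\<dots> = (LINT x|lebesgue. v x * pd b h x)"
      using b by (simp add: inner_sum_left inner_Basis if_distrib sum.delta cong: if_cong)
    also have "\<dots> = (LINT x|lborel. v x * pd b h x)"
      using vi[OF test_fun_pd[OF h b]] by (intro lebesgue_integral_lborel(1)) (auto dest: borel_measurable_integrable)
    finally have "(LINT x|lborel. v x * pd b h x) = - ((LINT x|lebesgue. h x *\<^sub>R g x) \<bullet> b)" unfolding eq2 by simp
    also have "(LINT x|lebesgue. h x *\<^sub>R g x) \<bullet> b = (LINT x|lebesgue. (h x *\<^sub>R g x) \<bullet> b)"
      by (rule integral_inner_left[symmetric, OF each[OF h]])
    finally show ?thesis by simp
  qed
  have "(LINT x|lebesgue. g x \<bullet> (\<Sum>b\<in>Basis. pd b \<psi> x *\<^sub>R b)) = (LINT x|lebesgue. (\<Sum>b\<in>Basis. pd b \<psi> x * (g x \<bullet> b)))"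
    by (simp add: inner_sum_right)
  also have "\<dots> = (\<Sum>b\<in>Basis. LINT x|lebesgue. pd b \<psi> x * (g x \<bullet> b))"
  proof (rule Bochner_Integration.integral_sum)
    fix b :: 'a assume "b \<in> Basis"
    from integrable_inner_left[OF each[OF test_fun_pd[OF \<psi> this]], of b]
    show "integrable lebesgue (\<lambda>x. pd b \<psi> x * (g x \<bullet> b))" by simp
  qed
  also have "\<dots> = (\<Sum>b\<in>Basis. - (LINT x|lborel. v x * pd b (pd b \<psi>) x))"
    using comp[OF test_fun_pd[OF \<psi>]] by (intro sum.cong) auto
  also have "\<dots> = - (LINT x|lborel. (\<Sum>b\<in>Basis. v x * pd b (pd b \<psi>) x))"
    by (subst Bochner_Integration.integral_sum) (auto simp: sum_negf intro!: vi test_fun_pd \<psi>)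
  finally show ?thesis by (simp add: sum_distrib_left)
qed

text \<open>The exceptional set is covered by a Borel null set, for which the order of the variables
  may be exchanged. Time comes first because weak gradients are given for almost every time.\<close>

lemma AE_lborel_slices:
  fixes P :: "'a::euclidean_space \<times> 'b::euclidean_space \<Rightarrow> bool"
  assumes "AE z in lborel. P z"
  shows "AE t in lborel. AE x in lborel. P (x, t)"
proof -
  obtain N where N: "{z \<in> space lborel. \<not> P z} \<subseteq> N" "N \<in> null_sets lborel"
    using assms unfolding eventually_ae_filter by blast
  have a: "AE z in lborel \<Otimes>\<^sub>M lborel. z \<notin> N"
    unfolding lborel_prod using N(2) by (rule AE_not_in)
  have b: "AE x in lborel. AE t in lborel. (x, t) \<notin> N" by (rule lborel_pair.AE_pair[OF a])
  have "{z \<in> space (lborel \<Otimes>\<^sub>M lborel). (fst z, snd z) \<notin> N} = - N" by (auto simp: space_pair_measure)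
  moreover have "- N \<in> sets (lborel \<Otimes>\<^sub>M lborel)"
    using null_setsD2[OF N(2)] unfolding lborel_prod by simp
  ultimately have c: "{z \<in> space (lborel \<Otimes>\<^sub>M lborel). (fst z, snd z) \<notin> N} \<in> sets (lborel \<Otimes>\<^sub>M lborel)" by metis
  have d: "AE t in lborel. AE x in lborel. (x, t) \<notin> N"
    using lborel_pair.AE_commute[where P = "\<lambda>x t. (x, t) \<notin> N", OF c] b by blast
  have "P z" if "z \<notin> N" for z using N(1) that by auto
  then have "AE x in lborel. P (x, t)" if "AE x in lborel. (x, t) \<notin> N" for t
    using that by (rule eventually_mono[rotated])
  with d show ?thesis by (rule eventually_mono)
qed

text \<open>The gradient is weak on time slices only, so the integration by parts is done slice by
  slice. Fubini is applied to a Borel version \<open>h\<close> of the integrand, because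
  \<open>g\<close> is merely Lebesgue measurable; on almost every slice \<open>h\<close> is then
  exchanged for \<open>g\<close> again.\<close>

lemma parabolic_divergence:
  fixes v :: "'a::euclidean_space \<times> real \<Rightarrow> real"
  assumes v: "continuous_on QQ v" and \<phi>: "test_fun QQ \<phi>"
    and w: "AE t in lebesgue_on {-1<..<0}. has_weak_grad (ball 0 1) (\<lambda>x. v (x, t)) (\<lambda>x. g (x, t))"
    and G: "\<And>z. G z = (\<Sum>b\<in>Basis. pd (b, 0) \<phi> z *\<^sub>R b)"
    and i: "integrable lebesgue (\<lambda>z. g z \<bullet> G z)"
  shows "(LINT z|lebesgue. g z \<bullet> G z) = - (LINT z|lborel. v z * lap \<phi> z)"
proof -
  note sm = test_fun_smooth[OF \<phi>]
  have vi: "integrable lborel (\<lambda>z. v z * lap \<phi> z)"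
    by (rule continuous_mult_test_fun_integrable[OF v test_fun_lap[OF \<phi>]])
  obtain h where h: "h \<in> borel_measurable borel" "AE z in lborel. g z \<bullet> G z = h z"
    using completion_ex_borel_measurable_real[OF borel_measurable_integrable[OF i]] by auto
  have h': "h \<in> borel_measurable lebesgue" using h(1) by (intro measurable_completion) auto
  have AEl: "AE z in lebesgue. g z \<bullet> G z = h z" using h(2) by (rule AE_completion)
  have hi: "integrable lborel h"
    using i integrable_cong_AE[OF borel_measurable_integrable[OF i] h' AEl] h(1) integrable_completion[of h lborel] by auto
  have "(LINT z|lebesgue. g z \<bullet> G z) = (LINT z|lebesgue. h z)"
    by (rule integral_cong_AE[OF borel_measurable_integrable[OF i] h' AEl])
  also have "\<dots> = (LINT z|lborel. h z)" by (rule lebesgue_integral_lborel(1)[OF h(1)])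
  also have "\<dots> = (LINT t|lborel. (LINT x|lborel. h (x, t)))"
    using lborel_pair.integral_snd[of "\<lambda>x t. h (x, t)"] hi by (simp add: lborel_prod)
  also have "\<dots> = (LINT t|lborel. (LINT x|lborel. - (v (x, t) * lap \<phi> (x, t))))"
  proof (rule integral_cong_AE)
    have w': "AE t in lebesgue. t \<in> {-1<..<0} \<longrightarrow> has_weak_grad (ball 0 1) (\<lambda>x. v (x, t)) (\<lambda>x. g (x, t))"
      using w by (subst (asm) AE_restrict_space_iff) auto
    have "AE t in lborel. t \<in> {-1<..<0} \<longrightarrow> has_weak_grad (ball 0 1) (\<lambda>x. v (x, t)) (\<lambda>x. g (x, t))"
      using w' by (simp add: AE_completion_iff)
    moreover have "AE t in lborel. AE x in lborel. g (x, t) \<bullet> G (x, t) = h (x, t)"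
      using AE_lborel_slices[OF h(2)] by simp
    ultimately show "AE t in lborel. (LINT x|lborel. h (x, t)) = (LINT x|lborel. - (v (x, t) * lap \<phi> (x, t)))"
    proof eventually_elim
      case (elim t)
      have s: "test_fun (ball 0 1) (\<lambda>x. \<phi> (x, t))" using \<phi> unfolding QQ_def2 by (rule test_fun_slice)
      have p1: "pd b (\<lambda>x. \<phi> (x, t)) x = pd (b, 0) \<phi> (x, t)" if "b \<in> Basis" for b x
        by (rule pd_slice(2)[OF smooth_differentiable[OF sm] that])
      have p2: "pd b (pd b (\<lambda>x. \<phi> (x, t))) x = pd (b, 0) (pd (b, 0) \<phi>) (x, t)" if "b \<in> Basis" for b x
      proof -
        have "pd b (\<lambda>x. \<phi> (x, t)) = (\<lambda>x. pd (b, 0) \<phi> (x, t))" using p1[OF that] by (rule ext)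
        then show ?thesis using pd_slice(2)[OF smooth_differentiable[OF smooth_pd[OF sm space_in_Basis[OF that]]] that] by simp
      qed
      have hm: "(\<lambda>x. h (x, t)) \<in> borel_measurable borel" using h(1) by measurable
      have G0: "(\<lambda>x. g (x, t) \<bullet> G (x, t)) = (\<lambda>x. g (x, t) \<bullet> (\<Sum>b\<in>Basis. pd b (\<lambda>x. \<phi> (x, t)) x *\<^sub>R b))"
        by (simp add: G p1 cong: sum.cong)
      show ?case
      proof (cases "t \<in> {-1<..<0}")
        case True
        have wt: "has_weak_grad (ball 0 1) (\<lambda>x. v (x, t)) (\<lambda>x. g (x, t))" using elim(1) True by blast
        have vt: "continuous_on (ball 0 1) (\<lambda>x. v (x, t))"
          using True by (intro continuous_on_compose2[OF v] continuous_intros) (auto simp: QQ_def2)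
        have "(LINT x|lborel. h (x, t)) = (LINT x|lebesgue. h (x, t))" by (rule lebesgue_integral_lborel(1)[OF hm, symmetric])
        also have "\<dots> = (LINT x|lebesgue. g (x, t) \<bullet> G (x, t))"
        proof (rule integral_cong_AE)
          show hl: "(\<lambda>x. h (x, t)) \<in> borel_measurable lebesgue" using hm by (intro measurable_completion) auto
          have e: "AE x in lebesgue. h (x, t) = g (x, t) \<bullet> G (x, t)" using elim(2) by (auto simp: AE_completion_iff)
          then show "AE x in lebesgue. h (x, t) = g (x, t) \<bullet> G (x, t)" .
          show "(\<lambda>x. g (x, t) \<bullet> G (x, t)) \<in> borel_measurable lebesgue"
            using slice_weak_integrable(2)[OF wt s] unfolding G0 by (rule borel_measurable_integrable)
        qed
        also have "\<dots> = - (LINT x|lborel. v (x, t) * (\<Sum>b\<in>Basis. pd b (pd b (\<lambda>x. \<phi> (x, t))) x))"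
          unfolding G0 by (rule slice_divergence[OF wt vt s])
        finally show ?thesis by (simp add: lap_def p2 cong: sum.cong)
      next
        case False
        have z: "pd (b, 0) \<phi> (x, t) = 0" "lap \<phi> (x, t) = 0" if "b \<in> Basis" for x b
          using False test_fun_pd[OF \<phi> space_in_Basis[OF that]] test_fun_lap[OF \<phi>] by (auto elim!: test_funE simp: QQ_def2)
        have "AE x in lborel. h (x, t) = 0" using elim(2) by (rule eventually_mono) (simp add: G z)
        then have "(LINT x|lborel. h (x, t)) = (LINT x|(lborel::'a measure). 0)" using hm by (intro integral_cong_AE) auto
        moreover obtain i :: 'a where "i \<in> Basis" using nonempty_Basis by blast
        ultimately show ?thesis using z(2) by simp
      qed
    qed
    show "(\<lambda>t. LINT x|lborel. h (x, t)) \<in> borel_measurable lborel"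
      using hi lborel_pair.integrable_snd[of "\<lambda>x t. h (x, t)"] by (simp add: lborel_prod borel_measurable_integrable)
    show "(\<lambda>t. LINT x|lborel. - (v (x, t) * lap \<phi> (x, t))) \<in> borel_measurable lborel"
      using lborel_pair.integrable_snd[of "\<lambda>x t. v (x, t) * lap \<phi> (x, t)"] vi
      by (simp add: lborel_prod borel_measurable_integrable case_prod_beta')
  qed
  also have "\<dots> = (LINT z|lborel. - (v z * lap \<phi> z))"
    using lborel_pair.integral_snd[of "\<lambda>x t. v (x, t) * lap \<phi> (x, t)"] vi by (simp add: lborel_prod case_prod_beta')
  finally show ?thesis by simp
qed

text \<open>Local integrability of weak solutions is stated on boxes, whereas supports of test
  functions are arbitrary compact sets.\<close>

lemma compact_subset_box:
  fixes K :: "('a::topological_space \<times> real) set"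
  assumes "compact K" "K \<subseteq> U \<times> {l<..<r}" "l < r"
  obtains Kx a b where "compact Kx" "Kx \<subseteq> U" "l < a" "b < r" "K \<subseteq> Kx \<times> {a..b}"
proof (cases "K = {}")
  case True
  \<comment> \<open>With \<open>a = r\<close> and \<open>b = l\<close> the time interval is empty
    and both strict inequalities follow from \<open>l < r\<close>.\<close>
  show ?thesis by (rule that[of "{}" r l]) (use True assms in auto)
next
  case False
  have c: "compact (fst ` K)" "compact (snd ` K)" "snd ` K \<noteq> {}"
    using False assms(1) by (auto intro!: compact_continuous_image continuous_intros)
  obtain a where a: "a \<in> snd ` K" "\<forall>t\<in>snd ` K. a \<le> t" using compact_attains_inf[OF c(2,3)] by blast
  obtain b where b: "b \<in> snd ` K" "\<forall>t\<in>snd ` K. t \<le> b" using compact_attains_sup[OF c(2,3)] by blast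
  show ?thesis
  proof (rule that[of "fst ` K" a b])
    show "compact (fst ` K)" by (rule c)
    show "fst ` K \<subseteq> U" "l < a" "b < r" using assms(2) a(1) b(1) by auto
    show "K \<subseteq> fst ` K \<times> {a..b}"
    proof
      fix z assume z: "z \<in> K"
      then have "fst z \<in> fst ` K" "snd z \<in> {a..b}" using a(2) b(2) by auto
      then show "z \<in> fst ` K \<times> {a..b}" by (simp add: mem_Times_iff)
    qed
  qed
qed

lemma cyl_1: "cyl 1 = cQ" by (simp add: cyl_def)

lemma lebesgue_on_scaleR_measurable:
  fixes g :: "'a::euclidean_space \<Rightarrow> 'b::euclidean_space"
  assumes "S \<in> sets lebesgue"
  shows "g \<in> borel_measurable (lebesgue_on S) \<longleftrightarrow> (\<lambda>x. indicator S x *\<^sub>R g x) \<in> borel_measurable lebesgue"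
  using assms by (intro borel_measurable_restrict_space_iff) auto

lemma cQ_sets: "(cQ :: ('a::euclidean_space \<times> real) set) \<in> sets borel"
  unfolding borel_prod[symmetric] by (intro pair_measureI) auto

lemma cyl_1_lebesgue: "cyl 1 \<in> sets lebesgue"
  using cQ_sets unfolding cyl_1 by (intro sets_completionI_sets) simp

text \<open>On a box of finite measure square integrability yields integrability, here through the
  bound of \<open>norm (g z)\<close> by \<open>1 + (norm (g z))\<^sup>2\<close>.\<close>

lemma L2_loc_mult_integrable:
  fixes g :: "(real ^ 'd) \<times> real \<Rightarrow> real ^ 'd"
  assumes "L2_W12_loc v g" and h: "test_fun QQ h"
  shows "integrable lebesgue (\<lambda>z. h z * (g z \<bullet> b))"
proof -
  obtain K where K: "smooth h" "compact K" "K \<subseteq> QQ" "\<And>x. x \<notin> K \<Longrightarrow> h x = 0" using h by (auto elim: test_funE)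
  obtain B where B: "B > 0" "\<And>x. \<bar>h x\<bar> \<le> B"
    using continuous_compact_support_bounded[OF smooth_continuous[OF K(1)] K(2,4)] by metis
  have hm: "h \<in> borel_measurable lebesgue"
    by (rule measurable_completion) (use smooth_continuous[OF K(1)] in \<open>auto intro: borel_measurable_continuous_onI\<close>)
  obtain L s t where L: "compact L" "L \<subseteq> ball 0 1" "-1 < s" "t < 0" "K \<subseteq> L \<times> {s..t}"
    using compact_subset_box[OF K(2) K(3)[unfolded QQ_def2]] by auto
  let ?K = "L \<times> {s..t}"
  have cK: "compact ?K" using L by (intro compact_Times) auto
  have Ks: "?K \<subseteq> cyl 1" using L by (auto simp: cyl_def)
  have gi: "integrable lebesgue (\<lambda>z. indicator ?K z *\<^sub>R (norm (g z))\<^sup>2)"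
    using assms(1) L unfolding L2_W12_loc_def set_integrable_def by blast
  have "emeasure lebesgue ?K < \<infinity>"
    using emeasure_compact_finite[OF cK] by (simp add: emeasure_completion cK borel_compact)
  then have Ki: "integrable lebesgue (indicator ?K :: _ \<Rightarrow> real)"
    using borel_compact[OF cK] by (intro integrable_real_indicator sets_completionI_sets) auto
  have gm: "(\<lambda>z. indicator (cyl 1) z *\<^sub>R g z) \<in> borel_measurable lebesgue"
    using assms(1) unfolding L2_W12_loc_def
    by (intro iffD1[OF lebesgue_on_scaleR_measurable[OF cyl_1_lebesgue]]) simp
  show ?thesis
  proof (rule Bochner_Integration.integrable_bound)
    show "integrable lebesgue (\<lambda>z. B * norm b * (indicator ?K z + indicator ?K z *\<^sub>R (norm (g z))\<^sup>2))"
      using gi Ki by (intro integrable_mult_right Bochner_Integration.integrable_add)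
    have "(\<lambda>z. h z * ((indicator (cyl 1) z *\<^sub>R g z) \<bullet> b)) \<in> borel_measurable lebesgue"
      by (intro borel_measurable_times borel_measurable_inner hm gm borel_measurable_const)
    moreover have "(\<lambda>z. h z * ((indicator (cyl 1) z *\<^sub>R g z) \<bullet> b)) = (\<lambda>z. h z * (g z \<bullet> b))"
    proof
      fix z show "h z * ((indicator (cyl 1) z *\<^sub>R g z) \<bullet> b) = h z * (g z \<bullet> b)"
        using K(4)[of z] L(5) Ks by (cases "z \<in> K") (auto simp: indicator_def)
    qed
    ultimately show "(\<lambda>z. h z * (g z \<bullet> b)) \<in> borel_measurable lebesgue" by (simp only:)
    show "AE z in lebesgue. norm (h z * (g z \<bullet> b)) \<le> norm (B * norm b * (indicator ?K z + indicator ?K z *\<^sub>R (norm (g z))\<^sup>2))"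
    proof (rule AE_I2)
      fix z
      show "norm (h z * (g z \<bullet> b)) \<le> norm (B * norm b * (indicator ?K z + indicator ?K z *\<^sub>R (norm (g z))\<^sup>2))"
      proof (cases "z \<in> ?K")
        case True
        have "\<bar>h z\<bar> * \<bar>g z \<bullet> b\<bar> \<le> B * (norm (g z) * norm b)"
          using B Cauchy_Schwarz_ineq2[of "g z" b] by (intro mult_mono) auto
        also have "\<dots> \<le> B * ((1 + (norm (g z))\<^sup>2) * norm b)"
        proof -
          have "0 \<le> (norm (g z) - 1)\<^sup>2" by simp
          then have "norm (g z) \<le> 1 + (norm (g z))\<^sup>2" using norm_ge_zero[of "g z"] unfolding power2_diff power_one mult_1_right by linarith
          then show ?thesis using B by (intro mult_left_mono mult_right_mono) auto
        qed
        also have "\<dots> = B * norm b * (1 + (norm (g z))\<^sup>2)" by simp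
        finally have le: "\<bar>h z\<bar> * \<bar>g z \<bullet> b\<bar> \<le> B * norm b * (1 + (norm (g z))\<^sup>2)" .
        have nn: "0 \<le> B * norm b * (1 + (norm (g z))\<^sup>2)" using B by simp
        have i: "indicator ?K z + indicator ?K z *\<^sub>R (norm (g z))\<^sup>2 = 1 + (norm (g z))\<^sup>2" using True by simp
        show ?thesis unfolding i real_norm_def abs_mult[of "h z"] abs_of_nonneg[OF nn] by (rule le)
      next
        case False
        then show ?thesis using K(4)[of z] L(5) by auto
      qed
    qed
  qed
qed

lemma weak_solution_pv:
  fixes u f f0 :: "(real ^ 'd) \<times> real \<Rightarrow> real"
  assumes w: "weak_solution m f u" and u: "continuous_on (cyl 1) u" and m: "0 < m"
    and f0: "integrable lborel f0" "AE z in lebesgue. z \<in> cyl 1 \<longrightarrow> f z = f0 z"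
    and fm: "f \<in> borel_measurable (lebesgue_on (cyl 1))"
  shows "pv QQ u (\<lambda>z. u z powr m) f0"
  unfolding pv_def
proof (intro allI impI)
  fix \<phi> :: "(real ^ 'd) \<times> real \<Rightarrow> real" assume \<phi>: "test_fun QQ \<phi>"
  note sm = test_fun_smooth[OF \<phi>]
  obtain g where g: "L2_W12_loc (\<lambda>z. u z powr m) g" and
    eq: "(LINT z:cyl 1|lebesgue. - u z * deriv (\<lambda>s. \<phi> (fst z, s)) (snd z) + g z \<bullet> grad (\<lambda>y. \<phi> (y, snd z)) (fst z))
           = (LINT z:cyl 1|lebesgue. f z * \<phi> z)"
    using w \<phi> unfolding weak_solution_def QQ_def2 by blast
  define G where "G z = (\<Sum>b\<in>Basis. pd (b, 0) \<phi> z *\<^sub>R b)" for z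
  have Qc: "QQ \<subseteq> (cyl 1 :: ((real^'d) \<times> real) set)" by (auto simp: QQ_def2 cyl_def)
  have u0: "0 \<le> u z" if "z \<in> cyl 1" for z using w that by (simp add: weak_solution_def)
  have uc: "continuous_on QQ u" using u Qc by (rule continuous_on_subset)
  have vc: "continuous_on QQ (\<lambda>z. u z powr m)" using u0 Qc m by (intro continuous_on_powr_nonneg uc) auto
  have z0: "h z = 0" if "test_fun QQ h" "z \<notin> cyl 1" for h :: "(real ^ 'd) \<times> real \<Rightarrow> real" and z
    using that Qc by (auto elim!: test_funE)
  have gG: "integrable lebesgue (\<lambda>z. g z \<bullet> G z)"
  proof -
    have "integrable lebesgue (\<lambda>z. \<Sum>b\<in>Basis. pd (b, 0) \<phi> z * (g z \<bullet> b))"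
      by (intro Bochner_Integration.integrable_sum L2_loc_mult_integrable[OF g] test_fun_pd[OF \<phi>] space_in_Basis)
    then show ?thesis by (simp add: G_def inner_sum_right)
  qed
  have div: "(LINT z|lebesgue. g z \<bullet> G z) = - (LINT z|lborel. u z powr m * lap \<phi> z)"
    using g by (intro parabolic_divergence[OF vc \<phi> _ G_def gG]) (simp add: L2_W12_loc_def)
  have ui: "integrable lborel (\<lambda>z. u z * dt \<phi> z)" by (rule continuous_mult_test_fun_integrable[OF uc test_fun_dt[OF \<phi>]])
  have vi: "integrable lborel (\<lambda>z. u z powr m * lap \<phi> z)" by (rule continuous_mult_test_fun_integrable[OF vc test_fun_lap[OF \<phi>]])
  have fi: "integrable lborel (\<lambda>z. f0 z * \<phi> z)"
  proof -
    obtain K where K: "compact K" "\<And>x. x \<notin> K \<Longrightarrow> \<phi> x = 0" using \<phi> by (auto elim: test_funE)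
    obtain B where "\<And>x. \<bar>\<phi> x\<bar> \<le> B"
      using continuous_compact_support_bounded[OF smooth_continuous[OF sm] K] by metis
    moreover have "\<phi> \<in> borel_measurable lborel"
      using smooth_continuous[OF sm] by (simp add: borel_measurable_continuous_onI)
    ultimately have "integrable lborel (\<lambda>z. \<phi> z * f0 z)" by (intro bounded_times_integrable[OF f0(1)])
    then show ?thesis by (simp add: mult.commute)
  qed
  have e1: "(\<lambda>z. indicator (cyl 1) z *\<^sub>R (- u z * deriv (\<lambda>s. \<phi> (fst z, s)) (snd z) + g z \<bullet> grad (\<lambda>y. \<phi> (y, snd z)) (fst z)))
    = (\<lambda>z. - (u z * dt \<phi> z) + g z \<bullet> G z)"
  proof
    fix z :: "(real ^ 'd) \<times> real"
    have "dt \<phi> z = 0 \<and> G z = 0" if "z \<notin> cyl 1"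
      using z0[OF test_fun_dt[OF \<phi>] that] z0[OF test_fun_pd[OF \<phi> space_in_Basis] that] by (simp add: G_def)
    then show "indicator (cyl 1) z *\<^sub>R (- u z * deriv (\<lambda>s. \<phi> (fst z, s)) (snd z) + g z \<bullet> grad (\<lambda>y. \<phi> (y, snd z)) (fst z))
      = - (u z * dt \<phi> z) + g z \<bullet> G z"
      by (cases "z \<in> cyl 1") (auto simp: deriv_time_slice[OF sm] grad_space_slice[OF sm] G_def)
  qed
  have "(LINT z|lebesgue. - (u z * dt \<phi> z) + g z \<bullet> G z) = (LINT z:cyl 1|lebesgue. f z * \<phi> z)"
    using eq unfolding set_lebesgue_integral_def e1 .
  also have "\<dots> = (LINT z|lebesgue. f0 z * \<phi> z)"
    unfolding set_lebesgue_integral_def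
  proof (rule integral_cong_AE)
    have hm: "\<phi> \<in> borel_measurable lebesgue"
      by (rule measurable_completion) (use smooth_continuous[OF sm] in \<open>auto intro: borel_measurable_continuous_onI\<close>)
    have "(\<lambda>z. (indicator (cyl 1) z *\<^sub>R f z) * \<phi> z) \<in> borel_measurable lebesgue"
      by (intro borel_measurable_times hm iffD1[OF lebesgue_on_scaleR_measurable[OF cyl_1_lebesgue] fm])
    then show "(\<lambda>z. indicator (cyl 1) z *\<^sub>R (f z * \<phi> z)) \<in> borel_measurable lebesgue" by (simp add: mult.assoc)
    show "(\<lambda>z. f0 z * \<phi> z) \<in> borel_measurable lebesgue"
      by (rule borel_measurable_integrable[OF lebesgue_integral_lborel(2)[OF fi]])
    show "AE z in lebesgue. indicator (cyl 1) z *\<^sub>R (f z * \<phi> z) = f0 z * \<phi> z"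
      using f0(2) by eventually_elim (auto simp: indicator_def z0[OF \<phi>])
  qed
  also have "\<dots> = (LINT z|lborel. f0 z * \<phi> z)"
    by (rule lebesgue_integral_lborel(1)[OF borel_measurable_integrable[OF fi, simplified]])
  also have "(LINT z|lebesgue. - (u z * dt \<phi> z) + g z \<bullet> G z) = - (LINT z|lborel. u z * dt \<phi> z) - (LINT z|lborel. u z powr m * lap \<phi> z)"
    using lebesgue_integral_lborel[of "\<lambda>z. u z * dt \<phi> z"] ui gG div by (simp add: borel_measurable_integrable)
  finally show "(LINT z|lborel. u z * dt \<phi> z + u z powr m * lap \<phi> z + f0 z * \<phi> z) = 0"
    using ui vi fi by simp
qed

section \<open>Sources in mixed Lebesgue spaces\<close>

lemma le_threshold_powr:
  fixes y \<mu> p :: real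
  assumes "0 \<le> y" "0 < \<mu>" "1 \<le> p"
  shows "y \<le> \<mu> + \<mu> powr (1 - p) * y powr p"
proof (cases "y \<le> \<mu>")
  case True
  then show ?thesis using assms by (simp add: add_increasing2)
next
  case False
  have "1 \<le> (y / \<mu>) powr (p - 1)" using False assms by (intro ge_one_powr_ge_zero) auto
  then have "y * 1 \<le> y * (y / \<mu>) powr (p - 1)" using assms by (intro mult_left_mono) auto
  also have "\<dots> = \<mu> powr (1 - p) * y powr p"
    using False assms by (simp add: powr_divide powr_diff divide_simps)
  finally show ?thesis using assms by simp
qed

text \<open>Hoelder's inequality up to a factor 2, by splitting at one level.\<close>
lemma nn_integral_powr_bound:
  fixes g :: "'a \<Rightarrow> real"
  assumes [measurable]: "g \<in> borel_measurable M" "E \<in> sets M" and E: "emeasure M E \<le> ennreal e" "0 < e"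
    and p: "1 \<le> p" and J: "(\<integral>\<^sup>+x. ennreal (\<bar>g x\<bar> powr p) \<partial>M) \<le> ennreal J" "0 \<le> J"
  shows "(\<integral>\<^sup>+x. ennreal \<bar>g x\<bar> * indicator E x \<partial>M) \<le> ennreal (2 * e powr (1 - 1 / p) * J powr (1 / p))"
proof (cases "J = 0")
  case True
  then have "(\<integral>\<^sup>+x. ennreal (\<bar>g x\<bar> powr p) \<partial>M) = 0" using J by simp
  then have "AE x in M. ennreal (\<bar>g x\<bar> powr p) = 0" by (subst (asm) nn_integral_0_iff_AE) auto
  then have "AE x in M. ennreal \<bar>g x\<bar> * indicator E x = 0" by eventually_elim auto
  then have "(\<integral>\<^sup>+x. ennreal \<bar>g x\<bar> * indicator E x \<partial>M) = 0" by (subst nn_integral_0_iff_AE) auto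
  then show ?thesis by simp
next
  case False
  then have J0: "0 < J" using J by simp
  \<comment> \<open>At this level the two parts of the splitting have the same bound, which gives
    the factor 2.\<close>
  define \<mu> where "\<mu> = (J / e) powr (1 / p)"
  have \<mu>: "0 < \<mu>" using J0 E by (simp add: \<mu>_def)
  have "(\<integral>\<^sup>+x. ennreal \<bar>g x\<bar> * indicator E x \<partial>M)
      \<le> (\<integral>\<^sup>+x. ennreal \<mu> * indicator E x + ennreal (\<mu> powr (1 - p)) * ennreal (\<bar>g x\<bar> powr p) \<partial>M)"
  proof (rule nn_integral_mono)
    fix x
    have "ennreal \<bar>g x\<bar> \<le> ennreal (\<mu> + \<mu> powr (1 - p) * \<bar>g x\<bar> powr p)"
      using le_threshold_powr[of "\<bar>g x\<bar>" \<mu> p] \<mu> p by (intro ennreal_leI) auto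
    also have "\<dots> = ennreal \<mu> + ennreal (\<mu> powr (1 - p)) * ennreal (\<bar>g x\<bar> powr p)"
      using \<mu> by (simp add: ennreal_mult)
    finally show "ennreal \<bar>g x\<bar> * indicator E x
      \<le> ennreal \<mu> * indicator E x + ennreal (\<mu> powr (1 - p)) * ennreal (\<bar>g x\<bar> powr p)"
      by (auto simp: indicator_def)
  qed
  also have "\<dots> = ennreal \<mu> * emeasure M E + ennreal (\<mu> powr (1 - p)) * (\<integral>\<^sup>+x. ennreal (\<bar>g x\<bar> powr p) \<partial>M)"
    by (subst nn_integral_add) (auto simp: nn_integral_cmult)
  also have "\<dots> \<le> ennreal \<mu> * ennreal e + ennreal (\<mu> powr (1 - p)) * ennreal J"
    by (intro add_mono mult_left_mono E J) auto
  also have "\<dots> = ennreal (\<mu> * e + \<mu> powr (1 - p) * J)" using \<mu> E J by (simp add: ennreal_mult)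
  also have "\<mu> * e + \<mu> powr (1 - p) * J = 2 * e powr (1 - 1 / p) * J powr (1 / p)"
  proof -
    have "\<mu> * e = e powr (1 - 1 / p) * J powr (1 / p)"
      using E J0 by (simp add: \<mu>_def powr_divide powr_diff)
    moreover have "\<mu> powr (1 - p) * J = e powr (1 - 1 / p) * J powr (1 / p)"
    proof -
      have "1 / p * (1 - p) = 1 / p - 1" using p by (simp add: field_simps)
      then have "\<mu> powr (1 - p) = (J / e) powr (1 / p - 1)" by (simp add: \<mu>_def powr_powr)
      then show ?thesis using E J0 by (simp add: powr_divide powr_diff)
    qed
    ultimately show ?thesis by simp
  qed
  finally show ?thesis .
qed

text \<open>The split Hoelder inequality is used first in space and then in time, whence the factor
  4; \<open>n\<close> is the mixed norm of \<open>f\<close> as a real number. The Borel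
  representative \<open>f0\<close> makes iterated integrals over \<open>lborel\<close>
  available.\<close>

lemma Lpq_box_bound:
  fixes f :: "(real ^ 'd) \<times> real \<Rightarrow> real"
  assumes f: "f \<in> Lpq p q" and p: "1 \<le> p" and q: "1 \<le> q"
  obtains f0 n where "f0 \<in> borel_measurable borel" "AE z in lebesgue. z \<in> cyl 1 \<longrightarrow> f z = f0 z"
    "\<And>z. z \<notin> cyl 1 \<Longrightarrow> f0 z = 0" "0 \<le> n"
    "\<And>E I e i. E \<in> sets borel \<Longrightarrow> I \<in> sets borel \<Longrightarrow> emeasure lborel E \<le> ennreal e \<Longrightarrow> emeasure lborel I \<le> ennreal i
       \<Longrightarrow> 0 < e \<Longrightarrow> 0 < i
       \<Longrightarrow> (\<integral>\<^sup>+z. ennreal \<bar>f0 z\<bar> * indicator (E \<times> I) z \<partial>lborel) \<le> ennreal (4 * e powr (1 - 1 / p) * i powr (1 - 1 / q) * n)"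
proof -
  have "(\<lambda>z. indicator (cyl 1) z *\<^sub>R f z) \<in> borel_measurable lebesgue"
    using f unfolding Lpq_def by (intro iffD1[OF lebesgue_on_scaleR_measurable[OF cyl_1_lebesgue]]) simp
  then obtain h where h: "h \<in> borel_measurable borel" "AE z in lborel. indicator (cyl 1) z *\<^sub>R f z = h z"
    using completion_ex_borel_measurable_real[of "\<lambda>z. indicator (cyl 1) z *\<^sub>R f z" lborel] by auto
  define f0 where "f0 z = indicator (cyl 1) z * h z" for z
  have f0m [measurable]: "f0 \<in> borel_measurable borel"
    unfolding f0_def[abs_def] cyl_1 using h(1) cQ_sets by (intro borel_measurable_times borel_measurable_indicator) auto
  have f0AE: "AE z in lborel. z \<in> cyl 1 \<longrightarrow> f z = f0 z"
    using h(2) by eventually_elim (auto simp: f0_def)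
  have f0z: "f0 z = 0" if "z \<notin> cyl 1" for z using that by (simp add: f0_def)
  define \<Phi> where "\<Phi> t = (\<integral>\<^sup>+x. ennreal (\<bar>f0 (x, t)\<bar> powr p) \<partial>lborel)" for t
  have \<Phi>m [measurable]: "\<Phi> \<in> borel_measurable borel"
  proof -
    have "(\<lambda>(t, x). ennreal (\<bar>f0 (x, t)\<bar> powr p)) \<in> borel_measurable (borel \<Otimes>\<^sub>M lborel)" by measurable
    then show ?thesis unfolding \<Phi>_def[abs_def] by (intro lborel.borel_measurable_nn_integral[of _ borel, simplified]) simp
  qed
  define S where "S = (\<integral>\<^sup>+t. epowr (\<Phi> t) (q / p) \<partial>lborel)"
  have e0: "epowr 0 a = 0" for a by (simp add: epowr_def)
  have S: "Lpq_norm p q f = epowr S (1 / q)"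
  proof -
    have "AE t in lborel. epowr (\<integral>\<^sup>+x\<in>ball 0 1. ennreal (\<bar>f (x, t)\<bar> powr p) \<partial>lebesgue) (q / p) * indicator {-1<..0} t = epowr (\<Phi> t) (q / p)"
      using AE_lborel_slices[OF f0AE]
    proof eventually_elim
      case (elim t)
      show ?case
      proof (cases "t \<in> {-1<..0}")
        case True
        have "(\<integral>\<^sup>+x\<in>ball 0 1. ennreal (\<bar>f (x, t)\<bar> powr p) \<partial>lebesgue) = \<Phi> t"
          unfolding nn_integral_completion \<Phi>_def
          by (rule nn_integral_cong_AE) (use elim in eventually_elim, use True f0z[of "(_, t)"] in \<open>auto simp: indicator_def cyl_def\<close>)
        then show ?thesis using True by simp
      next
        case False
        then have "f0 (x, t) = 0" for x by (intro f0z) (auto simp: cyl_def)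
        then show ?thesis using False by (simp add: \<Phi>_def e0)
      qed
    qed
    then have "(\<integral>\<^sup>+t\<in>{-1<..0}. epowr (\<integral>\<^sup>+x\<in>ball 0 1. ennreal (\<bar>f (x, t)\<bar> powr p) \<partial>lebesgue) (q / p) \<partial>lborel) = S"
      unfolding S_def by (rule nn_integral_cong_AE)
    then show ?thesis by (simp add: Lpq_norm_def nn_integral_completion)
  qed
  have "Lpq_norm p q f < top" using f by (simp add: Lpq_def)
  then have "S \<noteq> top" unfolding S by (auto simp: epowr_def)
  then obtain s where s: "S = ennreal s" "0 \<le> s" by (cases S) auto
  have em [measurable]: "(\<lambda>t. epowr (\<Phi> t) (q / p)) \<in> borel_measurable borel"
    unfolding epowr_def by measurable
  have "AE t in lborel. epowr (\<Phi> t) (q / p) \<noteq> \<infinity>"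
    using \<open>S \<noteq> top\<close> unfolding S_def by (intro nn_integral_PInf_AE) auto
  \<comment> \<open>\<open>enn2real\<close> sends \<open>top\<close> to 0, so slices with an
    infinite integral have to be excluded before \<open>\<psi>\<close> can serve as a bound.\<close>
  then have fin: "AE t in lborel. \<Phi> t \<noteq> top" by eventually_elim (auto simp: epowr_def)
  define \<psi> where "\<psi> t = enn2real (\<Phi> t) powr (1 / p)" for t
  have [measurable]: "\<psi> \<in> borel_measurable borel" unfolding \<psi>_def[abs_def] by measurable
  have \<psi>q: "(\<integral>\<^sup>+t. ennreal (\<bar>\<psi> t\<bar> powr q) \<partial>lborel) \<le> ennreal s"
  proof -
    have "(\<integral>\<^sup>+t. ennreal (\<bar>\<psi> t\<bar> powr q) \<partial>lborel) \<le> S"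
      unfolding S_def by (intro nn_integral_mono) (auto simp: \<psi>_def epowr_def powr_powr mult.commute)
    then show ?thesis by (simp add: s)
  qed
  have box: "(\<integral>\<^sup>+z. ennreal \<bar>f0 z\<bar> * indicator (E \<times> I) z \<partial>lborel) \<le> ennreal (4 * e powr (1 - 1 / p) * i powr (1 - 1 / q) * s powr (1 / q))"
    if EI: "E \<in> sets borel" "I \<in> sets borel" "emeasure lborel E \<le> ennreal e" "emeasure lborel I \<le> ennreal i" "0 < e" "0 < i" for E I e i
  proof -
    note [measurable] = EI(1,2)
    have [measurable]: "E \<times> I \<in> sets borel" unfolding borel_prod[symmetric] by (intro pair_measureI EI)
    have m: "(\<lambda>z. ennreal \<bar>f0 z\<bar> * indicator (E \<times> I) z) \<in> borel_measurable (lborel \<Otimes>\<^sub>M lborel)"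
      unfolding lborel_prod by measurable
    have "(\<integral>\<^sup>+z. ennreal \<bar>f0 z\<bar> * indicator (E \<times> I) z \<partial>lborel)
      = (\<integral>\<^sup>+t. (\<integral>\<^sup>+x. ennreal \<bar>f0 (x, t)\<bar> * indicator (E \<times> I) (x, t) \<partial>lborel) \<partial>lborel)"
      using lborel_pair.nn_integral_snd[OF m] unfolding lborel_prod by (rule sym)
    also have "\<dots> \<le> (\<integral>\<^sup>+t. ennreal (2 * e powr (1 - 1 / p)) * (ennreal \<bar>\<psi> t\<bar> * indicator I t) \<partial>lborel)"
    proof (rule nn_integral_mono_AE, use fin in eventually_elim)
      case (elim t)
      have "(\<integral>\<^sup>+x. ennreal \<bar>f0 (x, t)\<bar> * indicator (E \<times> I) (x, t) \<partial>lborel)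
        = (\<integral>\<^sup>+x. (ennreal \<bar>f0 (x, t)\<bar> * indicator E x) * indicator I t \<partial>lborel)"
        by (intro nn_integral_cong) (auto simp: indicator_def)
      also have "\<dots> = (\<integral>\<^sup>+x. ennreal \<bar>f0 (x, t)\<bar> * indicator E x \<partial>lborel) * indicator I t"
        by (rule nn_integral_multc) measurable
      also have "\<dots> \<le> ennreal (2 * e powr (1 - 1 / p) * enn2real (\<Phi> t) powr (1 / p)) * indicator I t"
        using elim EI p by (intro mult_right_mono nn_integral_powr_bound) (auto simp: \<Phi>_def[symmetric] ennreal_enn2real_if)
      finally show ?case by (simp add: \<psi>_def ennreal_mult mult.assoc)
    qed
    also have "\<dots> = ennreal (2 * e powr (1 - 1 / p)) * (\<integral>\<^sup>+t. ennreal \<bar>\<psi> t\<bar> * indicator I t \<partial>lborel)"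
      by (rule nn_integral_cmult) measurable
    also have "\<dots> \<le> ennreal (2 * e powr (1 - 1 / p)) * ennreal (2 * i powr (1 - 1 / q) * s powr (1 / q))"
      using EI q s \<psi>q by (intro mult_left_mono nn_integral_powr_bound) auto
    also have "\<dots> = ennreal (4 * e powr (1 - 1 / p) * i powr (1 - 1 / q) * s powr (1 / q))"
      by (simp add: ennreal_mult[symmetric] mult_ac)
    finally show ?thesis .
  qed
  show ?thesis
    by (rule that[OF f0m AE_completion[OF f0AE] f0z _ box]) auto
qed

section \<open>Growth at zeros on intrinsic cylinders\<close>

lemma morrey_mono:
  assumes "morrey F f" "F \<le> F'"
  shows "morrey F' f"
  unfolding morrey_def
proof (intro allI impI)
  fix z :: "'a \<times> real" and r :: real
  assume zr: "0 < r \<and> norm (fst z) + r \<le> 1 \<and> - 1 \<le> snd z - r\<^sup>2 \<and> snd z \<le> 0"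
  then have "(LINT w|lborel. indicator (Cq z r) w * \<bar>f w\<bar>) \<le> F * r ^ DIM('a) * sqrt r"
    using assms(1) unfolding morrey_def by blast
  also have "\<dots> \<le> F' * r ^ DIM('a) * sqrt r" using assms(2) zr by (intro mult_right_mono) auto
  finally show "(LINT w|lborel. indicator (Cq z r) w * \<bar>f w\<bar>) \<le> F' * r ^ DIM('a) * sqrt r" .
qed

text \<open>The choice of \<open>T\<close> makes \<open>T / A / R\<^sup>2\<close> equal to
  \<open>A powr (- m)\<close>. So the factor in front of the power is the one produced by dividing
  \<open>u\<close> by \<open>A\<close>, and the equation keeps its form.\<close>

lemma rescaled_sol:
  fixes u f0 :: "'a::euclidean_space \<times> real \<Rightarrow> real"
  assumes u: "continuous_on cQ u" "\<And>w. w \<in> cQ \<Longrightarrow> 0 \<le> u w" and m: "0 < m"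
    and pv: "pv QQ u (\<lambda>z. u z powr m) f0" and f0: "integrable lborel f0"
    and RTA: "0 < R" "0 < A" "T = A powr (1 - m) * R\<^sup>2"
    and sub: "aff z R T ` cQ \<subseteq> cQ" and le: "\<And>w. w \<in> cQ \<Longrightarrow> u (aff z R T w) \<le> A"
  shows "sol m (\<lambda>w. T / A * f0 (aff z R T w)) (\<lambda>w. u (aff z R T w) / A)"
proof -
  have T: "0 < T" using RTA by simp
  have subQ: "aff z R T ` QQ \<subseteq> QQ"
  proof
    fix w' assume "w' \<in> aff z R T ` QQ"
    then obtain w where w: "w \<in> QQ" "w' = aff z R T w" by blast
    have "aff z R T (0, 0) \<in> cQ" using sub by (auto simp: image_subset_iff)
    then have "snd z \<le> 0" by (auto simp: aff_def)
    moreover have "w' \<in> cQ" using sub QQ_cQ[OF w(1)] w(2) by blast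
    moreover have "T * snd w < 0" using w(1) T by (auto simp: QQ_def2 mult_pos_neg)
    ultimately show "w' \<in> QQ" using w(2) by (auto simp: QQ_def2 aff_def)
  qed
  have Qc: "(QQ :: ('a \<times> real) set) \<subseteq> cQ" using QQ_cQ by blast
  have uQ: "continuous_on QQ u" using u(1) Qc by (rule continuous_on_subset)
  have "pv QQ (\<lambda>w. (T / A / T) * u (aff z R T w)) (\<lambda>w. (T / A / R\<^sup>2) * u (aff z R T w) powr m) (\<lambda>w. T / A * f0 (aff z R T w))"
  proof (rule pv_aff_cont[OF pv RTA(1) T open_Cq uQ _ _ subQ])
    show "continuous_on QQ (\<lambda>z. u z powr m)" using m u(2) Qc by (intro continuous_on_powr_nonneg uQ) auto
    show "(\<lambda>w. indicator QQ w * f0 w) \<in> borel_measurable borel"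
      using borel_measurable_integrable[OF f0] by (intro borel_measurable_times borel_measurable_indicator) auto
  qed
  also have "pv QQ (\<lambda>w. (T / A / T) * u (aff z R T w)) (\<lambda>w. (T / A / R\<^sup>2) * u (aff z R T w) powr m) (\<lambda>w. T / A * f0 (aff z R T w))
    \<longleftrightarrow> pv QQ (\<lambda>w. u (aff z R T w) / A) (\<lambda>w. (u (aff z R T w) / A) powr m) (\<lambda>w. T / A * f0 (aff z R T w))"
  proof (rule pv_cong)
    fix w :: "'a \<times> real" assume "w \<in> QQ"
    then have 0: "0 \<le> u (aff z R T w)" using subQ Qc by (intro u(2)) blast
    show "(T / A / T) * u (aff z R T w) = u (aff z R T w) / A" using T by simp
    have "T / A / R\<^sup>2 = A powr (- m)" using RTA by (simp add: powr_diff powr_minus field_simps)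
    then show "(T / A / R\<^sup>2) * u (aff z R T w) powr m = (u (aff z R T w) / A) powr m"
      using 0 RTA by (simp add: powr_divide powr_minus field_simps)
  qed simp
  finally have "pv QQ (\<lambda>w. u (aff z R T w) / A) (\<lambda>w. (u (aff z R T w) / A) powr m) (\<lambda>w. T / A * f0 (aff z R T w))" .
  moreover have "continuous_on cQ (\<lambda>w. u (aff z R T w) / A)"
    using sub RTA by (intro continuous_intros continuous_on_compose2[OF u(1)]) auto
  moreover have "0 \<le> u (aff z R T w) / A \<and> u (aff z R T w) / A \<le> 1" if "w \<in> cQ" for w
    using le[OF that] u(2)[of "aff z R T w"] sub that RTA by (auto simp: image_subset_iff)
  moreover have "integrable lborel (\<lambda>w. indicator QQ w * (T / A * f0 (aff z R T w)))"
    using integrable_mult_indicator[of QQ lborel "\<lambda>w. T / A * f0 (aff z R T w)"] integrable_aff[OF RTA(1) T f0, of z] by simp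
  ultimately show ?thesis by (simp add: sol_def)
qed

text \<open>Hoelder's inequality yields the growth \<open>r powr (d - x + 2 * (1 - y'))\<close> on
  \<open>Cq z r\<close>. The condition \<open>x + 2 * y' \<le> 3/2\<close> leaves the extra half
  power of \<open>r\<close> that \<open>morrey\<close> demands.\<close>

lemma rescaled_morrey:
  fixes f0 :: "'a::euclidean_space \<times> real \<Rightarrow> real"
  assumes [measurable]: "f0 \<in> borel_measurable borel"
    and box: "\<And>y \<rho> s h. 0 < \<rho> \<Longrightarrow> 0 < h \<Longrightarrow> (\<integral>\<^sup>+z. ennreal \<bar>f0 z\<bar> * indicator (ball y \<rho> \<times> {s - h<..<s}) z \<partial>lborel)
       \<le> ennreal (D * \<rho> powr (real DIM('a) - x) * h powr (1 - y'))"
    and D: "0 \<le> D" and RTA: "0 < R" "0 < T" "0 < A" and xy: "x + 2 * y' \<le> 3/2"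
  shows "morrey (D * (R powr (- x) * T powr (1 - y') / A)) (\<lambda>w. T / A * f0 (aff z0 R T w))"
  unfolding morrey_def
proof (intro allI impI)
  fix z :: "'a \<times> real" and r :: real
  assume zr: "0 < r \<and> norm (fst z) + r \<le> 1 \<and> - 1 \<le> snd z - r\<^sup>2 \<and> snd z \<le> 0"
  then have r: "0 < r" "r \<le> 1" using norm_ge_zero[of "fst z"] by linarith+
  define d where "d = DIM('a)"
  let ?S = "ball (fst z0 + R *\<^sub>R fst z) (R * r) \<times> {snd z0 + T * snd z - T * r\<^sup>2 <..< snd z0 + T * snd z}"
  have S: "aff z0 R T w \<in> ?S \<longleftrightarrow> w \<in> Cq z r" for w
  proof -
    have "dist (fst z0 + R *\<^sub>R fst z) (fst z0 + R *\<^sub>R fst w) = R * dist (fst z) (fst w)"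
      using RTA by (simp add: dist_norm scaleR_diff_right[symmetric])
    moreover have "T * snd z - T * r\<^sup>2 < T * snd w \<longleftrightarrow> snd z - r\<^sup>2 < snd w"
      using RTA by (simp add: right_diff_distrib[symmetric])
    ultimately show ?thesis using RTA by (cases w) (auto simp: aff_def Cq_def)
  qed
  have [measurable]: "?S \<in> sets borel" by (intro borel_open open_Times) auto
  define X where "X = (\<integral>\<^sup>+w. ennreal \<bar>f0 (aff z0 R T w)\<bar> * indicator ?S (aff z0 R T w) \<partial>lborel)"
  define b where "b = D * (R * r) powr (real d - x) * (T * r\<^sup>2) powr (1 - y')"
  have "ennreal (R ^ d * T) * X \<le> ennreal b"
    using box[of "R * r" "T * r\<^sup>2" "fst z0 + R *\<^sub>R fst z" "snd z0 + T * snd z"] RTA r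
      nn_integral_aff[of R T "\<lambda>w. ennreal \<bar>f0 w\<bar> * indicator ?S w" z0]
    by (simp add: X_def b_def d_def)
  have RT: "0 < R ^ d * T" using RTA by simp
  have X: "X \<le> ennreal (b / (R ^ d * T))"
  proof -
    have "X = ennreal (1 / (R ^ d * T)) * (ennreal (R ^ d * T) * X)"
    proof -
      have "ennreal (1 / (R ^ d * T)) * ennreal (R ^ d * T) = 1" using RT RTA by (subst ennreal_mult[symmetric]) auto
      then show ?thesis by (simp add: mult.assoc[symmetric])
    qed
    also have "\<dots> \<le> ennreal (1 / (R ^ d * T)) * ennreal b" by (rule mult_left_mono) (use \<open>_ \<le> ennreal b\<close> in auto)
    also have "\<dots> = ennreal (b / (R ^ d * T))" using RT by (simp add: ennreal_mult'[symmetric])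
    finally show ?thesis .
  qed
  have "(LINT w|lborel. indicator (Cq z r) w * \<bar>T / A * f0 (aff z0 R T w)\<bar>)
    = enn2real (\<integral>\<^sup>+w. ennreal (indicator (Cq z r) w * \<bar>T / A * f0 (aff z0 R T w)\<bar>) \<partial>lborel)"
    by (rule integral_eq_nn_integral) auto
  also have "(\<integral>\<^sup>+w. ennreal (indicator (Cq z r) w * \<bar>T / A * f0 (aff z0 R T w)\<bar>) \<partial>lborel)
    = (\<integral>\<^sup>+w. ennreal (T / A) * (ennreal \<bar>f0 (aff z0 R T w)\<bar> * indicator ?S (aff z0 R T w)) \<partial>lborel)"
  proof (rule nn_integral_cong)
    fix w
    have "ennreal \<bar>T / A * f0 (aff z0 R T w)\<bar> = ennreal (T / A) * ennreal \<bar>f0 (aff z0 R T w)\<bar>"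
      using RTA by (subst ennreal_mult[symmetric]) (auto simp: abs_mult)
    then show "ennreal (indicator (Cq z r) w * \<bar>T / A * f0 (aff z0 R T w)\<bar>)
      = ennreal (T / A) * (ennreal \<bar>f0 (aff z0 R T w)\<bar> * indicator ?S (aff z0 R T w))"
      unfolding indicator_def S by simp
  qed
  also have "\<dots> = ennreal (T / A) * X"
    unfolding X_def by (rule nn_integral_cmult) measurable
  also have "enn2real (ennreal (T / A) * X) \<le> T / A * (b / (R ^ d * T))"
  proof (rule enn2real_leI)
    show "0 \<le> T / A * (b / (R ^ d * T))" using RTA D by (simp add: b_def)
    have "ennreal (T / A) * X \<le> ennreal (T / A) * ennreal (b / (R ^ d * T))" using X by (rule mult_left_mono) simp
    then show "ennreal (T / A) * X \<le> ennreal (T / A * (b / (R ^ d * T)))"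
      using RTA D by (subst ennreal_mult) (auto simp: b_def)
  qed
  also have "T / A * (b / (R ^ d * T)) = D * (R powr (- x) * T powr (1 - y') / A) * r powr (real d - x + 2 * (1 - y'))"
  proof -
    have "R powr (real d - x) = R ^ d * R powr (- x)" using RTA by (simp add: powr_add[symmetric] powr_realpow[symmetric])
    moreover have "r powr (real d - x + 2 * (1 - y')) = r powr (real d - x) * (r\<^sup>2) powr (1 - y')"
    proof -
      have "(r\<^sup>2) powr (1 - y') = (r powr 2) powr (1 - y')" using r by simp
      also have "\<dots> = r powr (2 * (1 - y'))" by (rule powr_powr)
      finally show ?thesis by (simp only: powr_add)
    qed
    moreover have "b = D * (R powr (real d - x) * r powr (real d - x)) * (T powr (1 - y') * (r\<^sup>2) powr (1 - y'))"
      using RTA r by (simp add: b_def powr_mult)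
    ultimately show ?thesis using RTA r by simp
  qed
  also have "\<dots> \<le> D * (R powr (- x) * T powr (1 - y') / A) * (r ^ d * sqrt r)"
  proof (rule mult_left_mono)
    have "r powr (real d - x + 2 * (1 - y')) \<le> r powr (real d + 1/2)" using r xy by (intro powr_mono') auto
    also have "\<dots> = r ^ d * sqrt r" using r by (simp add: powr_add powr_realpow powr_half_sqrt)
    finally show "r powr (real d - x + 2 * (1 - y')) \<le> r ^ d * sqrt r" .
    show "0 \<le> D * (R powr (- x) * T powr (1 - y') / A)" using D RTA by simp
  qed
  finally show "(LINT w|lborel. indicator (Cq z r) w * \<bar>T / A * f0 (aff z0 R T w)\<bar>)
    \<le> D * (R powr (- x) * T powr (1 - y') / A) * r ^ DIM('a) * sqrt r" by (simp add: d_def mult.assoc)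
qed

text \<open>In the application \<open>x = d / p\<close> and \<open>y = 1 / q\<close>, and the third condition on \<open>x\<close> and \<open>y\<close> is the lower
  bound on \<open>q\<close>.\<close>
lemma scaling_exponents:
  fixes m a x y R0 A0 s :: real
  assumes m: "1 < m" "m < 2" and a: "0 < a" "a < 1" and xy: "0 \<le> x" "0 \<le> y" "2 * (3 - m) * y \<le> 2 - m - x"
    and s: "0 < s" "s \<le> 1" and RA: "0 < R0" "R0 \<le> 1" "1 \<le> A0"
  defines "A \<equiv> A0 * s powr a" and "R \<equiv> R0 * s"
  shows "R powr (- x) * (A powr (1 - m) * R\<^sup>2) powr (1 - y) / A \<le> R0"
    and "A powr (1 - m) * R\<^sup>2 = A0 powr (1 - m) * R0\<^sup>2 * s powr (2 - (m - 1) * a)"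
    and "A powr (1 - m) * R\<^sup>2 \<le> R0\<^sup>2"
proof -
  have A: "0 < A" and R: "0 < R" using assms by (auto simp: A_def R_def)
  \<comment> \<open>The size of the rescaled source is \<open>A powr (- c) * R powr g\<close>, which
    is governed by \<open>s powr (g - a * c)\<close> along the scales. Hence
    \<open>a * c \<le> g\<close> is needed for boundedness, and \<open>1 \<le> g\<close> keeps the
    small factor \<open>R0\<close>.\<close>
  define c g where "c = 1 + (m - 1) * (1 - y)" and "g = 2 - x - 2 * y"
  have "1 * (2 * y) \<le> (3 - m) * (2 * y)" using m xy by (intro mult_right_mono) auto
  then have xy2: "x + 2 * y \<le> 2 - m" using xy(3) by (simp add: mult_ac)
  then have c: "0 \<le> c" and g: "1 \<le> g" using m xy by (auto simp: c_def g_def)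
  have "a * c \<le> 1 * c" using a c by (intro mult_right_mono) auto
  moreover have "g - c = (2 - m - x - 2 * (3 - m) * y) + (3 - m) * y" by (simp add: g_def c_def algebra_simps)
  moreover have "0 \<le> (3 - m) * y" using m xy by simp
  ultimately have gac: "0 \<le> g - a * c" using xy(3) by linarith
  have "R powr (- x) * (A powr (1 - m) * R\<^sup>2) powr (1 - y) / A = A powr (- c) * R powr g"
  proof -
    have "(A powr (1 - m) * R\<^sup>2) powr (1 - y) = (A powr (1 - m)) powr (1 - y) * (R powr 2) powr (1 - y)"
      using A R by (simp add: powr_mult)
    also have "\<dots> = A powr ((1 - m) * (1 - y)) * R powr (2 * (1 - y))" by (simp only: powr_powr)
    finally have 1: "(A powr (1 - m) * R\<^sup>2) powr (1 - y) = A powr ((1 - m) * (1 - y)) * R powr (2 * (1 - y))" .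
    have "- c = (1 - m) * (1 - y) + - 1" "g = - x + 2 * (1 - y)" by (auto simp: c_def g_def algebra_simps)
    then have "A powr (- c) * R powr g = (A powr ((1 - m) * (1 - y)) * A powr (- 1)) * (R powr (- x) * R powr (2 * (1 - y)))"
      by (simp only: powr_add)
    moreover have "A powr (- 1) = 1 / A" using A by (simp add: powr_minus_divide)
    ultimately show ?thesis unfolding 1 by simp
  qed
  also have "\<dots> \<le> (s powr a) powr (- c) * (R0 powr g * s powr g)"
  proof (rule mult_mono)
    show "A powr (- c) \<le> (s powr a) powr (- c)" using RA s c by (intro powr_mono2') (auto simp: A_def)
    show "R powr g \<le> R0 powr g * s powr g" using RA s by (simp add: R_def powr_mult)
  qed auto
  also have "\<dots> = R0 powr g * s powr (g - a * c)"
    by (simp add: powr_powr powr_diff powr_minus_divide)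
  also have "\<dots> \<le> R0 powr 1 * 1"
    using RA s g gac by (intro mult_mono powr_mono' powr_le1) auto
  finally show "R powr (- x) * (A powr (1 - m) * R\<^sup>2) powr (1 - y) / A \<le> R0" using RA by simp
  show eq: "A powr (1 - m) * R\<^sup>2 = A0 powr (1 - m) * R0\<^sup>2 * s powr (2 - (m - 1) * a)"
  proof -
    have "2 - (m - 1) * a = a * (1 - m) + 2" by (simp add: algebra_simps)
    then have "s powr (2 - (m - 1) * a) = (s powr a) powr (1 - m) * s powr 2" by (simp only: powr_add powr_powr)
    moreover have "A powr (1 - m) = A0 powr (1 - m) * (s powr a) powr (1 - m)"
      using RA s by (simp add: A_def powr_mult)
    ultimately show ?thesis using s by (simp add: R_def power_mult_distrib)
  qed
  have "A0 powr (1 - m) \<le> 1 powr (1 - m)" using RA m by (intro powr_mono2') auto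
  moreover have "(m - 1) * a \<le> 1 * 1" using m a by (intro mult_mono) auto
  then have "s powr (2 - (m - 1) * a) \<le> 1" using s by (intro powr_le1) auto
  ultimately have "A0 powr (1 - m) * R0\<^sup>2 * s powr (2 - (m - 1) * a) \<le> 1 * R0\<^sup>2 * 1"
    by (intro mult_mono) auto
  then show "A powr (1 - m) * R\<^sup>2 \<le> R0\<^sup>2" unfolding eq by simp
qed

text \<open>Each intrinsic cylinder is rescaled to \<open>cQ\<close>, where the induction hypothesis
  bounds the normalised solution by 1. The gain \<open>8 powr (- a)\<close> of \<open>core\<close>
  is the ratio of consecutive heights.\<close>

lemma dyadic_decay:
  fixes u f0 :: "'a::euclidean_space \<times> real \<Rightarrow> real"
  assumes u: "continuous_on cQ u" "\<And>w. w \<in> cQ \<Longrightarrow> 0 \<le> u w"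
    and pv: "pv QQ u (\<lambda>z. u z powr m) f0" and f0: "integrable lborel f0"
    and m: "1 < m" "m \<le> 3/2" and a: "0 < a" "a < 1"
    and core: "\<And>f (v :: 'a \<times> real \<Rightarrow> real) z. sol m f v \<Longrightarrow> v 0 = 0 \<Longrightarrow> morrey F0 f \<Longrightarrow>
      norm (fst z) < 1/4 \<Longrightarrow> - 1/16 < snd z \<Longrightarrow> snd z \<le> 0 \<Longrightarrow> v z \<le> 8 powr (- a)"
    and box: "\<And>y' \<rho> s h. 0 < \<rho> \<Longrightarrow> 0 < h \<Longrightarrow> (\<integral>\<^sup>+z. ennreal \<bar>f0 z\<bar> * indicator (ball y' \<rho> \<times> {s - h<..<s}) z \<partial>lborel)
       \<le> ennreal (D * \<rho> powr (real DIM('a) - x) * h powr (1 - y))"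
    and D: "0 \<le> D" "D * R0 \<le> F0"
    and xy: "0 \<le> x" "0 \<le> y" "2 * (3 - m) * y \<le> 2 - m - x"
    and RA: "0 < R0" "R0 \<le> 1/4" "1 \<le> A0"
    and bound: "\<And>w. norm (fst w) < 3/4 \<Longrightarrow> - 1/2 < snd w \<Longrightarrow> snd w \<le> 0 \<Longrightarrow> u w \<le> A0"
    and z: "u z = 0" "norm (fst z) < 1/2" "- 1/4 < snd z" "snd z \<le> 0"
  assumes "s = (1/8) ^ k" and w: "dist (fst z) (fst w) < R0 * s" "snd z - (A0 * s powr a) powr (1 - m) * (R0 * s)\<^sup>2 < snd w" "snd w \<le> snd z"
  shows "u w \<le> A0 * s powr a"
  using assms(24-)
proof (induction k arbitrary: s w)
  case 0
  have R2: "R0\<^sup>2 \<le> (1/4)\<^sup>2" using RA by (intro power_mono) auto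
  have "(A0 * 1 powr a) powr (1 - m) * (R0 * 1)\<^sup>2 \<le> R0\<^sup>2"
    by (rule scaling_exponents(3)[of m a 0 0]) (use m a RA in auto)
  then have "snd z - 1/16 < snd w" using 0 R2 by (simp add: power2_eq_square)
  moreover have "norm (fst w) \<le> norm (fst z) + dist (fst z) (fst w)"
    using norm_triangle_ineq4[of "fst z" "fst z - fst w"] by (simp add: dist_norm)
  ultimately show ?case using 0 bound[of w] z RA by simp
next
  case (Suc k)
  define s' where "s' = (1/8 :: real) ^ k"
  define A R where "A = A0 * s' powr a" and "R = R0 * s'"
  define T where "T = A powr (1 - m) * R\<^sup>2"
  have s': "0 < s'" "s' \<le> 1" by (auto simp: s'_def power_le_one)
  have s: "s = s' / 8" using Suc.prems by (simp add: s'_def)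
  have A: "0 < A" and R: "0 < R" "R \<le> 1/4" and T: "0 < T"
    using RA s' mult_mono[of R0 "1/4" s' 1] by (auto simp: A_def R_def T_def)
  have m2: "m < 2" and R01: "R0 \<le> 1" using m RA by auto
  note se = scaling_exponents[OF m(1) m2 a xy s' RA(1) R01 RA(3)]
  have T16: "T \<le> 1/16"
  proof -
    have "T \<le> R0\<^sup>2" using se(3) by (simp add: T_def A_def R_def)
    also have "\<dots> \<le> (1/4)\<^sup>2" using RA by (intro power_mono) auto
    finally show ?thesis by (simp add: power2_eq_square)
  qed
  have sub: "aff z R T ` cQ \<subseteq> cQ"
  proof
    fix w' assume "w' \<in> aff z R T ` cQ"
    then obtain v where v: "v \<in> cQ" "w' = aff z R T v" by blast
    have "norm (fst z + R *\<^sub>R fst v) \<le> norm (fst z) + R * norm (fst v)"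
      using norm_triangle_ineq[of "fst z" "R *\<^sub>R fst v"] R by simp
    moreover have "R * norm (fst v) \<le> 1/4 * 1" using v(1) R by (intro mult_mono) auto
    moreover have "T * snd v \<le> 0" using v(1) T by (auto simp: mult_le_0_iff)
    moreover have "T * (- snd v) \<le> 1/16 * 1" using v(1) T T16 by (intro mult_mono) auto
    ultimately show "w' \<in> cQ" using z v(2) by (auto simp: aff_def)
  qed
  have leA: "u (aff z R T v) \<le> A" if v: "v \<in> cQ" for v
    unfolding A_def
  proof (rule Suc.IH[OF s'_def])
    have "dist (fst z) (fst (aff z R T v)) = R * norm (fst v)" using R by (simp add: aff_def dist_norm)
    also have "\<dots> < R * 1" using v R by (intro mult_strict_left_mono) auto
    finally show "dist (fst z) (fst (aff z R T v)) < R0 * s'" by (simp add: R_def)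
    have "T * (- snd v) < T * 1" using v T by (intro mult_strict_left_mono) auto
    then show "snd z - (A0 * s' powr a) powr (1 - m) * (R0 * s')\<^sup>2 < snd (aff z R T v)"
      by (simp add: aff_def T_def A_def R_def)
    show "snd (aff z R T v) \<le> snd z" using v T by (auto simp: aff_def mult_le_0_iff)
  qed
  have so: "sol m (\<lambda>w. T / A * f0 (aff z R T w)) (\<lambda>w. u (aff z R T w) / A)"
    using m by (intro rescaled_sol[OF u _ pv f0 R(1) A T_def sub leA]) auto
  have mo: "morrey F0 (\<lambda>w. T / A * f0 (aff z R T w))"
  proof -
    have "D * (R powr (- x) * T powr (1 - y) / A) \<le> D * R0"
      using se(1) D by (intro mult_left_mono) (auto simp: T_def A_def R_def)
    also have "\<dots> \<le> F0" by (rule D)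
    finally have le: "D * (R powr (- x) * T powr (1 - y) / A) \<le> F0" .
    have "1 * (2 * y) \<le> (3 - m) * (2 * y)" using m xy by (intro mult_right_mono) auto
    then have "x + 2 * y \<le> 3/2" using xy(3) m by (simp add: mult_ac)
    from rescaled_morrey[OF _ box D(1) R(1) T A this, of z] borel_measurable_integrable[OF f0]
    have "morrey (D * (R powr (- x) * T powr (1 - y) / A)) (\<lambda>w. T / A * f0 (aff z R T w))" by simp
    then show ?thesis using le by (rule morrey_mono)
  qed
  define v where "v = ((1 / R) *\<^sub>R (fst w - fst z), (snd w - snd z) / T)"
  have av: "aff z R T v = w" using R T by (simp add: v_def aff_def)
  have As: "A0 * s powr a = A * 8 powr (- a)"
    using s' by (simp add: s A_def powr_divide powr_minus_divide)
  have "u (aff z R T v) / A \<le> 8 powr (- a)"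
  proof (rule core[OF so _ mo])
    show "u (aff z R T 0) / A = 0" using z by (simp add: aff_0)
    have "norm (fst v) = dist (fst z) (fst w) / R" using R by (simp add: v_def dist_norm norm_minus_commute)
    then show "norm (fst v) < 1/4" using Suc.prems R by (simp add: s R_def field_simps)
    \<comment> \<open>A smaller height slows the intrinsic clock by the factor
      \<open>8 powr (a * (m - 1))\<close>, at most \<open>sqrt 8\<close> because
      \<open>m \<le> 3/2\<close>. Bounding it by 4 and dividing by 64, the square of the scale
      ratio, leaves \<open>T / 16\<close>, the range covered by \<open>core\<close>.\<close>
    have "(A0 * s powr a) powr (1 - m) * (R0 * s)\<^sup>2 \<le> T / 16"
    proof -
      have "(A * 8 powr (- a)) powr (1 - m) = A powr (1 - m) * 8 powr (a * (m - 1))"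
        using A by (simp add: powr_mult powr_powr algebra_simps)
      moreover have "8 powr (a * (m - 1)) \<le> (4::real)"
      proof -
        have "a * (m - 1) \<le> 1 * (1/2)" using a m by (intro mult_mono) auto
        then have "8 powr (a * (m - 1)) \<le> 8 powr (1/2 :: real)" by (intro powr_mono) auto
        also have "\<dots> \<le> 4" by (simp add: powr_half_sqrt real_le_lsqrt)
        finally show ?thesis .
      qed
      then have "A powr (1 - m) * 8 powr (a * (m - 1)) * (R\<^sup>2 / 64) \<le> A powr (1 - m) * 4 * (R\<^sup>2 / 64)"
        by (intro mult_left_mono mult_right_mono) auto
      moreover have e: "(R0 * s)\<^sup>2 = R\<^sup>2 / 64" by (simp add: s R_def power2_eq_square)
      moreover have "A powr (1 - m) * 4 * (R\<^sup>2 / 64) = T / 16" by (simp add: T_def)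
      ultimately show ?thesis unfolding As e by (simp only:)
    qed
    then have "- T / 16 < snd w - snd z" using Suc.prems by linarith
    then show "- 1/16 < snd v" using T by (simp add: v_def field_simps)
    show "snd v \<le> 0" using Suc.prems T by (simp add: v_def divide_le_0_iff)
  qed
  then show ?case using A unfolding av As by (simp add: field_simps)
qed

section \<open>Passage to all small radii and the final estimate\<close>

lemma dyadic_scale:
  fixes c r :: real
  assumes "0 < r" "r \<le> c"
  obtains k where "r \<le> c * (1/8) ^ k" "c * (1/8) ^ k < 8 * r"
proof -
  define P where "P k \<longleftrightarrow> c * (1/8) ^ k < 8 * r" for k
  have "0 < r / c" using assms by simp
  then obtain n where "(1/8) ^ n < r / c" using real_arch_pow_inv[of "r / c" "1/8"] by auto
  then have "c * (1/8) ^ n < r" using assms by (simp add: field_simps)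
  then have "P n" using assms unfolding P_def by linarith
  then have L: "P (LEAST k. P k)" by (rule LeastI)
  show ?thesis
  proof (rule that[of "LEAST k. P k"])
    show "c * (1/8) ^ (LEAST k. P k) < 8 * r" using L by (simp add: P_def)
    show "r \<le> c * (1/8) ^ (LEAST k. P k)"
    proof (cases "LEAST k. P k")
      case 0
      then show ?thesis using assms by simp
    next
      case (Suc k)
      then have "\<not> P k" by (intro not_less_Least) simp
      then show ?thesis unfolding Suc by (simp add: P_def)
    qed
  qed
qed

text \<open>At a scale with \<open>c1 * s\<close> between \<open>r\<close> and \<open>8 * r\<close>
  the cylinder of height \<open>r powr \<sigma>\<close> fits into the intrinsic one: the base
  because \<open>c1 \<le> R0\<close>, the height because \<open>c1 powr \<sigma>' \<le> c0\<close>
  and, for radii at most 1, \<open>r powr \<sigma> \<le> r powr \<sigma>'\<close>.\<close>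

lemma cylinder_growth:
  fixes u :: "'a::metric_space \<times> real \<Rightarrow> real"
  assumes decay: "\<And>k w s. s = (1/8) ^ k \<Longrightarrow> dist (fst z) (fst w) < R0 * s \<Longrightarrow>
      snd z - c0 * s powr \<sigma>' < snd w \<Longrightarrow> snd w \<le> snd z \<Longrightarrow> u w \<le> A0 * s powr a"
    and pos: "0 < R0" "0 < c0" "0 < \<sigma>'" "0 < a" "0 < A0"
    and c1: "c1 = min (min R0 1) (c0 powr (1 / \<sigma>'))" and \<sigma>: "\<sigma>' \<le> \<sigma>"
    and r: "0 < r" "r \<le> c1"
    and w: "dist (fst z) (fst w) < r" "snd z - r powr \<sigma> < snd w" "snd w \<le> snd z"
  shows "u w \<le> A0 * (8 / c1) powr a * r powr a"
proof -
  have c1': "0 < c1" "c1 \<le> R0" "c1 \<le> 1" "c1 \<le> c0 powr (1 / \<sigma>')" using pos by (auto simp: c1)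
  obtain k where k: "r \<le> c1 * (1/8) ^ k" "c1 * (1/8) ^ k < 8 * r" using dyadic_scale[OF r] .
  define s where "s = (1/8 :: real) ^ k"
  have s: "0 < s" by (simp add: s_def)
  have "u w \<le> A0 * s powr a"
  proof (rule decay[OF s_def])
    have "c1 * s \<le> R0 * s" using c1' s by (intro mult_right_mono) auto
    then show "dist (fst z) (fst w) < R0 * s" using w(1) k(1) unfolding s_def by linarith
    have "r powr \<sigma> \<le> r powr \<sigma>'" using r c1' \<sigma> by (intro powr_mono') auto
    also have "\<dots> \<le> (c1 * s) powr \<sigma>'" using r k pos by (intro powr_mono2) (auto simp: s_def)
    also have "\<dots> = c1 powr \<sigma>' * s powr \<sigma>'" using c1' s by (simp add: powr_mult)
    also have "\<dots> \<le> (c0 powr (1 / \<sigma>')) powr \<sigma>' * s powr \<sigma>'"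
      using c1' pos by (intro mult_right_mono powr_mono2) auto
    also have "(c0 powr (1 / \<sigma>')) powr \<sigma>' = c0" using pos by (simp add: powr_powr)
    finally show "snd z - c0 * s powr \<sigma>' < snd w" using w by linarith
  qed (rule w)
  also have "\<dots> \<le> A0 * (8 / c1 * r) powr a"
  proof -
    have "s \<le> 8 / c1 * r" using k c1' by (simp add: s_def field_simps)
    then have "s powr a \<le> (8 / c1 * r) powr a" using s pos by (intro powr_mono2) auto
    then show ?thesis using pos by simp
  qed
  also have "(8 / c1 * r) powr a = (8 / c1) powr a * r powr a" by (rule powr_mult)
  finally show ?thesis by (simp only: mult.assoc)
qed

lemma continuous_AE_zero:
  fixes u :: "'a::euclidean_space \<times> real \<Rightarrow> real"
  assumes u: "continuous_on cQ u" and ae: "AE z in lebesgue. z \<in> cQ \<longrightarrow> u z = 0" and z: "z \<in> QQ"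
  shows "u z = 0"
proof (rule ccontr)
  assume nz: "u z \<noteq> 0"
  have "(QQ :: ('a \<times> real) set) \<subseteq> cQ" using QQ_cQ by blast
  then have uQ: "continuous_on QQ u" using u by (blast intro: continuous_on_subset)
  define S where "S = QQ \<inter> u -` (- {0})"
  have "open S" unfolding S_def by (rule continuous_open_preimage[OF uQ]) auto
  moreover have "z \<in> S" using z nz by (simp add: S_def)
  ultimately have "\<not> negligible S" using open_not_negligible by blast
  moreover have "S \<in> null_sets lebesgue"
  proof -
    have "AE z in lebesgue. z \<notin> S" using ae by eventually_elim (auto simp: S_def dest: QQ_cQ)
    then show ?thesis using \<open>open S\<close> by (subst AE_iff_null_sets) (auto intro!: sets_completionI_sets)
  qed
  ultimately show False by (simp add: negligible_iff_null_sets)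
qed

text \<open>Covers the degenerate case of the final estimate, in which the norm of \<open>u\<close>
  provides no positive lower bound of the right side.\<close>

lemma Linf_norm_zero:
  fixes u :: "(real ^ 'd) \<times> real \<Rightarrow> real"
  assumes "Linf_norm u = 0" "continuous_on (cyl 1) u" "z \<in> QQ"
  shows "u z = 0"
proof (rule continuous_AE_zero[OF _ _ assms(3)])
  show "continuous_on cQ u" using assms(2) by (simp add: cyl_1)
  have "AE z in lebesgue_on (cyl 1). ennreal \<bar>u z\<bar> \<le> Linf_norm u"
    unfolding Linf_norm_def by (rule esssup_AE)
  then have "AE z in lebesgue_on (cyl 1). u z = 0" unfolding assms(1) by eventually_elim (simp add: ennreal_eq_0_iff)
  then show "AE z in lebesgue. z \<in> cQ \<longrightarrow> u z = 0"
    using cyl_1_lebesgue by (subst (asm) AE_restrict_space_iff) (auto simp: cyl_1)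
qed

text \<open>The smallness demanded by \<open>core\<close> is reached by starting at a small radius
  \<open>R0\<close>, which makes the rescaled sources small, with \<open>A0\<close> bounding
  \<open>u\<close>. \<open>K\<close> and \<open>c\<close> may depend on \<open>u\<close> and
  \<open>f\<close>; the final theorem can afford this, as its exponent is smaller than
  \<open>a\<close>.\<close>

lemma weak_solution_zero_growth:
  fixes a m p q :: real and u f :: "(real ^ 'd) \<times> real \<Rightarrow> real"
  assumes a: "0 < a" "a < 1" and m: "1 < m" "m \<le> 3/2"
    and core: "\<And>f (v :: (real ^ 'd) \<times> real \<Rightarrow> real) z. sol m f v \<Longrightarrow> v 0 = 0 \<Longrightarrow> morrey F0 f \<Longrightarrow>
      norm (fst z) < 1/4 \<Longrightarrow> - 1/16 < snd z \<Longrightarrow> snd z \<le> 0 \<Longrightarrow> v z \<le> 8 powr (- a)"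
    and F0: "0 < F0"
    and p: "p > real CARD('d) / (2 - m)" and q: "q \<ge> 2 * (3 - m) * p / ((2 - m) * p - real CARD('d))"
    and f: "f \<in> Lpq p q" and ws: "weak_solution m f u" and u: "continuous_on (cyl 1) u"
    and \<sigma>: "2 - (m - 1) * a \<le> \<sigma>"
  shows "\<exists>K c. 0 < c \<and> c \<le> 1/4 \<and> 0 \<le> K \<and> (\<forall>r. 0 < r \<longrightarrow> r \<le> c \<longrightarrow> (\<forall>z \<in> zero_level u \<inter> cyl (1/2). \<forall>w \<in> cyl_at \<sigma> z r.
     w \<in> QQ \<and> 0 \<le> u w \<and> u w \<le> K * r powr a))"
proof -
  define d where "d = real CARD('d)"
  have d: "1 \<le> d" by (simp add: d_def Suc_leI)
  have mm: "0 < 2 - m" "2 - m < 1" using m by auto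
  have dp: "d < (2 - m) * p" using p mm by (simp add: d_def field_simps)
  \<comment> \<open>Since \<open>d \<ge> 1\<close> and \<open>2 - m < 1\<close>, the lower bound on
    \<open>p\<close> forces \<open>p > 1\<close>, and the one on \<open>q\<close> then forces
    \<open>q > 1\<close>. Both feed the box bound.\<close>
  have p1: "1 < p"
  proof (rule ccontr)
    assume "\<not> 1 < p"
    then have "(2 - m) * p \<le> (2 - m) * 1" using mm by (intro mult_left_mono) auto
    then have "(2 - m) * p \<le> 2 - m" by simp
    with dp d mm(2) show False by simp
  qed
  have q': "2 * (3 - m) * p \<le> q * ((2 - m) * p - d)" using q dp by (simp add: d_def field_simps)
  have q1: "1 < q"
  proof (rule ccontr)
    assume "\<not> 1 < q"
    then have "q * ((2 - m) * p - d) \<le> 1 * ((2 - m) * p - d)" using dp by (intro mult_right_mono) auto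
    moreover have "(2 - m) * p < 1 * p" using mm p1 by (intro mult_strict_right_mono) auto
    moreover have "1 * p \<le> (2 * (3 - m)) * p" using m p1 by (intro mult_right_mono) auto
    moreover define Y Z where "Y = q * ((2 - m) * p - d)" and "Z = (2 - m) * p"
    ultimately have "Y \<le> Z - d" "Z < p" "p \<le> Y" using q' by (simp_all only: mult_1)
    then show False using d by linarith
  qed
  define x y where "x = d / p" and "y = 1 / q"
  have xy: "0 \<le> x" "0 \<le> y" "2 * (3 - m) * y \<le> 2 - m - x"
  proof -
    show "0 \<le> x" "0 \<le> y" using d p1 q1 by (auto simp: x_def y_def)
    have "2 * (3 - m) * p / (q * p) \<le> q * ((2 - m) * p - d) / (q * p)"
      using q' p1 q1 by (intro divide_right_mono) auto
    then show "2 * (3 - m) * y \<le> 2 - m - x" using p1 q1 by (simp add: x_def y_def diff_divide_distrib)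
  qed
  obtain f0 n where f0m: "f0 \<in> borel_measurable borel" and f0AE: "AE z in lebesgue. z \<in> cyl 1 \<longrightarrow> f z = f0 z"
    and f0z: "\<And>z. z \<notin> cyl 1 \<Longrightarrow> f0 z = 0" and n: "0 \<le> n"
    and box0: "\<And>E I e i. E \<in> sets borel \<Longrightarrow> I \<in> sets borel \<Longrightarrow> emeasure lborel E \<le> ennreal e \<Longrightarrow> emeasure lborel I \<le> ennreal i
       \<Longrightarrow> 0 < e \<Longrightarrow> 0 < i
       \<Longrightarrow> (\<integral>\<^sup>+z. ennreal \<bar>f0 z\<bar> * indicator (E \<times> I) z \<partial>lborel) \<le> ennreal (4 * e powr (1 - 1 / p) * i powr (1 - 1 / q) * n)"
    by (rule Lpq_box_bound[OF f less_imp_le[OF p1] less_imp_le[OF q1]], rule that, assumption+)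
  define V where "V = unit_ball_vol d"
  have V: "0 < V" using d by (simp add: V_def)
  define D where "D = 4 * V powr (1 - 1 / p) * n"
  have D: "0 \<le> D" using n by (simp add: D_def)
  have eb: "emeasure lborel (ball y' \<rho> :: (real ^ 'd) set) = ennreal (V * \<rho> powr d)" if "0 < \<rho>" for y' \<rho>
    using emeasure_ball[of \<rho> y'] that by (simp add: V_def d_def powr_realpow)
  have box: "(\<integral>\<^sup>+z. ennreal \<bar>f0 z\<bar> * indicator (ball y' \<rho> \<times> {s - h<..<s}) z \<partial>lborel)
       \<le> ennreal (D * \<rho> powr (real DIM(real ^ 'd) - x) * h powr (1 - y))" if "0 < \<rho>" "0 < h" for y' \<rho> s h
  proof -
    have "(V * \<rho> powr d) powr (1 - 1 / p) = V powr (1 - 1 / p) * \<rho> powr (d - x)"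
      using V that by (simp add: powr_mult powr_powr x_def right_diff_distrib)
    moreover have "(\<integral>\<^sup>+z. ennreal \<bar>f0 z\<bar> * indicator (ball y' \<rho> \<times> {s - h<..<s}) z \<partial>lborel)
       \<le> ennreal (4 * (V * \<rho> powr d) powr (1 - 1 / p) * h powr (1 - 1 / q) * n)"
      using that V by (intro box0) (auto simp: eb)
    ultimately show ?thesis by (simp add: D_def d_def y_def mult_ac)
  qed
  have f0i: "integrable lborel f0"
  proof (rule integrableI_bounded)
    have "(\<integral>\<^sup>+z. ennreal (norm (f0 z)) \<partial>lborel) = (\<integral>\<^sup>+z. ennreal \<bar>f0 z\<bar> * indicator (ball 0 1 \<times> {-1..0}) z \<partial>lborel)"
    proof (rule nn_integral_cong)
      fix z
      show "ennreal (norm (f0 z)) = ennreal \<bar>f0 z\<bar> * indicator (ball 0 1 \<times> {-1..0}) z"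
        using f0z[of z] by (cases "z \<in> cyl 1") (auto simp: cyl_def indicator_def)
    qed
    also have "\<dots> \<le> ennreal (4 * (V * 1 powr d) powr (1 - 1 / p) * 1 powr (1 - 1 / q) * n)"
      using V by (intro box0) (auto simp: eb)
    also have "\<dots> < \<infinity>" by simp
    finally show "(\<integral>\<^sup>+z. ennreal (norm (f0 z)) \<partial>lborel) < \<infinity>" .
  qed (use f0m in simp)
  have fm: "f \<in> borel_measurable (lebesgue_on (cyl 1))" using f by (simp add: Lpq_def)
  have pv: "pv QQ u (\<lambda>z. u z powr m) f0"
    using m by (intro weak_solution_pv[OF ws u _ f0i f0AE fm]) auto
  have uc: "continuous_on cQ u" using u by (simp add: cyl_1)
  have u0: "0 \<le> u w" if "w \<in> cQ" for w using ws that unfolding weak_solution_def cyl_1 by blast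
  obtain A0 where A0: "1 \<le> A0" "\<And>w. norm (fst w) < 3/4 \<Longrightarrow> - 1/2 < snd w \<Longrightarrow> snd w \<le> 0 \<Longrightarrow> u w \<le> A0"
  proof -
    let ?K = "cball (0 :: real ^ 'd) (3/4) \<times> {- 1/2..0::real}"
    have "?K \<subseteq> cQ" by auto
    then have "compact (u ` ?K)"
      by (intro compact_continuous_image continuous_on_subset[OF uc] compact_Times) auto
    then obtain B where B: "\<And>w. w \<in> ?K \<Longrightarrow> \<bar>u w\<bar> \<le> B"
      using compact_imp_bounded[of "u ` ?K"] unfolding bounded_iff by auto
    show thesis
    proof (rule that[of "max 1 B"])
      fix w :: "(real ^ 'd) \<times> real" assume "norm (fst w) < 3/4" "- 1/2 < snd w" "snd w \<le> 0"
      then have "w \<in> ?K" by (cases w) auto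
      from B[OF this] show "u w \<le> max 1 B" by linarith
    qed simp
  qed
  \<comment> \<open>Adding 1 to \<open>D\<close> avoids a division by 0 when the source
    vanishes.\<close>
  define R0 where "R0 = min (1/4) (F0 / (D + 1))"
  have R0: "0 < R0" "R0 \<le> 1/4" "D * R0 \<le> F0"
  proof -
    show "0 < R0" using F0 D by (simp add: R0_def)
    show "R0 \<le> 1/4" unfolding R0_def by (rule min.cobounded1)
    have "D * R0 \<le> (D + 1) * (F0 / (D + 1))" using D F0 by (intro mult_mono) (auto simp: R0_def)
    also have "\<dots> = F0" using D by simp
    finally show "D * R0 \<le> F0" .
  qed
  define \<sigma>' c0 where "\<sigma>' = 2 - (m - 1) * a" and "c0 = A0 powr (1 - m) * R0\<^sup>2"
  define c1 where "c1 = min (min R0 1) (c0 powr (1 / \<sigma>'))"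
  have "(m - 1) * a \<le> 1 * 1" using m a by (intro mult_mono) auto
  then have \<sigma>': "1 \<le> \<sigma>'" by (simp add: \<sigma>'_def)
  have c0: "0 < c0" using A0 R0 by (simp add: c0_def)
  have c1: "0 < c1" "c1 \<le> 1/4" using R0 c0 by (auto simp: c1_def)
  have growth: "w \<in> QQ \<and> 0 \<le> u w \<and> u w \<le> A0 * (8 / c1) powr a * r powr a"
    if r: "0 < r" "r \<le> c1" and z: "z \<in> zero_level u \<inter> cyl (1/2)" and w: "w \<in> cyl_at \<sigma> z r" for r z w
  proof -
    have z': "u z = 0" "norm (fst z) < 1/2" "- 1/4 < snd z" "snd z \<le> 0"
      using z by (auto simp: zero_level_def cyl_def power2_eq_square)
    have w': "dist (fst z) (fst w) < r" "snd z - r powr \<sigma> < snd w" "snd w < snd z"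
      using w by (auto simp: cyl_at_def)
    have "r powr \<sigma> \<le> r powr 1" using r c1 \<sigma> \<sigma>' by (intro powr_mono') (auto simp: \<sigma>'_def)
    then have "r powr \<sigma> \<le> 1/4" using r c1 by simp
    moreover have "norm (fst w) \<le> norm (fst z) + dist (fst z) (fst w)"
      using norm_triangle_ineq4[of "fst z" "fst z - fst w"] by (simp add: dist_norm)
    ultimately have wQ: "w \<in> QQ" using w' z' r c1 by (cases w) (auto simp: QQ_def2)
    have "u w \<le> A0 * (8 / c1) powr a * r powr a"
    proof (rule cylinder_growth[OF _ R0(1) c0 _ a(1) _ c1_def _ r w'(1,2)])
      fix k v and s :: real
      assume s: "s = (1/8) ^ k" and v: "dist (fst z) (fst v) < R0 * s" "snd z - c0 * s powr \<sigma>' < snd v" "snd v \<le> snd z"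
      have s01: "0 < s" "s \<le> 1" by (auto simp: s power_le_one)
      have "(A0 * s powr a) powr (1 - m) * (R0 * s)\<^sup>2 = c0 * s powr \<sigma>'"
        unfolding c0_def \<sigma>'_def using m a xy R0 A0 s01 by (intro scaling_exponents(2)[of m a x y]) auto
      then have v2: "snd z - (A0 * s powr a) powr (1 - m) * (R0 * s)\<^sup>2 < snd v" using v(2) by simp
      show "u v \<le> A0 * s powr a"
        by (rule dyadic_decay[OF uc _ pv f0i m a _ _ D R0(3) xy R0(1,2) A0(1) _ z' s v(1) v2 v(3)])
          (rule u0 core box A0(2); assumption)+
    qed (use \<sigma> \<sigma>' A0 w' in \<open>auto simp: \<sigma>'_def\<close>)
    then show ?thesis using wQ u0 QQ_cQ by blast
  qed
  show ?thesis
    by (rule exI[of _ "A0 * (8 / c1) powr a"], rule exI[of _ c1]) (use growth c1 A0 in auto)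
qed

theorem theorem1:
  fixes \<alpha> :: real
  assumes "0 < \<alpha>" and "\<alpha> < 1"
  shows "\<exists>\<epsilon>>0. \<exists>C>0. \<forall>(m::real) (p::real) (q::real)
      (u :: (real ^ 'd) \<times> real \<Rightarrow> real) (f :: (real ^ 'd) \<times> real \<Rightarrow> real).
    0 < m - 1 \<and> m - 1 < \<epsilon> \<and>
    p > real CARD('d) / (2 - m) \<and>
    q \<ge> 2 * (3 - m) * p / ((2 - m) * p - real CARD('d)) \<and>
    f \<in> Lpq p q \<and> weak_solution m f u \<and> continuous_on (cyl 1) u \<longrightarrow>
    (let \<sigma> = 2 + (1 - m) * \<alpha> in
      (\<forall>z \<in> zero_level u \<inter> cyl (1/2). Holder_at \<alpha> \<sigma> u z) \<and>
      (\<forall>\<^sub>F r in at_right 0. \<forall>z \<in> zero_level u \<inter> cyl (1/2).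
        (SUP w \<in> cyl_at \<sigma> z r. ennreal \<bar>u z - u w\<bar>)
          \<le> ennreal (C * r powr \<alpha>) * (Linf_norm u + Lpq_norm p q f)))"
proof -
  define a where "a = (1 + \<alpha>) / 2"
  have a: "0 < a" "a < 1" "\<alpha> < a" using assms by (auto simp: a_def)
  have "8 powr (- a) < 8 powr (0::real)" using a by (intro powr_less_mono) auto
  then have \<eta>: "0 < 8 powr (- a)" "8 powr (- a) < 1" by auto
  obtain \<epsilon> F0 where \<epsilon>: "0 < \<epsilon>" "0 < F0" and
    core: "\<And>m (f :: (real ^ 'd) \<times> real \<Rightarrow> real) v z. 0 < m - 1 \<and> m - 1 < \<epsilon> \<Longrightarrow> sol m f v \<Longrightarrow> v 0 = 0 \<Longrightarrow> morrey F0 f \<Longrightarrow>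
      norm (fst z) < 1/4 \<Longrightarrow> - 1/16 < snd z \<Longrightarrow> snd z \<le> 0 \<Longrightarrow> v z \<le> 8 powr (- a)"
    using core_estimate[OF \<eta>, where 'a = "real ^ 'd"] by metis
  have main: "(\<forall>z \<in> zero_level u \<inter> cyl (1/2). Holder_at \<alpha> \<sigma> u z) \<and>
      (\<forall>\<^sub>F r in at_right 0. \<forall>z \<in> zero_level u \<inter> cyl (1/2).
        (SUP w \<in> cyl_at \<sigma> z r. ennreal \<bar>u z - u w\<bar>)
          \<le> ennreal (1 * r powr \<alpha>) * (Linf_norm u + Lpq_norm p q f))"
    if m: "0 < m - 1" "m - 1 < min \<epsilon> (1/2)" and p: "p > real CARD('d) / (2 - m)"
      and q: "q \<ge> 2 * (3 - m) * p / ((2 - m) * p - real CARD('d))"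
      and f: "f \<in> Lpq p q" and ws: "weak_solution m f u" and u: "continuous_on (cyl 1) u"
      and \<sigma>: "\<sigma> = 2 + (1 - m) * \<alpha>"
    for m p q \<sigma> and u f :: "(real ^ 'd) \<times> real \<Rightarrow> real"
  proof -
    \<comment> \<open>Since \<open>\<alpha> < a\<close>, the time exponent of the theorem exceeds
      the intrinsic one, so its cylinders are shorter for small radii.\<close>
    have "(m - 1) * \<alpha> \<le> (m - 1) * a" using m a by (intro mult_left_mono) auto
    moreover have "\<sigma> = 2 - (m - 1) * \<alpha>" by (simp add: \<sigma> algebra_simps)
    ultimately have \<sigma>a: "2 - (m - 1) * a \<le> \<sigma>" by linarith
    have m': "1 < m" "m \<le> 3/2" "0 < m - 1 \<and> m - 1 < \<epsilon>" using m by auto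
    have "\<exists>K c. 0 < c \<and> c \<le> 1/4 \<and> 0 \<le> K \<and> (\<forall>r. 0 < r \<longrightarrow> r \<le> c \<longrightarrow> (\<forall>z \<in> zero_level u \<inter> cyl (1/2). \<forall>w \<in> cyl_at \<sigma> z r.
       w \<in> QQ \<and> 0 \<le> u w \<and> u w \<le> K * r powr a))"
      by (rule weak_solution_zero_growth[OF a(1,2) m'(1,2) _ \<epsilon>(2) p q f ws u \<sigma>a]) (rule core[OF m'(3)])
    then obtain K c where c: "0 < c" "c \<le> 1/4" "0 \<le> K" and
      growth: "\<And>r z w. 0 < r \<Longrightarrow> r \<le> c \<Longrightarrow> z \<in> zero_level u \<inter> cyl (1/2) \<Longrightarrow> w \<in> cyl_at \<sigma> z r \<Longrightarrow>
        w \<in> QQ \<and> 0 \<le> u w \<and> u w \<le> K * r powr a"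
      by blast
    have uz: "\<bar>u z - u w\<bar> = u w" if "0 < r" "r \<le> c" "z \<in> zero_level u \<inter> cyl (1/2)" "w \<in> cyl_at \<sigma> z r" for r z w
      using growth[OF that] that(3) by (simp add: zero_level_def)
    have small: "\<forall>\<^sub>F r in at_right 0. 0 < r \<and> r \<le> c"
      using eventually_at_right_less[of 0] eventually_at_right_real[OF c(1)] by eventually_elim auto
    have "Holder_at \<alpha> \<sigma> u z" if z: "z \<in> zero_level u \<inter> cyl (1/2)" for z
      unfolding Holder_at_def
    proof (intro exI[of _ K])
      show "\<forall>\<^sub>F r in at_right 0. \<forall>w\<in>cyl_at \<sigma> z r. \<bar>u z - u w\<bar> \<le> K * r powr \<alpha>"
        using small
      proof eventually_elim
        case (elim r)
        have "K * r powr a \<le> K * r powr \<alpha>" using elim a c by (intro mult_left_mono powr_mono') auto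
        then show ?case using growth[OF _ _ z] uz[OF _ _ z] elim by fastforce
      qed
    qed
    moreover have "\<forall>\<^sub>F r in at_right 0. \<forall>z \<in> zero_level u \<inter> cyl (1/2).
        (SUP w \<in> cyl_at \<sigma> z r. ennreal \<bar>u z - u w\<bar>) \<le> ennreal (1 * r powr \<alpha>) * (Linf_norm u + Lpq_norm p q f)"
    \<comment> \<open>If the norm of \<open>u\<close> vanishes, the right side may be 0, and the
      estimate holds only because \<open>u\<close> vanishes on the cylinders.\<close>
    proof (cases "Linf_norm u = 0")
      case True
      show ?thesis using small
      proof eventually_elim
        case (elim r)
        show ?case
        proof (intro ballI SUP_least)
          fix z w assume zw: "z \<in> zero_level u \<inter> cyl (1/2)" "w \<in> cyl_at \<sigma> z r"
          have "u w = 0" using Linf_norm_zero[OF True u] growth[OF _ _ zw] elim by blast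
          then show "ennreal \<bar>u z - u w\<bar> \<le> ennreal (1 * r powr \<alpha>) * (Linf_norm u + Lpq_norm p q f)"
            using uz[OF _ _ zw] elim by simp
        qed
      qed
    next
      case False
      \<comment> \<open>\<open>Linf_norm u\<close> may be infinite, so a positive real number below
        it is used; \<open>K * r powr (a - \<alpha>)\<close> drops below that number for small
        \<open>r\<close>.\<close>
      obtain l where l: "0 < l" "ennreal l \<le> Linf_norm u"
      proof (cases "Linf_norm u")
        case (real l)
        then show thesis using that[of l] False by simp
      next
        case top
        then show thesis using that[of 1] by simp
      qed
      have "((\<lambda>r. K * r powr (a - \<alpha>)) \<longlongrightarrow> K * 0 powr (a - \<alpha>)) (at_right 0)"
        using a by (intro tendsto_intros tendsto_powr') (auto intro: eventually_mono[OF eventually_at_right_less])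
      then have "\<forall>\<^sub>F r in at_right 0. K * r powr (a - \<alpha>) < l" using l a by (intro order_tendstoD) auto
      with small show ?thesis
      proof eventually_elim
        case (elim r)
        show ?case
        proof (intro ballI SUP_least)
          fix z w assume zw: "z \<in> zero_level u \<inter> cyl (1/2)" "w \<in> cyl_at \<sigma> z r"
          have "r powr a = r powr \<alpha> * r powr (a - \<alpha>)" by (simp add: powr_add[symmetric])
          then have "\<bar>u z - u w\<bar> \<le> r powr \<alpha> * (K * r powr (a - \<alpha>))"
            using growth[OF _ _ zw] uz[OF _ _ zw] elim by (simp add: mult_ac)
          also have "\<dots> \<le> r powr \<alpha> * l" using elim by (intro mult_left_mono) auto
          finally have "ennreal \<bar>u z - u w\<bar> \<le> ennreal (r powr \<alpha> * l)" by (rule ennreal_leI)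
          also have "\<dots> = ennreal (r powr \<alpha>) * ennreal l" using l by (simp add: ennreal_mult)
          also have "\<dots> \<le> ennreal (1 * r powr \<alpha>) * (Linf_norm u + Lpq_norm p q f)"
            using l by (intro mult_mono) (auto intro: add_increasing2)
          finally show "ennreal \<bar>u z - u w\<bar> \<le> ennreal (1 * r powr \<alpha>) * (Linf_norm u + Lpq_norm p q f)" .
        qed
      qed
    qed
    ultimately show ?thesis by blast
  qed
  \<comment> \<open>The bound 1/2 supplies \<open>m \<le> 3/2\<close>, the requirement of the decay
    over dyadic scales.\<close>
  have "0 < min \<epsilon> (1/2)" using \<epsilon> by simp
  moreover have "0 < (1::real)" by simp
  ultimately show ?thesis unfolding Let_def using main by blast
qed

end
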